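(* Let $M=S^d$ with $d>2$, with its usual Riemannian metric and geodesic distance $\rho_g$. Suppose the probability measure $Q$ on $S^d$ has an intrinsic mean $\mu$ and is absolutely continuous on a neighborhood $W$ of $\mathrm{Cut}(\mu)$ with a continuous density on $W$ (with respect to the volume measure). Then the central limit theorem for the sample intrinsic mean $\mu_n$ holds, i.e. $$\sqrt n\,[\phi(\mu_n)-\phi(\mu)]\ \longrightarrow\ N(0,\Lambda^{-1}C\Lambda^{-1})\quad\text{in distribution as } n\to\infty,$$ where $\phi=\mathrm{Exp}_\mu^{-1}$, $h(x;q)=\rho_g^2(\phi^{-1}(x),q)$, $\Lambda=[E D_{r,r'}h(\phi(\mu);Y_1)]_{r,r'=1,\ldots,d}$, $C$ is the covariance matrix of $(D_rh(\phi(\mu);Y_1))_{r=1,\ldots,d}$, and $Y_1,Y_2,\ldots$ are the i.i.d. observations with distribution $Q$ on which $\mu_n$ is based.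
   Context: $S^d=\{x\in\mathbb R^{d+1}:|x|=1\}$ and $\mathrm{Cut}(\mu)=\{-\mu\}$. The intrinsic mean $\mu$ of $Q$ is said to exist when the Fréchet function $F(p)=\int\rho_g^2(p,q)\,Q(dq)$ has a unique minimizer, which is then $\mu$. The sample intrinsic mean $\mu_n$ is a measurable selection from the set of minimizers of $F_n(p)=\frac1n\sum_{j=1}^n\rho_g^2(p,Y_j)$. The inverse exponential map $\phi=\mathrm{Exp}_\mu^{-1}$ is defined on $S^d\setminus\{-\mu\}$ with values in $T_\mu S^d$, identified with $\mathbb R^d$ by an orthonormal basis, and $\phi(\mu)=0$; $D_r=\partial/\partial x_r$, $D_{r,r'}=\partial^2/\partial x_r\partial x_{r'}$ act on the variable $x$.
   Formalization: The matrix Λ is assumed to be invertible; this does not follow from the other hypotheses (there are laws Q on S^3 satisfying them with Λ = 0), and without it the limit law N(0, Λ^{-1}CΛ^{-1}) is undefined. *)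

theory Defs
  imports "HOL-Probability.Probability"
begin

section \<open>Riemannian geometry of the unit sphere\<close>

text \<open>The unit sphere \<open>sphere 0 1\<close> of a Euclidean space of dimension \<open>d + 1\<close> carries the
  Riemannian metric induced by the inner product of the ambient space, so the length of a curve
  in the sphere is its Euclidean length.\<close>

definition curve_length :: "(real \<Rightarrow> 'a::euclidean_space) \<Rightarrow> real" where
  "curve_length \<gamma> = integral {0..1} (\<lambda>t. norm (vector_derivative \<gamma> (at t)))"

text \<open>\<open>valid_path\<close> lets the speed be unbounded near a breakpoint. Curves of infinite length have
  to be excluded, since \<open>integral\<close> would assign them the length 0.\<close>

definition sphere_curve :: "'a::euclidean_space \<Rightarrow> 'a \<Rightarrow> (real \<Rightarrow> 'a) \<Rightarrow> bool" where
  "sphere_curve p q \<gamma> \<longleftrightarrow> valid_path \<gamma> \<and> path_image \<gamma> \<subseteq> sphere 0 1 \<and>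
     pathstart \<gamma> = p \<and> pathfinish \<gamma> = q \<and>
     (\<lambda>t. norm (vector_derivative \<gamma> (at t))) integrable_on {0..1}"

definition geo_dist :: "'a::euclidean_space \<Rightarrow> 'a \<Rightarrow> real" where
  "geo_dist p q = Inf {curve_length \<gamma> | \<gamma>. sphere_curve p q \<gamma>}"

text \<open>The Levi-Civita covariant acceleration of a curve in the sphere is the component of its
  second derivative that is tangent to the sphere; for a geodesic it vanishes.\<close>

definition sphere_geodesic :: "(real \<Rightarrow> 'a::euclidean_space) \<Rightarrow> bool" where
  "sphere_geodesic \<gamma> \<longleftrightarrow> (\<exists>\<gamma>' \<gamma>''. \<forall>t. \<gamma> t \<in> sphere 0 1 \<and>
      (\<gamma> has_vector_derivative \<gamma>' t) (at t) \<and> (\<gamma>' has_vector_derivative \<gamma>'' t) (at t) \<and>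
      \<gamma>'' t - (\<gamma>'' t \<bullet> \<gamma> t) *\<^sub>R \<gamma> t = 0)"

definition tangent_space :: "'a::euclidean_space \<Rightarrow> 'a set" where
  "tangent_space p = {v. v \<bullet> p = 0}"

definition sphere_exp :: "'a::euclidean_space \<Rightarrow> 'a \<Rightarrow> 'a" where
  "sphere_exp p v = (THE y. \<exists>\<gamma>. sphere_geodesic \<gamma> \<and> \<gamma> 0 = p \<and>
                                vector_derivative \<gamma> (at 0) = v \<and> \<gamma> 1 = y)"

text \<open>The open ball of radius \<open>pi\<close> in the tangent space is the injectivity domain of the
  exponential map; its image is the sphere without the cut locus \<open>{- p}\<close>. At \<open>- p\<close> the value
  of \<open>sphere_log\<close> is unspecified.\<close>

definition sphere_log :: "'a::euclidean_space \<Rightarrow> 'a \<Rightarrow> 'a" where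
  "sphere_log p = inv_into {v \<in> tangent_space p. norm v < pi} (sphere_exp p)"

definition tangent_onb :: "'a::euclidean_space \<Rightarrow> ('d::finite \<Rightarrow> 'a) \<Rightarrow> bool" where
  "tangent_onb p e \<longleftrightarrow> (\<forall>i. e i \<in> tangent_space p) \<and>
     (\<forall>i j. e i \<bullet> e j = (if i = j then 1 else 0)) \<and> span (range e) = tangent_space p"

definition log_chart :: "'a::euclidean_space \<Rightarrow> ('d::finite \<Rightarrow> 'a) \<Rightarrow> 'a \<Rightarrow> real ^ 'd" where
  "log_chart p e q = (\<chi> i. sphere_log p q \<bullet> e i)"

definition log_chart_inv :: "'a::euclidean_space \<Rightarrow> ('d::finite \<Rightarrow> 'a) \<Rightarrow> real ^ 'd \<Rightarrow> 'a" where
  "log_chart_inv p e = inv_into (sphere 0 1 - {- p}) (log_chart p e)"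

abbreviation sphere_borel :: "'a::euclidean_space measure" where
  "sphere_borel \<equiv> restrict_space borel (sphere 0 1)"

text \<open>Riemannian volume on the sphere: the volume of \<open>A\<close> is \<open>DIM('a)\<close> times the Lebesgue
  measure of the cone \<open>{t *\<^sub>R x | x t. x \<in> A \<and> 0 < t \<and> t \<le> 1}\<close>, which is the preimage of \<open>A\<close>
  under the radial projection \<open>sgn x = x /\<^sub>R norm x\<close> of the punctured unit ball.\<close>

definition sphere_volume :: "'a::euclidean_space measure" where
  "sphere_volume = scale_measure (ennreal (real DIM('a)))
     (distr (restrict_space lborel (cball 0 1 - {0})) sphere_borel sgn)"


section \<open>Frechet means\<close>

definition frechet_minimizers :: "('a::euclidean_space \<Rightarrow> real) \<Rightarrow> 'a set" where
  "frechet_minimizers F = {p \<in> sphere 0 1. \<forall>p' \<in> sphere 0 1. F p \<le> F p'}"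

definition frechet_fun :: "'a::euclidean_space measure \<Rightarrow> 'a \<Rightarrow> real" where
  "frechet_fun Q p = (\<integral>q. (geo_dist p q)\<^sup>2 \<partial>Q)"

definition is_intrinsic_mean :: "'a::euclidean_space measure \<Rightarrow> 'a \<Rightarrow> bool" where
  "is_intrinsic_mean Q \<mu> \<longleftrightarrow> frechet_minimizers (frechet_fun Q) = {\<mu>}"

definition sample_frechet_fun :: "nat \<Rightarrow> (nat \<Rightarrow> 'a::euclidean_space) \<Rightarrow> 'a \<Rightarrow> real" where
  "sample_frechet_fun n y p = 1 / real n * (\<Sum>j = 1..n. (geo_dist p (y j))\<^sup>2)"


section \<open>Partial derivatives, covariance, Gaussian limits\<close>

definition partial_deriv :: "'d::finite \<Rightarrow> (real ^ 'd \<Rightarrow> real) \<Rightarrow> real ^ 'd \<Rightarrow> real" where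
  "partial_deriv r f x = deriv (\<lambda>t. f (x + t *\<^sub>R axis r 1)) 0"

definition covariance_matrix ::
    "'w measure \<Rightarrow> ('w \<Rightarrow> real ^ 'd::finite) \<Rightarrow> real ^ 'd ^ 'd" where
  "covariance_matrix M X =
     (\<chi> r s. \<integral>\<omega>. (X \<omega> $ r - (\<integral>\<omega>'. X \<omega>' $ r \<partial>M)) * (X \<omega> $ s - (\<integral>\<omega>'. X \<omega>' $ s \<partial>M)) \<partial>M)"

definition std_gaussian :: "(real ^ 'd::finite) measure" where
  "std_gaussian = density lborel (\<lambda>x. ennreal (\<Prod>i\<in>UNIV. std_normal_density (x $ i)))"

text \<open>For a positive semidefinite, possibly singular \<open>S\<close>, the distribution \<open>N(m, S)\<close> is the
  law of \<open>m + A Z\<close> with \<open>Z\<close> standard Gaussian and \<open>A A\<^sup>T = S\<close>; it depends on \<open>A\<close> only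
  through \<open>S\<close>.\<close>

definition gaussian :: "real ^ 'd \<Rightarrow> real ^ 'd ^ 'd \<Rightarrow> (real ^ 'd::finite) measure" where
  "gaussian m S =
     distr std_gaussian borel (\<lambda>z. m + (SOME A :: real ^ 'd ^ 'd. A ** transpose A = S) *v z)"

definition weakly_converges ::
    "(nat \<Rightarrow> 'a::euclidean_space measure) \<Rightarrow> 'a measure \<Rightarrow> bool" where
  "weakly_converges P N \<longleftrightarrow>
     (\<forall>f :: 'a \<Rightarrow> real. continuous_on UNIV f \<and> bounded (range f) \<longrightarrow>
        (\<lambda>n. \<integral>x. f x \<partial>P n) \<longlonglongrightarrow> (\<integral>x. f x \<partial>N))"

definition converges_in_distribution ::
    "'w measure \<Rightarrow> (nat \<Rightarrow> 'w \<Rightarrow> 'a::euclidean_space) \<Rightarrow> 'a measure \<Rightarrow> bool" where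
  "converges_in_distribution M X N \<longleftrightarrow> weakly_converges (\<lambda>n. distr M borel (X n)) N"


section \<open>Closed forms of the exponential map and the geodesic distance\<close>

lemma sphere_geodesicI:
  fixes p v :: "'a::euclidean_space"
  assumes "p \<in> sphere 0 1" "v \<in> tangent_space p"
  shows "\<exists>\<gamma>. sphere_geodesic \<gamma> \<and> \<gamma> 0 = p \<and> vector_derivative \<gamma> (at 0) = v \<and>
             \<gamma> 1 = cos (norm v) *\<^sub>R p + sin (norm v) *\<^sub>R sgn v"
proof -
  define c where "c = norm v"
  define u where "u = sgn v"
  have cu: "c *\<^sub>R u = v" by (cases "v = 0") (simp_all add: c_def u_def sgn_div_norm)
  have pp: "p \<bullet> p = 1" using assms by (simp add: dot_square_norm)
  have pu: "p \<bullet> u = 0" "u \<bullet> p = 0"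
    using assms by (auto simp: tangent_space_def u_def sgn_div_norm inner_commute)
  have uu: "c \<noteq> 0 \<Longrightarrow> u \<bullet> u = 1"
    by (simp add: u_def c_def sgn_div_norm dot_square_norm power2_eq_square field_simps)
  define g where "g = (\<lambda>t. cos (c * t) *\<^sub>R p + sin (c * t) *\<^sub>R u)"
  define g' where "g' = (\<lambda>t. (- c * sin (c * t)) *\<^sub>R p + (c * cos (c * t)) *\<^sub>R u)"
  define g'' where "g'' = (\<lambda>t. (- c * c * cos (c * t)) *\<^sub>R p + (- c * c * sin (c * t)) *\<^sub>R u)"
  have d1: "(g has_vector_derivative g' t) (at t)" for t
    unfolding g_def g'_def by (auto intro!: derivative_eq_intros simp: has_vector_derivative_def algebra_simps)
  have d2: "(g' has_vector_derivative g'' t) (at t)" for t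
    unfolding g''_def g'_def by (auto intro!: derivative_eq_intros simp: has_vector_derivative_def algebra_simps)
  have gg: "g t \<bullet> g t = 1" for t
  proof (cases "c = 0")
    case True then show ?thesis by (simp add: g_def pp)
  next
    case False
    have "g t \<bullet> g t = (cos (c*t))\<^sup>2 + (sin (c*t))\<^sup>2"
      by (simp add: g_def inner_add_left inner_add_right pp pu uu[OF False] power2_eq_square)
    then show ?thesis by simp
  qed
  have g2: "g'' t = - (c * c) *\<^sub>R g t" for t by (simp add: g''_def g_def algebra_simps)
  have "sphere_geodesic g"
    unfolding sphere_geodesic_def
    apply (rule exI[of _ g'], rule exI[of _ g''])
    using d1 d2 gg by (auto simp: g2 norm_eq_sqrt_inner)
  moreover have "g 0 = p" by (simp add: g_def)
  moreover have "vector_derivative g (at 0) = v"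
    using vector_derivative_at[OF d1[of 0]] cu by (simp add: g'_def)
  moreover have "g 1 = cos (norm v) *\<^sub>R p + sin (norm v) *\<^sub>R sgn v"
    by (simp add: g_def c_def u_def)
  ultimately show ?thesis by blast
qed

lemma sphere_geodesic_unique:
  fixes p v :: "'a::euclidean_space"
  assumes "sphere_geodesic \<gamma>" "\<gamma> 0 = p" "vector_derivative \<gamma> (at 0) = v"
    and "sphere_geodesic \<delta>" "\<delta> 0 = p" "vector_derivative \<delta> (at 0) = v"
  shows "\<gamma> = \<delta>"
proof -
  have ode: "\<exists>g'. g' 0 = vector_derivative g (at 0) \<and> (\<forall>t. (g has_vector_derivative g' t) (at t) \<and>
       (g' has_vector_derivative (- (norm (vector_derivative g (at 0)))\<^sup>2) *\<^sub>R g t) (at t))"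
    if "sphere_geodesic g" for g :: "real \<Rightarrow> 'a"
  proof -
    from that obtain g' g'' where s: "\<And>t. g t \<in> sphere 0 1"
      and d1: "\<And>t. (g has_vector_derivative g' t) (at t)"
      and d2: "\<And>t. (g' has_vector_derivative g'' t) (at t)"
      and n: "\<And>t. g'' t - (g'' t \<bullet> g t) *\<^sub>R g t = 0"
      unfolding sphere_geodesic_def by blast
    have one: "g t \<bullet> g t = 1" for t using s[of t] by (simp add: dot_square_norm)
    have "((\<lambda>t. g t \<bullet> g t) has_real_derivative 2 * (g t \<bullet> g' t)) (at t)" for t
      using d1[of t] by (auto intro!: derivative_eq_intros simp: has_vector_derivative_def has_field_derivative_def fun_eq_iff inner_commute algebra_simps)
    then have orth: "g t \<bullet> g' t = 0" for t
      using DERIV_unique[of "\<lambda>t. g t \<bullet> g t" "2 * (g t \<bullet> g' t)" t 0] by (simp add: one)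
    have "((\<lambda>t. g t \<bullet> g' t) has_real_derivative (g t \<bullet> g'' t + g' t \<bullet> g' t)) (at t)" for t
      using d1[of t] d2[of t] by (auto intro!: derivative_eq_intros simp: has_vector_derivative_def has_field_derivative_def fun_eq_iff inner_commute algebra_simps)
    then have a: "g t \<bullet> g'' t + g' t \<bullet> g' t = 0" for t
      using DERIV_unique[of "\<lambda>t. g t \<bullet> g' t" _ t 0] by (simp add: orth)
    have "((\<lambda>t. g' t \<bullet> g' t) has_real_derivative 2 * (g' t \<bullet> g'' t)) (at t)" for t
      using d2[of t] by (auto intro!: derivative_eq_intros simp: has_vector_derivative_def has_field_derivative_def fun_eq_iff inner_commute algebra_simps)
    moreover have "g' t \<bullet> g'' t = 0" for t
    proof -
      have "g'' t = (g'' t \<bullet> g t) *\<^sub>R g t" using n[of t] by simp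
      then have "g' t \<bullet> g'' t = (g'' t \<bullet> g t) * (g' t \<bullet> g t)" by (metis inner_scaleR_right)
      then show ?thesis using orth[of t] by (simp add: inner_commute)
    qed
    ultimately have "((\<lambda>t. g' t \<bullet> g' t) has_real_derivative 0) (at t)" for t by simp
    then have "g' t \<bullet> g' t = g' 0 \<bullet> g' 0" for t
      by (intro DERIV_isconst_all) auto
    then have "g'' t \<bullet> g t = - (norm (g' 0))\<^sup>2" for t
      using a[of t] by (metis add_eq_0_iff2 dot_square_norm inner_commute)
    then have "g'' t = (- (norm (g' 0))\<^sup>2) *\<^sub>R g t" for t
      using n[of t] by (metis eq_iff_diff_eq_0)
    then show ?thesis using d1 d2 vector_derivative_at[OF d1[of 0]]
      by (intro exI[of _ g']) auto
  qed
  define k where "k = (norm v)\<^sup>2"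
  obtain a where a: "a 0 = v" "\<And>t. (\<gamma> has_vector_derivative a t) (at t)"
      "\<And>t. (a has_vector_derivative (- k) *\<^sub>R \<gamma> t) (at t)"
    using ode[OF assms(1)] assms k_def by metis
  obtain b where b: "b 0 = v" "\<And>t. (\<delta> has_vector_derivative b t) (at t)"
      "\<And>t. (b has_vector_derivative (- k) *\<^sub>R \<delta> t) (at t)"
    using ode[OF assms(4)] assms k_def by metis
  have k0: "k \<ge> 0" by (simp add: k_def)
  define x where "x = (\<lambda>t. \<gamma> t - \<delta> t)"
  define y where "y = (\<lambda>t. a t - b t)"
  have dx: "(x has_vector_derivative y t) (at t)" for t
    unfolding x_def y_def by (intro derivative_intros a b)
  have dy: "(y has_vector_derivative (- k) *\<^sub>R x t) (at t)" for t
    unfolding x_def y_def using has_vector_derivative_diff[OF a(3)[of t] b(3)[of t]]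
    by (simp add: algebra_simps)
  have e: "((\<lambda>t. k * (x t \<bullet> x t) + y t \<bullet> y t) has_real_derivative 0) (at t)" for t
    using dx[of t] dy[of t] by (auto intro!: derivative_eq_intros simp: has_vector_derivative_def has_field_derivative_def fun_eq_iff inner_commute algebra_simps)
  have x0: "x 0 = 0" "y 0 = 0" using assms a b by (auto simp: x_def y_def)
  have "k * (x t \<bullet> x t) + y t \<bullet> y t = k * (x 0 \<bullet> x 0) + y 0 \<bullet> y 0" for t
    using DERIV_isconst_all[of "\<lambda>t. k * (x t \<bullet> x t) + y t \<bullet> y t" t 0] e by blast
  then have "k * (x t \<bullet> x t) + y t \<bullet> y t = 0" for t by (simp add: x0)
  then have "y t \<bullet> y t = 0" for t
    using k0 by (smt (verit) inner_ge_zero mult_nonneg_nonneg)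
  then have y: "y t = 0" for t by simp
  have "x t = x 0" for t
    using has_vector_derivative_zero_constant[of UNIV x] dx y
    by (metis UNIV_I convex_UNIV)
  then show ?thesis using x0 by (auto simp: x_def fun_eq_iff)
qed

lemma sphere_exp_eq:
  assumes "p \<in> sphere 0 1" "v \<in> tangent_space p"
  shows "sphere_exp p v = cos (norm v) *\<^sub>R p + sin (norm v) *\<^sub>R sgn v"
  unfolding sphere_exp_def
proof (rule the_equality)
  show "\<exists>\<gamma>. sphere_geodesic \<gamma> \<and> \<gamma> 0 = p \<and> vector_derivative \<gamma> (at 0) = v \<and>
          \<gamma> 1 = cos (norm v) *\<^sub>R p + sin (norm v) *\<^sub>R sgn v"
    using assms by (rule sphere_geodesicI)
next
  fix y
  assume "\<exists>\<gamma>. sphere_geodesic \<gamma> \<and> \<gamma> 0 = p \<and> vector_derivative \<gamma> (at 0) = v \<and> \<gamma> 1 = y"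
  then show "y = cos (norm v) *\<^sub>R p + sin (norm v) *\<^sub>R sgn v"
    using sphere_geodesicI[OF assms] sphere_geodesic_unique by blast
qed

lemma curve_length_ge:
  fixes p q :: "'a::euclidean_space"
  assumes "sphere_curve p q \<gamma>"
  shows "arccos (p \<bullet> q) \<le> curve_length \<gamma>"
proof -
  note assms = assms[unfolded sphere_curve_def, THEN conjunct1]
    assms[unfolded sphere_curve_def, THEN conjunct2, THEN conjunct1]
    assms[unfolded sphere_curve_def, THEN conjunct2, THEN conjunct2, THEN conjunct1]
    assms[unfolded sphere_curve_def, THEN conjunct2, THEN conjunct2, THEN conjunct2, THEN conjunct1]
    assms[unfolded sphere_curve_def, THEN conjunct2, THEN conjunct2, THEN conjunct2, THEN conjunct2]
  have s: "\<gamma> t \<bullet> \<gamma> t = 1" if "t \<in> {0..1}" for t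
  proof -
    have "norm (\<gamma> t) = 1" using assms(2) that by (force simp: path_image_def)
    then show ?thesis by (simp add: dot_square_norm)
  qed
  have p1: "p \<bullet> p = 1" using s[of 0] assms(3) by (simp add: pathstart_def)
  from assms(1) obtain S where cont: "continuous_on {0..1} \<gamma>" and fin: "finite S"
    and C1: "\<gamma> C1_differentiable_on ({0..1} - S)"
    unfolding valid_path_def piecewise_C1_differentiable_on_def by blast
  define D where "D = (\<lambda>t. vector_derivative \<gamma> (at t))"
  have d: "(\<gamma> has_vector_derivative D t) (at t)" if "t \<in> {0..1} - S" for t
    using C1 that by (simp add: C1_differentiable_on_eq D_def vector_derivative_works)
  have orth: "\<gamma> t \<bullet> D t = 0" if t: "t \<in> {0<..<1} - S" for t
  proof -
    have "((\<lambda>t. \<gamma> t \<bullet> \<gamma> t) has_real_derivative 2 * (\<gamma> t \<bullet> D t)) (at t)"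
      using d[of t] t by (auto intro!: derivative_eq_intros simp: has_vector_derivative_def has_field_derivative_def fun_eq_iff inner_commute algebra_simps)
    moreover have "((\<lambda>t. \<gamma> t \<bullet> \<gamma> t) has_real_derivative 0) (at t)"
    proof (rule has_field_derivative_transform_within_open[of "\<lambda>_. 1" _ _ "{0<..<1}"])
      show "\<And>x. x \<in> {0<..<1} \<Longrightarrow> 1 = \<gamma> x \<bullet> \<gamma> x" using s by simp
    qed (use t in auto)
    ultimately have "2 * (\<gamma> t \<bullet> D t) = 0" by (rule DERIV_unique)
    then show ?thesis by simp
  qed
  have "arccos (c * (p \<bullet> q)) - arccos c \<le> curve_length \<gamma>" if c: "0 < c" "c < 1" for c
  proof -
    define u where "u = (\<lambda>t. p \<bullet> \<gamma> t)"
    define G where "G = (\<lambda>t. - (c * (p \<bullet> D t)) / sqrt (1 - (c * u t)\<^sup>2))"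
    have u1: "\<bar>u t\<bar> \<le> 1" if "t \<in> {0..1}" for t
      using Cauchy_Schwarz_ineq2[of p "\<gamma> t"] s[OF that] p1 by (simp add: u_def norm_eq_sqrt_inner)
    have cu: "\<bar>c * u t\<bar> < 1" if "t \<in> {0..1}" for t
      using u1[OF that] c by (simp add: abs_mult) (smt (verit) mult_left_le)
    have I: "(G has_integral (arccos (c * u 1) - arccos (c * u 0))) {0..1}"
    proof (rule fundamental_theorem_of_calculus_interior_strong[OF fin])
      show "continuous_on {0..1} (\<lambda>a. arccos (c * u a))"
        unfolding u_def using cu by (intro continuous_intros cont) (force simp: u_def abs_less_iff)+
      fix t assume t: "t \<in> {0<..<1} - S"
      have "(u has_real_derivative p \<bullet> D t) (at t)"
        using d[of t] t unfolding u_def by (auto intro!: derivative_eq_intros simp: has_vector_derivative_def has_field_derivative_def fun_eq_iff inner_commute algebra_simps)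
      moreover have "-1 < c * u t" "c * u t < 1" using cu[of t] t by (auto simp: abs_less_iff)
      ultimately have "((\<lambda>t. arccos (c * u t)) has_real_derivative G t) (at t)"
        unfolding G_def by (auto intro!: derivative_eq_intros simp: field_simps)
      then show "((\<lambda>a. arccos (c * u a)) has_vector_derivative G t) (at t)"
        by (simp add: has_real_derivative_iff_has_vector_derivative)
    qed simp
    have GD: "\<bar>G t\<bar> \<le> norm (D t)" if t: "t \<in> {0<..<1} - S" for t
    proof -
      have t': "t \<in> {0..1}" using t by auto
      have "p \<bullet> D t = (p - u t *\<^sub>R \<gamma> t) \<bullet> D t" using orth[OF t] by (simp add: inner_diff_left)
      then have "\<bar>p \<bullet> D t\<bar> \<le> norm (p - u t *\<^sub>R \<gamma> t) * norm (D t)"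
        using Cauchy_Schwarz_ineq2 by metis
      also have "norm (p - u t *\<^sub>R \<gamma> t) = sqrt (1 - (u t)\<^sup>2)"
        using s[OF t'] p1 by (simp add: norm_eq_sqrt_inner inner_diff_left inner_diff_right u_def
            inner_commute power2_eq_square)
      finally have 1: "\<bar>p \<bullet> D t\<bar> \<le> sqrt (1 - (u t)\<^sup>2) * norm (D t)" .
      have "(c * u t)\<^sup>2 \<le> (u t)\<^sup>2"
        using c by (simp add: power_mult_distrib mult_left_le_one_le power_le_one)
      then have 2: "sqrt (1 - (u t)\<^sup>2) \<le> sqrt (1 - (c * u t)\<^sup>2)" by simp
      have "c * \<bar>p \<bullet> D t\<bar> \<le> \<bar>p \<bullet> D t\<bar>" using c by (simp add: mult_left_le_one_le)
      also have "\<dots> \<le> sqrt (1 - (c * u t)\<^sup>2) * norm (D t)"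
        using 1 mult_right_mono[OF 2, of "norm (D t)"] by simp
      finally have 3: "c * \<bar>p \<bullet> D t\<bar> \<le> sqrt (1 - (c * u t)\<^sup>2) * norm (D t)" .
      have "(c * u t)\<^sup>2 < 1" using cu[OF t'] by (simp add: abs_square_less_1)
      then have "0 < sqrt (1 - (c * u t)\<^sup>2)" by simp
      then show ?thesis using 3 c unfolding G_def by (simp add: abs_mult field_simps)
    qed
    have Dint: "(\<lambda>t. norm (D t)) integrable_on {0..1}" using assms(5) by (simp add: D_def)
    have "arccos (c * u 1) - arccos (c * u 0) \<le> integral {0..1} (\<lambda>t. norm (D t))"
    proof (rule has_integral_le[of "\<lambda>t. if t \<in> S \<union> {0,1} then 0 else G t" _ "{0..1}" "\<lambda>t. norm (D t)"])
      show "((\<lambda>t. if t \<in> S \<union> {0, 1} then 0 else G t) has_integral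
              arccos (c * u 1) - arccos (c * u 0)) {0..1}"
        by (rule has_integral_spike_finite[OF _ _ I, of "S \<union> {0,1}"]) (use fin in auto)
      show "((\<lambda>t. norm (D t)) has_integral integral {0..1} (\<lambda>t. norm (D t))) {0..1}"
        using Dint by (rule integrable_integral)
      show "(if t \<in> S \<union> {0, 1} then 0 else G t) \<le> norm (D t)" if "t \<in> {0..1}" for t
        using GD[of t] that by (cases "t = 0"; cases "t = 1") auto
    qed
    then show ?thesis using assms(3,4) p1
      by (simp add: curve_length_def D_def u_def pathstart_def pathfinish_def)
  qed
  note le = this
  have pq: "\<bar>p \<bullet> q\<bar> \<le> 1"
    using Cauchy_Schwarz_ineq2[of p q] s[of 1] p1 assms(4)
    by (simp add: norm_eq_sqrt_inner pathfinish_def)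
  have "((\<lambda>c. arccos (c * (p \<bullet> q)) - arccos c) \<longlongrightarrow> arccos (1 * (p \<bullet> q)) - arccos 1)
          (at 1 within {0..1})"
  proof -
    have "continuous_on {0..1} (\<lambda>c. arccos (c * (p \<bullet> q)) - arccos c)"
    proof (intro continuous_intros; clarsimp)
      fix c :: real assume c: "0 \<le> c" "c \<le> 1"
      then have "\<bar>c * (p \<bullet> q)\<bar> \<le> 1" using pq by (simp add: abs_mult mult_le_one)
      then show "- 1 \<le> c * (p \<bullet> q) \<and> c * (p \<bullet> q) \<le> 1" by (simp add: abs_le_iff)
    qed
    then show ?thesis unfolding continuous_on_def by (rule bspec) simp
  qed
  moreover have "at (1::real) within {0..1} = at_left 1"
    by (rule at_within_nhd[of _ "{0<..<2}"]) auto
  ultimately have L: "((\<lambda>c. arccos (c * (p \<bullet> q)) - arccos c) \<longlongrightarrow> arccos (p \<bullet> q)) (at_left 1)"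
    by simp
  show ?thesis
  proof (rule tendsto_upperbound[OF L])
    show "\<forall>\<^sub>F c in at_left 1. arccos (c * (p \<bullet> q)) - arccos c \<le> curve_length \<gamma>"
      by (rule eventually_at_leftI[of 0]) (use le in auto)
  qed simp
qed

lemma geo_dist_eq:
  fixes p q :: "'a::euclidean_space"
  assumes "DIM('a) \<ge> 2" and "p \<in> sphere 0 1" "q \<in> sphere 0 1"
  shows "geo_dist p q = arccos (p \<bullet> q)"
proof -
  have pp: "p \<bullet> p = 1" and qq: "q \<bullet> q = 1" using assms by (auto simp: dot_square_norm)
  have pq: "\<bar>p \<bullet> q\<bar> \<le> 1"
    using Cauchy_Schwarz_ineq2[of p q] assms by simp
  define \<theta> where "\<theta> = arccos (p \<bullet> q)"
  have c: "cos \<theta> = p \<bullet> q" using pq by (simp add: \<theta>_def cos_arccos_abs)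
  have \<theta>0: "0 \<le> \<theta>" unfolding \<theta>_def using pq by (intro arccos_lbound) auto
  define w where "w = q - cos \<theta> *\<^sub>R p"
  have pw: "p \<bullet> w = 0" by (simp add: w_def inner_diff_right pp c)
  have "w \<bullet> w = 1 - (cos \<theta>)\<^sup>2"
    by (simp add: w_def inner_diff_left inner_diff_right pp qq c inner_commute power2_eq_square)
  then have ww: "w \<bullet> w = (sin \<theta>)\<^sup>2" by (simp add: sin_squared_eq)
  obtain u where u: "p \<bullet> u = 0" "u \<bullet> u = 1" "sin \<theta> *\<^sub>R u = w"
  proof (cases "sin \<theta> = 0")
    case True
    obtain y where y: "y \<noteq> 0" "orthogonal p y" using orthogonal_to_vector_exists[OF assms(1)] .
    show ?thesis
      by (rule that[of "sgn y"]) (use True ww y in \<open>auto simp: orthogonal_def sgn_div_norm dot_square_norm power2_eq_square\<close>)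
  next
    case False
    show ?thesis
      by (rule that[of "w /\<^sub>R sin \<theta>"]) (use False ww pw in \<open>auto simp: power2_eq_square field_simps\<close>)
  qed
  define g where "g = (\<lambda>t. cos (\<theta> * t) *\<^sub>R p + sin (\<theta> * t) *\<^sub>R u)"
  define g' where "g' = (\<lambda>t. (- \<theta> * sin (\<theta> * t)) *\<^sub>R p + (\<theta> * cos (\<theta> * t)) *\<^sub>R u)"
  have d1: "(g has_vector_derivative g' t) (at t)" for t
    unfolding g_def g'_def by (auto intro!: derivative_eq_intros simp: has_vector_derivative_def algebra_simps)
  then have vd: "vector_derivative g (at t) = g' t" for t by (rule vector_derivative_at)
  have gg: "norm (g t) = 1" for t
  proof -
    have "g t \<bullet> g t = (cos (\<theta>*t))\<^sup>2 + (sin (\<theta>*t))\<^sup>2"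
      using u by (simp add: g_def inner_add_left inner_add_right pp inner_commute power2_eq_square)
    then show ?thesis by (simp add: norm_eq_sqrt_inner)
  qed
  have g'g': "norm (g' t) = \<theta>" for t
  proof -
    have "g' t \<bullet> g' t = \<theta>\<^sup>2 * ((cos (\<theta>*t))\<^sup>2 + (sin (\<theta>*t))\<^sup>2)"
      using u unfolding g'_def inner_add_left inner_add_right inner_scaleR_left inner_scaleR_right
      by (simp add: pp inner_commute power2_eq_square algebra_simps)
         (metis add.commute distrib_left mult.right_neutral power2_eq_square sin_cos_squared_add)
    then show ?thesis using \<theta>0 by (simp add: norm_eq_sqrt_inner)
  qed
  have "continuous_on {0..1} g'" unfolding g'_def by (intro continuous_intros)
  then have "valid_path g"
    unfolding valid_path_def
    by (intro C1_differentiable_imp_piecewise)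
       (auto simp: C1_differentiable_on_eq vd intro: differentiableI_vector[OF d1])
  moreover have "g 1 = q" "g 0 = p" using u(3) by (simp_all add: g_def w_def)
  ultimately have "sphere_curve p q g"
    by (auto simp: sphere_curve_def path_image_def gg pathstart_def pathfinish_def vd g'g' integrable_const_ivl)
  moreover have "curve_length g = \<theta>" by (simp add: curve_length_def vd g'g')
  ultimately show ?thesis
    unfolding geo_dist_def \<theta>_def[symmetric]
    by (intro cInf_eq_minimum) (use curve_length_ge \<theta>_def in \<open>auto intro!: exI[of _ g]\<close>)
qed
end

theory Submission
  imports Defs
begin

text \<open>In normal coordinates \<open>u\<close> at \<open>\<mu>\<close> the squared distance \<open>h u q\<close> fails to be differentiable on the cut
  locus of \<open>q\<close>, but it is Lipschitz and semiconcave (\<open>K |u|\<^sup>2 - h u q\<close> is convex) uniformly in \<open>q\<close>. A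
  semiconcave function is bounded below by its values on a finite net, so Chebyshev's inequality at
  the points of a net controls the empirical criterion from below on whole shells; this gives the
  rate \<open>1 / sqrt n\<close> and the linearisation \<open>sqrt n x\<^sub>n = - \<Lambda>\<^sup>-\<^sup>1 (\<Sum> g (Y\<^sub>i)) / sqrt n + o(1)\<close> in probability,
  where \<open>g q\<close> is the gradient of \<open>h\<close> at \<open>0\<close>.

  The second-order remainder of \<open>h\<close> at \<open>0\<close> is at most \<open>K |u|\<^sup>2 / |q + \<mu>|\<close>. Near \<open>- \<mu>\<close> the law \<open>Q\<close> has a
  bounded density, so a cap of radius \<open>\<rho>\<close> has probability \<open>O(\<rho>\<^sup>2)\<close> and \<open>1 / |q + \<mu>|\<close> is integrable; dominated
  convergence then yields the second-order expansion of the population criterion with matrix \<open>\<Lambda>\<close>.\<close>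

section \<open>Weak convergence from characteristic functions\<close>

text \<open>The classical route expands the empirical gradient at an intermediate point, which needs
  second derivatives of \<open>h u q\<close> that are continuous in \<open>u\<close> near 0. For
  \<open>q\<close> near the antipode of mu they blow up: the tangential eigenvalue of half the
  squared distance at distance t is t cot t, which is at most 1 but tends to minus infinity as t
  approaches pi. Only the upper bound is uniform in \<open>q\<close>, so values of the criterion are
  compared instead of gradients.

  Two-sided control is needed only in the mean, at mu itself. There minimality of mu supplies both
  the vanishing mean gradient and the semidefiniteness of Lambda; invertibility, implicit in the
  limit covariance, upgrades this to positive definiteness.

  Along a line in the chart the image curve lies in a subspace of dimension at most 3. As d > 2
  makes the ambient dimension at least 4, points \<open>q\<close> off that subspace are dense; for
  them the curve avoids the cut locus, and continuity of the distance carries the inequalities to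
  every \<open>q\<close>.\<close>

inductive trig_poly :: "('a::euclidean_space \<Rightarrow> complex) \<Rightarrow> bool" where
  cis: "trig_poly (\<lambda>x. c * cis (t \<bullet> x))"
| add: "trig_poly f \<Longrightarrow> trig_poly g \<Longrightarrow> trig_poly (\<lambda>x. f x + g x)"

lemma trig_poly_const: "trig_poly (\<lambda>x. c)"
  using trig_poly.cis[of c 0] by simp

lemma trig_poly_sum:
  "finite I \<Longrightarrow> (\<And>i. i \<in> I \<Longrightarrow> trig_poly (f i)) \<Longrightarrow> trig_poly (\<lambda>x. \<Sum>i\<in>I. f i x)"
  by (induction I rule: finite_induct) (auto intro: trig_poly_const trig_poly.add)

text \<open>Frequencies add under multiplication. This closure is what turns polynomials in a point
  of the torus into trigonometric polynomials.\<close>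

lemma trig_poly_mult:
  assumes "trig_poly f" "trig_poly g"
  shows "trig_poly (\<lambda>x. f x * g x)"
  using assms
proof (induction f arbitrary: g rule: trig_poly.induct)
  case (cis c t)
  from cis show ?case
  proof (induction g rule: trig_poly.induct)
    case (cis d s)
    have "(\<lambda>x. c * cis (t \<bullet> x) * (d * cis (s \<bullet> x))) = (\<lambda>x. (c * d) * cis ((t + s) \<bullet> x))"
      by (simp add: fun_eq_iff inner_add_left flip: cis_mult)
    then show ?case using trig_poly.cis by metis
  next
    case (add f g)
    then show ?case by (auto simp: distrib_left intro: trig_poly.add)
  qed
next
  case (add f1 f2)
  show ?case
    using trig_poly.add[OF add.IH(1)[OF add.prems] add.IH(2)[OF add.prems]]
    by (simp add: distrib_right)
qed

lemma trig_poly_cos: "trig_poly (\<lambda>x. complex_of_real (c * cos (t \<bullet> x)))"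
proof -
  have "(\<lambda>x. complex_of_real (c * cos (t \<bullet> x))) =
      (\<lambda>x. (of_real c / 2) * cis (t \<bullet> x) + (of_real c / 2) * cis ((- t) \<bullet> x))"
    by (auto simp: fun_eq_iff complex_eq_iff)
  then show ?thesis by (simp only: trig_poly.intros)
qed

lemma trig_poly_sin: "trig_poly (\<lambda>x. complex_of_real (c * sin (t \<bullet> x)))"
proof -
  have "(\<lambda>x. complex_of_real (c * sin (t \<bullet> x))) =
      (\<lambda>x. (- \<i> * of_real c / 2) * cis (t \<bullet> x) + (\<i> * of_real c / 2) * cis ((- t) \<bullet> x))"
    by (auto simp: fun_eq_iff complex_eq_iff)
  then show ?thesis by (simp only: trig_poly.intros)
qed

lemma trig_poly_borel_measurable: "trig_poly f \<Longrightarrow> f \<in> borel_measurable borel"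
  by (induction rule: trig_poly.induct)
     (auto intro!: borel_measurable_continuous_onI continuous_intros)

lemma trig_poly_bounded: "trig_poly f \<Longrightarrow> \<exists>B. \<forall>x. norm (f x) \<le> B"
proof (induction rule: trig_poly.induct)
  case (cis c t)
  then show ?case by (auto simp: norm_mult)
next
  case (add f g)
  then obtain A B where "\<And>x. norm (f x) \<le> A" "\<And>x. norm (g x) \<le> B" by blast
  then show ?case by (intro exI[of _ "A + B"] allI norm_triangle_le add_mono) auto
qed

lemma trig_poly_integrable:
  assumes "trig_poly f" "prob_space P" "sets P = sets borel"
  shows "integrable P f"
proof -
  interpret prob_space P by fact
  obtain B where "\<And>x. norm (f x) \<le> B" using trig_poly_bounded[OF assms(1)] by blast
  moreover have "f \<in> borel_measurable P"
    using trig_poly_borel_measurable[OF assms(1)] assms(3) measurable_cong_sets by blast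
  ultimately show ?thesis by (intro integrable_const_bound[of _ B]) auto
qed

lemma trig_poly_integral_tendsto:
  assumes "trig_poly f"
    and "\<And>n. prob_space (P n)" "\<And>n. sets (P n) = sets borel" "prob_space N" "sets N = sets borel"
    and char: "\<And>t. (\<lambda>n. \<integral>x. cis (t \<bullet> x) \<partial>P n) \<longlonglongrightarrow> (\<integral>x. cis (t \<bullet> x) \<partial>N)"
  shows "(\<lambda>n. \<integral>x. f x \<partial>P n) \<longlonglongrightarrow> (\<integral>x. f x \<partial>N)"
  using assms(1)
proof (induction rule: trig_poly.induct)
  case (cis c t)
  then show ?case by (simp add: tendsto_mult_left char)
next
  case (add f g)
  then show ?case
    using trig_poly_integrable[OF _ assms(2,3)] trig_poly_integrable[OF _ assms(4,5)]
    by (simp add: tendsto_add)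
qed

text \<open>Each coordinate is wrapped around a circle. Polynomials on the compact torus then pull
  back to functions that are bounded on the whole space, which polynomials on the space itself are
  not.\<close>

definition torus_map :: "real \<Rightarrow> real ^ 'd \<Rightarrow> complex ^ 'd" where
  "torus_map a x = (\<chi> i. cis (a * x $ i))"

lemma trig_poly_polynomial_torus:
  assumes "real_polynomial_function p"
  shows "trig_poly (\<lambda>x :: real ^ 'd. complex_of_real (p (torus_map a x)))"
  using assms
proof (induction rule: real_polynomial_function.induct)
  case (linear f)
  then interpret bounded_linear f .
  have 1: "f (torus_map a x) = (\<Sum>i\<in>UNIV. f (axis i 1) * cos ((a *\<^sub>R axis i 1) \<bullet> x)
      + f (axis i \<i>) * sin ((a *\<^sub>R axis i 1) \<bullet> x))" for x :: "real ^ 'd"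
  proof -
    have t: "torus_map a x = (\<Sum>i\<in>UNIV. axis i (cis (a * x $ i)))"
      unfolding vec_eq_iff torus_map_def sum_component axis_def
      by (auto simp: sum.delta)
    have c: "axis i (cis r) = cos r *\<^sub>R axis i 1 + sin r *\<^sub>R axis i \<i>" for i :: 'd and r
      by (auto simp: vec_eq_iff axis_def complex_eq_iff)
    have "f (axis i (cis (a * x $ i))) = f (axis i 1) * cos ((a *\<^sub>R axis i 1) \<bullet> x)
      + f (axis i \<i>) * sin ((a *\<^sub>R axis i 1) \<bullet> x)" for i
      unfolding c add scaleR by (simp add: inner_axis' mult.commute)
    then show ?thesis unfolding t sum by simp
  qed
  show ?case unfolding 1 of_real_sum of_real_add
    by (rule trig_poly_sum[OF finite trig_poly.add[OF trig_poly_cos trig_poly_sin]])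
next
  case (const c)
  then show ?case by (simp add: trig_poly_const)
next
  case (add f g)
  then show ?case by (simp add: trig_poly.add)
next
  case (mult f g)
  then show ?case by (simp add: trig_poly_mult)
qed

text \<open>With a K at most 1 all angles lie in [-1, 1], inside [-pi/2, pi/2], where the sine alone
  determines the angle.\<close>

lemma torus_map_inj:
  assumes "a > 0" "a * K \<le> 1"
  shows "inj_on (torus_map a) (cball (0 :: real ^ 'd) K)"
proof (rule inj_onI)
  fix x y :: "real ^ 'd"
  assume x: "x \<in> cball 0 K" and y: "y \<in> cball 0 K" and e: "torus_map a x = torus_map a y"
  have b: "\<bar>a * z $ i\<bar> \<le> 1" if "z \<in> cball 0 K" for z :: "real ^ 'd" and i
  proof -
    have "\<bar>z $ i\<bar> \<le> K" using component_le_norm_cart[of z i] that by simp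
    then have "a * \<bar>z $ i\<bar> \<le> a * K" using assms by (intro mult_left_mono) auto
    then have "a * \<bar>z $ i\<bar> \<le> 1" using assms by linarith
    then show ?thesis using assms by (simp add: abs_mult)
  qed
  have "sin (a * x $ i) = sin (a * y $ i)" for i
    using e by (simp add: torus_map_def vec_eq_iff complex_eq_iff)
  moreover have "- (pi / 2) \<le> a * z $ i \<and> a * z $ i \<le> pi / 2" if "z \<in> cball 0 K"
    for z :: "real ^ 'd" and i
    using b[OF that, of i] pi_gt3 unfolding abs_le_iff by linarith
  ultimately have "a * x $ i = a * y $ i" for i
    using x y sin_inj_pi by metis
  then show "x = y" using assms by (simp add: vec_eq_iff)
qed

lemma continuous_on_torus_map: "continuous_on S (torus_map a)"
  unfolding torus_map_def by (intro continuous_intros)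

text \<open>The function is transported to the torus by the embedding \<open>torus_map\<close>, extended by Tietze
  and approximated there by a polynomial; so the approximant is bounded on the whole space.\<close>

lemma trig_poly_approx:
  fixes f :: "real ^ 'd \<Rightarrow> real"
  assumes "continuous_on UNIV f" "\<And>x. \<bar>f x\<bar> \<le> B" "e > 0" "K > 0"
  obtains T :: "real ^ 'd \<Rightarrow> real" where "trig_poly (\<lambda>x. complex_of_real (T x))"
    "\<And>x. norm x \<le> K \<Longrightarrow> \<bar>f x - T x\<bar> \<le> e" "\<And>x. \<bar>T x\<bar> \<le> B + e"
proof -
  define a where "a = 1 / K"
  have a: "a > 0" "a * K \<le> 1" using assms by (auto simp: a_def)
  let ?A = "torus_map a ` cball (0 :: real ^ 'd) K"
  obtain g where g: "continuous_on ?A g" "\<And>x. x \<in> cball 0 K \<Longrightarrow> g (torus_map a x) = x"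
  proof
    show "continuous_on ?A (inv_into (cball 0 K) (torus_map a))"
      by (rule continuous_on_inv[OF continuous_on_torus_map]) (auto simp: inv_into_f_f torus_map_inj[OF a])
    show "inv_into (cball 0 K) (torus_map a) (torus_map a x) = x" if "x \<in> cball 0 K" for x
      using that torus_map_inj[OF a] by (rule inv_into_f_f[rotated])
  qed
  have A: "compact ?A"
    by (intro compact_continuous_image continuous_on_torus_map compact_cball)
  have "continuous_on ?A (\<lambda>z. f (g z))"
    by (rule continuous_on_compose2[OF assms(1) g(1)]) auto
  moreover have "B \<ge> 0" using assms(2)[of 0] by linarith
  ultimately obtain F where F: "continuous_on UNIV F" "\<And>z. z \<in> ?A \<Longrightarrow> F z = f (g z)"
      "\<And>z. norm (F z) \<le> B"
    using Tietze[of ?A "\<lambda>z. f (g z)" UNIV B] A assms(2) compact_imp_closed by auto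
  let ?R = "range (torus_map a :: real ^ 'd \<Rightarrow> _)"
  let ?S = "{z :: complex ^ 'd. \<forall>i. z $ i \<in> sphere 0 1}"
  have RS: "?R \<subseteq> ?S" by (auto simp: torus_map_def)
  have "?S = (\<Inter>i. (\<lambda>z. z $ i) -` sphere 0 1)" by auto
  then have "closed ?S" by (auto intro!: closed_INT closed_vimage continuous_intros)
  moreover have "bounded ?S"
  proof (rule boundedI)
    fix z :: "complex ^ 'd" assume "z \<in> ?S"
    then have "(\<Sum>i\<in>UNIV. norm (z $ i)) = real CARD('d)" by simp
    then show "norm z \<le> real CARD('d)" using L2_set_le_sum[of UNIV "\<lambda>i. norm (z $ i)"]
      by (simp add: norm_vec_def)
  qed
  ultimately have S: "compact ?S" by (simp add: compact_eq_bounded_closed)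
  obtain p where p: "real_polynomial_function p" "\<And>z. z \<in> ?S \<Longrightarrow> \<bar>F z - p z\<bar> < e"
    using Stone_Weierstrass_real_polynomial_function[OF S _ assms(3), of F] F(1)
      continuous_on_subset by blast
  have 1: "\<bar>F (torus_map a x) - p (torus_map a x)\<bar> < e" for x :: "real ^ 'd" using p(2) RS by blast
  show ?thesis
  proof (rule that[OF trig_poly_polynomial_torus[OF p(1), of a]])
    show "\<bar>f x - p (torus_map a x)\<bar> \<le> e" if "norm x \<le> K" for x
      using 1[of x] F(2)[of "torus_map a x"] g(2)[of x] that by fastforce
    show "\<bar>p (torus_map a x)\<bar> \<le> B + e" for x
      using 1[of x] F(3)[of "torus_map a x"] by simp
  qed
qed

section \<open>Tightness and the continuity theorem\<close>

lemma tail_borel: "{x :: 'a::real_normed_vector. norm x > K} \<in> sets borel"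
  by (intro borel_open open_Collect_less continuous_intros)

lemma prob_tail_tendsto_0:
  fixes N :: "'a::real_normed_vector measure"
  assumes "prob_space N" "sets N = sets borel" "e > 0"
  shows "\<exists>K. measure N {x. norm x > K} < e"
proof -
  interpret prob_space N by fact
  have sp: "space N = UNIV" using sets_eq_imp_space_eq[OF assms(2)] by simp
  have "(\<lambda>n. prob {x. norm x > real n}) \<longlonglongrightarrow> prob (\<Inter>n. {x. norm x > real n})"
  proof (rule finite_Lim_measure_decseq)
    show "range (\<lambda>n. {x. norm x > real n}) \<subseteq> events"
      unfolding assms(2) by (rule image_subsetI) (rule tail_borel)
    show "decseq (\<lambda>n. {x :: 'a. norm x > real n})" by (rule decseq_SucI) (rule Collect_mono, simp)
  qed
  moreover have "(\<Inter>n. {x::'a. norm x > real n}) = {}"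
  proof -
    have "\<exists>n. \<not> norm x > real n" for x :: 'a using real_arch_simple[of "norm x"] by (auto simp: not_less)
    then show ?thesis by auto
  qed
  ultimately have "(\<lambda>n. prob {x. norm x > real n}) \<longlonglongrightarrow> 0" by simp
  from order_tendstoD(2)[OF this assms(3)] show ?thesis
    by (auto dest!: eventually_happens)
qed

text \<open>Convergence of characteristic functions is convergence of integrals of trigonometric
  polynomials. Such a polynomial T is within e of f on a ball that carries all but e of the mass and
  is bounded by B + e outside, so replacing f by T costs at most e + (2 B + e) e under every law
  involved.\<close>

theorem weakly_converges_if_char_tendsto:
  fixes P :: "nat \<Rightarrow> (real ^ 'd) measure"
  assumes P: "\<And>n. prob_space (P n)" "\<And>n. sets (P n) = sets borel"
    and N: "prob_space N" "sets N = sets borel"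
    and tight: "\<And>e. e > 0 \<Longrightarrow> \<exists>K. \<forall>\<^sub>F n in sequentially. measure (P n) {x. norm x > K} < e"
    and char: "\<And>t. (\<lambda>n. \<integral>x. cis (t \<bullet> x) \<partial>P n) \<longlonglongrightarrow> (\<integral>x. cis (t \<bullet> x) \<partial>N)"
  shows "weakly_converges P N"
  unfolding weakly_converges_def
proof (intro allI impI)
  fix f :: "real ^ 'd \<Rightarrow> real"
  assume f: "continuous_on UNIV f \<and> bounded (range f)"
  then obtain B where B: "\<And>x. \<bar>f x\<bar> \<le> B" by (auto simp: bounded_iff)
  have B0: "B \<ge> 0" using B[of 0] by linarith
  have close: "\<bar>(\<integral>x. f x \<partial>R) - (\<integral>x. T x \<partial>R)\<bar> \<le> e + (2 * B + e) * e"
    if R: "prob_space R" "sets R = sets borel" and m: "measure R {x. norm x > K} < e" and e: "e > 0"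
      and T: "trig_poly (\<lambda>x. complex_of_real (T x))" "\<And>x. norm x \<le> K \<Longrightarrow> \<bar>f x - T x\<bar> \<le> e"
        "\<And>x. \<bar>T x\<bar> \<le> B + e" for R :: "(real ^ 'd) measure" and T K e
  proof -
    interpret prob_space R by fact
    have fm: "f \<in> borel_measurable R"
      using f borel_measurable_continuous_onI R(2) measurable_cong_sets by blast
    have "(\<lambda>x. Re (complex_of_real (T x))) \<in> borel_measurable borel"
      using trig_poly_borel_measurable[OF T(1)] by measurable
    then have Tm: "T \<in> borel_measurable R" using R(2) measurable_cong_sets by auto
    have If: "integrable R f" by (rule integrable_const_bound[of _ B]) (use B fm in auto)
    have IT: "integrable R T" by (rule integrable_const_bound[of _ "B + e"]) (use T fm Tm in auto)
    have ms: "{x :: real ^ 'd. norm x > K} \<in> sets R"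
      using tail_borel R(2) by simp
    then have i: "integrable R (indicat_real {x. norm x > K})"
      by (intro integrable_real_indicator) (auto simp: less_top[symmetric])
    have "\<bar>(\<integral>x. f x \<partial>R) - (\<integral>x. T x \<partial>R)\<bar> = \<bar>\<integral>x. f x - T x \<partial>R\<bar>" using If IT by simp
    also have "\<dots> \<le> (\<integral>x. \<bar>f x - T x\<bar> \<partial>R)" by (rule integral_abs_bound)
    also have "\<dots> \<le> (\<integral>x. e + (2 * B + e) * indicat_real {x. norm x > K} x \<partial>R)"
    proof (rule integral_mono)
      show "integrable R (\<lambda>x. e + (2 * B + e) * indicat_real {x. norm x > K} x)"
        using i by simp
      fix x
      show "\<bar>f x - T x\<bar> \<le> e + (2 * B + e) * indicat_real {x. norm x > K} x"
        using T(2)[of x] T(3)[of x] B[of x] e by (cases "norm x \<le> K") (auto simp: indicator_def)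
    qed (use If IT in auto)
    also have "\<dots> = e + (2 * B + e) * measure R {x. norm x > K}" using ms i by (simp add: prob_space)
    also have "\<dots> \<le> e + (2 * B + e) * e" using m B0 e by (intro add_left_mono mult_left_mono) auto
    finally show ?thesis .
  qed
  show "(\<lambda>n. \<integral>x. f x \<partial>P n) \<longlonglongrightarrow> (\<integral>x. f x \<partial>N)"
  proof (rule LIMSEQ_I)
    fix r :: real assume r: "r > 0"
    \<comment> \<open>Two replacement errors and the error for T add up to at most (4 B + 5) e once
      e is at most 1; the bound (4 B + 6) e \<le> r covers this.\<close>
    define e where "e = min 1 (r / (2 * (2 * B + 3)))"
    have pos: "2 * (2 * B + 3) > 0" using B0 by simp
    have e: "e > 0" "e \<le> 1" using r pos by (auto simp: e_def)
    have "e \<le> r / (2 * (2 * B + 3))" by (simp add: e_def)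
    with pos have er': "e * (2 * (2 * B + 3)) \<le> r" by (simp only: pos_le_divide_eq)
    have "e + (2 * B + e) * e + (e + (2 * B + e) * e) + e \<le> r"
    proof -
      have "(2 * B + e) * e \<le> (2 * B + 1) * e" using e by (intro mult_right_mono) auto
      moreover have "(2 * B + 1) * e = 2 * (B * e) + e" "e * (2 * (2 * B + 3)) = 4 * (B * e) + 6 * e"
        by (simp_all add: algebra_simps)
      ultimately show ?thesis using e er' by linarith
    qed
    note er = this
    obtain K1 where K1: "\<forall>\<^sub>F n in sequentially. measure (P n) {x. norm x > K1} < e" using tight e by blast
    obtain K2 where K2: "measure N {x. norm x > K2} < e" using prob_tail_tendsto_0[OF N e(1)] by blast
    define K where "K = max 1 (max K1 K2)"
    have mono: "measure R {x. norm x > K} < e"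
      if "prob_space R" "sets R = sets borel" "measure R {x. norm x > L} < e" "L \<le> K"
      for R :: "(real ^ 'd) measure" and L
    proof -
      interpret prob_space R by fact
      have "prob {x. norm x > K} \<le> prob {x. norm x > L}"
        using that tail_borel[of L] by (intro finite_measure_mono) auto
      then show ?thesis using that by linarith
    qed
    have "K > 0" by (simp add: K_def)
    from trig_poly_approx[OF conjunct1[OF f] B e(1) this]
    obtain T where T: "trig_poly (\<lambda>x. complex_of_real (T x))" "\<And>x. norm x \<le> K \<Longrightarrow> \<bar>f x - T x\<bar> \<le> e"
      "\<And>x. \<bar>T x\<bar> \<le> B + e" by blast
    have N': "\<bar>(\<integral>x. f x \<partial>N) - (\<integral>x. T x \<partial>N)\<bar> \<le> e + (2 * B + e) * e"
      by (rule close[OF N mono[OF N K2] e(1) T]) (auto simp: K_def)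
    have "(\<lambda>n. \<integral>x. complex_of_real (T x) \<partial>P n) \<longlonglongrightarrow> (\<integral>x. complex_of_real (T x) \<partial>N)"
      by (rule trig_poly_integral_tendsto[OF T(1) P N char])
    then have "(\<lambda>n. \<integral>x. T x \<partial>P n) \<longlonglongrightarrow> (\<integral>x. T x \<partial>N)" by (simp add: tendsto_of_real_iff)
    from LIMSEQ_D[OF this e(1)] have ev: "\<forall>\<^sub>F n in sequentially. \<bar>(\<integral>x. T x \<partial>P n) - (\<integral>x. T x \<partial>N)\<bar> < e"
      by (auto simp: eventually_sequentially)
    have "\<forall>\<^sub>F n in sequentially. norm ((\<integral>x. f x \<partial>P n) - (\<integral>x. f x \<partial>N)) < r"
      using K1 ev
    proof eventually_elim
      case (elim n)
      have "\<bar>(\<integral>x. f x \<partial>P n) - (\<integral>x. T x \<partial>P n)\<bar> \<le> e + (2 * B + e) * e"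
        by (rule close[OF P mono[OF P elim(1)] e(1) T]) (auto simp: K_def)
      then show ?case using N' elim(2) er unfolding real_norm_def by linarith
    qed
    then show "\<exists>no. \<forall>n\<ge>no. norm ((\<integral>x. f x \<partial>P n) - (\<integral>x. f x \<partial>N)) < r"
      by (simp add: eventually_sequentially)
  qed
qed

section \<open>Gaussian laws\<close>

lemma Basis_vec_real: "(Basis :: (real ^ 'd) set) = range (\<lambda>i. axis i 1)"
  by (auto simp: Basis_vec_def)

lemma prod_Basis_vec:
  fixes g :: "real \<Rightarrow> 'b::comm_monoid_mult" and x :: "real ^ 'd"
  shows "(\<Prod>i\<in>UNIV. g (x $ i)) = (\<Prod>b\<in>Basis. g (x \<bullet> b))"
proof -
  have "inj (\<lambda>i::'d. axis i (1::real))" by (auto simp: inj_on_def axis_eq_axis)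
  then show ?thesis unfolding Basis_vec_real by (simp add: prod.reindex inner_axis)
qed

lemma sets_std_gaussian: "sets std_gaussian = sets borel"
  by (simp add: std_gaussian_def)

text \<open>Density and exponential both factor over the coordinates, and Lebesgue measure is the
  image of a product measure, so the integral is a product of scalar characteristic
  functions.\<close>

lemma char_std_gaussian:
  fixes s :: "real ^ 'd"
  shows "(\<integral>z. cis (s \<bullet> z) \<partial>std_gaussian) = of_real (exp (- (norm s)\<^sup>2 / 2))"
proof -
  interpret P: product_sigma_finite "\<lambda>_ :: real ^ 'd. lborel :: real measure"
    by unfold_locales
  let ?g = "\<lambda>b r. std_normal_density r *\<^sub>R cis ((s \<bullet> b) * r)"
  have cm: "(\<lambda>r. cis (c * r)) \<in> borel_measurable borel" for c :: real
    by (intro borel_measurable_continuous_onI continuous_intros)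
  have 1: "integrable lborel (?g b)" for b
  proof (rule Bochner_Integration.integrable_bound)
    show "integrable lborel std_normal_density" by (rule integrable_normal_density) simp
    show "?g b \<in> borel_measurable lborel" using cm by simp
    show "AE r in lborel. norm (?g b r) \<le> norm (std_normal_density r)" by simp
  qed
  have 2: "(\<integral>r. ?g b r \<partial>lborel) = of_real (exp (- (s \<bullet> b)\<^sup>2 / 2))" for b
  proof -
    have "(\<integral>r. ?g b r \<partial>lborel) = (\<integral>r. cis ((s \<bullet> b) * r) \<partial>std_normal_distribution)"
      using cm by (subst integral_density) auto
    also have "\<dots> = char std_normal_distribution (s \<bullet> b)"
      by (simp add: char_def cis_conv_exp)
    finally show ?thesis by (simp add: char_std_normal_distribution)
  qed
  have prodcis: "cis (s \<bullet> z) = (\<Prod>b\<in>Basis. cis ((s \<bullet> b) * (z \<bullet> b)))" for z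
  proof -
    have "(\<Prod>b\<in>B. cis (h b)) = cis (\<Sum>b\<in>B. h b)" if "finite B" for B :: "(real ^ 'd) set" and h
      using that by (induction rule: finite_induct) (auto simp: cis_mult)
    then show ?thesis by (simp add: euclidean_inner[of s z])
  qed
  have fm: "(\<lambda>z :: real ^ 'd. cis (s \<bullet> z)) \<in> borel_measurable borel"
    by (intro borel_measurable_continuous_onI continuous_intros)
  have dm: "(\<lambda>z :: real ^ 'd. \<Prod>i\<in>UNIV. std_normal_density (z $ i)) \<in> borel_measurable borel"
    unfolding std_normal_density_def by (intro borel_measurable_continuous_onI continuous_intros) auto
  have "(\<integral>z. cis (s \<bullet> z) \<partial>std_gaussian) =
      (\<integral>z. (\<Prod>i\<in>UNIV. std_normal_density (z $ i)) *\<^sub>R cis (s \<bullet> z) \<partial>lborel)"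
    unfolding std_gaussian_def using fm dm by (subst integral_density) (auto intro!: prod_nonneg)
  also have "\<dots> = (\<integral>z. (\<Prod>b\<in>Basis. ?g b (z \<bullet> b)) \<partial>lborel)"
    unfolding prod_Basis_vec[of std_normal_density] prodcis
    by (simp add: scaleR_conv_of_real prod.distrib)
  also have "\<dots> = (\<integral>f. (\<Prod>b\<in>Basis. ?g b ((\<Sum>b\<in>Basis. f b *\<^sub>R b) \<bullet> b))
      \<partial>(\<Pi>\<^sub>M b\<in>(Basis :: (real ^ 'd) set). lborel))"
  proof (subst lborel_eq, subst integral_distr)
    show "(\<lambda>z :: real ^ 'd. \<Prod>b\<in>Basis. ?g b (z \<bullet> b)) \<in> borel_measurable borel"
      unfolding std_normal_density_def by (intro borel_measurable_continuous_onI continuous_intros) auto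
  qed (auto intro!: borel_measurable_sum simp: )
  also have "\<dots> = (\<integral>f. (\<Prod>b\<in>Basis. ?g b (f b)) \<partial>(\<Pi>\<^sub>M b\<in>(Basis :: (real ^ 'd) set). lborel))"
    by (intro Bochner_Integration.integral_cong prod.cong refl) (simp add: inner_sum_left_Basis)
  also have "\<dots> = (\<Prod>b\<in>Basis. \<integral>r. ?g b r \<partial>lborel)"
    by (rule P.product_integral_prod) (auto intro: 1)
  also have "\<dots> = of_real (\<Prod>b\<in>Basis. exp (- (s \<bullet> b)\<^sup>2 / 2))" unfolding 2 by simp
  also have "(\<Prod>b\<in>Basis. exp (- (s \<bullet> b)\<^sup>2 / 2)) = exp (\<Sum>b\<in>Basis. - (s \<bullet> b)\<^sup>2 / 2)"
    by (simp add: exp_sum)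
  also have "(\<Sum>b\<in>Basis. - (s \<bullet> b)\<^sup>2 / 2) = - (norm s)\<^sup>2 / 2"
    unfolding power2_norm_eq_inner euclidean_inner[of s s]
    by (simp add: power2_eq_square sum_negf sum_divide_distrib)
  finally show ?thesis .
qed

text \<open>The total mass is the characteristic function at 0.\<close>

lemma prob_space_std_gaussian: "prob_space (std_gaussian :: (real ^ 'd::finite) measure)"
proof -
  have "(\<integral>z. 1 \<partial>(std_gaussian :: (real ^ 'd) measure)) = (1 :: complex)"
    using char_std_gaussian[of "0 :: real ^ 'd"] by simp
  then have "measure (std_gaussian :: (real ^ 'd) measure) (space std_gaussian) = 1"
    by (simp add: scaleR_conv_of_real)
  then show ?thesis
    by (intro prob_spaceI, cases "emeasure (std_gaussian :: (real ^ 'd) measure) (space std_gaussian)")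
       (auto simp: measure_def)
qed

text \<open>The matrix picked by the choice operator enters only through A A^T, because |A^T t|^2 =
  t . S t. The hypothesis ensures that the choice returns a genuine factor.\<close>

lemma gaussian_zero:
  fixes S :: "real ^ 'd ^ 'd"
  assumes "\<exists>A :: real ^ 'd ^ 'd. A ** transpose A = S"
  shows "prob_space (gaussian 0 S)" "sets (gaussian 0 S) = sets borel"
    "(\<integral>x. cis (t \<bullet> x) \<partial>gaussian 0 S) = of_real (exp (- (t \<bullet> (S *v t)) / 2))"
proof -
  define A :: "real ^ 'd ^ 'd" where "A = (SOME A. A ** transpose A = S)"
  have A: "A ** transpose A = S" unfolding A_def by (rule someI_ex[OF assms])
  have g: "gaussian 0 S = distr std_gaussian borel (\<lambda>z. A *v z)"
    by (simp add: gaussian_def A_def)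
  have m: "(\<lambda>z. A *v z) \<in> measurable std_gaussian borel"
    unfolding measurable_cong_sets[OF sets_std_gaussian refl]
    by (intro borel_measurable_continuous_onI linear_continuous_on) simp
  show "prob_space (gaussian 0 S)"
    unfolding g by (rule prob_space.prob_space_distr[OF prob_space_std_gaussian m])
  show "sets (gaussian 0 S) = sets borel" by (simp add: g)
  have "(\<integral>x. cis (t \<bullet> x) \<partial>gaussian 0 S) = (\<integral>z. cis (t \<bullet> (A *v z)) \<partial>std_gaussian)"
    unfolding g by (rule integral_distr[OF m])
      (intro borel_measurable_continuous_onI continuous_intros)
  also have "\<dots> = (\<integral>z. cis ((transpose A *v t) \<bullet> z) \<partial>std_gaussian)"
    by (simp add: dot_lmul_matrix transpose_matrix_vector)
  also have "\<dots> = of_real (exp (- (norm (transpose A *v t))\<^sup>2 / 2))" by (rule char_std_gaussian)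
  also have "(norm (transpose A *v t))\<^sup>2 = t \<bullet> (S *v t)"
    unfolding power2_norm_eq_inner A[symmetric]
    by (metis dot_lmul_matrix matrix_vector_mul_assoc transpose_matrix_vector)
  finally show "(\<integral>x. cis (t \<bullet> x) \<partial>gaussian 0 S) = of_real (exp (- (t \<bullet> (S *v t)) / 2))" .
qed

section \<open>Factorization of positive semidefinite matrices\<close>

lemma inner_matrix_symmetric:
  fixes S :: "real ^ 'd ^ 'd"
  assumes "transpose S = S"
  shows "x \<bullet> (S *v y) = y \<bullet> (S *v x)"
  by (metis assms dot_lmul_matrix inner_commute transpose_matrix_vector)

lemma quadratic_form_sum: "x \<bullet> (S *v x) = (\<Sum>i\<in>UNIV. \<Sum>j\<in>UNIV. S $ i $ j * (x $ i * x $ j))"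
  for S :: "real ^ 'd ^ 'd"
  by (simp add: inner_vec_def matrix_vector_mult_def sum_distrib_left mult_ac)

text \<open>Cholesky elimination, by induction on a set \<open>K\<close> of indices that supports
  the matrix. The claim that the columns of A outside \<open>K\<close> vanish keeps column
  \<open>k\<close> free for the next pivot.\<close>

lemma psd_factorization_aux:
  fixes S :: "real ^ 'd ^ 'd"
  assumes "finite K" "transpose S = S" "\<And>x. 0 \<le> x \<bullet> (S *v x)"
    and "\<And>i j. S $ i $ j \<noteq> 0 \<Longrightarrow> i \<in> K \<and> j \<in> K"
  shows "\<exists>A :: real ^ 'd ^ 'd. A ** transpose A = S \<and> (\<forall>i j. A $ i $ j \<noteq> 0 \<longrightarrow> j \<in> K)"
  using assms
proof (induction K arbitrary: S rule: finite_induct)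
  case empty
  then have "S = 0" by (metis empty_iff vec_eq_iff zero_index)
  then show ?case by (intro exI[of _ 0]) (auto simp: matrix_matrix_mult_def vec_eq_iff)
next
  case (insert k K)
  note sym = insert.prems(1) and psd = insert.prems(2) and supp = insert.prems(3)
  have sij: "S $ i $ j = S $ j $ i" for i j
    using sym by (metis transpose_def vec_lambda_beta)
  have entry: "axis i 1 \<bullet> (S *v axis j 1) = S $ i $ j" for i j
    by (simp add: inner_axis' matrix_vector_mult_basis column_def)
  have expand: "(x + c *\<^sub>R axis k 1) \<bullet> (S *v (x + c *\<^sub>R axis k 1)) =
      x \<bullet> (S *v x) + 2 * c * (x \<bullet> (S *v axis k 1)) + c\<^sup>2 * S $ k $ k" for x c
    using inner_matrix_symmetric[OF sym, of x "axis k 1"] entry[of k k]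
    by (simp add: matrix_vector_right_distrib inner_add_left inner_add_right
        power2_eq_square algebra_simps matrix_vector_mult_scaleR)
  show ?case
  proof (cases "S $ k $ k = 0")
    case True
    have 0: "S $ j $ k = 0" for j
    proof (rule ccontr)
      assume n: "S $ j $ k \<noteq> 0"
      \<comment> \<open>With pivot 0 the form is affine in c along the axis k; this c gives it the
        value -1, contradicting semidefiniteness. So a vanishing pivot forces its whole row and
        column to vanish.\<close>
      define c where "c = - (S $ j $ j + 1) / (2 * S $ j $ k)"
      have "2 * c * S $ j $ k = - (S $ j $ j + 1)" using n by (simp add: c_def)
      moreover have "0 \<le> S $ j $ j + 2 * c * S $ j $ k"
        using psd[of "axis j 1 + c *\<^sub>R axis k 1"] expand[of "axis j 1" c] True by (simp add: entry)
      ultimately show False by simp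
    qed
    have "S $ i $ j \<noteq> 0 \<Longrightarrow> i \<in> K \<and> j \<in> K" for i j
      using supp[of i j] 0 sij by (metis insertE)
    from insert.IH[OF sym psd this] show ?thesis by blast
  next
    case False
    then have pos: "S $ k $ k > 0" using psd[of "axis k 1"] by (simp add: entry)
    \<comment> \<open>The Schur complement: removing the rank-one part of the pivot clears row and
      column k.\<close>
    define S' :: "real ^ 'd ^ 'd" where "S' = (\<chi> i j. S $ i $ j - S $ i $ k * S $ j $ k / S $ k $ k)"
    have sym': "transpose S' = S'" by (auto simp: S'_def transpose_def vec_eq_iff sij)
    have psd': "0 \<le> x \<bullet> (S' *v x)" for x
    proof -
      define m where "m = x \<bullet> (S *v axis k 1)"
      have m: "m = (\<Sum>i\<in>UNIV. x $ i * S $ i $ k)"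
        by (simp add: m_def inner_vec_def matrix_vector_mult_basis column_def)
      have "x \<bullet> (S' *v x) = x \<bullet> (S *v x) - (\<Sum>i\<in>UNIV. \<Sum>j\<in>UNIV. (x $ i * S $ i $ k) * (x $ j * S $ j $ k)) / S $ k $ k"
        unfolding quadratic_form_sum S'_def
        by (simp add: sum_subtractf sum_divide_distrib algebra_simps)
      also have "(\<Sum>i\<in>UNIV. \<Sum>j\<in>UNIV. (x $ i * S $ i $ k) * (x $ j * S $ j $ k)) = m\<^sup>2"
        by (simp add: m power2_eq_square sum_product)
      \<comment> \<open>The form of the Schur complement at x is the form of S at x minus its
        S-projection onto the axis k, so it inherits nonnegativity.\<close>
      also have "x \<bullet> (S *v x) - m\<^sup>2 / S $ k $ k =
          (x + (- m / S $ k $ k) *\<^sub>R axis k 1) \<bullet> (S *v (x + (- m / S $ k $ k) *\<^sub>R axis k 1))"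
        unfolding expand m_def[symmetric] using pos by (simp add: power2_eq_square field_simps)
      finally show ?thesis using psd by metis
    qed
    have supp': "i \<in> K \<and> j \<in> K" if ne: "S' $ i $ j \<noteq> 0" for i j
    proof -
      have "S' $ k $ j = 0" "S' $ i $ k = 0" using pos by (simp_all add: S'_def sij[of k j])
      then have "i \<noteq> k" "j \<noteq> k" using ne by auto
      moreover have "S $ i $ j \<noteq> 0 \<or> (S $ i $ k \<noteq> 0 \<and> S $ j $ k \<noteq> 0)"
        using ne by (auto simp: S'_def)
      ultimately show ?thesis using supp by blast
    qed
    from insert.IH[OF sym' psd' supp'] obtain A' where A': "A' ** transpose A' = S'"
      and sA: "\<And>i j. A' $ i $ j \<noteq> 0 \<Longrightarrow> j \<in> K" by blast
    define A where "A = (\<chi> i j. if j = k then S $ i $ k / sqrt (S $ k $ k) else A' $ i $ j)"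
    have "A' $ i $ k = 0" for i using sA insert.hyps by blast
    then have prd: "A $ i $ l * A $ j $ l = A' $ i $ l * A' $ j $ l
        + (if l = k then S $ i $ k * S $ j $ k / S $ k $ k else 0)" for i j l
      using pos by (simp add: A_def)
    have "(A ** transpose A) $ i $ j = S $ i $ j" for i j
    proof -
      have "(A ** transpose A) $ i $ j = (A' ** transpose A') $ i $ j + S $ i $ k * S $ j $ k / S $ k $ k"
        by (simp add: matrix_matrix_mult_def transpose_def prd sum.distrib)
      then show ?thesis by (simp add: A' S'_def)
    qed
    then have "A ** transpose A = S" by (simp add: vec_eq_iff)
    moreover have "\<forall>i j. A $ i $ j \<noteq> 0 \<longrightarrow> j \<in> insert k K" using sA by (auto simp: A_def)
    ultimately show ?thesis by blast
  qed
qed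

lemma psd_factorization:
  fixes S :: "real ^ 'd ^ 'd"
  assumes "transpose S = S" "\<And>x. 0 \<le> x \<bullet> (S *v x)"
  shows "\<exists>A :: real ^ 'd ^ 'd. A ** transpose A = S"
  using psd_factorization_aux[of UNIV S] assms by auto

text \<open>The standardised limit theorem is evaluated at the frequency sqrt v, which undoes the
  division by the standard deviation. Variance 0 cannot be standardised and is treated apart: the
  sums then vanish almost surely. This case does occur for a singular covariance.\<close>

lemma (in prob_space) central_limit_char:
  fixes X :: "nat \<Rightarrow> 'a \<Rightarrow> real"
  assumes ind: "indep_vars (\<lambda>i. borel) X UNIV"
    and mean: "\<And>n. expectation (X n) = 0"
    and sq: "\<And>n. integrable M (\<lambda>x. (X n x)\<^sup>2)"
    and distr: "\<And>n. distr M borel (X n) = \<nu>"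
  shows "(\<lambda>n. \<integral>x. cis ((\<Sum>i<n. X i x) / sqrt n) \<partial>M) \<longlonglongrightarrow> of_real (exp (- expectation (\<lambda>x. (X 0 x)\<^sup>2) / 2))"
proof -
  have rv [measurable]: "random_variable borel (X n)" for n
    using ind unfolding indep_vars_def2 by simp
  have same: "expectation (\<lambda>x. (X n x)\<^sup>2) = expectation (\<lambda>x. (X 0 x)\<^sup>2)" for n
  proof -
    have "expectation (\<lambda>x. (X m x)\<^sup>2) = (\<integral>y. y\<^sup>2 \<partial>\<nu>)" for m
      unfolding distr[of m, symmetric] by (subst integral_distr) auto
    then show ?thesis by metis
  qed
  define v where "v = expectation (\<lambda>x. (X 0 x)\<^sup>2)"
  have v0: "v \<ge> 0" by (simp add: v_def)
  show ?thesis
  proof (cases "v = 0")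
    case True
    have "AE x in M. X n x = 0" for n
    proof -
      have "expectation (\<lambda>x. (X n x)\<^sup>2) = 0" using True same v_def by metis
      then show ?thesis using integral_nonneg_eq_0_iff_AE[OF sq[of n]] by auto
    qed
    then have "AE x in M. \<forall>n. X n x = 0" by (simp add: AE_all_countable)
    then have "(\<integral>x. cis ((\<Sum>i<n. X i x) / sqrt n) \<partial>M) = (\<integral>x. 1 \<partial>M)" for n
      by (intro integral_cong_AE) (auto elim!: eventually_mono intro!: borel_measurable_continuous_on[where f=cis] continuous_intros)
    then show ?thesis using True by (simp add: v_def[symmetric] prob_space)
  next
    case False
    then have pos: "v > 0" using v0 by simp
    let ?W = "\<lambda>n x. (\<Sum>i<n. X i x) / sqrt (real n * (sqrt v)\<^sup>2)"
    have "weak_conv_m (\<lambda>n. distr M borel (?W n)) std_normal_distribution"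
    proof (rule central_limit_theorem_zero_mean[OF ind mean _ sq _ distr])
      show "variance (X n) = (sqrt v)\<^sup>2" for n using mean same v0 by (simp add: v_def)
    qed (use pos in auto)
    then have "(\<lambda>n. char (distr M borel (?W n)) (sqrt v)) \<longlonglongrightarrow> char std_normal_distribution (sqrt v)"
      by (intro levy_continuity1 real_dist_normal_dist real_distribution_distr) auto
    moreover have "char (distr M borel (?W n)) (sqrt v) = (\<integral>x. cis ((\<Sum>i<n. X i x) / sqrt n) \<partial>M)" for n
    proof -
      have "sqrt v * ?W n x = (\<Sum>i<n. X i x) / sqrt n" for x
        using pos by (simp add: real_sqrt_mult)
      moreover have "char (distr M borel (?W n)) (sqrt v) = (\<integral>x. iexp (sqrt v * ?W n x) \<partial>M)"
        unfolding char_def by (subst integral_distr) auto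
      ultimately show ?thesis by (simp add: cis_conv_exp)
    qed
    ultimately show ?thesis using v0 by (simp add: char_std_normal_distribution v_def)
  qed
qed

section \<open>Finite nets and mean deviations\<close>

text \<open>The net consists of the corners of finitely many small cubes covering K. Being near a
  net point would not be enough for a lower bound by semiconcavity; each point has to be a convex
  combination of nearby net points, and the corners of its cube provide this.\<close>

lemma finite_convex_cover:
  fixes K :: "'a::euclidean_space set"
  assumes "compact K" "e > 0"
  obtains V where "finite V" "\<And>v. v \<in> V \<Longrightarrow> \<exists>u\<in>K. norm (v - u) \<le> e"
    "\<And>u. u \<in> K \<Longrightarrow> \<exists>S\<subseteq>V. u \<in> convex hull S \<and> (\<forall>v\<in>S. norm (v - u) \<le> e)"
proof -
  \<comment> \<open>A cube with half side d has l1 radius DIM d = e/2 around its centre, hence any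
    two of its points are at most e apart.\<close>
  define d where "d = e / (2 * real DIM('a))"
  have d: "d > 0" using assms by (simp add: d_def)
  let ?D = "(\<Sum>i\<in>Basis. d *\<^sub>R i) :: 'a"
  have D: "?D \<bullet> i = d" if "i \<in> Basis" for i
    using that by (simp add: inner_sum_left_Basis)
  have "\<exists>S. finite S \<and> cbox (x - ?D) (x + ?D) = convex hull S" for x :: 'a
    using cube_convex_hull[OF d] by metis
  then obtain S where S: "\<And>x. finite (S x)" "\<And>x. cbox (x - ?D) (x + ?D) = convex hull (S x)"
    by metis
  have near: "norm (z - x) \<le> e / 2" if "z \<in> cbox (x - ?D) (x + ?D)" for x z :: 'a
  proof -
    have "\<bar>(z - x) \<bullet> i\<bar> \<le> d" if "i \<in> Basis" for i
      using \<open>z \<in> _\<close> that D[OF that] by (force simp: mem_box inner_diff_left inner_add_left abs_le_iff)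
    then have "(\<Sum>i\<in>Basis. \<bar>(z - x) \<bullet> i\<bar>) \<le> (\<Sum>i\<in>(Basis :: 'a set). d)" by (intro sum_mono)
    then show ?thesis using norm_le_l1[of "z - x"] by (simp add: d_def)
  qed
  have xin: "x \<in> box (x - ?D) (x + ?D)" for x :: 'a
    using d D by (simp add: mem_box inner_diff_left inner_add_left)
  obtain X where X: "X \<subseteq> K" "finite X" "K \<subseteq> (\<Union>x\<in>X. box (x - ?D) (x + ?D))"
    using compactE_image[OF assms(1), of K "\<lambda>x. box (x - ?D) (x + ?D)"] xin by (metis (no_types, lifting) UN_I open_box subsetI)
  show thesis
  proof (rule that[of "\<Union>x\<in>X. S x"])
    show "finite (\<Union>x\<in>X. S x)" using X S by auto
    have hull: "v \<in> cbox (x - ?D) (x + ?D)" if "v \<in> S x" for v x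
      using S(2) that hull_inc by metis
    show "\<exists>u\<in>K. norm (v - u) \<le> e" if "v \<in> (\<Union>x\<in>X. S x)" for v
    proof -
      from that obtain x where "x \<in> X" "v \<in> S x" by blast
      moreover have "norm (v - x) \<le> e" using near[OF hull[OF \<open>v \<in> S x\<close>]] assms(2) by simp
      ultimately show ?thesis using X(1) by blast
    qed
    fix u assume "u \<in> K"
    then obtain x where x: "x \<in> X" "u \<in> box (x - ?D) (x + ?D)" using X by blast
    then have u: "u \<in> cbox (x - ?D) (x + ?D)" using box_subset_cbox by blast
    have "norm (v - u) \<le> e" if "v \<in> S x" for v
      using norm_triangle_ineq4[of "v - x" "u - x"] near[OF hull[OF that]] near[OF u] by simp
    then show "\<exists>S'\<subseteq>(\<Union>x\<in>X. S x). u \<in> convex hull S' \<and> (\<forall>v\<in>S'. norm (v - u) \<le> e)"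
      using x u S by (intro exI[of _ "S x"]) auto
  qed
qed

text \<open>Semiconcavity is used in this form: a lower bound at the points of a finite net
  is a lower bound everywhere.\<close>

lemma semiconcave_net_bound:
  fixes f :: "'a::real_inner \<Rightarrow> real"
  assumes "convex_on B (\<lambda>x. C * (norm x)\<^sup>2 - f x)" "C \<ge> 0"
    and "finite S" "convex hull S \<subseteq> B" "u \<in> convex hull S"
    and near: "\<And>v. v \<in> S \<Longrightarrow> norm (v - u) \<le> e"
  shows "\<exists>v\<in>S. f v \<le> f u + C * e\<^sup>2"
proof (rule ccontr)
  assume "\<not> ?thesis"
  then have f: "f v > f u + C * e\<^sup>2" if "v \<in> S" for v using that by force
  \<comment> \<open>Up to a constant this is C |w - u|^2 - f w: the linear term recentres the square
    at u. A convex function cannot be larger at u than at all points of S.\<close>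
  define g where "g w = C * (norm w)\<^sup>2 - f w + (- 2 * C) * (u \<bullet> w)" for w
  have "convex_on (convex hull S) (\<lambda>w. (- 2 * C) * (u \<bullet> w))"
    by (rule convex_onI) (auto simp: inner_add_right algebra_simps)
  then have cg: "convex_on (convex hull S) g"
    unfolding g_def using convex_on_subset[OF assms(1,4)] by (intro convex_on_add) auto
  have gv: "g v < g u" if "v \<in> S" for v
  proof -
    have "(norm (v - u))\<^sup>2 \<le> e\<^sup>2" using near[OF that] by (intro power_mono) auto
    then have "C * (norm (v - u))\<^sup>2 \<le> C * e\<^sup>2" using assms(2) by (intro mult_left_mono)
    moreover have "C * (norm (v - u))\<^sup>2 = C * (norm v)\<^sup>2 - 2 * C * (u \<bullet> v) + C * (norm u)\<^sup>2"
      by (simp add: power2_norm_eq_inner inner_diff_left inner_diff_right inner_commute algebra_simps)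
    ultimately show ?thesis using f[OF that]
      by (simp add: g_def power2_norm_eq_inner)
  qed
  have ne: "S \<noteq> {}" using assms(5) by auto
  have "\<forall>x\<in>S. g x \<le> Max (g ` S)" using assms(3) by auto
  from convex_on_convex_hull_bound[OF cg this] assms(5) have "g u \<le> Max (g ` S)" by blast
  moreover have "Max (g ` S) < g u" using gv ne assms(3) by (simp add: Max_less_iff)
  ultimately show False by simp
qed

section \<open>Chebyshev's inequality for means of i.i.d. variables\<close>

lemma (in prob_space) expectation_square_sum:
  fixes X :: "nat \<Rightarrow> 'a \<Rightarrow> real"
  assumes ind: "indep_vars (\<lambda>_. borel) X UNIV"
    and bound: "\<And>i \<omega>. \<omega> \<in> space M \<Longrightarrow> \<bar>X i \<omega>\<bar> \<le> B"
    and mean: "\<And>i. expectation (X i) = 0"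
  shows "expectation (\<lambda>\<omega>. (\<Sum>i<n. X i \<omega>)\<^sup>2) = (\<Sum>i<n. expectation (\<lambda>\<omega>. (X i \<omega>)\<^sup>2))"
proof (induction n)
  case 0
  then show ?case by simp
next
  case (Suc n)
  have rv [measurable]: "random_variable borel (X i)" for i
    using ind unfolding indep_vars_def2 by simp
  have int: "integrable M (X i)" for i
    by (rule integrable_const_bound[of _ B]) (use bound in auto)
  have intp: "integrable M (\<lambda>\<omega>. X i \<omega> * X j \<omega>)" for i j
    by (rule integrable_const_bound[of _ "B * B"])
      (auto simp: abs_mult intro!: mult_mono bound AE_I2 order_trans[OF abs_ge_zero bound])
  have cross: "expectation (\<lambda>\<omega>. X i \<omega> * X n \<omega>) = 0" if "i < n" for i
  proof -
    have "expectation (\<lambda>\<omega>. \<Prod>k\<in>{i, n}. X k \<omega>) = (\<Prod>k\<in>{i, n}. expectation (X k))"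
      by (rule indep_vars_lebesgue_integral) (auto intro: indep_vars_subset[OF ind] int)
    then show ?thesis using that mean by simp
  qed
  have sq: "(\<Sum>i<Suc n. X i \<omega>)\<^sup>2 = (\<Sum>i<n. X i \<omega>)\<^sup>2 + 2 * (\<Sum>i<n. X i \<omega> * X n \<omega>) + X n \<omega> * X n \<omega>" for \<omega>
    by (simp add: power2_eq_square algebra_simps sum_distrib_right sum_distrib_left)
  have ints: "integrable M (\<lambda>\<omega>. (\<Sum>i<n. X i \<omega>)\<^sup>2)"
    unfolding power2_eq_square sum_product by (intro Bochner_Integration.integrable_sum intp)
  have "expectation (\<lambda>\<omega>. (\<Sum>i<Suc n. X i \<omega>)\<^sup>2) = expectation (\<lambda>\<omega>. (\<Sum>i<n. X i \<omega>)\<^sup>2)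
      + 2 * (\<Sum>i<n. expectation (\<lambda>\<omega>. X i \<omega> * X n \<omega>)) + expectation (\<lambda>\<omega>. X n \<omega> * X n \<omega>)"
    unfolding sq using ints intp by simp
  then show ?case using Suc.IH cross by (simp add: power2_eq_square)
qed

text \<open>Chebyshev's inequality with the second moment in place of the smaller variance. The
  second moment is the quantity that becomes small when the estimate is applied to first-order
  remainders.\<close>

lemma (in prob_space) iid_mean_deviation:
  fixes Y :: "nat \<Rightarrow> 'a \<Rightarrow> 'b" and \<phi> :: "'b \<Rightarrow> real"
  assumes ind: "indep_vars (\<lambda>_. N) Y UNIV" and same: "\<And>i. distr M N (Y i) = D"
    and [measurable]: "\<phi> \<in> borel_measurable N"
    and bound: "\<And>q. q \<in> space N \<Longrightarrow> \<bar>\<phi> q\<bar> \<le> B"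
    and "n \<ge> 1" "a > 0"
  shows "prob {\<omega> \<in> space M. a \<le> \<bar>(\<Sum>i<n. \<phi> (Y i \<omega>)) / real n - (\<integral>q. \<phi> q \<partial>D)\<bar>}
    \<le> (\<integral>q. (\<phi> q)\<^sup>2 \<partial>D) / (real n * a\<^sup>2)"
proof -
  have rv [measurable]: "random_variable N (Y i)" for i
    using ind unfolding indep_vars_def2 by simp
  define m where "m = (\<integral>q. \<phi> q \<partial>D)"
  define X where "X i \<omega> = \<phi> (Y i \<omega>) - m" for i \<omega>
  have E: "expectation (\<lambda>\<omega>. f (Y i \<omega>)) = (\<integral>q. f q \<partial>D)" if "f \<in> borel_measurable N" for f :: "'b \<Rightarrow> real" and i
    unfolding same[of i, symmetric] using that by (subst integral_distr) auto
  have sp: "Y i \<omega> \<in> space N" if "\<omega> \<in> space M" for i \<omega> using measurable_space[OF rv that] .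
  have B0: "B \<ge> 0" using not_empty sp bound by fastforce
  have int: "integrable M (\<lambda>\<omega>. \<phi> (Y i \<omega>))" for i
    by (rule integrable_const_bound[of _ B]) (use bound sp in auto)
  have int2: "integrable M (\<lambda>\<omega>. (\<phi> (Y i \<omega>))\<^sup>2)" for i
  proof (rule integrable_const_bound[of _ "B\<^sup>2"])
    show "AE \<omega> in M. norm ((\<phi> (Y i \<omega>))\<^sup>2) \<le> B\<^sup>2"
      using bound sp B0 by (intro AE_I2) (simp add: abs_le_square_iff[symmetric])
  qed simp
  have indX: "indep_vars (\<lambda>_. borel) X UNIV"
    unfolding X_def by (rule indep_vars_compose2[OF ind]) simp
  have mean: "expectation (X i) = 0" for i
    using int E[of \<phi> i] by (simp add: X_def[abs_def] m_def prob_space)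
  have rvX [measurable]: "random_variable borel (X i)" for i unfolding X_def[abs_def] by simp
  have bX: "\<bar>X i \<omega>\<bar> \<le> B + \<bar>m\<bar>" if "\<omega> \<in> space M" for i \<omega>
    using bound[OF sp[OF that, of i]] by (simp add: X_def)
  have var: "expectation (\<lambda>\<omega>. (X i \<omega>)\<^sup>2) \<le> (\<integral>q. (\<phi> q)\<^sup>2 \<partial>D)" for i
  proof -
    have "(X i \<omega>)\<^sup>2 = (\<phi> (Y i \<omega>))\<^sup>2 - 2 * m * \<phi> (Y i \<omega>) + m\<^sup>2" for \<omega>
      by (simp add: X_def power2_eq_square algebra_simps)
    then have "expectation (\<lambda>\<omega>. (X i \<omega>)\<^sup>2) = expectation (\<lambda>\<omega>. (\<phi> (Y i \<omega>))\<^sup>2) - 2 * m * m + m\<^sup>2"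
      using int int2 E[of \<phi> i] by (simp add: prob_space m_def)
    then show ?thesis using E[of "\<lambda>q. (\<phi> q)\<^sup>2" i] by (simp add: power2_eq_square)
  qed
  define W where "W \<omega> = (\<Sum>i<n. X i \<omega>)\<^sup>2" for \<omega>
  have Wm [measurable]: "W \<in> borel_measurable M" unfolding W_def by measurable
  have W: "expectation W \<le> real n * (\<integral>q. (\<phi> q)\<^sup>2 \<partial>D)"
  proof -
    have "expectation W = (\<Sum>i<n. expectation (\<lambda>\<omega>. (X i \<omega>)\<^sup>2))"
      unfolding W_def by (rule expectation_square_sum[OF indX bX mean])
    also have "\<dots> \<le> (\<Sum>i<n. \<integral>q. (\<phi> q)\<^sup>2 \<partial>D)" by (intro sum_mono var)
    finally show ?thesis by simp
  qed
  have Wi: "integrable M W"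
  proof (rule integrable_const_bound[of _ "(real n * (B + \<bar>m\<bar>))\<^sup>2"])
    show "AE \<omega> in M. norm (W \<omega>) \<le> (real n * (B + \<bar>m\<bar>))\<^sup>2"
    proof (rule AE_I2)
      fix \<omega> assume "\<omega> \<in> space M"
      then have "\<bar>\<Sum>i<n. X i \<omega>\<bar> \<le> (\<Sum>i<n. B + \<bar>m\<bar>)"
        by (intro order_trans[OF sum_abs] sum_mono bX)
      then have "\<bar>\<Sum>i<n. X i \<omega>\<bar> \<le> \<bar>real n * (B + \<bar>m\<bar>)\<bar>" using B0 by simp
      then show "norm (W \<omega>) \<le> (real n * (B + \<bar>m\<bar>))\<^sup>2" unfolding W_def abs_le_square_iff by simp
    qed
  qed simp
  have na: "(real n * a)\<^sup>2 > 0" using assms by simp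
  have "prob {\<omega> \<in> space M. a \<le> \<bar>(\<Sum>i<n. \<phi> (Y i \<omega>)) / real n - m\<bar>}
      = prob {\<omega> \<in> space M. (real n * a)\<^sup>2 \<le> W \<omega>}"
  proof (rule arg_cong[where f = prob], rule Collect_cong, rule conj_cong[OF refl])
    fix \<omega>
    have "(\<Sum>i<n. \<phi> (Y i \<omega>)) / real n - m = (\<Sum>i<n. X i \<omega>) / real n"
      using assms by (simp add: X_def sum_subtractf field_simps)
    then have "a \<le> \<bar>(\<Sum>i<n. \<phi> (Y i \<omega>)) / real n - m\<bar> \<longleftrightarrow> real n * a \<le> \<bar>\<Sum>i<n. X i \<omega>\<bar>"
      using assms by (simp add: field_simps)
    also have "\<dots> \<longleftrightarrow> \<bar>real n * a\<bar> \<le> \<bar>\<Sum>i<n. X i \<omega>\<bar>" using assms by simp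
    finally show "a \<le> \<bar>(\<Sum>i<n. \<phi> (Y i \<omega>)) / real n - m\<bar> \<longleftrightarrow> (real n * a)\<^sup>2 \<le> W \<omega>"
      unfolding W_def abs_le_square_iff .
  qed
  also have "\<dots> \<le> expectation W / (real n * a)\<^sup>2"
    using Wi na integral_Markov_inequality_measure[where M = M and A = "{}" and u = W and c = "(real n * a)\<^sup>2"]
    by (auto simp: W_def[abs_def])
  also have "\<dots> \<le> (real n * (\<integral>q. (\<phi> q)\<^sup>2 \<partial>D)) / (real n * a)\<^sup>2"
    using W by (intro divide_right_mono) auto
  also have "\<dots> = (\<integral>q. (\<phi> q)\<^sup>2 \<partial>D) / (real n * a\<^sup>2)"
    using assms by (simp add: power2_eq_square)
  finally show ?thesis by (simp add: m_def)
qed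

text \<open>Locates a number in a dyadic range; used to split the position of the minimiser into
  shells and the function 1/u into levels.\<close>

lemma ex_power2_interval:
  fixes y :: real
  assumes "y \<ge> 1"
  obtains k :: nat where "2 ^ k \<le> y" "y < 2 ^ Suc k"
proof -
  obtain n where n: "y < 2 ^ n" using real_arch_pow[of 2 y] by auto
  define m where "m = (LEAST n. y < 2 ^ n)"
  have m: "y < 2 ^ m" unfolding m_def by (rule LeastI[of _ n]) (rule n)
  then have "m \<noteq> 0" using assms by (intro notI) simp
  then obtain k where k: "m = Suc k" using not0_implies_Suc by blast
  have "\<not> y < 2 ^ k" using not_less_Least[of k "\<lambda>n. y < 2 ^ n"] k unfolding m_def by simp
  then show thesis using that[of k] m k by simp
qed

section \<open>M-estimation with a semiconcave criterion\<close>

text \<open>The bounds that hold for every q are one-sided in second order: Lipschitz plus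
  semiconcave. Differentiability is asked at 0 only and almost surely, and the quadratic expansion
  is asked of the integrated criterion. Minimality is needed only against competitors in the ball of
  radius \<delta>, which fits a criterion known only in a chart.\<close>

locale semiconcave_m_estimation = prob_space M for M :: "'w measure" +
  fixes N :: "'b measure" and D :: "'b measure" and Y :: "nat \<Rightarrow> 'w \<Rightarrow> 'b"
    and h :: "real ^ 'd \<Rightarrow> 'b \<Rightarrow> real" and g :: "'b \<Rightarrow> real ^ 'd" and \<Lambda> :: "real ^ 'd ^ 'd"
    and x :: "nat \<Rightarrow> 'w \<Rightarrow> real ^ 'd"
    and \<delta> L C c :: real
  assumes ind: "indep_vars (\<lambda>_. N) Y UNIV" and same: "\<And>i. distr M N (Y i) = D"
    and \<delta>: "\<delta> > 0" and L: "L \<ge> 0" and C: "C \<ge> 0" and c: "c > 0"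
    and h_meas: "\<And>u. norm u < \<delta> \<Longrightarrow> h u \<in> borel_measurable N"
    and g_meas [measurable]: "g \<in> borel_measurable N"
    and g_bound: "\<And>q. q \<in> space N \<Longrightarrow> norm (g q) \<le> L"
    and lip: "\<And>q u. q \<in> space N \<Longrightarrow> norm u < \<delta> \<Longrightarrow> \<bar>h u q - h 0 q\<bar> \<le> L * norm u"
    and semiconc: "\<And>q. q \<in> space N \<Longrightarrow> convex_on (ball 0 \<delta>) (\<lambda>u. C * (norm u)\<^sup>2 - h u q)"
    and g_mean: "\<And>t. (\<integral>q. g q \<bullet> t \<partial>D) = 0"
    and diff: "AE q in D. ((\<lambda>u. (h u q - h 0 q - g q \<bullet> u) / norm u) \<longlongrightarrow> 0) (at 0)"
    and taylor: "((\<lambda>u. ((\<integral>q. h u q - h 0 q \<partial>D) - (u \<bullet> (\<Lambda> *v u)) / 2) / (norm u)\<^sup>2) \<longlongrightarrow> 0) (at 0)"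
    and sym: "transpose \<Lambda> = \<Lambda>" and pos: "\<And>u. c * (norm u)\<^sup>2 \<le> u \<bullet> (\<Lambda> *v u)"
    and x_meas: "\<And>n. n \<ge> 1 \<Longrightarrow> x n \<in> borel_measurable M"
    and consistent: "\<And>\<eta>. \<eta> > 0 \<Longrightarrow> (\<lambda>n. prob {\<omega> \<in> space M. norm (x n \<omega>) \<ge> \<eta>}) \<longlonglongrightarrow> 0"
    and minimal: "\<And>n \<omega> y. n \<ge> 1 \<Longrightarrow> \<omega> \<in> space M \<Longrightarrow> norm (x n \<omega>) < \<delta> \<Longrightarrow> norm y < \<delta> \<Longrightarrow>
      (\<Sum>i<n. h (x n \<omega>) (Y i \<omega>)) \<le> (\<Sum>i<n. h y (Y i \<omega>))"
begin

section \<open>Decomposition of the empirical criterion\<close>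

lemma Y_meas [measurable]: "Y i \<in> measurable M N"
  using ind unfolding indep_vars_def2 by simp

lemma Y_space: "\<omega> \<in> space M \<Longrightarrow> Y i \<omega> \<in> space N"
  by (rule measurable_space[OF Y_meas])

lemma sets_D: "sets D = sets N" using same[of 0] by auto

lemma space_D: "space D = space N" by (rule sets_eq_imp_space_eq[OF sets_D])

lemma prob_space_D: "prob_space D"
  using prob_space_distr[OF Y_meas[of 0]] same by simp

definition F :: "real ^ 'd \<Rightarrow> real" where "F u = (\<integral>q. h u q - h 0 q \<partial>D)"

definition r :: "real ^ 'd \<Rightarrow> 'b \<Rightarrow> real" where "r u q = h u q - h 0 q - g q \<bullet> u"

definition Fn :: "nat \<Rightarrow> 'w \<Rightarrow> real ^ 'd \<Rightarrow> real" where
  "Fn n \<omega> u = (\<Sum>i<n. h u (Y i \<omega>) - h 0 (Y i \<omega>)) / real n"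

definition gn :: "nat \<Rightarrow> 'w \<Rightarrow> real ^ 'd" where
  "gn n \<omega> = (\<Sum>i<n. g (Y i \<omega>)) /\<^sub>R real n"

definition Dn :: "nat \<Rightarrow> real ^ 'd \<Rightarrow> 'w \<Rightarrow> real" where
  "Dn n u \<omega> = (\<Sum>i<n. r u (Y i \<omega>)) / real n - (\<integral>q. r u q \<partial>D)"

lemma r_meas: "norm u < \<delta> \<Longrightarrow> r u \<in> borel_measurable N"
  unfolding r_def[abs_def] using h_meas[of u] h_meas[of 0] \<delta> by simp

lemma r_bound:
  assumes "q \<in> space N" "norm u < \<delta>"
  shows "\<bar>r u q\<bar> \<le> 2 * L * norm u"
proof -
  have "\<bar>g q \<bullet> u\<bar> \<le> norm (g q) * norm u" by (rule Cauchy_Schwarz_ineq2)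
  also have "\<dots> \<le> L * norm u" using g_bound[OF assms(1)] by (intro mult_right_mono) auto
  finally show ?thesis using lip[OF assms] by (simp add: r_def)
qed

lemma integral_r: "norm u < \<delta> \<Longrightarrow> (\<integral>q. r u q \<partial>D) = F u"
proof -
  assume u: "norm u < \<delta>"
  interpret D: prob_space D by (rule prob_space_D)
  have "integrable D (\<lambda>q. h u q - h 0 q)"
    by (rule D.integrable_const_bound[of _ "L * norm u"])
      (use lip u h_meas[of u] h_meas[of 0] \<delta> in \<open>auto simp: space_D measurable_cong_sets[OF sets_D refl]\<close>)
  moreover have "integrable D (\<lambda>q. g q \<bullet> u)"
  proof (rule D.integrable_const_bound[of _ "L * norm u"])
    show "AE q in D. norm (g q \<bullet> u) \<le> L * norm u"
      using g_bound
      by (intro AE_I2) (auto simp: space_D intro!: order_trans[OF Cauchy_Schwarz_ineq2] mult_right_mono)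
    show "(\<lambda>q. g q \<bullet> u) \<in> borel_measurable D"
      unfolding measurable_cong_sets[OF sets_D refl] by measurable
  qed
  ultimately show ?thesis unfolding r_def F_def using g_mean[of u] by simp
qed

text \<open>Random linear term, deterministic quadratic term, centred remainder. The mean of g
  vanishes, so centring the remainder brings out exactly \<open>F u\<close>.\<close>

lemma Fn_eq:
  assumes "n \<ge> 1" "norm u < \<delta>"
  shows "Fn n \<omega> u = gn n \<omega> \<bullet> u + F u + Dn n u \<omega>"
proof -
  have "(\<Sum>i<n. r u (Y i \<omega>)) / real n = Fn n \<omega> u - gn n \<omega> \<bullet> u"
    by (simp add: Fn_def gn_def r_def sum_subtractf inner_sum_left sum.distrib divide_inverse_commute algebra_simps)
  then show ?thesis unfolding Dn_def integral_r[OF assms(2)] by simp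
qed

lemma Fn_minimal:
  assumes "n \<ge> 1" "\<omega> \<in> space M" "norm (x n \<omega>) < \<delta>" "norm y < \<delta>"
  shows "Fn n \<omega> (x n \<omega>) \<le> Fn n \<omega> y"
  unfolding Fn_def using minimal[OF assms] by (intro divide_right_mono) (auto simp: sum_subtractf)

lemma Fn_semiconcave:
  assumes "n \<ge> 1" "\<omega> \<in> space M"
  shows "convex_on (ball 0 \<delta>) (\<lambda>u. C * (norm u)\<^sup>2 - Fn n \<omega> u)"
proof -
  have "convex_on (ball 0 \<delta>) (\<lambda>u. \<Sum>i<m. (C * (norm u)\<^sup>2 - h u (Y i \<omega>)) + h 0 (Y i \<omega>))" for m
  proof (induction m)
    case 0
    then show ?case by (simp add: convex_on_const)
  next
    case (Suc m)
    then show ?case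
      using semiconc[OF Y_space[OF assms(2)]] by (auto intro!: convex_on_add simp: convex_on_const)
  qed
  then have "convex_on (ball 0 \<delta>) (\<lambda>u. (\<Sum>i<n. (C * (norm u)\<^sup>2 - h u (Y i \<omega>)) + h 0 (Y i \<omega>)) / real n)"
    by (intro convex_on_cdiv) auto
  moreover have "(\<Sum>i<n. (C * (norm u)\<^sup>2 - h u (Y i \<omega>)) + h 0 (Y i \<omega>)) / real n = C * (norm u)\<^sup>2 - Fn n \<omega> u" for u
    using assms(1) by (simp add: Fn_def sum_subtractf sum.distrib field_simps)
  ultimately show ?thesis by simp
qed

text \<open>One fixed net, dilated by \<rho>, serves all scales; the loss in the semiconcave lower
  bound then scales like \<rho>^2, as the population criterion does.\<close>

lemma net_bound:
  assumes "n \<ge> 1" "\<omega> \<in> space M" "\<rho> > 0" "finite S" "u \<in> convex hull S"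
    and "\<And>v. v \<in> S \<Longrightarrow> norm (v - u) \<le> e" and "\<And>v. v \<in> S \<Longrightarrow> \<rho> * norm v < \<delta>"
  shows "\<exists>v\<in>S. Fn n \<omega> (\<rho> *\<^sub>R v) \<le> Fn n \<omega> (\<rho> *\<^sub>R u) + C * (\<rho> * e)\<^sup>2"
proof -
  have "\<exists>v\<in>(\<lambda>v. \<rho> *\<^sub>R v) ` S. Fn n \<omega> v \<le> Fn n \<omega> (\<rho> *\<^sub>R u) + C * (\<rho> * e)\<^sup>2"
  proof (rule semiconcave_net_bound[OF Fn_semiconcave[OF assms(1,2)] C])
    show "finite ((\<lambda>v. \<rho> *\<^sub>R v) ` S)" using assms by simp
    have "(\<lambda>v. \<rho> *\<^sub>R v) ` S \<subseteq> ball 0 \<delta>" using assms(3,7) by auto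
    then show "convex hull ((\<lambda>v. \<rho> *\<^sub>R v) ` S) \<subseteq> ball 0 \<delta>" by (intro hull_minimal convex_ball)
    show "\<rho> *\<^sub>R u \<in> convex hull ((\<lambda>v. \<rho> *\<^sub>R v) ` S)" unfolding convex_hull_scaling using assms by auto
    show "norm (v - \<rho> *\<^sub>R u) \<le> \<rho> * e" if "v \<in> (\<lambda>v. \<rho> *\<^sub>R v) ` S" for v
    proof -
      from that obtain w where w: "w \<in> S" "v = \<rho> *\<^sub>R w" by blast
      then have "norm (v - \<rho> *\<^sub>R u) = \<rho> * norm (w - u)"
        using assms(3) by (simp flip: scaleR_diff_right)
      then show ?thesis using assms(3,6) w by simp
    qed
  qed
  then show ?thesis by blast
qed

lemma Dn_meas [measurable]: "norm u < \<delta> \<Longrightarrow> Dn n u \<in> borel_measurable M"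
proof -
  assume "norm u < \<delta>"
  from r_meas[OF this] have [measurable]: "r u \<in> borel_measurable N" .
  show ?thesis unfolding Dn_def[abs_def] by measurable
qed

lemma gn_meas [measurable]: "gn n \<in> borel_measurable M"
  unfolding gn_def[abs_def] by measurable

lemma Dn_deviation:
  assumes "norm u < \<delta>" "n \<ge> 1" "a > 0"
  shows "prob {\<omega> \<in> space M. a \<le> \<bar>Dn n u \<omega>\<bar>} \<le> (\<integral>q. (r u q)\<^sup>2 \<partial>D) / (real n * a\<^sup>2)"
  unfolding Dn_def
  by (rule iid_mean_deviation[OF ind same r_meas[OF assms(1)] r_bound[OF _ assms(1)] assms(2,3)])

text \<open>By the Lipschitz bound a deviation of order |u|^2 at u has probability O(1 / (n |u|^2)),
  which is summable over dyadic radii.\<close>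

lemma integral_r_square:
  assumes "norm u < \<delta>"
  shows "(\<integral>q. (r u q)\<^sup>2 \<partial>D) \<le> (2 * L * norm u)\<^sup>2"
proof -
  interpret D: prob_space D by (rule prob_space_D)
  have b: "(r u q)\<^sup>2 \<le> (2 * L * norm u)\<^sup>2" if "q \<in> space N" for q
    using r_bound[OF that assms] L by (intro iffD1[OF abs_le_square_iff]) simp
  have rm: "r u \<in> borel_measurable D"
    using r_meas[OF assms] measurable_cong_sets[OF sets_D refl] by blast
  have "(\<integral>q. (r u q)\<^sup>2 \<partial>D) \<le> (\<integral>q. (2 * L * norm u)\<^sup>2 \<partial>D)"
  proof (rule integral_mono)
    show "integrable D (\<lambda>q. (r u q)\<^sup>2)"
      by (rule D.integrable_const_bound[of _ "(2 * L * norm u)\<^sup>2"]) (use b rm in \<open>auto simp: space_D\<close>)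
  qed (use b in \<open>auto simp: space_D\<close>)
  then show ?thesis by (simp add: D.prob_space)
qed

text \<open>If the norm is at least a then, by the l1 bound, one of the d coordinates is at least
  a/d in absolute value; Chebyshev's inequality is applied to each coordinate.\<close>

lemma gn_deviation:
  obtains A where "A \<ge> 0" "\<And>n a. n \<ge> 1 \<Longrightarrow> a > 0 \<Longrightarrow>
    prob {\<omega> \<in> space M. a \<le> norm (gn n \<omega>)} \<le> A / (real n * a\<^sup>2)"
proof
  interpret D: prob_space D by (rule prob_space_D)
  let ?d = "real CARD('d)"
  have d: "?d > 0" by simp
  show "?d * (L\<^sup>2 * ?d\<^sup>2) \<ge> 0" by simp
  fix n :: nat and a :: real assume n: "n \<ge> 1" and a: "a > 0"
  have comp: "prob {\<omega> \<in> space M. a / ?d \<le> \<bar>gn n \<omega> $ i\<bar>} \<le> L\<^sup>2 * ?d\<^sup>2 / (real n * a\<^sup>2)" for i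
  proof -
    have b: "\<bar>g q $ i\<bar> \<le> L" if "q \<in> space N" for q
      using component_le_norm_cart[of "g q" i] g_bound[OF that] by linarith
    have gi: "(\<lambda>q. g q $ i) \<in> borel_measurable N"
    proof -
      have "(\<lambda>q. g q \<bullet> axis i 1) \<in> borel_measurable N" by measurable
      then show ?thesis by (simp add: inner_axis)
    qed
    have "(\<integral>q. g q $ i \<partial>D) = 0" using g_mean[of "axis i 1"] by (simp add: inner_axis)
    then have "prob {\<omega> \<in> space M. a / ?d \<le> \<bar>gn n \<omega> $ i\<bar>} \<le> (\<integral>q. (g q $ i)\<^sup>2 \<partial>D) / (real n * (a / ?d)\<^sup>2)"
      using iid_mean_deviation[OF ind same gi b n, of "a / ?d"] a
      by (simp add: gn_def divide_inverse_commute)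
    also have "\<dots> \<le> L\<^sup>2 / (real n * (a / ?d)\<^sup>2)"
    proof (rule divide_right_mono)
      have "(\<integral>q. (g q $ i)\<^sup>2 \<partial>D) \<le> (\<integral>q. L\<^sup>2 \<partial>D)"
      proof (rule integral_mono)
        have b2: "(g q $ i)\<^sup>2 \<le> L\<^sup>2" if "q \<in> space N" for q
          using b[OF that] L by (intro iffD1[OF abs_le_square_iff]) simp
        then show "integrable D (\<lambda>q. (g q $ i)\<^sup>2)"
          using gi by (intro D.integrable_const_bound[of _ "L\<^sup>2"])
            (auto simp: space_D measurable_cong_sets[OF sets_D refl])
        show "(g q $ i)\<^sup>2 \<le> L\<^sup>2" if "q \<in> space D" for q using that b2 by (simp add: space_D)
      qed auto
      then show "(\<integral>q. (g q $ i)\<^sup>2 \<partial>D) \<le> L\<^sup>2" by (simp add: D.prob_space)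
    qed simp
    finally show ?thesis using a by (simp add: power_divide field_simps)
  qed
  have "prob {\<omega> \<in> space M. a \<le> norm (gn n \<omega>)} \<le> prob (\<Union>i\<in>UNIV. {\<omega> \<in> space M. a / ?d \<le> \<bar>gn n \<omega> $ i\<bar>})"
  proof (rule finite_measure_mono)
    show "{\<omega> \<in> space M. a \<le> norm (gn n \<omega>)} \<subseteq> (\<Union>i\<in>UNIV. {\<omega> \<in> space M. a / ?d \<le> \<bar>gn n \<omega> $ i\<bar>})"
    proof (rule subsetI, rule ccontr)
      fix \<omega> assume "\<omega> \<in> {\<omega> \<in> space M. a \<le> norm (gn n \<omega>)}"
        "\<omega> \<notin> (\<Union>i\<in>UNIV. {\<omega> \<in> space M. a / ?d \<le> \<bar>gn n \<omega> $ i\<bar>})"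
      then have "a \<le> norm (gn n \<omega>)" "\<And>i. \<bar>gn n \<omega> $ i\<bar> < a / ?d" by (auto simp: not_le)
      moreover have "norm (gn n \<omega>) \<le> (\<Sum>i\<in>UNIV. \<bar>gn n \<omega> $ i\<bar>)" by (rule norm_le_l1_cart)
      moreover have "(\<Sum>i\<in>UNIV. \<bar>gn n \<omega> $ i\<bar>) < (\<Sum>i\<in>(UNIV :: 'd set). a / ?d)"
        using calculation by (intro sum_strict_mono) auto
      ultimately show False by simp
    qed
  qed measurable
  also have "\<dots> \<le> (\<Sum>i\<in>UNIV. prob {\<omega> \<in> space M. a / ?d \<le> \<bar>gn n \<omega> $ i\<bar>})"
    by (rule finite_measure_subadditive_finite) auto
  also have "\<dots> \<le> (\<Sum>i\<in>(UNIV :: 'd set). L\<^sup>2 * ?d\<^sup>2 / (real n * a\<^sup>2))" by (intro sum_mono comp)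
  finally show "prob {\<omega> \<in> space M. a \<le> norm (gn n \<omega>)} \<le> ?d * (L\<^sup>2 * ?d\<^sup>2) / (real n * a\<^sup>2)" by simp
qed

section \<open>Rate of convergence of the minimiser\<close>

lemma F_lower:
  obtains \<delta>1 where "0 < \<delta>1" "\<delta>1 \<le> \<delta>" "\<And>u. norm u < \<delta>1 \<Longrightarrow> (c / 4) * (norm u)\<^sup>2 \<le> F u"
proof -
  have F0: "F 0 = 0" by (simp add: F_def)
  \<comment> \<open>Half the form is at least (c/2) |u|^2, so an expansion error below (c/4) |u|^2
    leaves c/4.\<close>
  from taylor[folded F_def, THEN tendstoD, of "c / 4"] c obtain \<delta>2 where d2: "\<delta>2 > 0"
    "\<And>u. u \<noteq> 0 \<Longrightarrow> norm u < \<delta>2 \<Longrightarrow> \<bar>(F u - (u \<bullet> (\<Lambda> *v u)) / 2) / (norm u)\<^sup>2\<bar> < c / 4"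
    by (auto simp: eventually_at)
  show thesis
  proof (rule that[of "min \<delta> \<delta>2"])
    fix u :: "real ^ 'd" assume u: "norm u < min \<delta> \<delta>2"
    show "(c / 4) * (norm u)\<^sup>2 \<le> F u"
    proof (cases "u = 0")
      case False
      then have "\<bar>F u - (u \<bullet> (\<Lambda> *v u)) / 2\<bar> < (c / 4) * (norm u)\<^sup>2"
        using d2(2)[of u] u by (simp add: abs_div pos_divide_less_eq)
      then have "- ((c * (norm u)\<^sup>2) / 4) < F u - (u \<bullet> (\<Lambda> *v u)) / 2" by linarith
      then show ?thesis using pos[of u] by simp
    qed (simp add: F0)
  qed (use d2 \<delta> in auto)
qed

text \<open>Peeling into dyadic shells. If the minimiser lies in the shell of radius \<rho>, its
  value is at most \<open>Fn n \<omega> 0 = 0\<close>, so some dilated net point has a value below a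
  small multiple of \<rho>^2, although F is much larger there. Hence the linear term or the centred
  remainder at one of finitely many points is large, and these probabilities sum to O(1/K^2) over
  the shells. The event that the minimiser is far away is left to consistency.\<close>

lemma rate:
  obtains A \<delta>1 where "0 < \<delta>1" "A \<ge> 0" "\<And>n K. n \<ge> 1 \<Longrightarrow> K > 0 \<Longrightarrow>
    prob {\<omega> \<in> space M. K \<le> sqrt n * norm (x n \<omega>) \<and> norm (x n \<omega>) < \<delta>1} \<le> A / K\<^sup>2"
proof -
  obtain \<delta>1 where d1: "0 < \<delta>1" "\<delta>1 \<le> \<delta>" "\<And>u. norm u < \<delta>1 \<Longrightarrow> (c / 4) * (norm u)\<^sup>2 \<le> F u"
    using F_lower by blast
  obtain A where A: "A \<ge> 0" "\<And>n a. n \<ge> 1 \<Longrightarrow> a > 0 \<Longrightarrow>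
    prob {\<omega> \<in> space M. a \<le> norm (gn n \<omega>)} \<le> A / (real n * a\<^sup>2)"
    using gn_deviation by blast
  \<comment> \<open>The bound 1/2 keeps the net points over the shell 1 to 2 within norms 1/2 to
    5/2; the square root makes the semiconcavity loss C e^2 at most c/64.\<close>
  define e where "e = min (1/2) (sqrt (c / (64 * (C + 1))))"
  have e: "e > 0" "e \<le> 1/2" using c C by (auto simp: e_def)
  have Ce: "C * e\<^sup>2 \<le> c / 64"
  proof -
    have "e\<^sup>2 \<le> (sqrt (c / (64 * (C + 1))))\<^sup>2" using e by (intro power_mono) (auto simp: e_def)
    then have "e\<^sup>2 \<le> c / (64 * (C + 1))" using c C by simp
    then have "(C + 1) * e\<^sup>2 \<le> (C + 1) * (c / (64 * (C + 1)))" using C by (intro mult_left_mono) auto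
    also have "\<dots> = c / 64" using C by (simp add: field_simps)
    finally show ?thesis by (simp add: distrib_right) (smt (verit) zero_le_power2)
  qed
  define K0 where "K0 = {w :: real ^ 'd. 1 \<le> norm w \<and> norm w \<le> 2}"
  have "K0 = cball 0 2 - ball 0 1" by (auto simp: K0_def)
  then have "compact K0" by (simp add: compact_diff)
  from finite_convex_cover[OF this e(1)] obtain V where V: "finite V"
    "\<And>v. v \<in> V \<Longrightarrow> \<exists>u\<in>K0. norm (v - u) \<le> e"
    "\<And>u. u \<in> K0 \<Longrightarrow> \<exists>S\<subseteq>V. u \<in> convex hull S \<and> (\<forall>v\<in>S. norm (v - u) \<le> e)" by blast
  have Vn: "1/2 \<le> norm v \<and> norm v \<le> 5/2" if "v \<in> V" for v
  proof -
    from V(2)[OF that] obtain u where "u \<in> K0" "norm (v - u) \<le> e" by blast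
    then show ?thesis using norm_triangle_ineq2[of v u] norm_triangle_ineq2[of u v] e
      by (auto simp: K0_def norm_minus_commute)
  qed
  \<comment> \<open>In units of (c/64) \<rho>^2: F is at least 4 at the net point, the semiconcave
    upper bound for the criterion is 1, and the linear term is at most 1 in absolute value since
    (c/192)(5/2) is below c/64. A centred remainder below 1 would then leave more than 2, a
    contradiction.\<close>
  have shell: "\<exists>v\<in>V. (c / 64) * \<rho>\<^sup>2 \<le> \<bar>Dn n (\<rho> *\<^sub>R v) \<omega>\<bar>"
    if n: "n \<ge> 1" "\<omega> \<in> space M" and \<rho>: "\<rho> > 0" "3 * \<rho> < \<delta>1"
      and xn: "\<rho> \<le> norm (x n \<omega>)" "norm (x n \<omega>) \<le> 2 * \<rho>"
      and small: "norm (gn n \<omega>) < (c / 192) * \<rho>" for n \<omega> \<rho>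
  proof (rule ccontr)
    assume "\<not> ?thesis"
    then have D: "\<bar>Dn n (\<rho> *\<^sub>R v) \<omega>\<bar> < (c / 64) * \<rho>\<^sup>2" if "v \<in> V" for v using that by (auto simp: not_le)
    define u where "u = x n \<omega> /\<^sub>R \<rho>"
    have u: "u \<in> K0" "\<rho> *\<^sub>R u = x n \<omega>" using \<rho> xn by (auto simp: u_def K0_def field_simps)
    obtain S where S: "S \<subseteq> V" "u \<in> convex hull S" "\<And>v. v \<in> S \<Longrightarrow> norm (v - u) \<le> e"
      using V(3)[OF u(1)] by blast
    have small_v: "\<rho> * norm v < \<delta>1" if "v \<in> S" for v
    proof -
      have "\<rho> * norm v \<le> \<rho> * (5/2)" using Vn[of v] that S \<rho> by (intro mult_left_mono) auto
      then show ?thesis using \<rho> by linarith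
    qed
    then obtain v where v: "v \<in> S" "Fn n \<omega> (\<rho> *\<^sub>R v) \<le> Fn n \<omega> (\<rho> *\<^sub>R u) + C * (\<rho> * e)\<^sup>2"
      using net_bound[OF n \<rho>(1) finite_subset[OF S(1) V(1)] S(2,3)] d1(2) by fastforce
    have "norm (x n \<omega>) < \<delta>" using \<rho> xn d1 by simp
    then have "Fn n \<omega> (x n \<omega>) \<le> Fn n \<omega> 0" using Fn_minimal[OF n, of 0] \<delta> by simp
    moreover have "Fn n \<omega> 0 = 0" by (simp add: Fn_def)
    moreover have "C * (\<rho> * e)\<^sup>2 \<le> (c / 64) * \<rho>\<^sup>2"
      using mult_right_mono[OF Ce, of "\<rho>\<^sup>2"] by (simp add: power_mult_distrib mult_ac)
    ultimately have up: "Fn n \<omega> (\<rho> *\<^sub>R v) \<le> (c / 64) * \<rho>\<^sup>2" using v u by simp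
    have vV: "v \<in> V" using v S by blast
    have nv: "norm (\<rho> *\<^sub>R v) < \<delta>1" using small_v[OF v(1)] \<rho> by simp
    have eq: "Fn n \<omega> (\<rho> *\<^sub>R v) = gn n \<omega> \<bullet> (\<rho> *\<^sub>R v) + F (\<rho> *\<^sub>R v) + Dn n (\<rho> *\<^sub>R v) \<omega>"
      using Fn_eq[OF n(1), of "\<rho> *\<^sub>R v"] nv d1 by simp
    have "\<bar>gn n \<omega> \<bullet> (\<rho> *\<^sub>R v)\<bar> \<le> norm (gn n \<omega>) * norm (\<rho> *\<^sub>R v)" by (rule Cauchy_Schwarz_ineq2)
    also have "\<dots> \<le> ((c / 192) * \<rho>) * (\<rho> * (5/2))"
      using small Vn[OF vV] \<rho> c by (intro mult_mono) auto
    also have "\<dots> \<le> (c / 64) * \<rho>\<^sup>2" using c \<rho> by (simp add: power2_eq_square)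
    finally have 1: "\<bar>gn n \<omega> \<bullet> (\<rho> *\<^sub>R v)\<bar> \<le> (c / 64) * \<rho>\<^sup>2" .
    have "(1/2)\<^sup>2 \<le> (norm v)\<^sup>2" using Vn[OF vV] by (intro power_mono) auto
    then have "(c / 4) * (\<rho>\<^sup>2 * (1/2)\<^sup>2) \<le> (c / 4) * (\<rho>\<^sup>2 * (norm v)\<^sup>2)"
      using c by (intro mult_left_mono) auto
    also have "\<dots> = (c / 4) * (norm (\<rho> *\<^sub>R v))\<^sup>2" using \<rho> by (simp add: power_mult_distrib)
    also have "\<dots> \<le> F (\<rho> *\<^sub>R v)" by (rule d1(3)[OF nv])
    finally have 2: "(c / 16) * \<rho>\<^sup>2 \<le> F (\<rho> *\<^sub>R v)" by (simp add: power2_eq_square)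
    define z where "z = c * \<rho>\<^sup>2"
    have "z > 0" using c \<rho> by (simp add: z_def)
    then show False using up eq 1 2 D[OF vV] unfolding abs_le_iff abs_less_iff times_divide_eq_left z_def[symmetric] by linarith
  qed
  define B where "B = real (card V) * (25 * L\<^sup>2 * (64 / c)\<^sup>2)"
  have B: "B \<ge> 0" by (simp add: B_def)
  have main: "prob {\<omega> \<in> space M. K \<le> sqrt n * norm (x n \<omega>) \<and> norm (x n \<omega>) < \<delta>1 / 3}
      \<le> (A * (192 / c)\<^sup>2 + B * (4 / 3)) / K\<^sup>2" if n: "n \<ge> 1" and K: "K > 0" for n K
  proof -
    have [measurable]: "x n \<in> borel_measurable M" by (rule x_meas[OF n])
    have sn: "sqrt n > 0" using n by simp
    \<comment> \<open>Shell k runs from \<rho> k to 2 \<rho> k and shell 0 starts at K / sqrt n.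
      Shells reaching beyond \<delta>1 contain no admissible minimiser, so their event is declared
      empty and every net point used stays in the domain of h.\<close>
    define \<rho> where "\<rho> k = 2 ^ k * (K / sqrt n)" for k
    have \<rho>pos: "\<rho> k > 0" for k using K sn by (simp add: \<rho>_def)
    define G where "G = {\<omega> \<in> space M. (c / 192) * (K / sqrt n) \<le> norm (gn n \<omega>)}"
    define E where "E k = (if 3 * \<rho> k < \<delta>1 then \<Union>v\<in>V. {\<omega> \<in> space M. (c / 64) * (\<rho> k)\<^sup>2 \<le> \<bar>Dn n (\<rho> k *\<^sub>R v) \<omega>\<bar>} else {})" for k
    have G: "G \<in> events" by (simp add: G_def)
    have nrm: "norm (\<rho> k *\<^sub>R v) < \<delta>" if "3 * \<rho> k < \<delta>1" "v \<in> V" for k v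
    proof -
      have "\<rho> k * norm v \<le> \<rho> k * (5/2)" using Vn[OF that(2)] \<rho>pos[of k] by (intro mult_left_mono) auto
      then have "\<rho> k * norm v < \<delta>" using that(1) \<rho>pos[of k] d1 by linarith
      then show ?thesis using \<rho>pos[of k] by simp
    qed
    have Ev: "{\<omega> \<in> space M. (c / 64) * (\<rho> k)\<^sup>2 \<le> \<bar>Dn n (\<rho> k *\<^sub>R v) \<omega>\<bar>} \<in> events"
      if "3 * \<rho> k < \<delta>1" "v \<in> V" for k v
    proof -
      have [measurable]: "Dn n (\<rho> k *\<^sub>R v) \<in> borel_measurable M" by (rule Dn_meas[OF nrm[OF that]])
      show ?thesis by measurable
    qed
    have E: "E k \<in> events" for k using Ev V(1) by (auto simp: E_def)
    have sub: "{\<omega> \<in> space M. K \<le> sqrt n * norm (x n \<omega>) \<and> norm (x n \<omega>) < \<delta>1 / 3} \<subseteq> G \<union> (\<Union>k. E k)"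
    proof (rule subsetI, rule ccontr)
      fix \<omega> assume w: "\<omega> \<in> {\<omega> \<in> space M. K \<le> sqrt n * norm (x n \<omega>) \<and> norm (x n \<omega>) < \<delta>1 / 3}"
        and no: "\<omega> \<notin> G \<union> (\<Union>k. E k)"
      have "1 \<le> norm (x n \<omega>) / (K / sqrt n)" using w K sn by (simp add: field_simps)
      then obtain k where "2 ^ k \<le> norm (x n \<omega>) / (K / sqrt n)" "norm (x n \<omega>) / (K / sqrt n) < 2 ^ Suc k"
        by (rule ex_power2_interval)
      then have k: "\<rho> k \<le> norm (x n \<omega>)" "norm (x n \<omega>) \<le> 2 * \<rho> k"
        using K sn by (auto simp: \<rho>_def field_simps)
      have k3: "3 * \<rho> k < \<delta>1" using k w by simp
      have "1 * (K / sqrt n) \<le> \<rho> k"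
        unfolding \<rho>_def using K sn by (intro mult_right_mono) auto
      then have "(c / 192) * (K / sqrt n) \<le> (c / 192) * \<rho> k"
        using c by (intro mult_left_mono) auto
      moreover have "norm (gn n \<omega>) < (c / 192) * (K / sqrt n)" using no w by (simp add: G_def)
      ultimately have "norm (gn n \<omega>) < (c / 192) * \<rho> k" by linarith
      then have "\<omega> \<in> E k" using shell[OF n _ \<rho>pos k3 k] w k3 by (auto simp: E_def)
      then show False using no by blast
    qed
    \<comment> \<open>Since n (\<rho> k)^2 = K^2 4^k, the union bound over V gives a geometric
      series in k.\<close>
    have EP: "prob (E k) \<le> (B / K\<^sup>2) * (1/4) ^ k" for k
    proof (cases "3 * \<rho> k < \<delta>1")
      case True
      have "prob (E k) \<le> (\<Sum>v\<in>V. prob {\<omega> \<in> space M. (c / 64) * (\<rho> k)\<^sup>2 \<le> \<bar>Dn n (\<rho> k *\<^sub>R v) \<omega>\<bar>})"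
        unfolding E_def if_P[OF True]
        by (rule finite_measure_subadditive_finite[OF V(1)]) (use Ev[OF True] in blast)
      also have "\<dots> \<le> (\<Sum>v\<in>V. 25 * L\<^sup>2 * (64 / c)\<^sup>2 / (K\<^sup>2 * 4 ^ k))"
      proof (rule sum_mono)
        fix v assume v: "v \<in> V"
        have "prob {\<omega> \<in> space M. (c / 64) * (\<rho> k)\<^sup>2 \<le> \<bar>Dn n (\<rho> k *\<^sub>R v) \<omega>\<bar>}
            \<le> (\<integral>q. (r (\<rho> k *\<^sub>R v) q)\<^sup>2 \<partial>D) / (real n * ((c / 64) * (\<rho> k)\<^sup>2)\<^sup>2)"
          using nrm[OF True v] n \<rho>pos[of k] c by (intro Dn_deviation) auto
        also have "\<dots> \<le> (2 * L * (\<rho> k * (5/2)))\<^sup>2 / (real n * ((c / 64) * (\<rho> k)\<^sup>2)\<^sup>2)"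
        proof (rule divide_right_mono)
          have "(2 * L * norm (\<rho> k *\<^sub>R v))\<^sup>2 \<le> (2 * L * (\<rho> k * (5/2)))\<^sup>2"
            using Vn[OF v] L \<rho>pos[of k] by (intro power_mono mult_left_mono) auto
          then show "(\<integral>q. (r (\<rho> k *\<^sub>R v) q)\<^sup>2 \<partial>D) \<le> (2 * L * (\<rho> k * (5/2)))\<^sup>2"
            using integral_r_square[OF nrm[OF True v]] by linarith
        qed simp
        also have "\<dots> = 25 * L\<^sup>2 * (64 / c)\<^sup>2 / (real n * (\<rho> k)\<^sup>2)"
          using \<rho>pos[of k] c n by (simp add: field_simps power2_eq_square)
        also have "real n * (\<rho> k)\<^sup>2 = K\<^sup>2 * 4 ^ k"
        proof -
          have "((2::real) ^ k)\<^sup>2 = 4 ^ k" by (simp add: power2_eq_square flip: power_mult_distrib)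
          then show ?thesis using n by (simp add: \<rho>_def power_mult_distrib power_divide)
        qed
        finally show "prob {\<omega> \<in> space M. (c / 64) * (\<rho> k)\<^sup>2 \<le> \<bar>Dn n (\<rho> k *\<^sub>R v) \<omega>\<bar>}
            \<le> 25 * L\<^sup>2 * (64 / c)\<^sup>2 / (K\<^sup>2 * 4 ^ k)" .
      qed
      also have "\<dots> = (B / K\<^sup>2) * (1/4) ^ k" by (simp add: B_def power_divide)
      finally show ?thesis .
    next
      case False
      then show ?thesis using B by (simp add: E_def)
    qed
    have sm: "summable (\<lambda>k. (B / K\<^sup>2) * (1/4 :: real) ^ k)" by (intro summable_mult summable_geometric) simp
    have smE: "summable (\<lambda>k. prob (E k))"
      by (rule summable_comparison_test'[OF sm, of 0]) (use EP in simp)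
    have "prob (\<Union>k. E k) \<le> (\<Sum>k. prob (E k))"
      using E smE by (intro finite_measure_subadditive_countably) auto
    also have "\<dots> \<le> (\<Sum>k. (B / K\<^sup>2) * (1/4) ^ k)" by (rule suminf_le[OF EP smE sm])
    also have "\<dots> = (B / K\<^sup>2) * (4 / 3)" by (subst suminf_mult) (auto simp: suminf_geometric)
    finally have PE: "prob (\<Union>k. E k) \<le> (B / K\<^sup>2) * (4 / 3)" .
    have "prob G \<le> A / (real n * ((c / 192) * (K / sqrt n))\<^sup>2)"
      unfolding G_def using K sn c by (intro A(2)[OF n]) auto
    also have "\<dots> = A * (192 / c)\<^sup>2 / K\<^sup>2"
      using n K c by (simp add: power_mult_distrib power_divide field_simps)
    finally have PG: "prob G \<le> A * (192 / c)\<^sup>2 / K\<^sup>2" .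
    have "prob {\<omega> \<in> space M. K \<le> sqrt n * norm (x n \<omega>) \<and> norm (x n \<omega>) < \<delta>1 / 3} \<le> prob (G \<union> (\<Union>k. E k))"
      by (rule finite_measure_mono[OF sub]) (use G E in auto)
    also have "\<dots> \<le> prob G + prob (\<Union>k. E k)"
      by (rule measure_Un_le) (use G E in auto)
    finally show ?thesis using PE PG by (simp add: add_divide_distrib)
  qed
  show thesis
    by (rule that[of "\<delta>1 / 3" "A * (192 / c)\<^sup>2 + B * (4 / 3)"]) (use main d1 A B in auto)
qed

lemma tight:
  assumes "e > 0"
  obtains K where "K > 0" "\<forall>\<^sub>F n in sequentially. prob {\<omega> \<in> space M. K \<le> norm (sqrt n *\<^sub>R x n \<omega>)} < e"
proof -
  obtain A \<delta>1 where A: "0 < \<delta>1" "A \<ge> 0" "\<And>n K. n \<ge> 1 \<Longrightarrow> K > 0 \<Longrightarrow>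
    prob {\<omega> \<in> space M. K \<le> sqrt n * norm (x n \<omega>) \<and> norm (x n \<omega>) < \<delta>1} \<le> A / K\<^sup>2"
    by (rule rate) blast
  \<comment> \<open>Chosen so that A / K^2 is below e/2; the summand 1 keeps K positive even if A =
    0.\<close>
  define K where "K = sqrt (2 * A / e + 1)"
  have arg: "2 * A / e + 1 > 0" using A assms by (intro add_nonneg_pos) auto
  have K: "K > 0" using arg by (simp add: K_def)
  have K2: "K\<^sup>2 = 2 * A / e + 1" using arg by (simp add: K_def)
  have "A < (e / 2) * K\<^sup>2" using assms unfolding K2 by (simp add: field_simps)
  then have AK: "A / K\<^sup>2 < e / 2" using K by (simp add: pos_divide_less_eq)
  have "\<forall>\<^sub>F n in sequentially. prob {\<omega> \<in> space M. norm (x n \<omega>) \<ge> \<delta>1} < e / 2"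
    using order_tendstoD(2)[OF consistent[OF A(1)], of "e / 2"] assms by simp
  moreover have "\<forall>\<^sub>F n in sequentially. n \<ge> 1" by (rule eventually_ge_at_top)
  ultimately have "\<forall>\<^sub>F n in sequentially. prob {\<omega> \<in> space M. K \<le> norm (sqrt n *\<^sub>R x n \<omega>)} < e"
  proof eventually_elim
    case (elim n)
    have [measurable]: "x n \<in> borel_measurable M" by (rule x_meas[OF elim(2)])
    have "prob {\<omega> \<in> space M. K \<le> norm (sqrt n *\<^sub>R x n \<omega>)} \<le>
       prob ({\<omega> \<in> space M. K \<le> sqrt n * norm (x n \<omega>) \<and> norm (x n \<omega>) < \<delta>1} \<union> {\<omega> \<in> space M. norm (x n \<omega>) \<ge> \<delta>1})"
      by (rule finite_measure_mono) auto
    also have "\<dots> \<le> prob {\<omega> \<in> space M. K \<le> sqrt n * norm (x n \<omega>) \<and> norm (x n \<omega>) < \<delta>1}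
        + prob {\<omega> \<in> space M. norm (x n \<omega>) \<ge> \<delta>1}"
      by (rule measure_Un_le) auto
    finally show ?case using A(3)[OF elim(2) K] AK elim(1) by linarith
  qed
  then show thesis using that K by blast
qed

end

section \<open>Linearisation of the minimiser\<close>

lemma norm_cis_diff_le: "norm (cis a - cis b) \<le> \<bar>a - b\<bar>"
proof -
  have "cis a - cis b = cis b * (cis (a - b) - 1)" by (simp add: cis_mult algebra_simps)
  then have "norm (cis a - cis b) = norm (cis (a - b) - 1)" by (simp add: norm_mult)
  also have "\<dots> \<le> \<bar>a - b\<bar>" using iexp_approx1[of "a - b" 0] by (simp add: cis_conv_exp)
  finally show ?thesis .
qed

lemma matrix_inv_works:
  assumes "invertible A"
  shows "A ** matrix_inv A = mat 1" "matrix_inv A ** A = mat 1"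
  using someI_ex[OF assms[unfolded invertible_def]] by (simp_all add: matrix_inv_def)

context semiconcave_m_estimation
begin

abbreviation "\<Lambda>i \<equiv> matrix_inv \<Lambda>"

lemma \<Lambda>_inverse: "\<Lambda> *v (\<Lambda>i *v u) = u" "transpose \<Lambda>i = \<Lambda>i"
proof -
  have "u = 0" if "\<Lambda> *v u = 0" for u
    using pos[of u] c that by (simp add: mult_le_0_iff)
  then have "invertible \<Lambda>" using matrix_left_invertible_ker invertible_left_inverse by metis
  then have i: "\<Lambda> ** \<Lambda>i = mat 1" "\<Lambda>i ** \<Lambda> = mat 1" using matrix_inv_works by auto
  then show "\<Lambda> *v (\<Lambda>i *v u) = u" by (simp add: matrix_vector_mul_assoc)
  have "transpose \<Lambda>i ** \<Lambda> = mat 1" using i sym by (metis matrix_transpose_mul transpose_mat)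
  then show "transpose \<Lambda>i = \<Lambda>i" using i(1) by (metis matrix_mul_assoc matrix_mul_lid matrix_mul_rid)
qed

text \<open>The minimiser of the limiting random quadratic G . w + (w . \<Lambda> w)/2 with G = sqrt
  n \<open>gn n \<omega>\<close>.\<close>

definition us :: "nat \<Rightarrow> 'w \<Rightarrow> real ^ 'd" where
  "us n \<omega> = - (sqrt n *\<^sub>R (\<Lambda>i *v gn n \<omega>))"

lemma us_meas [measurable]: "us n \<in> borel_measurable M"
proof -
  have "continuous_on UNIV (\<lambda>v. \<Lambda>i *v v)" by (intro linear_continuous_on) simp
  then have "(\<lambda>v. \<Lambda>i *v v) \<in> borel_measurable borel" by (rule borel_measurable_continuous_onI)
  then have [measurable]: "(\<lambda>\<omega>. \<Lambda>i *v gn n \<omega>) \<in> borel_measurable M"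
    using measurable_compose[OF gn_meas] by blast
  show ?thesis unfolding us_def[abs_def] by measurable
qed

lemma scaled_argument:
  assumes "n \<ge> (1::nat)"
  shows "real n * (norm (v /\<^sub>R sqrt n))\<^sup>2 = (norm v)\<^sup>2"
  using assms by (simp add: power_mult_distrib power_inverse)

lemma scaled_argument_filterlim:
  assumes "v \<noteq> (0 :: real ^ 'd)"
  shows "filterlim (\<lambda>n. v /\<^sub>R sqrt (real n)) (at 0) sequentially"
proof (rule filterlim_atI)
  have "(\<lambda>n. inverse (sqrt (real n)) *\<^sub>R v) \<longlonglongrightarrow> 0 *\<^sub>R v"
    by (intro tendsto_intros tendsto_inverse_0_at_top filterlim_compose[OF sqrt_at_top filterlim_real_sequentially])
  then show "(\<lambda>n. v /\<^sub>R sqrt (real n)) \<longlonglongrightarrow> 0" by simp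
  show "\<forall>\<^sub>F n in sequentially. v /\<^sub>R sqrt (real n) \<noteq> 0"
    using eventually_gt_at_top[of 0] by eventually_elim (use assms in auto)
qed

lemma scaled_argument_small:
  assumes "e > 0"
  shows "\<forall>\<^sub>F n in sequentially. norm (v /\<^sub>R sqrt (real n) :: real ^ 'd) < e"
proof (cases "v = 0")
  case False
  then have "((\<lambda>n. v /\<^sub>R sqrt (real n)) \<longlonglongrightarrow> 0)"
    using scaled_argument_filterlim filterlim_at by blast
  from tendstoD[OF this assms] show ?thesis by simp
qed (use assms in simp)

lemma F_scaled: "(\<lambda>n. real n * F (v /\<^sub>R sqrt n)) \<longlonglongrightarrow> (v \<bullet> (\<Lambda> *v v)) / 2"
proof (cases "v = 0")
  case True
  then show ?thesis by (simp add: F_def)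
next
  case False
  have "(\<lambda>n. (norm v)\<^sup>2 * ((F (v /\<^sub>R sqrt n) - ((v /\<^sub>R sqrt n) \<bullet> (\<Lambda> *v (v /\<^sub>R sqrt n))) / 2) / (norm (v /\<^sub>R sqrt n))\<^sup>2))
      \<longlonglongrightarrow> (norm v)\<^sup>2 * 0"
    by (intro tendsto_mult tendsto_const
        filterlim_compose[OF taylor[folded F_def] scaled_argument_filterlim[OF False]])
  moreover have "\<forall>\<^sub>F n in sequentially. (norm v)\<^sup>2 * ((F (v /\<^sub>R sqrt n) - ((v /\<^sub>R sqrt n) \<bullet> (\<Lambda> *v (v /\<^sub>R sqrt n))) / 2) / (norm (v /\<^sub>R sqrt n))\<^sup>2)
      = real n * F (v /\<^sub>R sqrt n) - (v \<bullet> (\<Lambda> *v v)) / 2"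
    using eventually_gt_at_top[of 0]
  proof eventually_elim
    case (elim n)
    then have "(norm v)\<^sup>2 / (norm (v /\<^sub>R sqrt n))\<^sup>2 = real n"
      using False by (simp add: power_mult_distrib field_simps)
    moreover have "real n * ((v /\<^sub>R sqrt n) \<bullet> (\<Lambda> *v (v /\<^sub>R sqrt n))) = v \<bullet> (\<Lambda> *v v)"
    proof -
      have "(v /\<^sub>R sqrt n) \<bullet> (\<Lambda> *v (v /\<^sub>R sqrt n)) = inverse (sqrt n) * (inverse (sqrt n) * (v \<bullet> (\<Lambda> *v v)))"
        by (simp add: matrix_vector_mult_scaleR)
      then show ?thesis using elim by (simp add: field_simps)
    qed
    ultimately show ?case
      by (metis (no_types, opaque_lifting) right_diff_distrib times_divide_eq_left times_divide_eq_right)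
  qed
  ultimately have "(\<lambda>n. real n * F (v /\<^sub>R sqrt n) - (v \<bullet> (\<Lambda> *v v)) / 2) \<longlonglongrightarrow> 0"
    using Lim_transform_eventually by fastforce
  then show ?thesis by (simp add: LIM_zero_iff)
qed

text \<open>At displacement v / sqrt n the Lipschitz bound dominates n r^2 by the constant (2 L
  |v|)^2, and differentiability at 0 sends it to 0 for almost every q, so dominated convergence
  applies.\<close>

lemma r_square_scaled: "(\<lambda>n. real n * (\<integral>q. (r (v /\<^sub>R sqrt n) q)\<^sup>2 \<partial>D)) \<longlonglongrightarrow> 0"
proof (cases "v = 0")
  case True
  then show ?thesis by (simp add: r_def)
next
  case False
  interpret D: prob_space D by (rule prob_space_D)
  \<comment> \<open>The Lipschitz bound and measurability hold only inside the ball of radius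
    \<delta>; the value 0 elsewhere affects finitely many n and keeps the domination valid for all
    of them.\<close>
  define s where "s n q = (if norm (v /\<^sub>R sqrt n) < \<delta> then real n * (r (v /\<^sub>R sqrt n) q)\<^sup>2 else 0)" for n :: nat and q
  have sm: "s n \<in> borel_measurable D" for n
  proof (cases "norm (v /\<^sub>R sqrt n) < \<delta>")
    case True
    from r_meas[OF this] have [measurable]: "r (v /\<^sub>R sqrt n) \<in> borel_measurable D"
      by (simp add: measurable_cong_sets[OF sets_D refl])
    show ?thesis using True unfolding s_def[abs_def] by simp
  next
    case False
    then show ?thesis by (simp add: s_def[abs_def])
  qed
  have "(\<lambda>n. \<integral>q. s n q \<partial>D) \<longlonglongrightarrow> (\<integral>q. 0 \<partial>D)"
  proof (rule integral_dominated_convergence[where w = "\<lambda>_. (2 * L * norm v)\<^sup>2"])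
    show "AE q in D. (\<lambda>n. s n q) \<longlonglongrightarrow> 0"
      using diff
    proof eventually_elim
      case (elim q)
      have "(\<lambda>n. (norm v)\<^sup>2 * ((h (v /\<^sub>R sqrt n) q - h 0 q - g q \<bullet> (v /\<^sub>R sqrt n)) / norm (v /\<^sub>R sqrt n))\<^sup>2) \<longlonglongrightarrow> (norm v)\<^sup>2 * 0\<^sup>2"
        by (intro tendsto_mult tendsto_power tendsto_const
          filterlim_compose[OF elim scaled_argument_filterlim[OF False]])
      moreover have "\<forall>\<^sub>F n in sequentially. (norm v)\<^sup>2 * ((h (v /\<^sub>R sqrt n) q - h 0 q - g q \<bullet> (v /\<^sub>R sqrt n)) / norm (v /\<^sub>R sqrt n))\<^sup>2 = s n q"
        using eventually_gt_at_top[of 0] scaled_argument_small[OF \<delta>, of v]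
      proof eventually_elim
        case (elim n)
        then have "(norm v)\<^sup>2 / (norm (v /\<^sub>R sqrt n))\<^sup>2 = real n"
          using False by (simp add: power_mult_distrib field_simps)
        moreover have "a * (b / d)\<^sup>2 = (a / d\<^sup>2) * b\<^sup>2" for a b d :: real by (simp add: power_divide)
        ultimately show ?case using elim by (simp only: s_def r_def if_True)
      qed
      ultimately show ?case using Lim_transform_eventually by fastforce
    qed
    show "AE q in D. norm (s n q) \<le> (2 * L * norm v)\<^sup>2" for n
    proof (rule AE_I2)
      fix q assume q: "q \<in> space D"
      show "norm (s n q) \<le> (2 * L * norm v)\<^sup>2"
      proof (cases "norm (v /\<^sub>R sqrt n) < \<delta> \<and> n \<noteq> 0")
        case True
        then have "\<bar>r (v /\<^sub>R sqrt n) q\<bar> \<le> \<bar>2 * L * norm (v /\<^sub>R sqrt n)\<bar>"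
          using r_bound[of q "v /\<^sub>R sqrt n"] q by (simp add: space_D)
        then have "(r (v /\<^sub>R sqrt n) q)\<^sup>2 \<le> (2 * L * norm (v /\<^sub>R sqrt n))\<^sup>2" by (simp add: abs_le_square_iff)
        then have "real n * (r (v /\<^sub>R sqrt n) q)\<^sup>2 \<le> real n * (2 * L * norm (v /\<^sub>R sqrt n))\<^sup>2"
          by (intro mult_left_mono) auto
        also have "\<dots> = (2 * L)\<^sup>2 * (real n * (norm (v /\<^sub>R sqrt n))\<^sup>2)"
          unfolding power_mult_distrib by (simp only: ac_simps)
        also have "\<dots> = (2 * L * norm v)\<^sup>2"
          using scaled_argument[of n v] True by (simp add: power_mult_distrib)
        finally show ?thesis using True by (simp add: s_def)
      qed (auto simp: s_def)
    qed
  qed (use sm in auto)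
  then have "(\<lambda>n. \<integral>q. s n q \<partial>D) \<longlonglongrightarrow> 0" by simp
  moreover have "\<forall>\<^sub>F n in sequentially. (\<integral>q. s n q \<partial>D) = real n * (\<integral>q. (r (v /\<^sub>R sqrt n) q)\<^sup>2 \<partial>D)"
    using scaled_argument_small[OF \<delta>, of v] by eventually_elim (simp add: s_def)
  ultimately show ?thesis by (rule Lim_transform_eventually)
qed

text \<open>Convergence in probability at each fixed v; the finite net later supplies what
  uniformity in v would have given.\<close>

lemma Dn_scaled:
  assumes "\<eta> > 0"
  shows "(\<lambda>n. prob {\<omega> \<in> space M. \<eta> \<le> \<bar>real n * Dn n (v /\<^sub>R sqrt n) \<omega>\<bar>}) \<longlonglongrightarrow> 0"
proof (rule tendsto_sandwich[OF _ _ tendsto_const])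
  show "(\<lambda>n. real n * (\<integral>q. (r (v /\<^sub>R sqrt n) q)\<^sup>2 \<partial>D) / \<eta>\<^sup>2) \<longlonglongrightarrow> 0"
    using tendsto_divide[OF r_square_scaled[of v] tendsto_const[of "\<eta>\<^sup>2"]] assms by simp
  show "\<forall>\<^sub>F n in sequentially. prob {\<omega> \<in> space M. \<eta> \<le> \<bar>real n * Dn n (v /\<^sub>R sqrt n) \<omega>\<bar>}
      \<le> real n * (\<integral>q. (r (v /\<^sub>R sqrt n) q)\<^sup>2 \<partial>D) / \<eta>\<^sup>2"
    using eventually_gt_at_top[of 0] scaled_argument_small[OF \<delta>, of v]
  proof eventually_elim
    case (elim n)
    have "{\<omega> \<in> space M. \<eta> \<le> \<bar>real n * Dn n (v /\<^sub>R sqrt n) \<omega>\<bar>} =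
        {\<omega> \<in> space M. \<eta> / real n \<le> \<bar>Dn n (v /\<^sub>R sqrt n) \<omega>\<bar>}"
      using elim(1) by (auto simp: abs_mult field_simps)
    then have "prob {\<omega> \<in> space M. \<eta> \<le> \<bar>real n * Dn n (v /\<^sub>R sqrt n) \<omega>\<bar>} \<le>
        (\<integral>q. (r (v /\<^sub>R sqrt n) q)\<^sup>2 \<partial>D) / (real n * (\<eta> / real n)\<^sup>2)"
      using Dn_deviation[OF elim(2), of n "\<eta> / real n"] elim(1) assms by simp
    also have "\<dots> = real n * (\<integral>q. (r (v /\<^sub>R sqrt n) q)\<^sup>2 \<partial>D) / \<eta>\<^sup>2"
      using elim(1) assms by (simp add: field_simps power2_eq_square)
    finally show ?case .
  qed
qed simp

text \<open>Semiconcavity yields a net point v near the scaled minimiser whose value is larger by at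
  most C e^2 / n; v' is any net point near \<open>us\<close>. On the net, n Fn agrees with the
  limiting quadratic q up to 2 \<eta>. Since q, after completing the square, grows quadratically
  away from \<open>us\<close>, comparing q v with q v' bounds the distance of v from
  \<open>us\<close>.\<close>

lemma argmin_close:
  assumes n: "n \<ge> 1" "\<omega> \<in> space M" and B: "\<And>w. norm (\<Lambda> *v w) \<le> B * norm w"
    and V: "finite V" "\<And>u. norm u \<le> K \<Longrightarrow> \<exists>S\<subseteq>V. u \<in> convex hull S \<and> (\<forall>v\<in>S. norm (v - u) \<le> e)"
    and V\<delta>: "\<And>v. v \<in> V \<Longrightarrow> norm (v /\<^sub>R sqrt n) < \<delta>"
    and V\<eta>: "\<And>v. v \<in> V \<Longrightarrow> \<bar>real n * Dn n (v /\<^sub>R sqrt n) \<omega>\<bar> \<le> \<eta>"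
      "\<And>v. v \<in> V \<Longrightarrow> \<bar>real n * F (v /\<^sub>R sqrt n) - (v \<bullet> (\<Lambda> *v v)) / 2\<bar> \<le> \<eta>"
    and u: "norm (sqrt n *\<^sub>R x n \<omega>) \<le> K" "norm (us n \<omega>) \<le> K" "norm (x n \<omega>) < \<delta>" and e: "e > 0"
  shows "\<exists>v. norm (v - sqrt n *\<^sub>R x n \<omega>) \<le> e \<and> c * (norm (v - us n \<omega>))\<^sup>2 \<le> B * e\<^sup>2 + 8 * \<eta> + 2 * C * e\<^sup>2"
proof -
  have sn: "sqrt n > 0" using n by simp
  let ?u = "sqrt n *\<^sub>R x n \<omega>" and ?s = "us n \<omega>"
  define G where "G = sqrt n *\<^sub>R gn n \<omega>"
  define q where "q w = G \<bullet> w + (w \<bullet> (\<Lambda> *v w)) / 2" for w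
  have Gs: "\<Lambda> *v ?s = - G"
    using \<Lambda>_inverse(1)[of "gn n \<omega>"] by (simp add: us_def G_def matrix_vector_mult_scaleR linear_neg)
  \<comment> \<open>Completing the square at the stationary point, where \<Lambda> \<open>us\<close>
    = - G.\<close>
  have q_eq: "q w = q ?s + ((w - ?s) \<bullet> (\<Lambda> *v (w - ?s))) / 2" for w
  proof -
    have "(w - ?s) \<bullet> (\<Lambda> *v (w - ?s)) = w \<bullet> (\<Lambda> *v w) - 2 * (w \<bullet> (\<Lambda> *v ?s)) + ?s \<bullet> (\<Lambda> *v ?s)"
      using inner_matrix_symmetric[OF sym, of ?s w]
      by (simp add: matrix_vector_mult_diff_distrib inner_diff_left inner_diff_right)
    then show ?thesis unfolding q_def Gs by (simp add: inner_commute[of _ G] field_simps)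
  qed
  have near: "\<bar>real n * Fn n \<omega> (v /\<^sub>R sqrt n) - q v\<bar> \<le> 2 * \<eta>" if v: "v \<in> V" for v
  proof -
    have "real n * Fn n \<omega> (v /\<^sub>R sqrt n) = real n * (gn n \<omega> \<bullet> (v /\<^sub>R sqrt n))
        + real n * F (v /\<^sub>R sqrt n) + real n * Dn n (v /\<^sub>R sqrt n) \<omega>"
      unfolding Fn_eq[OF n(1) V\<delta>[OF v]] by (simp add: distrib_left)
    moreover have "real n * (gn n \<omega> \<bullet> (v /\<^sub>R sqrt n)) = G \<bullet> v"
      using n by (simp add: G_def field_simps)
    ultimately show ?thesis using V\<eta>[OF v] unfolding q_def by linarith
  qed
  obtain S where S: "S \<subseteq> V" "?u \<in> convex hull S" "\<And>v. v \<in> S \<Longrightarrow> norm (v - ?u) \<le> e"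
    using V(2)[OF u(1)] by blast
  have "\<exists>v\<in>S. Fn n \<omega> (inverse (sqrt n) *\<^sub>R v) \<le> Fn n \<omega> (inverse (sqrt n) *\<^sub>R ?u) + C * (inverse (sqrt n) * e)\<^sup>2"
  proof (rule net_bound[OF n _ finite_subset[OF S(1) V(1)] S(2,3)])
    show "inverse (sqrt n) * norm v < \<delta>" if "v \<in> S" for v
      using V\<delta>[of v] S that by auto
  qed (use sn in auto)
  then obtain v where v: "v \<in> S" "Fn n \<omega> (v /\<^sub>R sqrt n) \<le> Fn n \<omega> (x n \<omega>) + C * (inverse (sqrt n) * e)\<^sup>2"
    using sn by auto
  obtain S' where S': "S' \<subseteq> V" "?s \<in> convex hull S'" "\<And>v. v \<in> S' \<Longrightarrow> norm (v - ?s) \<le> e"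
    using V(2)[OF u(2)] by blast
  then have "S' \<noteq> {}" by auto
  then obtain v' where v': "v' \<in> S'" by blast
  have "Fn n \<omega> (x n \<omega>) \<le> Fn n \<omega> (v' /\<^sub>R sqrt n)"
    using v' S' V\<delta> by (intro Fn_minimal n u) auto
  with v have "Fn n \<omega> (v /\<^sub>R sqrt n) \<le> Fn n \<omega> (v' /\<^sub>R sqrt n) + C * (inverse (sqrt n) * e)\<^sup>2" by linarith
  then have "real n * Fn n \<omega> (v /\<^sub>R sqrt n) \<le> real n * (Fn n \<omega> (v' /\<^sub>R sqrt n) + C * (inverse (sqrt n) * e)\<^sup>2)"
    by (intro mult_left_mono) auto
  also have "\<dots> = real n * Fn n \<omega> (v' /\<^sub>R sqrt n) + C * e\<^sup>2"
    using n by (simp add: distrib_left power_mult_distrib power_inverse)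
  \<comment> \<open>Both v and v' cost 2 \<eta>. The square in \<open>q_eq\<close> carries a factor
    1/2, so the error doubles to 8 \<eta> + 2 C e^2 in the next line.\<close>
  finally have "q v \<le> q v' + 4 * \<eta> + C * e\<^sup>2"
    using near[of v] near[of v'] v(1) v' S S' by (auto simp: subset_iff abs_le_iff)
  then have "(v - ?s) \<bullet> (\<Lambda> *v (v - ?s)) \<le> (v' - ?s) \<bullet> (\<Lambda> *v (v' - ?s)) + 8 * \<eta> + 2 * C * e\<^sup>2"
    unfolding q_eq[of v] q_eq[of v'] by simp
  also have "(v' - ?s) \<bullet> (\<Lambda> *v (v' - ?s)) \<le> norm (v' - ?s) * norm (\<Lambda> *v (v' - ?s))"
    by (rule norm_cauchy_schwarz)
  also have "\<dots> \<le> norm (v' - ?s) * (B * norm (v' - ?s))" by (intro mult_left_mono B) auto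
  also have "\<dots> = B * (norm (v' - ?s))\<^sup>2" by (simp add: power2_eq_square)
  also have "\<dots> \<le> B * e\<^sup>2"
  proof (rule mult_left_mono)
    show "(norm (v' - ?s))\<^sup>2 \<le> e\<^sup>2" using S'(3)[OF v'] by (intro power_mono) auto
    have "0 \<le> B * norm (axis undefined 1 :: real ^ 'd)" using B[of "axis undefined 1"] norm_ge_zero order_trans by blast
    then show "0 \<le> B" by simp
  qed
  finally have "c * (norm (v - ?s))\<^sup>2 \<le> B * e\<^sup>2 + 8 * \<eta> + 2 * C * e\<^sup>2" using pos[of "v - ?s"] by linarith
  then show ?thesis using S(3)[OF v(1)] by blast
qed

lemma us_tail:
  assumes "s > 0"
  obtains K where "K > 0" "\<And>n. n \<ge> 1 \<Longrightarrow> prob {\<omega> \<in> space M. K \<le> norm (us n \<omega>)} < s"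
proof -
  obtain A where A: "A \<ge> 0" "\<And>n a. n \<ge> 1 \<Longrightarrow> a > 0 \<Longrightarrow>
    prob {\<omega> \<in> space M. a \<le> norm (gn n \<omega>)} \<le> A / (real n * a\<^sup>2)"
    using gn_deviation by blast
  have "bounded_linear (\<lambda>v. \<Lambda>i *v v)" by (simp add: linear_linear)
  from bounded_linear.pos_bounded[OF this] obtain B where B: "B > 0" "\<And>v. norm (\<Lambda>i *v v) \<le> norm v * B" by blast
  define K where "K = sqrt (A * B\<^sup>2 / s + 1)"
  have arg: "A * B\<^sup>2 / s + 1 > 0" using A assms by (intro add_nonneg_pos) auto
  then have K: "K > 0" "K\<^sup>2 = A * B\<^sup>2 / s + 1" by (simp_all add: K_def)
  have "A * B\<^sup>2 < s * K\<^sup>2" using assms unfolding K(2) by (simp add: field_simps)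
  then have AK: "A * B\<^sup>2 / K\<^sup>2 < s"
    using K(1) by (subst pos_divide_less_eq) auto
  show thesis
  proof (rule that[OF K(1)])
    fix n :: nat assume n: "n \<ge> 1"
    then have sn: "sqrt n > 0" by simp
    have "prob {\<omega> \<in> space M. K \<le> norm (us n \<omega>)} \<le> prob {\<omega> \<in> space M. K / (sqrt n * B) \<le> norm (gn n \<omega>)}"
    proof (rule finite_measure_mono)
      show "{\<omega> \<in> space M. K \<le> norm (us n \<omega>)} \<subseteq> {\<omega> \<in> space M. K / (sqrt n * B) \<le> norm (gn n \<omega>)}"
      proof safe
        fix \<omega> assume "K \<le> norm (us n \<omega>)"
        also have "norm (us n \<omega>) = sqrt n * norm (\<Lambda>i *v gn n \<omega>)" by (simp add: us_def)
        also have "\<dots> \<le> sqrt n * (norm (gn n \<omega>) * B)" using B(2) by (intro mult_left_mono) auto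
        finally show "K / (sqrt n * B) \<le> norm (gn n \<omega>)" using sn B(1) by (simp add: field_simps)
      qed
    qed measurable
    also have "\<dots> \<le> A / (real n * (K / (sqrt n * B))\<^sup>2)" using sn B K by (intro A(2)[OF n]) auto
    also have "\<dots> = A * B\<^sup>2 / K\<^sup>2" using n B K by (simp add: power_divide power_mult_distrib)
    finally show "prob {\<omega> \<in> space M. K \<le> norm (us n \<omega>)} < s" using AK by linarith
  qed
qed

theorem linearization:
  assumes e: "e > 0"
  shows "(\<lambda>n. prob {\<omega> \<in> space M. e \<le> norm (sqrt n *\<^sub>R x n \<omega> - us n \<omega>)}) \<longlonglongrightarrow> 0"
proof (rule order_tendstoI)
  fix s :: real assume "s < 0"
  then have "s < p" if "p \<ge> 0" for p :: real using that by linarith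
  then show "\<forall>\<^sub>F n in sequentially. s < prob {\<omega> \<in> space M. e \<le> norm (sqrt n *\<^sub>R x n \<omega> - us n \<omega>)}"
    by simp
next
  fix s :: real assume "0 < s"
  then have s4: "s / 4 > 0" by simp
  obtain K1 where K1: "K1 > 0" "\<forall>\<^sub>F n in sequentially. prob {\<omega> \<in> space M. K1 \<le> norm (sqrt n *\<^sub>R x n \<omega>)} < s / 4"
    by (rule tight[OF s4])
  obtain K2 where K2: "K2 > 0" "\<And>n. n \<ge> 1 \<Longrightarrow> prob {\<omega> \<in> space M. K2 \<le> norm (us n \<omega>)} < s / 4"
    by (rule us_tail[OF s4]) blast
  define K where "K = max K1 K2"
  have "bounded_linear (\<lambda>v. \<Lambda> *v v)" by (simp add: linear_linear)
  from bounded_linear.pos_bounded[OF this] obtain B where B: "B > 0" "\<And>v. norm (\<Lambda> *v v) \<le> norm v * B" by blast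
  then have B': "norm (\<Lambda> *v v) \<le> B * norm v" for v by (simp add: mult.commute)
  \<comment> \<open>The net width d and the tolerance \<eta> below each contribute at most c e^2 /
    16 to the bound of \<open>argmin_close\<close>. The sum c e^2 / 8 is below c (e/2)^2, the least
    possible value if the minimiser were e away from \<open>us\<close> and the net point within e/4
    of the minimiser.\<close>
  define d where "d = min (e / 4) (sqrt (c * e\<^sup>2 / (16 * (B + 2 * C))))"
  have BC: "B + 2 * C > 0" using B(1) C by simp
  have d: "d > 0" "d \<le> e / 4" using e c BC by (auto simp: d_def)
  have dB: "(B + 2 * C) * d\<^sup>2 \<le> c * e\<^sup>2 / 16"
  proof -
    have "d\<^sup>2 \<le> (sqrt (c * e\<^sup>2 / (16 * (B + 2 * C))))\<^sup>2" using d by (intro power_mono) (auto simp: d_def)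
    also have "\<dots> = c * e\<^sup>2 / (16 * (B + 2 * C))" using c BC by simp
    finally have "(B + 2 * C) * d\<^sup>2 \<le> (B + 2 * C) * (c * e\<^sup>2 / (16 * (B + 2 * C)))"
      using BC by (intro mult_left_mono) auto
    moreover have "k * (z / (16 * k)) = z / 16" if "k > 0" for k z :: real
      using that by (simp add: field_simps)
    from this[OF BC, of "c * e\<^sup>2"] show ?thesis using calculation(1) by linarith
  qed
  define \<eta> where "\<eta> = c * e\<^sup>2 / 128"
  have \<eta>: "\<eta> > 0" using c e by (simp add: \<eta>_def)
  have "\<exists>V. finite V \<and> (\<forall>u\<in>cball (0 :: real ^ 'd) K. \<exists>S\<subseteq>V. u \<in> convex hull S \<and> (\<forall>v\<in>S. norm (v - u) \<le> d))"
    by (rule finite_convex_cover[OF compact_cball[of "0 :: real ^ 'd" K] d(1)]) (rule exI, rule conjI, assumption, rule ballI, simp only: mem_cball)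
  then obtain V where V: "finite V"
    "\<forall>u\<in>cball (0 :: real ^ 'd) K. \<exists>S\<subseteq>V. u \<in> convex hull S \<and> (\<forall>v\<in>S. norm (v - u) \<le> d)" by (elim exE conjE)
  have "(\<lambda>n. \<Sum>v\<in>V. prob {\<omega> \<in> space M. \<eta> \<le> \<bar>real n * Dn n (v /\<^sub>R sqrt n) \<omega>\<bar>}) \<longlonglongrightarrow> (\<Sum>v\<in>V. 0)"
    by (intro tendsto_sum Dn_scaled \<eta>)
  then have evD: "\<forall>\<^sub>F n in sequentially. (\<Sum>v\<in>V. prob {\<omega> \<in> space M. \<eta> \<le> \<bar>real n * Dn n (v /\<^sub>R sqrt n) \<omega>\<bar>}) < s / 4"
    using order_tendstoD(2) s4 by fastforce
  have ev\<delta>: "\<forall>\<^sub>F n in sequentially. \<forall>v\<in>V. norm (v /\<^sub>R sqrt (real n)) < \<delta>"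
    by (intro eventually_ball_finite V ballI scaled_argument_small \<delta>)
  have evF: "\<forall>\<^sub>F n in sequentially. \<forall>v\<in>V. \<bar>real n * F (v /\<^sub>R sqrt n) - (v \<bullet> (\<Lambda> *v v)) / 2\<bar> < \<eta>"
    using tendstoD[OF F_scaled \<eta>] by (intro eventually_ball_finite V ballI) (simp add: dist_real_def)
  have evx: "\<forall>\<^sub>F n in sequentially. prob {\<omega> \<in> space M. norm (x n \<omega>) \<ge> \<delta>} < s / 4"
    by (rule order_tendstoD(2)[OF consistent[OF \<delta>] s4])
  show "\<forall>\<^sub>F n in sequentially. prob {\<omega> \<in> space M. e \<le> norm (sqrt n *\<^sub>R x n \<omega> - us n \<omega>)} < s"
    using evD ev\<delta> evF evx K1(2) eventually_ge_at_top[of 1]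
  proof eventually_elim
    case (elim n)
    note n = elim(6)
    have [measurable]: "x n \<in> borel_measurable M" by (rule x_meas[OF n])
    let ?T1 = "{\<omega> \<in> space M. K1 \<le> norm (sqrt n *\<^sub>R x n \<omega>)}" and ?T2 = "{\<omega> \<in> space M. K2 \<le> norm (us n \<omega>)}"
    let ?T3 = "{\<omega> \<in> space M. norm (x n \<omega>) \<ge> \<delta>}"
    let ?T4 = "\<lambda>v. {\<omega> \<in> space M. \<eta> \<le> \<bar>real n * Dn n (v /\<^sub>R sqrt n) \<omega>\<bar>}"
    have T4: "?T4 v \<in> events" if "v \<in> V" for v
    proof -
      have [measurable]: "Dn n (v /\<^sub>R sqrt n) \<in> borel_measurable M" using elim(2) that by (intro Dn_meas) auto
      show ?thesis by measurable
    qed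
    have U4: "(\<Union>v\<in>V. ?T4 v) \<in> events" using T4 V(1) by auto
    \<comment> \<open>Four causes of failure, each of probability below s/4: the scaled minimiser is
      large, \<open>us\<close> is large, the minimiser leaves the chart ball, or the centred
      remainder is large at some net point.\<close>
    have "{\<omega> \<in> space M. e \<le> norm (sqrt n *\<^sub>R x n \<omega> - us n \<omega>)} \<subseteq> (?T1 \<union> ?T2) \<union> (?T3 \<union> (\<Union>v\<in>V. ?T4 v))"
    proof (rule subsetI, rule ccontr)
      fix \<omega> assume w: "\<omega> \<in> {\<omega> \<in> space M. e \<le> norm (sqrt n *\<^sub>R x n \<omega> - us n \<omega>)}"
        and no: "\<omega> \<notin> (?T1 \<union> ?T2) \<union> (?T3 \<union> (\<Union>v\<in>V. ?T4 v))"
      have "\<exists>v. norm (v - sqrt n *\<^sub>R x n \<omega>) \<le> d \<and> c * (norm (v - us n \<omega>))\<^sup>2 \<le> B * d\<^sup>2 + 8 * \<eta> + 2 * C * d\<^sup>2"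
      proof (rule argmin_close[OF n _ B' V(1), where K = K])
        show "\<exists>S\<subseteq>V. u \<in> convex hull S \<and> (\<forall>v\<in>S. norm (v - u) \<le> d)" if "norm u \<le> K" for u
          using bspec[OF V(2), of u] that by simp
        show "norm (sqrt n *\<^sub>R x n \<omega>) \<le> K" "norm (us n \<omega>) \<le> K" "norm (x n \<omega>) < \<delta>" "\<omega> \<in> space M"
          using no w unfolding K_def by auto
        show "\<bar>real n * Dn n (v /\<^sub>R sqrt n) \<omega>\<bar> \<le> \<eta>" if "v \<in> V" for v
          using no w that by force
      qed (use elim d in \<open>auto simp: less_imp_le\<close>)
      then obtain v where v: "norm (v - sqrt n *\<^sub>R x n \<omega>) \<le> d"
        "c * (norm (v - us n \<omega>))\<^sup>2 \<le> B * d\<^sup>2 + 8 * \<eta> + 2 * C * d\<^sup>2" by blast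
      have "e \<le> norm (v - us n \<omega>) + norm (v - sqrt n *\<^sub>R x n \<omega>)"
        using w norm_triangle_ineq4[of "v - us n \<omega>" "v - sqrt n *\<^sub>R x n \<omega>"] by simp
      then have "e / 2 \<le> norm (v - us n \<omega>)" using v(1) d e by linarith
      then have "(e / 2)\<^sup>2 \<le> (norm (v - us n \<omega>))\<^sup>2" using e by (intro power_mono) auto
      then have "c * (e / 2)\<^sup>2 \<le> c * (norm (v - us n \<omega>))\<^sup>2" using c by (intro mult_left_mono) auto
      also have "\<dots> \<le> (B + 2 * C) * d\<^sup>2 + 8 * \<eta>" using v(2) by (simp add: algebra_simps)
      also have "\<dots> \<le> c * e\<^sup>2 / 8" using dB by (simp add: \<eta>_def)
      finally have "c * e\<^sup>2 / 4 \<le> c * e\<^sup>2 / 8" by (simp add: power_divide)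
      moreover have "c * e\<^sup>2 > 0" using c e by simp
      ultimately show False by simp
    qed
    then have "prob {\<omega> \<in> space M. e \<le> norm (sqrt n *\<^sub>R x n \<omega> - us n \<omega>)} \<le> prob ((?T1 \<union> ?T2) \<union> (?T3 \<union> (\<Union>v\<in>V. ?T4 v)))"
      using U4 by (intro finite_measure_mono) auto
    also have "\<dots> \<le> prob (?T1 \<union> ?T2) + prob (?T3 \<union> (\<Union>v\<in>V. ?T4 v))" using U4 by (intro measure_Un_le) auto
    also have "prob (?T1 \<union> ?T2) \<le> prob ?T1 + prob ?T2" by (intro measure_Un_le) auto
    also have "prob (?T3 \<union> (\<Union>v\<in>V. ?T4 v)) \<le> prob ?T3 + prob (\<Union>v\<in>V. ?T4 v)" using U4 by (intro measure_Un_le) auto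
    also have "prob (\<Union>v\<in>V. ?T4 v) \<le> (\<Sum>v\<in>V. prob (?T4 v))"
      by (rule finite_measure_subadditive_finite[OF V(1)]) (use T4 in blast)
    finally show ?case using elim(1,4,5) K2(2)[OF n] by linarith
  qed
qed

text \<open>The inner product of t with \<open>us\<close> is a normalised sum of the i.i.d. scalars
  - g (Y i) . (\<Lambda>i t), so the scalar limit theorem applies for each t. The scaled minimiser
  may replace \<open>us\<close> because \<open>cis\<close> is bounded and 1-Lipschitz and the
  difference tends to 0 in probability.\<close>

lemma char_limit:
  "(\<lambda>n. expectation (\<lambda>\<omega>. cis (t \<bullet> (sqrt n *\<^sub>R x n \<omega>)))) \<longlonglongrightarrow>
    of_real (exp (- (\<integral>q. (g q \<bullet> (\<Lambda>i *v t))\<^sup>2 \<partial>D) / 2))"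
proof -
  interpret D: prob_space D by (rule prob_space_D)
  define \<tau> where "\<tau> = \<Lambda>i *v t"
  define X where "X i \<omega> = - (g (Y i \<omega>) \<bullet> \<tau>)" for i \<omega>
  have gm [measurable]: "(\<lambda>q. - (g q \<bullet> \<tau>)) \<in> borel_measurable N" by measurable
  have bnd: "\<bar>g q \<bullet> \<tau>\<bar> \<le> L * norm \<tau>" if "q \<in> space N" for q
    using g_bound[OF that] by (intro order_trans[OF Cauchy_Schwarz_ineq2] mult_right_mono) auto
  have E: "expectation (\<lambda>\<omega>. f (Y i \<omega>)) = (\<integral>q. f q \<partial>D)" if "f \<in> borel_measurable N" for f :: "'b \<Rightarrow> real" and i
    unfolding same[of i, symmetric] using that by (subst integral_distr) auto
  have clt: "(\<lambda>n. expectation (\<lambda>\<omega>. cis ((\<Sum>i<n. X i \<omega>) / sqrt n))) \<longlonglongrightarrow>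
      of_real (exp (- expectation (\<lambda>\<omega>. (X 0 \<omega>)\<^sup>2) / 2))"
  proof (rule central_limit_char)
    show "indep_vars (\<lambda>_. borel) X UNIV"
      unfolding X_def[abs_def] by (rule indep_vars_compose2[OF ind]) simp
    show "expectation (X n) = 0" for n
      unfolding X_def[abs_def] using E[of "\<lambda>q. - (g q \<bullet> \<tau>)" n] g_mean[of \<tau>] by simp
    show "integrable M (\<lambda>\<omega>. (X n \<omega>)\<^sup>2)" for n
    proof (rule integrable_const_bound[of _ "(L * norm \<tau>)\<^sup>2"])
      show "AE \<omega> in M. norm ((X n \<omega>)\<^sup>2) \<le> (L * norm \<tau>)\<^sup>2"
        using bnd[OF Y_space] L by (intro AE_I2) (simp add: X_def abs_le_square_iff[symmetric])
      show "(\<lambda>\<omega>. (X n \<omega>)\<^sup>2) \<in> borel_measurable M" unfolding X_def by measurable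
    qed
    show "distr M borel (X n) = distr D borel (\<lambda>q. - (g q \<bullet> \<tau>))" for n
      unfolding same[of n, symmetric] X_def[abs_def] by (subst distr_distr) (auto simp: comp_def)
  qed
  have var: "expectation (\<lambda>\<omega>. (X 0 \<omega>)\<^sup>2) = (\<integral>q. (g q \<bullet> \<tau>)\<^sup>2 \<partial>D)"
    unfolding X_def using E[of "\<lambda>q. (g q \<bullet> \<tau>)\<^sup>2" 0] by simp
  have tus: "t \<bullet> us n \<omega> = (\<Sum>i<n. X i \<omega>) / sqrt n" for n \<omega>
  proof -
    have "t \<bullet> (\<Lambda>i *v gn n \<omega>) = gn n \<omega> \<bullet> \<tau>"
      unfolding \<tau>_def by (rule inner_matrix_symmetric[OF \<Lambda>_inverse(2)])
    then have "t \<bullet> us n \<omega> = - (sqrt n / real n) * (\<Sum>i<n. g (Y i \<omega>) \<bullet> \<tau>)"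
      by (simp add: us_def gn_def inner_sum_left divide_inverse)
    also have "sqrt n / real n = 1 / sqrt n" by (simp add: real_div_sqrt real_divide_square_eq divide_simps)
    finally show ?thesis by (simp add: X_def sum_negf)
  qed
  have diff: "(\<lambda>n. expectation (\<lambda>\<omega>. cis (t \<bullet> (sqrt n *\<^sub>R x n \<omega>))) - expectation (\<lambda>\<omega>. cis (t \<bullet> us n \<omega>))) \<longlonglongrightarrow> 0"
  proof (rule LIMSEQ_I)
    fix s :: real assume s: "s > 0"
    define e where "e = s / (2 * (norm t + 1))"
    have nt: "norm t + 1 > 0" by (simp add: add_nonneg_pos)
    have e: "e > 0" using s nt by (simp add: e_def)
    have te: "norm t * e \<le> s / 2"
    proof -
      have "norm t * e \<le> (norm t + 1) * e" using e by (intro mult_right_mono) auto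
      also have "\<dots> = s / 2" using nt by (simp add: e_def field_simps)
      finally show ?thesis .
    qed
    have "\<forall>\<^sub>F n in sequentially. prob {\<omega> \<in> space M. e \<le> norm (sqrt n *\<^sub>R x n \<omega> - us n \<omega>)} < s / 4"
      using order_tendstoD(2)[OF linearization[OF e], of "s / 4"] s by simp
    then have "\<forall>\<^sub>F n in sequentially. norm (expectation (\<lambda>\<omega>. cis (t \<bullet> (sqrt n *\<^sub>R x n \<omega>))) - expectation (\<lambda>\<omega>. cis (t \<bullet> us n \<omega>)) - 0) < s"
      using eventually_ge_at_top[of 1]
    proof eventually_elim
      case (elim n)
      have [measurable]: "x n \<in> borel_measurable M" by (rule x_meas[OF elim(2)])
      have cm: "(\<lambda>\<omega>. cis (t \<bullet> z \<omega>)) \<in> borel_measurable M" if "z \<in> borel_measurable M" for z :: "'w \<Rightarrow> real ^ 'd"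
        using that by (intro borel_measurable_continuous_on[where f = "\<lambda>v. cis (t \<bullet> v)"] continuous_intros)
      have ci: "integrable M (\<lambda>\<omega>. cis (t \<bullet> z \<omega>))" if "z \<in> borel_measurable M" for z :: "'w \<Rightarrow> real ^ 'd"
        using cm[OF that] by (intro integrable_const_bound[of _ 1]) auto
      let ?T = "{\<omega> \<in> space M. e \<le> norm (sqrt n *\<^sub>R x n \<omega> - us n \<omega>)}"
      have i1: "integrable M (\<lambda>\<omega>. cis (t \<bullet> (sqrt n *\<^sub>R x n \<omega>)))" by (intro ci) measurable
      have i2: "integrable M (\<lambda>\<omega>. cis (t \<bullet> us n \<omega>))" by (intro ci) measurable
      have T: "?T \<in> events" by measurable
      then have iT: "integrable M (indicat_real ?T)" by (intro integrable_real_indicator) (auto simp: less_top[symmetric])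
      have "norm (expectation (\<lambda>\<omega>. cis (t \<bullet> (sqrt n *\<^sub>R x n \<omega>))) - expectation (\<lambda>\<omega>. cis (t \<bullet> us n \<omega>)))
          = norm (expectation (\<lambda>\<omega>. cis (t \<bullet> (sqrt n *\<^sub>R x n \<omega>)) - cis (t \<bullet> us n \<omega>)))"
        using i1 i2 by simp
      also have "\<dots> \<le> expectation (\<lambda>\<omega>. norm (cis (t \<bullet> (sqrt n *\<^sub>R x n \<omega>)) - cis (t \<bullet> us n \<omega>)))"
        by (rule integral_norm_bound)
      also have "\<dots> \<le> expectation (\<lambda>\<omega>. norm t * e + 2 * indicat_real ?T \<omega>)"
      proof (rule integral_mono)
        fix \<omega> assume w: "\<omega> \<in> space M"
        let ?a = "cis (t \<bullet> (sqrt n *\<^sub>R x n \<omega>))" and ?b = "cis (t \<bullet> us n \<omega>)"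
        show "norm (?a - ?b) \<le> norm t * e + 2 * indicat_real ?T \<omega>"
        proof (cases "\<omega> \<in> ?T")
          case True
          have "norm (?a - ?b) \<le> 2" using norm_triangle_ineq4[of ?a ?b] by simp
          moreover have "0 \<le> norm t * e" using e by simp
          ultimately show ?thesis using True by simp
        next
          case False
          have "norm (?a - ?b) \<le> \<bar>t \<bullet> (sqrt n *\<^sub>R x n \<omega>) - t \<bullet> us n \<omega>\<bar>" by (rule norm_cis_diff_le)
          also have "\<dots> = \<bar>t \<bullet> (sqrt n *\<^sub>R x n \<omega> - us n \<omega>)\<bar>" by (simp add: inner_diff_right)
          also have "\<dots> \<le> norm t * norm (sqrt n *\<^sub>R x n \<omega> - us n \<omega>)" by (rule Cauchy_Schwarz_ineq2)
          also have "\<dots> \<le> norm t * e" using False w by (intro mult_left_mono) auto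
          finally show ?thesis using False by simp
        qed
      qed (use i1 i2 iT in auto)
      also have "\<dots> = norm t * e + 2 * prob ?T" using iT T by (simp add: prob_space)
      also have "\<dots> < s" using te elim(1) by simp
      finally show ?case by simp
    qed
    then show "\<exists>no. \<forall>n\<ge>no. norm (expectation (\<lambda>\<omega>. cis (t \<bullet> (sqrt n *\<^sub>R x n \<omega>))) - expectation (\<lambda>\<omega>. cis (t \<bullet> us n \<omega>)) - 0) < s"
      by (simp add: eventually_sequentially)
  qed
  have "(\<lambda>n. expectation (\<lambda>\<omega>. cis (t \<bullet> us n \<omega>))) \<longlonglongrightarrow> of_real (exp (- (\<integral>q. (g q \<bullet> \<tau>)\<^sup>2 \<partial>D) / 2))"
    using clt unfolding tus var .
  from tendsto_add[OF diff this] show ?thesis by (simp add: \<tau>_def)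
qed

text \<open>The limit law enters through its characteristic function alone, so degenerate
  covariances are included. Tightness comes from the rate estimate together with
  consistency.\<close>

theorem asymptotic_normality:
  assumes G: "prob_space G" "sets G = sets borel"
    and char: "\<And>t. (\<integral>z. cis (t \<bullet> z) \<partial>G) = of_real (exp (- (\<integral>q. (g q \<bullet> (\<Lambda>i *v t))\<^sup>2 \<partial>D) / 2))"
  shows "converges_in_distribution M (\<lambda>n \<omega>. sqrt n *\<^sub>R x n \<omega>) G"
  unfolding converges_in_distribution_def
proof (rule weakly_converges_if_char_tendsto[OF _ _ G])
  have m: "(\<lambda>\<omega>. sqrt n *\<^sub>R x n \<omega>) \<in> borel_measurable M" for n
    using x_meas[of n] by (cases "n = 0") auto
  show "prob_space (distr M borel (\<lambda>\<omega>. sqrt n *\<^sub>R x n \<omega>))" for n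
    by (rule prob_space_distr[OF m])
  show "(\<lambda>n. \<integral>z. cis (t \<bullet> z) \<partial>distr M borel (\<lambda>\<omega>. sqrt n *\<^sub>R x n \<omega>)) \<longlonglongrightarrow> (\<integral>z. cis (t \<bullet> z) \<partial>G)" for t
  proof -
    have "(\<integral>z. cis (t \<bullet> z) \<partial>distr M borel (\<lambda>\<omega>. sqrt n *\<^sub>R x n \<omega>)) = expectation (\<lambda>\<omega>. cis (t \<bullet> (sqrt n *\<^sub>R x n \<omega>)))" for n
      by (rule integral_distr[OF m]) (intro borel_measurable_continuous_onI continuous_intros)
    then show ?thesis using char_limit[of t] by (simp add: char)
  qed
  show "\<exists>K. \<forall>\<^sub>F n in sequentially. measure (distr M borel (\<lambda>\<omega>. sqrt n *\<^sub>R x n \<omega>)) {z. K < norm z} < e" if e: "e > 0" for e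
  proof -
    obtain K where "K > 0" and K: "\<forall>\<^sub>F n in sequentially. prob {\<omega> \<in> space M. K \<le> norm (sqrt n *\<^sub>R x n \<omega>)} < e"
      by (rule tight[OF e])
    have "measure (distr M borel (\<lambda>\<omega>. sqrt n *\<^sub>R x n \<omega>)) {z. K < norm z}
        \<le> prob {\<omega> \<in> space M. K \<le> norm (sqrt n *\<^sub>R x n \<omega>)}" for n
    proof -
      have "measure (distr M borel (\<lambda>\<omega>. sqrt n *\<^sub>R x n \<omega>)) {z. K < norm z}
          = prob ((\<lambda>\<omega>. sqrt n *\<^sub>R x n \<omega>) -` {z. K < norm z} \<inter> space M)"
        by (rule measure_distr[OF m tail_borel])
      also have "\<dots> \<le> prob ((\<lambda>\<omega>. sqrt n *\<^sub>R x n \<omega>) -` {z. K \<le> norm z} \<inter> space M)"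
      proof (rule finite_measure_mono)
        show "(\<lambda>\<omega>. sqrt n *\<^sub>R x n \<omega>) -` {z. K \<le> norm z} \<inter> space M \<in> events"
          by (rule measurable_sets[OF m]) (intro borel_closed closed_Collect_le continuous_intros)
      qed auto
      also have "(\<lambda>\<omega>. sqrt n *\<^sub>R x n \<omega>) -` {z. K \<le> norm z} \<inter> space M
          = {\<omega> \<in> space M. K \<le> norm (sqrt n *\<^sub>R x n \<omega>)}" by blast
      finally show ?thesis .
    qed
    then show ?thesis using K by (intro exI[of _ K]) (auto elim!: eventually_mono intro: le_less_trans)
  qed
qed simp

end

section \<open>The squared distance along a spherical curve\<close>

text \<open>\<open>sqpow c u = (\<Sum>k. (-1)\<^sup>k / (2k + c)! * u\<^sup>k)\<close>: for \<open>c = 0, 1\<close> these entire functions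
  satisfy \<open>sqpow 0 (t\<^sup>2) = cos t\<close> and \<open>t * sqpow 1 (t\<^sup>2) = sin t\<close>.\<close>

definition sqcoeff :: "nat \<Rightarrow> nat \<Rightarrow> real" where
  "sqcoeff c k = (- 1) ^ k / fact (2 * k + c)"

definition sqpow :: "nat \<Rightarrow> real \<Rightarrow> real" where
  "sqpow c u = (\<Sum>k. sqcoeff c k * u ^ k)"

lemma sqcoeff_summable_square: "c \<le> 1 \<Longrightarrow> summable (\<lambda>k. sqcoeff c k * (t\<^sup>2) ^ k)"
proof (cases "t = 0")
  case True
  then show ?thesis by (auto intro!: summable_finite[of "{0}"] simp: power_0_left split: if_splits)
next
  case False
  assume "c \<le> 1"
  then consider "c = 0" | "c = 1" by linarith
  then show ?thesis
  proof cases
    case 1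
    then show ?thesis
      using sums_summable[OF cos_paired[of t]] by (simp add: sqcoeff_def power_mult)
  next
    case 2
    have "summable (\<lambda>n. inverse t * ((- 1) ^ n / (fact (2 * n + 1)) * t ^ (2 * n + 1)))"
      by (intro summable_mult sums_summable[OF sin_paired[of t]])
    moreover have "inverse t * ((- 1) ^ n / (fact (2 * n + 1)) * t ^ (2 * n + 1)) = sqcoeff 1 n * (t\<^sup>2) ^ n" for n
      using False by (simp add: sqcoeff_def power_mult)
    ultimately show ?thesis using 2 by simp
  qed
qed

text \<open>Every u is smaller in modulus than the square (1 + |u|)^2, and at squares the series is
  known from the cosine and sine series.\<close>

lemma sqcoeff_summable: "c \<le> 1 \<Longrightarrow> summable (\<lambda>k. sqcoeff c k * u ^ k)"
proof -
  assume c: "c \<le> 1"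
  have "\<bar>u\<bar> < (1 + \<bar>u\<bar>)\<^sup>2" by (simp add: power2_eq_square algebra_simps add_pos_nonneg)
  then have "norm u < norm ((1 + \<bar>u\<bar>)\<^sup>2)" by simp
  then show ?thesis by (rule powser_inside[OF sqcoeff_summable_square[OF c]])
qed

lemma sqpow_0: "sqpow 0 (t\<^sup>2) = cos t"
  using sums_unique[OF cos_paired[of t]] by (simp add: sqpow_def sqcoeff_def power_mult)

lemma sqpow_1: "t * sqpow 1 (t\<^sup>2) = sin t"
proof -
  have "t * sqpow 1 (t\<^sup>2) = (\<Sum>k. t * (sqcoeff 1 k * (t\<^sup>2) ^ k))"
    unfolding sqpow_def by (rule suminf_mult[symmetric]) (simp add: sqcoeff_summable)
  also have "\<dots> = (\<Sum>n. (- 1) ^ n / (fact (2 * n + 1)) * t ^ (2 * n + 1))"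
    by (intro suminf_cong) (simp add: sqcoeff_def power_mult)
  also have "\<dots> = sin t" using sums_unique[OF sin_paired[of t]] by simp
  finally show ?thesis .
qed

definition sqpow1 :: "nat \<Rightarrow> real \<Rightarrow> real" where
  "sqpow1 c u = (\<Sum>k. diffs (sqcoeff c) k * u ^ k)"

definition sqpow2 :: "nat \<Rightarrow> real \<Rightarrow> real" where
  "sqpow2 c u = (\<Sum>k. diffs (diffs (sqcoeff c)) k * u ^ k)"

lemma sqpow_deriv:
  assumes "c \<le> 1"
  shows "(sqpow c has_real_derivative sqpow1 c u) (at u)"
    "(sqpow1 c has_real_derivative sqpow2 c u) (at u)"
    "continuous_on S (sqpow2 c)"
proof -
  have s: "summable (\<lambda>k. sqcoeff c k * y ^ k)" for y by (rule sqcoeff_summable[OF assms])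
  have s1: "summable (\<lambda>k. diffs (sqcoeff c) k * y ^ k)" for y by (rule termdiff_converges_all[OF s])
  have s2: "summable (\<lambda>k. diffs (diffs (sqcoeff c)) k * y ^ k)" for y by (rule termdiff_converges_all[OF s1])
  show "(sqpow c has_real_derivative sqpow1 c u) (at u)"
    unfolding sqpow_def[abs_def] sqpow1_def by (rule termdiffs_strong_converges_everywhere[OF s])
  show "(sqpow1 c has_real_derivative sqpow2 c u) (at u)"
    unfolding sqpow1_def[abs_def] sqpow2_def by (rule termdiffs_strong_converges_everywhere[OF s1])
  show "continuous_on S (sqpow2 c)"
    unfolding sqpow2_def[abs_def]
    by (rule DERIV_continuous_on, rule has_field_derivative_at_within,
        rule termdiffs_strong_converges_everywhere[OF s2])
qed

lemma sqpow_at_0: "sqpow c 0 = 1 / fact c" "sqpow1 0 0 = - 1 / 2"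
  unfolding sqpow_def sqpow1_def powser_zero by (simp_all add: sqcoeff_def diffs_def)

lemma sqpow_deriv_chain [derivative_intros]:
  assumes "(f has_real_derivative D) (at x within S)" "c \<le> 1"
  shows "((\<lambda>x. sqpow c (f x)) has_real_derivative (sqpow1 c (f x) * D)) (at x within S)"
    "((\<lambda>x. sqpow1 c (f x)) has_real_derivative (sqpow2 c (f x) * D)) (at x within S)"
  using DERIV_chain2[OF sqpow_deriv(1) assms(1)] DERIV_chain2[OF sqpow_deriv(2) assms(1)] assms(2)
  by blast+

lemma sqpow_bounded:
  obtains b where "b \<ge> 1"
    "\<And>c u. c \<le> 1 \<Longrightarrow> 0 \<le> u \<Longrightarrow> u \<le> 1 \<Longrightarrow> \<bar>sqpow c u\<bar> \<le> b \<and> \<bar>sqpow1 c u\<bar> \<le> b \<and> \<bar>sqpow2 c u\<bar> \<le> b"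
proof -
  have bd: "\<exists>b. \<forall>u\<in>{0..1}. \<bar>f u\<bar> \<le> b" if "continuous_on {0..1} f" for f :: "real \<Rightarrow> real"
    using compact_imp_bounded[OF compact_continuous_image[OF that compact_Icc]] by (auto simp: bounded_iff)
  have c: "continuous_on {0..1} (sqpow c)" "continuous_on {0..1} (sqpow1 c)" "continuous_on {0..1} (sqpow2 c)"
    if "c \<le> 1" for c
    using DERIV_continuous_on[OF has_field_derivative_at_within[OF sqpow_deriv(1)[OF that]]]
      DERIV_continuous_on[OF has_field_derivative_at_within[OF sqpow_deriv(2)[OF that]]]
      sqpow_deriv(3)[OF that] by blast+
  have "\<exists>b. \<forall>u\<in>{0..1}. \<bar>sqpow c u\<bar> \<le> b \<and> \<bar>sqpow1 c u\<bar> \<le> b \<and> \<bar>sqpow2 c u\<bar> \<le> b" if cc: "c \<le> 1" for c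
  proof -
    obtain b0 b1 b2 where "\<forall>u\<in>{0..1}. \<bar>sqpow c u\<bar> \<le> b0" "\<forall>u\<in>{0..1}. \<bar>sqpow1 c u\<bar> \<le> b1"
      "\<forall>u\<in>{0..1}. \<bar>sqpow2 c u\<bar> \<le> b2" using bd c[OF cc] by metis
    then show ?thesis by (intro exI[of _ "max b0 (max b1 b2)"]) (auto simp: le_max_iff_disj)
  qed
  from this[of 0] this[of 1] obtain b0 b1 where
    b0: "\<forall>u\<in>{0..1}. \<bar>sqpow 0 u\<bar> \<le> b0 \<and> \<bar>sqpow1 0 u\<bar> \<le> b0 \<and> \<bar>sqpow2 0 u\<bar> \<le> b0" and
    b1: "\<forall>u\<in>{0..1}. \<bar>sqpow 1 u\<bar> \<le> b1 \<and> \<bar>sqpow1 1 u\<bar> \<le> b1 \<and> \<bar>sqpow2 1 u\<bar> \<le> b1" by auto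
  show thesis
  proof (rule that[of "max 1 (max b0 b1)"])
    fix c :: nat and u :: real assume "c \<le> 1" and u: "0 \<le> u" "u \<le> 1"
    then consider "c = 0" | "c = 1" by linarith
    then show "\<bar>sqpow c u\<bar> \<le> max 1 (max b0 b1) \<and> \<bar>sqpow1 c u\<bar> \<le> max 1 (max b0 b1) \<and> \<bar>sqpow2 c u\<bar> \<le> max 1 (max b0 b1)"
      using b0 b1 u by cases (auto simp: le_max_iff_disj)
  qed simp
qed

text \<open>This is t cot t \<le> 1, the Hessian comparison on the sphere; the uniform semiconcavity
  of the squared distance rests on it.\<close>

lemma mult_cos_le_sin:
  fixes t :: real
  assumes "0 \<le> t" "t \<le> pi"
  shows "t * cos t \<le> sin t"
proof -
  have "sin 0 - 0 * cos 0 \<le> sin t - t * cos t"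
  proof (rule DERIV_nonneg_imp_nondecreasing[OF assms(1)])
    fix x assume "0 \<le> x" "x \<le> t"
    then have "x * sin x \<ge> 0" using assms by (intro mult_nonneg_nonneg sin_ge_zero) auto
    moreover have "((\<lambda>t. sin t - t * cos t) has_real_derivative x * sin x) (at x)"
      by (auto intro!: derivative_eq_intros)
    ultimately show "\<exists>y. ((\<lambda>t. sin t - t * cos t) has_real_derivative y) (at x) \<and> 0 \<le> y" by blast
  qed
  then show ?thesis by simp
qed

text \<open>One-sided on purpose: the second derivative of the squared distance is bounded uniformly
  from above, but from below only in terms of the distance to the cut locus.\<close>

lemma taylor2_lower_bound:
  fixes f f' f'' :: "real \<Rightarrow> real"
  assumes d1: "\<And>t. t \<in> {0..1} \<Longrightarrow> (f has_real_derivative f' t) (at t)"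
    and d2: "\<And>t. t \<in> {0..1} \<Longrightarrow> (f' has_real_derivative f'' t) (at t)"
    and lb: "\<And>t. t \<in> {0..1} \<Longrightarrow> - 2 * K \<le> f'' t"
  shows "- K \<le> f 1 - f 0 - f' 0"
proof -
  have nonneg: "f' t + 2 * K * t - f' 0 \<ge> 0" if t: "t \<in> {0..1}" for t
  proof -
    have "f' 0 + 2 * K * 0 - f' 0 \<le> f' t + 2 * K * t - f' 0"
    proof (rule DERIV_nonneg_imp_nondecreasing[where f = "\<lambda>t. f' t + 2 * K * t - f' 0"])
      fix u assume "0 \<le> u" "u \<le> t"
      then have u: "u \<in> {0..1}" using t by auto
      have "((\<lambda>t. f' t + 2 * K * t - f' 0) has_real_derivative f'' u + 2 * K) (at u)"
        using d2[OF u] by (auto intro!: derivative_eq_intros)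
      moreover have "0 \<le> f'' u + 2 * K" using lb[OF u] by simp
      ultimately show "\<exists>z. ((\<lambda>t. f' t + 2 * K * t - f' 0) has_real_derivative z) (at u) \<and> 0 \<le> z" by blast
    qed (use t in auto)
    then show ?thesis by simp
  qed
  have "f 0 + K * 0\<^sup>2 - f' 0 * 0 \<le> f 1 + K * 1\<^sup>2 - f' 0 * 1"
  proof (rule DERIV_nonneg_imp_nondecreasing[where f = "\<lambda>t. f t + K * t\<^sup>2 - f' 0 * t"])
    fix t :: real assume "0 \<le> t" "t \<le> 1"
    then have t: "t \<in> {0..1}" by auto
    have "((\<lambda>t. f t + K * t\<^sup>2 - f' 0 * t) has_real_derivative f' t + 2 * K * t - f' 0) (at t)"
      using d1[OF t] by (auto intro!: derivative_eq_intros)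
    then show "\<exists>z. ((\<lambda>t. f t + K * t\<^sup>2 - f' 0 * t) has_real_derivative z) (at t) \<and> 0 \<le> z"
      using nonneg[OF t] by blast
  qed simp
  then show ?thesis by simp
qed

text \<open>The mean value inequality applied to the remainder: its derivative f'(a + z) - f'(a) - l
  z is o(z) because f' is differentiable at the single point a.\<close>

lemma taylor2_peano:
  fixes f f' :: "real \<Rightarrow> real"
  assumes d1: "\<forall>\<^sub>F s in nhds a. (f has_real_derivative f' s) (at s)"
    and d2: "(f' has_real_derivative l) (at a)"
  shows "((\<lambda>u. (f (a + u) - f a - f' a * u - l * u\<^sup>2 / 2) / u\<^sup>2) \<longlongrightarrow> 0) (at 0)"
proof (rule tendstoI)
  fix e :: real assume e: "e > 0"
  obtain r where r: "r > 0" "\<And>s. \<bar>s - a\<bar> < r \<Longrightarrow> (f has_real_derivative f' s) (at s)"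
    using d1 by (auto simp: eventually_nhds_metric dist_real_def)
  from d2[THEN DERIV_D, THEN tendstoD, of "e / 2"] e obtain r' where r': "r' > 0"
    "\<And>u. u \<noteq> 0 \<Longrightarrow> \<bar>u\<bar> < r' \<Longrightarrow> \<bar>(f' (a + u) - f' a) / u - l\<bar> < e / 2"
    by (auto simp: eventually_at dist_real_def)
  define \<phi> where "\<phi> u = f (a + u) - f a - f' a * u - l * u\<^sup>2 / 2" for u
  have small: "\<bar>f' (a + u) - f' a - l * u\<bar> \<le> (e / 2) * \<bar>u\<bar>" if "\<bar>u\<bar> < r'" for u
  proof (cases "u = 0")
    case False
    have "\<bar>f' (a + u) - f' a - l * u\<bar> = \<bar>(f' (a + u) - f' a) / u - l\<bar> * \<bar>u\<bar>"
    proof -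
      have "((f' (a + u) - f' a) / u - l) * u = f' (a + u) - f' a - l * u"
        using False by (simp add: field_simps)
      then show ?thesis by (metis abs_mult)
    qed
    also have "\<dots> \<le> (e / 2) * \<bar>u\<bar>" using r'(2)[OF False that] by (intro mult_right_mono) auto
    finally show ?thesis .
  qed simp
  have "\<bar>\<phi> u\<bar> \<le> (e / 2) * u\<^sup>2" if u: "\<bar>u\<bar> < min r r'" for u
  proof -
    have "norm (\<phi> u - \<phi> 0) \<le> ((e / 2) * \<bar>u\<bar>) * norm (u - 0)"
    proof (rule field_differentiable_bound[where S = "{- \<bar>u\<bar>..\<bar>u\<bar>}" and f' = "\<lambda>z. f' (a + z) - f' a - l * z"])
      fix z assume z: "z \<in> {- \<bar>u\<bar>..\<bar>u\<bar>}"
      then have z': "\<bar>z\<bar> \<le> \<bar>u\<bar>" by (simp add: abs_le_iff)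
      have fz: "(f has_real_derivative f' (a + z)) (at (a + z))" using z' u by (intro r(2)) simp
      have "((\<lambda>u. a + u) has_real_derivative 1) (at z)" by (auto intro!: derivative_eq_intros)
      from DERIV_chain2[where f = f and g = "\<lambda>u. a + u", OF fz this]
      have "((\<lambda>u. f (a + u)) has_real_derivative f' (a + z)) (at z)"
        by simp
      then have "(\<phi> has_real_derivative f' (a + z) - f' a - l * z) (at z)"
        unfolding \<phi>_def[abs_def] by (auto intro!: derivative_eq_intros)
      then show "(\<phi> has_field_derivative f' (a + z) - f' a - l * z) (at z within {- \<bar>u\<bar>..\<bar>u\<bar>})"
        by (rule has_field_derivative_at_within)
      have "\<bar>f' (a + z) - f' a - l * z\<bar> \<le> (e / 2) * \<bar>z\<bar>" using z' u by (intro small) simp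
      also have "\<dots> \<le> (e / 2) * \<bar>u\<bar>" using z' e by (intro mult_left_mono) auto
      finally show "norm (f' (a + z) - f' a - l * z) \<le> (e / 2) * \<bar>u\<bar>" by simp
    qed (auto simp: abs_le_iff)
    then show ?thesis by (simp add: \<phi>_def power2_eq_square mult.assoc)
  qed
  then have b: "\<bar>\<phi> u / u\<^sup>2\<bar> < e" if "u \<noteq> 0" "\<bar>u\<bar> < min r r'" for u
  proof -
    have u2: "u\<^sup>2 > 0" using that by simp
    have "\<bar>\<phi> u\<bar> \<le> (e / 2) * u\<^sup>2" using \<open>\<And>u. \<bar>u\<bar> < min r r' \<Longrightarrow> \<bar>\<phi> u\<bar> \<le> (e / 2) * u\<^sup>2\<close> that by blast
    also have "\<dots> < e * u\<^sup>2" using e u2 by simp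
    finally show ?thesis using u2 by (simp add: abs_div pos_divide_less_eq)
  qed
  show "\<forall>\<^sub>F u in at 0. dist ((f (a + u) - f a - f' a * u - l * u\<^sup>2 / 2) / u\<^sup>2) 0 < e"
    unfolding eventually_at using b r(1) r'(1)
    by (intro exI[of _ "min r r'"]) (auto simp: \<phi>_def dist_real_def)
qed

text \<open>With t = arccos s this is t / sin t, and s times it is t cot t. At s = 1 the quotient by
  0 gives the value 0 although the limit is 1, so the point q = mu has to be treated separately
  below.\<close>

definition arccos_ratio :: "real \<Rightarrow> real" where
  "arccos_ratio s = arccos s / sqrt (1 - s\<^sup>2)"

lemma arccos_ratio_bounds:
  assumes "\<bar>s\<bar> < 1"
  shows "0 \<le> arccos_ratio s" "s * arccos_ratio s \<le> 1"
    "arccos_ratio s * sqrt (1 - s\<^sup>2) = arccos s" "arccos_ratio s * sqrt (1 - s\<^sup>2) \<le> pi"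
proof -
  have s: "s\<^sup>2 < 1" "-1 < s" "s < 1" using assms by (auto simp: abs_square_less_1 abs_less_iff)
  then have pos: "sqrt (1 - s\<^sup>2) > 0" by simp
  have a: "0 \<le> arccos s" "arccos s \<le> pi" using s by (auto intro: arccos_lbound arccos_ubound)
  show "0 \<le> arccos_ratio s" using a pos by (simp add: arccos_ratio_def)
  show eq: "arccos_ratio s * sqrt (1 - s\<^sup>2) = arccos s" using pos by (simp add: arccos_ratio_def)
  then show "arccos_ratio s * sqrt (1 - s\<^sup>2) \<le> pi" using a by simp
  have "arccos s * cos (arccos s) \<le> sin (arccos s)" by (rule mult_cos_le_sin[OF a])
  then have "arccos s * s \<le> sqrt (1 - s\<^sup>2)" using s by (simp add: sin_arccos)
  then show "s * arccos_ratio s \<le> 1" using pos by (simp add: arccos_ratio_def mult.commute)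
qed

lemma arccos_ratio_deriv:
  assumes "\<bar>s\<bar> < 1"
  shows "(arccos_ratio has_real_derivative (s * arccos_ratio s - 1) / (1 - s\<^sup>2)) (at s)"
    "((\<lambda>s. (arccos s)\<^sup>2) has_real_derivative - 2 * arccos_ratio s) (at s)"
proof -
  have s: "s\<^sup>2 < 1" "-1 < s" "s < 1" using assms by (auto simp: abs_square_less_1 abs_less_iff)
  then have pos: "sqrt (1 - s\<^sup>2) > 0" "1 - s\<^sup>2 > 0" by simp_all
  define w where "w = sqrt (1 - s\<^sup>2)"
  have w: "w > 0" "w * w = 1 - s\<^sup>2" using pos by (simp_all add: w_def)
  have "((\<lambda>s. arccos s / sqrt (1 - s\<^sup>2)) has_real_derivative
     (inverse (- w) * w - arccos s * ((- (2 * s)) * (inverse w / 2))) / (w * w)) (at s)"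
    using s pos unfolding w_def by (auto intro!: derivative_eq_intros simp: power2_eq_square)
  moreover have "(inverse (- w) * w - arccos s * ((- (2 * s)) * (inverse w / 2))) / (w * w)
      = (s * (arccos s / w) - 1) / (1 - s\<^sup>2)"
    unfolding w(2)[symmetric] using w(1) by (simp add: field_simps)
  ultimately show "(arccos_ratio has_real_derivative (s * arccos_ratio s - 1) / (1 - s\<^sup>2)) (at s)"
    by (simp add: arccos_ratio_def[abs_def] w_def)
  show "((\<lambda>s. (arccos s)\<^sup>2) has_real_derivative - 2 * arccos_ratio s) (at s)"
    using s by (auto intro!: derivative_eq_intros simp: arccos_ratio_def inverse_eq_divide)
qed

text \<open>Here s is the cosine of the distance from the moving point p t to q, and d is the
  squared distance. The formulas for its derivatives hold where |s t| < 1, that is, while the curve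
  avoids both q and - q.\<close>

locale sphere_curve_point =
  fixes p p' p'' :: "real \<Rightarrow> 'a::euclidean_space" and q :: 'a
  assumes norm_p: "\<And>t. norm (p t) = 1"
    and deriv_p: "\<And>t. (p has_vector_derivative p' t) (at t)"
    and deriv_p': "\<And>t. (p' has_vector_derivative p'' t) (at t)"
    and norm_q: "norm q = 1"
begin

definition "s t = p t \<bullet> q"
definition "s' t = p' t \<bullet> q"
definition "s'' t = p'' t \<bullet> q"
definition "d t = (arccos (s t))\<^sup>2"
definition "d' t = - 2 * arccos_ratio (s t) * s' t"
definition "d'' t = 2 * (s' t)\<^sup>2 / (1 - (s t)\<^sup>2)
  - 2 * arccos_ratio (s t) * (s t * (s' t)\<^sup>2 / (1 - (s t)\<^sup>2) + s'' t)"

lemma deriv_s: "(s has_real_derivative s' t) (at t)" "(s' has_real_derivative s'' t) (at t)"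
  using deriv_p[of t] deriv_p'[of t] unfolding s_def[abs_def] s'_def[abs_def] s''_def
  by (auto intro!: derivative_eq_intros simp: has_vector_derivative_def has_field_derivative_def
      fun_eq_iff inner_commute algebra_simps)

lemma deriv_d:
  assumes "\<bar>s t\<bar> < 1"
  shows "(d has_real_derivative d' t) (at t)" "(d' has_real_derivative d'' t) (at t)"
proof -
  note D = arccos_ratio_deriv[OF assms]
  show "(d has_real_derivative d' t) (at t)"
    unfolding d_def[abs_def] d'_def using DERIV_chain2[where g = s, OF D(2) deriv_s(1)] by simp
  have "(s t)\<^sup>2 < 1" using assms by (simp add: abs_square_less_1)
  then have n: "1 - (s t)\<^sup>2 \<noteq> 0" by simp
  have "((\<lambda>t. - 2 * (arccos_ratio (s t) * s' t)) has_real_derivative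
     - 2 * ((s t * arccos_ratio (s t) - 1) / (1 - (s t)\<^sup>2) * s' t * s' t + s'' t * arccos_ratio (s t))) (at t)"
    by (intro DERIV_cmult DERIV_mult DERIV_chain2[where f = arccos_ratio and g = s, OF D(1)] deriv_s)
  moreover have "- 2 * ((s t * arccos_ratio (s t) - 1) / (1 - (s t)\<^sup>2) * s' t * s' t + s'' t * arccos_ratio (s t)) = d'' t"
    unfolding d''_def using n by (simp add: power2_eq_square diff_divide_distrib algebra_simps)
  ultimately show "(d' has_real_derivative d'' t) (at t)"
    unfolding d'_def[abs_def] by (simp add: mult.assoc)
qed

lemma orth: "p t \<bullet> p' t = 0" "p t \<bullet> p'' t = - (norm (p' t))\<^sup>2"
proof -
  have pp: "p t \<bullet> p t = 1" for t using norm_p[of t] by (simp add: dot_square_norm)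
  have "((\<lambda>t. p t \<bullet> p t) has_real_derivative 2 * (p t \<bullet> p' t)) (at t)" for t
    using deriv_p[of t] by (auto intro!: derivative_eq_intros simp: has_vector_derivative_def
        has_field_derivative_def fun_eq_iff inner_commute algebra_simps)
  then have o: "p t \<bullet> p' t = 0" for t
    using DERIV_unique[of "\<lambda>t. p t \<bullet> p t" "2 * (p t \<bullet> p' t)" t 0] by (simp add: pp)
  have "((\<lambda>t. p t \<bullet> p' t) has_real_derivative (p t \<bullet> p'' t + p' t \<bullet> p' t)) (at t)"
    using deriv_p[of t] deriv_p'[of t] by (auto intro!: derivative_eq_intros simp: has_vector_derivative_def
        has_field_derivative_def fun_eq_iff inner_commute algebra_simps)
  then have "p t \<bullet> p'' t + p' t \<bullet> p' t = 0"
    using DERIV_unique[of "\<lambda>t. p t \<bullet> p' t" _ t 0] by (simp add: o)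
  then show "p t \<bullet> p'' t = - (norm (p' t))\<^sup>2" by (simp add: power2_norm_eq_inner)
  show "p t \<bullet> p' t = 0" by (rule o)
qed

text \<open>The factor t / sin t is singular at the cut locus, but it always multiplies a quantity
  of size sin t, because p' and p'' are paired with the component of q tangent at p t. What remains
  is t cot t, bounded above by 1 and below by a multiple of -1 / |p + q|.\<close>

lemma d_bounds:
  assumes "\<bar>s t\<bar> < 1"
  shows "\<bar>d' t\<bar> \<le> 2 * pi * norm (p' t)"
    and "d'' t \<le> 4 * (norm (p' t))\<^sup>2 + 2 * pi * norm (p'' t)"
    and "- (4 * pi / norm (p t + q) * (norm (p' t))\<^sup>2 + 2 * pi * norm (p'' t)) \<le> d'' t"
proof -
  define w where "w = sqrt (1 - (s t)\<^sup>2)"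
  have s2: "(s t)\<^sup>2 < 1" using assms by (simp add: abs_square_less_1)
  then have w: "w > 0" "w * w = 1 - (s t)\<^sup>2" "w\<^sup>2 = 1 - (s t)\<^sup>2" by (simp_all add: w_def)
  \<comment> \<open>The tangential component of q at p t; its length is sin t = w.\<close>
  define y where "y = q - s t *\<^sub>R p t"
  have pp: "p t \<bullet> p t = 1" and qq: "q \<bullet> q = 1" using norm_p[of t] norm_q by (simp_all add: dot_square_norm)
  have "y \<bullet> y = 1 - (s t)\<^sup>2"
    by (simp add: y_def inner_diff_left inner_diff_right pp qq s_def inner_commute power2_eq_square)
  then have ny: "norm y = w" by (simp add: norm_eq_sqrt_inner w_def)
  have s'y: "s' t = p' t \<bullet> y" using orth(1)[of t] by (simp add: s'_def y_def inner_diff_right inner_commute)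
  have s''y: "s'' t = - s t * (norm (p' t))\<^sup>2 + p'' t \<bullet> y"
    using orth(2)[of t] by (simp add: s''_def y_def inner_diff_right inner_commute)
  have s'b: "\<bar>s' t\<bar> \<le> norm (p' t) * w" unfolding s'y ny[symmetric] by (rule Cauchy_Schwarz_ineq2)
  have zb: "\<bar>p'' t \<bullet> y\<bar> \<le> norm (p'' t) * w" unfolding ny[symmetric] by (rule Cauchy_Schwarz_ineq2)
  define A where "A = arccos_ratio (s t)"
  have A: "A \<ge> 0" "s t * A \<le> 1" "A * w = arccos (s t)" "A * w \<le> pi"
    using arccos_ratio_bounds[OF assms] by (simp_all add: A_def w_def)
  have "\<bar>d' t\<bar> = 2 * A * \<bar>s' t\<bar>" using A by (simp add: d'_def abs_mult A_def)
  also have "\<dots> \<le> 2 * A * (norm (p' t) * w)" using A s'b by (intro mult_left_mono) auto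
  also have "\<dots> = 2 * norm (p' t) * (A * w)" by simp
  also have "\<dots> \<le> 2 * norm (p' t) * pi" using A by (intro mult_left_mono) auto
  finally show "\<bar>d' t\<bar> \<le> 2 * pi * norm (p' t)" by (simp add: mult_ac)
  define R where "R = (s' t)\<^sup>2 / (1 - (s t)\<^sup>2)"
  have "(s' t)\<^sup>2 \<le> (norm (p' t) * w)\<^sup>2" using s'b w by (intro iffD1[OF abs_le_square_iff]) simp
  then have "(s' t)\<^sup>2 \<le> (norm (p' t))\<^sup>2 * (1 - (s t)\<^sup>2)" by (simp add: power_mult_distrib w)
  then have R: "0 \<le> R" "R \<le> (norm (p' t))\<^sup>2" using s2 by (simp_all add: R_def pos_divide_le_eq)
  define T where "T = (norm (p' t))\<^sup>2 - R"
  have T: "0 \<le> T" "T \<le> (norm (p' t))\<^sup>2" using R by (simp_all add: T_def)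
  \<comment> \<open>The Hessian in geometric form: R is the squared speed in the direction of q and
    has weight 2, T is the rest of the squared speed and has weight 2 t cot t; the last term is the
    pairing of p'' with the gradient direction.\<close>
  have eq: "d'' t = 2 * R + 2 * (s t * A) * T - 2 * A * (p'' t \<bullet> y)"
    unfolding d''_def A_def[symmetric] s''y T_def R_def by (simp add: algebra_simps)
  have Az: "\<bar>2 * A * (p'' t \<bullet> y)\<bar> \<le> 2 * pi * norm (p'' t)"
  proof -
    have "\<bar>2 * A * (p'' t \<bullet> y)\<bar> = 2 * A * \<bar>p'' t \<bullet> y\<bar>" using A by (simp add: abs_mult)
    also have "\<dots> \<le> 2 * A * (norm (p'' t) * w)" using A zb by (intro mult_left_mono) auto
    also have "\<dots> = 2 * norm (p'' t) * (A * w)" by simp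
    also have "\<dots> \<le> 2 * norm (p'' t) * pi" using A by (intro mult_left_mono) auto
    finally show ?thesis by (simp add: mult_ac)
  qed
  have "(s t * A) * T \<le> 1 * T" using A T by (intro mult_right_mono) auto
  then show "d'' t \<le> 4 * (norm (p' t))\<^sup>2 + 2 * pi * norm (p'' t)"
    using eq R T Az unfolding abs_le_iff by linarith
  have npq: "(norm (p t + q))\<^sup>2 = 2 * (1 + s t)"
    by (simp add: power2_norm_eq_inner inner_add_left inner_add_right pp qq s_def inner_commute)
  have pq: "norm (p t + q) > 0"
  proof -
    have "(norm (p t + q))\<^sup>2 > 0" unfolding npq using assms by (simp add: abs_less_iff)
    then show ?thesis by simp
  qed
  \<comment> \<open>Only s < 0 is critical. There (|p + q| / 2)^2 = (1 + s)/2 is at most (1 + s)(1 -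
    s) = w^2, so the ratio, at most pi / w, is at most 2 pi / |p + q|.\<close>
  have low: "- (2 * pi / norm (p t + q)) \<le> s t * A"
  proof (cases "s t \<ge> 0")
    case True
    then have "0 \<le> s t * A" using A by simp
    moreover have "0 \<le> 2 * pi / norm (p t + q)" by simp
    ultimately show ?thesis by linarith
  next
    case False
    have "(norm (p t + q) / 2)\<^sup>2 \<le> w\<^sup>2"
    proof -
      have "(1 + s t) * (1/2) \<le> (1 + s t) * (1 - s t)" using False assms by (intro mult_left_mono) (auto simp: abs_less_iff)
      then show ?thesis unfolding w power_divide npq by (simp add: power2_eq_square algebra_simps add_divide_distrib)
    qed
    then have "norm (p t + q) / 2 \<le> w" by (rule power2_le_imp_le) (use w in auto)
    then have "A * (norm (p t + q) / 2) \<le> A * w" using A by (intro mult_left_mono)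
    then have "A * norm (p t + q) \<le> 2 * pi" using A by linarith
    then have A': "A \<le> 2 * pi / norm (p t + q)" using pq by (simp add: field_simps)
    have "(- s t) * A \<le> 1 * A" using assms A by (intro mult_right_mono) (auto simp: abs_less_iff)
    then show ?thesis using A' by simp
  qed
  have "- (2 * pi / norm (p t + q)) * (norm (p' t))\<^sup>2 \<le> - (2 * pi / norm (p t + q)) * T"
    using T by (intro mult_left_mono_neg) auto
  also have "\<dots> \<le> (s t * A) * T" using low T by (intro mult_right_mono) auto
  finally have "- (4 * pi / norm (p t + q) * (norm (p' t))\<^sup>2) \<le> 2 * (s t * A) * T" by simp
  then show "- (4 * pi / norm (p t + q) * (norm (p' t))\<^sup>2 + 2 * pi * norm (p'' t)) \<le> d'' t"
    using eq R Az unfolding abs_le_iff by linarith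
qed

lemma d_lipschitz:
  assumes "\<And>t. t \<in> {0..1} \<Longrightarrow> \<bar>s t\<bar> < 1" "\<And>t. t \<in> {0..1} \<Longrightarrow> norm (p' t) \<le> B"
  shows "\<bar>d 1 - d 0\<bar> \<le> 2 * pi * B"
proof -
  obtain z where z: "0 < z" "z < 1" "d 1 - d 0 = (1 - 0) * d' z"
    using MVT2[of 0 1 d d'] deriv_d(1) assms(1) by (metis atLeastAtMost_iff zero_less_one)
  then have "\<bar>d 1 - d 0\<bar> \<le> 2 * pi * norm (p' z)" using d_bounds(1)[of z] assms(1)[of z] by simp
  also have "\<dots> \<le> 2 * pi * B" using assms(2)[of z] z by (intro mult_left_mono) auto
  finally show ?thesis .
qed

lemma d_semiconcave:
  assumes "\<And>t. t \<in> {0..1} \<Longrightarrow> \<bar>s t\<bar> < 1"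
    and "\<And>t. t \<in> {0..1} \<Longrightarrow> 4 * (norm (p' t))\<^sup>2 + 2 * pi * norm (p'' t) \<le> 2 * K"
  shows "convex_on {0..1} (\<lambda>t. K * t\<^sup>2 - d t)"
proof (rule f''_ge0_imp_convex)
  fix t :: real assume t: "t \<in> {0..1}"
  show "((\<lambda>t. K * t\<^sup>2 - d t) has_real_derivative 2 * K * t - d' t) (at t)"
    using deriv_d(1)[OF assms(1)[OF t]] by (auto intro!: derivative_eq_intros)
  show "((\<lambda>t. 2 * K * t - d' t) has_real_derivative 2 * K - d'' t) (at t)"
    using deriv_d(2)[OF assms(1)[OF t]] by (auto intro!: derivative_eq_intros)
  show "0 \<le> 2 * K - d'' t" using d_bounds(2)[OF assms(1)[OF t]] assms(2)[OF t] by linarith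
qed simp

lemma d_taylor_lower:
  assumes "\<And>t. t \<in> {0..1} \<Longrightarrow> \<bar>s t\<bar> < 1"
    and "\<And>t. t \<in> {0..1} \<Longrightarrow> 4 * pi / norm (p t + q) * (norm (p' t))\<^sup>2 + 2 * pi * norm (p'' t) \<le> 2 * K"
  shows "- K \<le> d 1 - d 0 - d' 0"
proof (rule taylor2_lower_bound)
  fix t :: real assume t: "t \<in> {0..1}"
  show "(d has_real_derivative d' t) (at t)" "(d' has_real_derivative d'' t) (at t)"
    using deriv_d[OF assms(1)[OF t]] by auto
  show "- 2 * K \<le> d'' t" using d_bounds(3)[OF assms(1)[OF t]] assms(2)[OF t] by linarith
qed

lemma d_taylor_upper:
  assumes "\<And>t. t \<in> {0..1} \<Longrightarrow> \<bar>s t\<bar> < 1"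
    and "\<And>t. t \<in> {0..1} \<Longrightarrow> 4 * (norm (p' t))\<^sup>2 + 2 * pi * norm (p'' t) \<le> 2 * K"
  shows "d 1 - d 0 - d' 0 \<le> K"
proof -
  have "- K \<le> - d 1 - (- d 0) - (- d' 0)"
  proof (rule taylor2_lower_bound[where f = "\<lambda>t. - d t" and f' = "\<lambda>t. - d' t" and f'' = "\<lambda>t. - d'' t"])
    fix t :: real assume t: "t \<in> {0..1}"
    show "((\<lambda>t. - d t) has_real_derivative - d' t) (at t)" "((\<lambda>t. - d' t) has_real_derivative - d'' t) (at t)"
      using deriv_d[OF assms(1)[OF t]] by (auto intro!: derivative_eq_intros)
    show "- 2 * K \<le> - d'' t" using d_bounds(2)[OF assms(1)[OF t]] assms(2)[OF t] by linarith
  qed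
  then show ?thesis by simp
qed

end

section \<open>Normal coordinates on the sphere\<close>

locale sphere_chart =
  fixes \<mu> :: "'a::euclidean_space" and e :: "'d::finite \<Rightarrow> 'a"
  assumes norm_\<mu>: "norm \<mu> = 1" and onb: "tangent_onb \<mu> e" and dim: "DIM('a) \<ge> 4"
begin

definition X :: "real ^ 'd \<Rightarrow> 'a" where "X x = (\<Sum>i\<in>UNIV. x $ i *\<^sub>R e i)"

text \<open>The exponential map in coordinates. Written with entire functions of |x|^2 it is visibly
  smooth at x = 0, where the norm is not.\<close>

definition E :: "real ^ 'd \<Rightarrow> 'a" where
  "E x = sqpow 0 ((norm x)\<^sup>2) *\<^sub>R \<mu> + sqpow 1 ((norm x)\<^sup>2) *\<^sub>R X x"

definition coords :: "'a \<Rightarrow> real ^ 'd" where "coords q = (\<chi> i. q \<bullet> e i)"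

lemma \<mu>\<mu>: "\<mu> \<bullet> \<mu> = 1" using norm_\<mu> by (simp add: dot_square_norm)

lemma e_simps: "e i \<bullet> \<mu> = 0" "\<mu> \<bullet> e i = 0" "e i \<bullet> e j = (if i = j then 1 else 0)"
  using onb by (auto simp: tangent_onb_def tangent_space_def inner_commute)

lemma X_add: "X (x + y) = X x + X y" by (simp add: X_def scaleR_add_left sum.distrib)
lemma X_scaleR: "X (c *\<^sub>R x) = c *\<^sub>R X x" by (simp add: X_def scaleR_sum_right)
lemma X_0 [simp]: "X 0 = 0" by (simp add: X_def)
lemma X_\<mu> [simp]: "X x \<bullet> \<mu> = 0" "\<mu> \<bullet> X x = 0"
  by (simp_all add: X_def inner_sum_left inner_sum_right e_simps)

lemma inner_X: "q \<bullet> X x = coords q \<bullet> x"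
  by (simp add: X_def inner_sum_right coords_def inner_vec_def mult.commute)

lemma coords_X: "coords (X x) = x"
  by (simp add: vec_eq_iff coords_def X_def inner_sum_left e_simps if_distrib cong: if_cong)

lemma X_X: "X x \<bullet> X y = x \<bullet> y" by (simp add: inner_X coords_X)

lemma norm_X [simp]: "norm (X x) = norm x" by (simp add: norm_eq_sqrt_inner X_X)

lemma X_in_tangent: "X x \<in> tangent_space \<mu>" by (simp add: tangent_space_def)

lemma X_coords:
  assumes "v \<in> tangent_space \<mu>"
  shows "X (coords v) = v"
proof -
  have sp: "span (range e) = tangent_space \<mu>" using onb by (simp add: tangent_onb_def)
  define w where "w = v - X (coords v)"
  have xs: "X (coords v) \<in> span (range e)" unfolding sp by (rule X_in_tangent)
  have w: "w \<in> span (range e)" unfolding w_def by (rule span_diff[OF _ xs]) (use assms sp in auto)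
  have "w \<bullet> e i = 0" for i
    using arg_cong[OF coords_X[of "coords v"], of "\<lambda>z. z $ i"] by (simp add: w_def inner_diff_left coords_def)
  then have "orthogonal w b" if "b \<in> range e" for b using that by (auto simp: orthogonal_def)
  then have "orthogonal w w" using orthogonal_to_span[OF w, of w] by blast
  then show ?thesis by (simp add: orthogonal_def w_def)
qed

lemma decompose: "q = (q \<bullet> \<mu>) *\<^sub>R \<mu> + X (coords q)"
proof -
  have t: "q - (q \<bullet> \<mu>) *\<^sub>R \<mu> \<in> tangent_space \<mu>" by (simp add: tangent_space_def inner_diff_left \<mu>\<mu>)
  have "coords (q - (q \<bullet> \<mu>) *\<^sub>R \<mu>) = coords q"
    by (simp add: vec_eq_iff coords_def inner_diff_left e_simps)
  then show ?thesis using X_coords[OF t] by simp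
qed

lemma norm_coords:
  assumes "norm q = 1"
  shows "(norm (coords q))\<^sup>2 = 1 - (q \<bullet> \<mu>)\<^sup>2"
proof -
  have "q \<bullet> q = ((q \<bullet> \<mu>) *\<^sub>R \<mu> + X (coords q)) \<bullet> ((q \<bullet> \<mu>) *\<^sub>R \<mu> + X (coords q))"
    using decompose[of q] by simp
  also have "\<dots> = (q \<bullet> \<mu>)\<^sup>2 + coords q \<bullet> coords q"
    by (simp add: inner_add_left inner_add_right \<mu>\<mu> X_X power2_eq_square)
  finally show ?thesis using assms by (simp add: dot_square_norm)
qed

lemma E_0 [simp]: "E 0 = \<mu>" by (simp add: E_def sqpow_at_0)

lemma E_inner: "E x \<bullet> q = sqpow 0 ((norm x)\<^sup>2) * (\<mu> \<bullet> q) + sqpow 1 ((norm x)\<^sup>2) * (coords q \<bullet> x)"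
  using inner_X[of q x] by (simp add: E_def inner_add_left inner_commute[of "X x"])

lemma E_inner_\<mu>: "E x \<bullet> \<mu> = cos (norm x)"
proof -
  have "coords \<mu> = 0" by (simp add: vec_eq_iff coords_def e_simps)
  then show ?thesis by (simp add: E_inner \<mu>\<mu> sqpow_0)
qed

lemma E_eq_exp: "E x = cos (norm x) *\<^sub>R \<mu> + sin (norm x) *\<^sub>R sgn (X x)" "E x = sphere_exp \<mu> (X x)"
proof -
  have "sqpow 1 ((norm x)\<^sup>2) *\<^sub>R X x = sin (norm x) *\<^sub>R sgn (X x)"
  proof (cases "x = 0")
    case False
    then have "sin (norm x) *\<^sub>R sgn (X x) = (sin (norm x) / norm x) *\<^sub>R X x"
      by (simp add: sgn_div_norm divide_inverse)
    also have "sin (norm x) / norm x = sqpow 1 ((norm x)\<^sup>2)"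
      using False sqpow_1[of "norm x"] by (simp add: field_simps)
    finally show ?thesis by simp
  qed simp
  then show 1: "E x = cos (norm x) *\<^sub>R \<mu> + sin (norm x) *\<^sub>R sgn (X x)" by (simp add: E_def sqpow_0)
  show "E x = sphere_exp \<mu> (X x)"
    using sphere_exp_eq[of \<mu> "X x"] norm_\<mu> X_in_tangent 1 by simp
qed

lemma norm_E [simp]: "norm (E x) = 1"
proof -
  have "E x \<bullet> E x = (sqpow 0 ((norm x)\<^sup>2))\<^sup>2 + (norm x * sqpow 1 ((norm x)\<^sup>2))\<^sup>2"
  proof -
    have "x \<bullet> x = norm x * norm x" by (simp add: dot_square_norm power2_eq_square)
    then show ?thesis
      by (simp add: E_def inner_add_left inner_add_right \<mu>\<mu> X_X power2_eq_square)
  qed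
  also have "\<dots> = 1" unfolding sqpow_0 sqpow_1 by simp
  finally show ?thesis by (simp add: norm_eq_sqrt_inner)
qed

lemma E_inj:
  assumes "norm x < pi" "norm y < pi" "E x = E y"
  shows "x = y"
proof -
  have "cos (norm x) = cos (norm y)" using assms(3) E_inner_\<mu> by metis
  then have n: "norm x = norm y" by (rule cos_inj_pi[rotated 4]) (use assms(1,2) in auto)
  show ?thesis
  proof (cases "norm x = 0")
    case False
    have "sin (norm x) > 0" using False assms(1) by (intro sin_gt_zero) auto
    then have s: "sqpow 1 ((norm x)\<^sup>2) \<noteq> 0"
      using sqpow_1[of "norm x"] by (metis less_irrefl mult_zero_right)
    have "sqpow 1 ((norm x)\<^sup>2) *\<^sub>R X x = sqpow 1 ((norm x)\<^sup>2) *\<^sub>R X y"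
      using assms(3) n by (simp add: E_def)
    then have "X x = X y" using s by simp
    then show ?thesis using coords_X by metis
  qed (use n in auto)
qed

text \<open>Closed form of the inverse exponential map. At - mu the coordinates vanish and
  \<open>sgn 0 = 0\<close>, so it takes the value 0 there, which is why that point is excluded from
  the inversion statements.\<close>

definition logc :: "'a \<Rightarrow> real ^ 'd" where
  "logc p = arccos (p \<bullet> \<mu>) *\<^sub>R sgn (coords p)"

lemma norm_logc:
  assumes "norm p = 1" "p \<noteq> - \<mu>"
  shows "norm (logc p) = arccos (p \<bullet> \<mu>)" "arccos (p \<bullet> \<mu>) < pi" "E (logc p) = p"
proof -
  have b: "\<bar>p \<bullet> \<mu>\<bar> \<le> 1" using Cauchy_Schwarz_ineq2[of p \<mu>] assms norm_\<mu> by simp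
  then have b': "-1 \<le> p \<bullet> \<mu>" "p \<bullet> \<mu> \<le> 1" by auto
  have pm: "(norm (p + \<mu>))\<^sup>2 = 2 * (1 + p \<bullet> \<mu>)"
    using assms(1) \<mu>\<mu> by (simp add: norm_eq_1 power2_norm_eq_inner inner_add_left inner_add_right inner_commute)
  have "p + \<mu> \<noteq> 0" using assms(2) by (metis add_eq_0_iff2)
  then have "(norm (p + \<mu>))\<^sup>2 > 0" by simp
  then have gt: "-1 < p \<bullet> \<mu>" unfolding pm by simp
  have ab: "0 \<le> arccos (p \<bullet> \<mu>)" using b' by (intro arccos_lbound) auto
  show lt: "arccos (p \<bullet> \<mu>) < pi"
    using gt b' arccos_less_arccos[of "-1" "p \<bullet> \<mu>"] by simp
  have nc: "norm (coords p) = sqrt (1 - (p \<bullet> \<mu>)\<^sup>2)"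
    using norm_coords[OF assms(1)] by (metis norm_ge_zero real_sqrt_unique)
  have c0: "coords p = 0 \<Longrightarrow> p \<bullet> \<mu> = 1"
    using norm_coords[OF assms(1)] gt by (auto simp: power2_eq_1_iff)
  show nl: "norm (logc p) = arccos (p \<bullet> \<mu>)"
    using ab c0 by (cases "coords p = 0") (auto simp: logc_def norm_sgn)
  have "E (logc p) = cos (arccos (p \<bullet> \<mu>)) *\<^sub>R \<mu> + sin (arccos (p \<bullet> \<mu>)) *\<^sub>R sgn (X (logc p))"
    using E_eq_exp(1)[of "logc p"] nl by simp
  also have "cos (arccos (p \<bullet> \<mu>)) = p \<bullet> \<mu>" using b by (rule cos_arccos_abs)
  also have "sin (arccos (p \<bullet> \<mu>)) *\<^sub>R sgn (X (logc p)) = X (coords p)"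
  proof (cases "coords p = 0")
    case True
    then show ?thesis using c0 by simp
  next
    case False
    then have "norm (coords p) > 0" by simp
    then have "1 - (p \<bullet> \<mu>)\<^sup>2 > 0" unfolding nc by simp
    then have "p \<bullet> \<mu> \<noteq> 1" by auto
    then have "arccos (p \<bullet> \<mu>) \<noteq> 0" using cos_arccos_abs[OF b] by (metis cos_zero)
    then have "arccos (p \<bullet> \<mu>) > 0" using ab by simp
    then have "sgn (X (logc p)) = sgn (X (coords p))"
      unfolding logc_def X_scaleR sgn_div_norm[of "coords p"] using False
      by (simp add: sgn_scaleR sgn_real_def)
    also have "sgn (X (coords p)) = X (coords p) /\<^sub>R norm (coords p)" by (simp add: sgn_div_norm)
    finally show ?thesis using b' False unfolding sin_arccos[OF b'] nc[symmetric] by simp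
  qed
  also have "(p \<bullet> \<mu>) *\<^sub>R \<mu> + X (coords p) = p" using decompose[of p] by simp
  finally show "E (logc p) = p" .
qed

lemma E_ne: "norm x < pi \<Longrightarrow> E x \<noteq> - \<mu>"
proof
  assume x: "norm x < pi" and "E x = - \<mu>"
  then have "cos (norm x) = - 1" using E_inner_\<mu>[of x] by (simp add: \<mu>\<mu>)
  then have "cos (norm x) = cos pi" by simp
  then have "norm x = pi" by (rule cos_inj_pi[rotated 4]) (use x in auto)
  then show False using x by simp
qed

lemma log_chart_E: "norm x < pi \<Longrightarrow> log_chart \<mu> e (E x) = x"
proof -
  assume x: "norm x < pi"
  let ?S = "{v \<in> tangent_space \<mu>. norm v < pi}"
  have "inj_on (sphere_exp \<mu>) ?S"
  proof (rule inj_onI)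
    fix v w assume v: "v \<in> ?S" and w: "w \<in> ?S" and eq: "sphere_exp \<mu> v = sphere_exp \<mu> w"
    have xv: "X (coords v) = v" "X (coords w) = w" using v w X_coords by auto
    then have n: "norm (coords v) < pi" "norm (coords w) < pi" using v w norm_X by (metis mem_Collect_eq)+
    have "E (coords v) = E (coords w)" using eq xv by (simp add: E_eq_exp(2))
    from E_inj[OF n this] show "v = w" using xv by metis
  qed
  then have "sphere_log \<mu> (E x) = X x"
    unfolding sphere_log_def E_eq_exp(2) using x X_in_tangent by (intro inv_into_f_f) auto
  then have "log_chart \<mu> e (E x) = coords (X x)" by (simp add: log_chart_def coords_def)
  then show ?thesis by (simp add: coords_X)
qed

lemma log_chart_eq: "norm p = 1 \<Longrightarrow> p \<noteq> - \<mu> \<Longrightarrow> log_chart \<mu> e p = logc p"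
  using log_chart_E[of "logc p"] norm_logc[of p] by simp

lemma log_chart_inv_eq:
  assumes "norm x < pi"
  shows "log_chart_inv \<mu> e x = E x"
  unfolding log_chart_inv_def
proof (rule inv_into_f_eq)
  show "inj_on (log_chart \<mu> e) (sphere 0 1 - {- \<mu>})"
  proof (rule inj_onI)
    fix p q assume "p \<in> sphere 0 1 - {- \<mu>}" "q \<in> sphere 0 1 - {- \<mu>}" "log_chart \<mu> e p = log_chart \<mu> e q"
    then show "p = q" using log_chart_eq norm_logc(3) by (metis DiffE insertI1 mem_sphere_0)
  qed
  show "E x \<in> sphere 0 1 - {- \<mu>}" using E_ne[OF assms] by simp
  show "log_chart \<mu> e (E x) = x" by (rule log_chart_E[OF assms])
qed

section \<open>Derivatives of the exponential map along lines\<close>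

definition \<tau>' :: "real ^ 'd \<Rightarrow> real ^ 'd \<Rightarrow> real \<Rightarrow> real" where "\<tau>' x v t = 2 * ((x + t *\<^sub>R v) \<bullet> v)"

definition E' :: "real ^ 'd \<Rightarrow> real ^ 'd \<Rightarrow> real \<Rightarrow> 'a" where
  "E' x v t = (let u = (norm (x + t *\<^sub>R v))\<^sup>2 in
     (sqpow1 0 u * \<tau>' x v t) *\<^sub>R \<mu> + (sqpow1 1 u * \<tau>' x v t) *\<^sub>R X (x + t *\<^sub>R v) + sqpow 1 u *\<^sub>R X v)"

definition E'' :: "real ^ 'd \<Rightarrow> real ^ 'd \<Rightarrow> real \<Rightarrow> 'a" where
  "E'' x v t = (let u = (norm (x + t *\<^sub>R v))\<^sup>2 in
     (sqpow2 0 u * (\<tau>' x v t)\<^sup>2 + sqpow1 0 u * (2 * (norm v)\<^sup>2)) *\<^sub>R \<mu>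
     + (sqpow2 1 u * (\<tau>' x v t)\<^sup>2 + sqpow1 1 u * (2 * (norm v)\<^sup>2)) *\<^sub>R X (x + t *\<^sub>R v)
     + (2 * (sqpow1 1 u * \<tau>' x v t)) *\<^sub>R X v)"

lemma deriv_norm2: "((\<lambda>t. (norm (x + t *\<^sub>R v))\<^sup>2) has_real_derivative \<tau>' x v t) (at t)"
proof -
  have "(norm (x + t *\<^sub>R v))\<^sup>2 = x \<bullet> x + 2 * t * (x \<bullet> v) + t\<^sup>2 * (v \<bullet> v)" for t
  proof -
    have "v \<bullet> x = x \<bullet> v" by (rule inner_commute)
    then show ?thesis
      unfolding power2_norm_eq_inner inner_add_left inner_add_right inner_scaleR_left inner_scaleR_right
      by (simp add: power2_eq_square distrib_left)
  qed
  then show ?thesis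
    by (auto intro!: derivative_eq_intros simp: \<tau>'_def inner_add_left algebra_simps)
qed

lemma deriv_\<tau>': "((\<lambda>t. \<tau>' x v t) has_real_derivative 2 * (norm v)\<^sup>2) (at t)"
  unfolding \<tau>'_def inner_add_left power2_norm_eq_inner
  by (auto intro!: derivative_eq_intros)

lemma deriv_X: "((\<lambda>t. X (x + t *\<^sub>R v)) has_vector_derivative X v) (at t)"
  unfolding X_add X_scaleR by (auto intro!: derivative_eq_intros simp: has_vector_derivative_def)

lemma deriv_E: "((\<lambda>t. E (x + t *\<^sub>R v)) has_vector_derivative E' x v t) (at t)"
proof -
  let ?u = "\<lambda>t. (norm (x + t *\<^sub>R v))\<^sup>2"
  have 0: "((\<lambda>t. sqpow 0 (?u t)) has_real_derivative sqpow1 0 (?u t) * \<tau>' x v t) (at t)"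
    and 1: "((\<lambda>t. sqpow 1 (?u t)) has_real_derivative sqpow1 1 (?u t) * \<tau>' x v t) (at t)"
    by (rule sqpow_deriv_chain(1)[OF deriv_norm2], simp)+
  have "((\<lambda>t. sqpow 0 (?u t) *\<^sub>R \<mu> + sqpow 1 (?u t) *\<^sub>R X (x + t *\<^sub>R v)) has_vector_derivative
      (sqpow 0 (?u t) *\<^sub>R 0 + (sqpow1 0 (?u t) * \<tau>' x v t) *\<^sub>R \<mu>) +
      (sqpow 1 (?u t) *\<^sub>R X v + (sqpow1 1 (?u t) * \<tau>' x v t) *\<^sub>R X (x + t *\<^sub>R v))) (at t)"
    by (intro has_vector_derivative_add has_vector_derivative_scaleR 0 1 deriv_X has_vector_derivative_const)
  then show ?thesis unfolding E_def E'_def Let_def by (simp add: algebra_simps)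
qed

lemma deriv_E': "((\<lambda>t. E' x v t) has_vector_derivative E'' x v t) (at t)"
proof -
  let ?u = "\<lambda>t. (norm (x + t *\<^sub>R v))\<^sup>2"
  have 1: "((\<lambda>t. sqpow 1 (?u t)) has_real_derivative sqpow1 1 (?u t) * \<tau>' x v t) (at t)"
    by (rule sqpow_deriv_chain(1)[OF deriv_norm2]) simp
  have 2: "((\<lambda>t. sqpow1 c (?u t) * \<tau>' x v t) has_real_derivative
      (sqpow2 c (?u t) * \<tau>' x v t) * \<tau>' x v t + (2 * (norm v)\<^sup>2) * sqpow1 c (?u t)) (at t)" if "c \<le> 1" for c
    by (intro DERIV_mult sqpow_deriv_chain(2)[OF deriv_norm2 that] deriv_\<tau>')
  have d: "((\<lambda>t. (sqpow1 0 (?u t) * \<tau>' x v t) *\<^sub>R \<mu> + (sqpow1 1 (?u t) * \<tau>' x v t) *\<^sub>R X (x + t *\<^sub>R v) + sqpow 1 (?u t) *\<^sub>R X v)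
      has_vector_derivative
      ((sqpow1 0 (?u t) * \<tau>' x v t) *\<^sub>R 0 + ((sqpow2 0 (?u t) * \<tau>' x v t) * \<tau>' x v t + (2 * (norm v)\<^sup>2) * sqpow1 0 (?u t)) *\<^sub>R \<mu>) +
      ((sqpow1 1 (?u t) * \<tau>' x v t) *\<^sub>R X v + ((sqpow2 1 (?u t) * \<tau>' x v t) * \<tau>' x v t + (2 * (norm v)\<^sup>2) * sqpow1 1 (?u t)) *\<^sub>R X (x + t *\<^sub>R v)) +
      (sqpow 1 (?u t) *\<^sub>R 0 + (sqpow1 1 (?u t) * \<tau>' x v t) *\<^sub>R X v)) (at t)"
    by (intro has_vector_derivative_add has_vector_derivative_scaleR 1 2 deriv_X has_vector_derivative_const) auto
  have alg: "(k1 *\<^sub>R 0 + A *\<^sub>R \<mu>) + (k2 *\<^sub>R V + B *\<^sub>R y) + (k3 *\<^sub>R 0 + k2 *\<^sub>R V)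
      = A' *\<^sub>R \<mu> + B' *\<^sub>R y + (2 * k2) *\<^sub>R V" if "A = A'" "B = B'" for k1 k2 k3 A A' B B' :: real and V y :: 'a
  proof -
    have "(2 * k2) *\<^sub>R V = k2 *\<^sub>R V + k2 *\<^sub>R V" by (simp only: mult_2 scaleR_add_left)
    then show ?thesis unfolding that by (simp only: scaleR_zero_right add_0_left ac_simps)
  qed
  have comm: "(a * z) * z + w * b = a * z\<^sup>2 + b * w" for a b z w :: real
    by (simp add: power2_eq_square)
  have "E'' x v t =
      ((sqpow1 0 (?u t) * \<tau>' x v t) *\<^sub>R 0 + ((sqpow2 0 (?u t) * \<tau>' x v t) * \<tau>' x v t + (2 * (norm v)\<^sup>2) * sqpow1 0 (?u t)) *\<^sub>R \<mu>) +
      ((sqpow1 1 (?u t) * \<tau>' x v t) *\<^sub>R X v + ((sqpow2 1 (?u t) * \<tau>' x v t) * \<tau>' x v t + (2 * (norm v)\<^sup>2) * sqpow1 1 (?u t)) *\<^sub>R X (x + t *\<^sub>R v)) +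
      (sqpow 1 (?u t) *\<^sub>R 0 + (sqpow1 1 (?u t) * \<tau>' x v t) *\<^sub>R X v)"
    unfolding E''_def Let_def by (rule alg[symmetric]; rule comm)
  moreover have "E' x v = (\<lambda>t. (sqpow1 0 (?u t) * \<tau>' x v t) *\<^sub>R \<mu> + (sqpow1 1 (?u t) * \<tau>' x v t) *\<^sub>R X (x + t *\<^sub>R v) + sqpow 1 (?u t) *\<^sub>R X v)"
    unfolding fun_eq_iff E'_def Let_def by blast
  ultimately show ?thesis using d by (simp only:)
qed

lemma curve_point:
  assumes "norm q = 1"
  shows "sphere_curve_point (\<lambda>t. E (x + t *\<^sub>R v)) (E' x v) (E'' x v) q"
  using assms by unfold_locales (auto intro: deriv_E deriv_E')

lemma E_deriv_bounds:
  obtains b where "b \<ge> 1"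
    "\<And>x v t. norm (x + t *\<^sub>R v) \<le> 1 \<Longrightarrow> norm (E' x v t) \<le> b * norm v"
    "\<And>x v t. norm (x + t *\<^sub>R v) \<le> 1 \<Longrightarrow> norm (E'' x v t) \<le> b * (norm v)\<^sup>2"
proof -
  obtain b where b: "b \<ge> 1"
    "\<And>c u. c \<le> 1 \<Longrightarrow> 0 \<le> u \<Longrightarrow> u \<le> 1 \<Longrightarrow> \<bar>sqpow c u\<bar> \<le> b \<and> \<bar>sqpow1 c u\<bar> \<le> b \<and> \<bar>sqpow2 c u\<bar> \<le> b"
    using sqpow_bounded by blast
  show thesis
  \<comment> \<open>The factor 16 collects the terms of the second derivative, (4 + 2) + (4 + 2) +
    4; the first derivative needs only 5.\<close>
  proof (rule that[of "16 * b"])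
    fix x v :: "real ^ 'd" and t
    assume n: "norm (x + t *\<^sub>R v) \<le> 1"
    define u where "u = (norm (x + t *\<^sub>R v))\<^sup>2"
    have u: "0 \<le> u" "u \<le> 1" using n by (simp_all add: u_def power_le_one)
    have f: "\<bar>sqpow c u\<bar> \<le> b" "\<bar>sqpow1 c u\<bar> \<le> b" "\<bar>sqpow2 c u\<bar> \<le> b" if "c \<le> 1" for c
      using b(2)[OF that u] by auto
    define y where "y = X (x + t *\<^sub>R v)"
    define z where "z = \<tau>' x v t"
    define m where "m = norm v"
    have m: "m \<ge> 0" by (simp add: m_def)
    have y: "norm y \<le> 1" using n by (simp add: y_def)
    have z: "\<bar>z\<bar> \<le> 2 * m"
    proof -
      have "\<bar>(x + t *\<^sub>R v) \<bullet> v\<bar> \<le> norm (x + t *\<^sub>R v) * norm v" by (rule Cauchy_Schwarz_ineq2)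
      also have "\<dots> \<le> 1 * norm v" using n by (intro mult_right_mono) auto
      finally show ?thesis by (simp add: z_def \<tau>'_def m_def)
    qed
    have z2: "z\<^sup>2 \<le> 4 * m\<^sup>2" using z m power_mono[of "\<bar>z\<bar>" "2 * m" 2] by (simp add: power_mult_distrib)
    have sy: "norm (k *\<^sub>R y) \<le> \<bar>k\<bar>" for k using mult_left_mono[OF y, of "\<bar>k\<bar>"] by simp
    have s\<mu>: "norm (k *\<^sub>R \<mu>) = \<bar>k\<bar>" for k by (simp add: norm_\<mu>)
    have sv: "norm (k *\<^sub>R X v) = \<bar>k\<bar> * m" for k by (simp add: m_def)
    have fz: "\<bar>sqpow1 c u * z\<bar> \<le> b * (2 * m)" if "c \<le> 1" for c
      unfolding abs_mult using f[OF that] z b(1) by (intro mult_mono) auto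
    have fv: "\<bar>sqpow 1 u\<bar> * m \<le> b * m" using f[of 1] m by (intro mult_right_mono) auto
    have "norm (E' x v t) \<le> \<bar>sqpow1 0 u * z\<bar> + \<bar>sqpow1 1 u * z\<bar> + \<bar>sqpow 1 u\<bar> * m"
      unfolding E'_def Let_def u_def[symmetric] y_def[symmetric] z_def[symmetric]
      by (intro order_trans[OF norm_triangle_ineq] add_mono sy eq_refl[OF s\<mu>] eq_refl[OF sv])
    also have "\<dots> \<le> b * (2 * m) + b * (2 * m) + b * m" by (intro add_mono fz fv) auto
    also have "\<dots> \<le> (16 * b) * m" using mult_nonneg_nonneg[of b m] b(1) m by simp
    finally show "norm (E' x v t) \<le> 16 * b * norm v" by (simp add: m_def)
    have ff: "\<bar>sqpow2 c u * z\<^sup>2 + sqpow1 c u * (2 * m\<^sup>2)\<bar> \<le> b * (4 * m\<^sup>2) + b * (2 * m\<^sup>2)" if "c \<le> 1" for c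
    proof (rule order_trans[OF abs_triangle_ineq add_mono])
      show "\<bar>sqpow2 c u * z\<^sup>2\<bar> \<le> b * (4 * m\<^sup>2)"
        unfolding abs_mult using f[OF that] z2 b(1) by (intro mult_mono) auto
      show "\<bar>sqpow1 c u * (2 * m\<^sup>2)\<bar> \<le> b * (2 * m\<^sup>2)"
        unfolding abs_mult using f[OF that] b(1) by (intro mult_mono) auto
    qed
    have fzm: "\<bar>2 * (sqpow1 1 u * z)\<bar> * m \<le> 2 * (b * (2 * m)) * m"
    proof -
      have "\<bar>2 * (sqpow1 1 u * z)\<bar> = 2 * \<bar>sqpow1 1 u * z\<bar>" by (simp only: abs_mult abs_numeral)
      then show ?thesis using m by (simp only:) (intro mult_right_mono mult_left_mono fz, auto)
    qed
    have "norm (E'' x v t) \<le> \<bar>sqpow2 0 u * z\<^sup>2 + sqpow1 0 u * (2 * m\<^sup>2)\<bar>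
       + \<bar>sqpow2 1 u * z\<^sup>2 + sqpow1 1 u * (2 * m\<^sup>2)\<bar> + \<bar>2 * (sqpow1 1 u * z)\<bar> * m"
      unfolding E''_def Let_def u_def[symmetric] y_def[symmetric] z_def[symmetric] m_def[symmetric]
      by (intro order_trans[OF norm_triangle_ineq] add_mono sy eq_refl[OF s\<mu>] eq_refl[OF sv])
    also have "\<dots> \<le> (b * (4 * m\<^sup>2) + b * (2 * m\<^sup>2)) + (b * (4 * m\<^sup>2) + b * (2 * m\<^sup>2)) + 2 * (b * (2 * m)) * m"
      by (intro add_mono ff fzm) auto
    also have "\<dots> = (16 * b) * m\<^sup>2" by (simp add: power2_eq_square)
    finally show "norm (E'' x v t) \<le> 16 * b * (norm v)\<^sup>2" by (simp add: m_def)
  qed (use b in auto)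
qed

section \<open>The squared distance in normal coordinates\<close>

definition h :: "real ^ 'd \<Rightarrow> 'a \<Rightarrow> real" where "h x q = (arccos (E x \<bullet> q))\<^sup>2"

text \<open>This is minus twice the logarithm of q: the coordinates of q have length sin t, so the
  vector has length 2 t. At q = mu it is 0, which is correct there; at q = - mu it is 0 by
  convention, on a null set.\<close>

definition g :: "'a \<Rightarrow> real ^ 'd" where "g q = (- 2 * arccos_ratio (\<mu> \<bullet> q)) *\<^sub>R coords q"

lemma E_line_orthogonal:
  assumes "\<xi> \<bullet> \<mu> = 0" "\<xi> \<bullet> X x = 0" "\<xi> \<bullet> X v = 0"
  shows "E (x + t *\<^sub>R v) \<bullet> \<xi> = 0"
  using assms by (simp add: E_def X_add X_scaleR inner_add_left inner_commute[of _ \<xi>] inner_add_right)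

lemma inner_E_le: "norm q = 1 \<Longrightarrow> \<bar>E x \<bullet> q\<bar> \<le> 1"
  using Cauchy_Schwarz_ineq2[of "E x" q] by simp

text \<open>The curve \<open>E (x + t v)\<close> stays in a three-dimensional subspace, so a small displacement of
  \<open>q\<close> out of that subspace keeps the curve away from \<open>q\<close> and \<open>- q\<close>.\<close>

lemma generic_points:
  assumes q: "norm q = 1"
  obtains qs :: "nat \<Rightarrow> 'a" where "\<And>k. norm (qs k) = 1" "\<And>k t. \<bar>E (x + t *\<^sub>R v) \<bullet> qs k\<bar> < 1" "qs \<longlonglongrightarrow> q"
proof -
  have "dim {\<mu>, X x, X v} \<le> card {\<mu>, X x, X v}" by (rule dim_le_card') simp
  also have "\<dots> \<le> 3" by (simp add: card_insert_if)
  finally have "dim {\<mu>, X x, X v} < DIM('a)" using dim by simp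
  then obtain \<zeta> where z: "\<zeta> \<noteq> 0" "\<And>y. y \<in> span {\<mu>, X x, X v} \<Longrightarrow> orthogonal \<zeta> y"
    by (rule orthogonal_to_subspace_exists) blast
  \<comment> \<open>The sign is chosen so that adding a positive multiple of \<xi> cannot cancel the
    component of q along \<xi>.\<close>
  define \<xi> where "\<xi> = (if q \<bullet> \<zeta> \<ge> 0 then \<zeta> else - \<zeta>)"
  have \<xi>: "\<xi> \<noteq> 0" "q \<bullet> \<xi> \<ge> 0" using z by (auto simp: \<xi>_def)
  have o: "\<xi> \<bullet> y = 0" if "y \<in> {\<mu>, X x, X v}" for y
    using z(2)[OF span_base[OF that]] by (auto simp: \<xi>_def orthogonal_def)
  define w where "w k = q + (1 / real (Suc k)) *\<^sub>R \<xi>" for k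
  have w\<xi>: "w k \<bullet> \<xi> > 0" for k
  proof -
    have "w k \<bullet> \<xi> = q \<bullet> \<xi> + (\<xi> \<bullet> \<xi>) / real (Suc k)" by (simp add: w_def inner_add_left)
    moreover have "(\<xi> \<bullet> \<xi>) / real (Suc k) > 0" using \<xi> by simp
    ultimately show ?thesis using \<xi> by linarith
  qed
  then have w0: "w k \<noteq> 0" for k by (metis inner_zero_left less_irrefl)
  define qs where "qs k = sgn (w k)" for k
  have n: "norm (qs k) = 1" for k using w0 by (simp add: qs_def norm_sgn)
  have qs\<xi>: "qs k \<bullet> \<xi> > 0" for k using w\<xi>[of k] w0[of k] by (simp add: qs_def sgn_div_norm)
  have lt: "\<bar>E (x + t *\<^sub>R v) \<bullet> qs k\<bar> < 1" for k t
  proof -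
    define p where "p = E (x + t *\<^sub>R v)"
    have pp: "p \<bullet> p = 1" and qq: "qs k \<bullet> qs k = 1" using n by (simp_all add: p_def dot_square_norm)
    have "p \<bullet> \<xi> = 0" unfolding p_def using o by (intro E_line_orthogonal) auto
    \<comment> \<open>Equality in the Cauchy-Schwarz inequality would make the displaced point a
      multiple of p, but p is orthogonal to \<xi> and the displaced point is not.\<close>
    have "qs k \<noteq> (p \<bullet> qs k) *\<^sub>R p"
    proof
      assume "qs k = (p \<bullet> qs k) *\<^sub>R p"
      then have "qs k \<bullet> \<xi> = (p \<bullet> qs k) * (p \<bullet> \<xi>)" by (metis inner_scaleR_left)
      then show False using \<open>p \<bullet> \<xi> = 0\<close> qs\<xi>[of k] by simp
    qed
    then have "0 < (qs k - (p \<bullet> qs k) *\<^sub>R p) \<bullet> (qs k - (p \<bullet> qs k) *\<^sub>R p)" by simp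
    also have "\<dots> = 1 - (p \<bullet> qs k)\<^sup>2"
      by (simp add: inner_diff_left inner_diff_right pp qq power2_eq_square inner_commute[of "qs k" p])
    finally have "(p \<bullet> qs k)\<^sup>2 < 1" by simp
    then show ?thesis by (simp add: p_def abs_square_less_1)
  qed
  have "w \<longlonglongrightarrow> q + 0 *\<^sub>R \<xi>"
    unfolding w_def[abs_def] by (intro tendsto_intros LIMSEQ_Suc lim_1_over_n)
  then have "(\<lambda>k. sgn (w k)) \<longlonglongrightarrow> sgn q" using q by (intro tendsto_sgn) auto
  moreover have "sgn q = q" using q by (simp add: sgn_div_norm)
  ultimately have "qs \<longlonglongrightarrow> q" unfolding qs_def[abs_def] by simp
  with n lt show thesis by (rule that)
qed

text \<open>The squared distance is continuous in q even across the cut locus, so inequalities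
  proved for generic points pass to the limit.\<close>

lemma h_tendsto:
  assumes "\<And>k. norm (qs k) = 1" "qs \<longlonglongrightarrow> q"
  shows "(\<lambda>k. h x (qs k)) \<longlonglongrightarrow> h x q"
proof -
  have nq: "norm q = 1" using tendsto_norm[OF assms(2)] assms(1) by (simp add: LIMSEQ_const_iff)
  have "(\<lambda>k. arccos (E x \<bullet> qs k)) \<longlonglongrightarrow> arccos (E x \<bullet> q)"
  proof (rule continuous_on_tendsto_compose[OF continuous_on_arccos'])
    show "(\<lambda>k. E x \<bullet> qs k) \<longlonglongrightarrow> E x \<bullet> q" by (intro tendsto_intros assms)
    show "E x \<bullet> q \<in> {-1..1}" using inner_E_le[OF nq, of x] by auto
    show "\<forall>\<^sub>F k in sequentially. E x \<bullet> qs k \<in> {-1..1}" using inner_E_le[OF assms(1), of x] by (auto simp: abs_le_iff)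
  qed
  then show ?thesis unfolding h_def by (intro tendsto_power)
qed

lemma \<mu>_inner_lt:
  assumes "norm q = 1" "q \<noteq> \<mu>" "q \<noteq> - \<mu>"
  shows "\<bar>\<mu> \<bullet> q\<bar> < 1"
proof -
  have qq: "q \<bullet> q = 1" using assms by (simp add: dot_square_norm)
  have "(norm (q - \<mu>))\<^sup>2 > 0" using assms by simp
  then have 1: "\<mu> \<bullet> q < 1" by (simp add: power2_norm_eq_inner inner_diff_left inner_diff_right qq \<mu>\<mu> inner_commute)
  have "q + \<mu> \<noteq> 0" using assms by (metis add_eq_0_iff2)
  then have "(norm (q + \<mu>))\<^sup>2 > 0" by simp
  then have 2: "- 1 < \<mu> \<bullet> q" by (simp add: power2_norm_eq_inner inner_add_left inner_add_right qq \<mu>\<mu> inner_commute)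
  show ?thesis using 1 2 by (simp add: abs_less_iff)
qed

lemma norm_g_le:
  assumes "norm q = 1"
  shows "norm (g q) \<le> 2 * pi"
proof (cases "\<bar>\<mu> \<bullet> q\<bar> < 1")
  case True
  have "norm (coords q) = sqrt (1 - (\<mu> \<bullet> q)\<^sup>2)"
    using norm_coords[OF assms] by (metis inner_commute norm_ge_zero real_sqrt_unique)
  then show ?thesis using arccos_ratio_bounds[OF True] by (simp add: g_def)
next
  case False
  then have "q = \<mu> \<or> q = - \<mu>" using \<mu>_inner_lt[OF assms] by blast
  then show ?thesis by (auto simp: g_def arccos_ratio_def \<mu>\<mu>)
qed

text \<open>A chord is no longer than its arc: 2 sin (|x| / 2) is at most |x|.\<close>

lemma norm_E_diff: "norm (E x - \<mu>) \<le> norm x"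
proof -
  have "(norm (E x - \<mu>))\<^sup>2 = 2 - 2 * cos (norm x)"
  proof -
    have "E x \<bullet> E x = 1" using norm_E[of x] by (simp only: norm_eq_1)
    then show ?thesis
      using E_inner_\<mu>[of x] by (simp add: power2_norm_eq_inner inner_diff_left inner_diff_right \<mu>\<mu> inner_commute)
  qed
  also have "\<dots> = (2 * sin (norm x / 2))\<^sup>2"
    using cos_double_sin[of "norm x / 2"] by (simp add: power2_eq_square)
  also have "\<dots> \<le> (norm x)\<^sup>2"
    using abs_sin_x_le_abs_x[of "norm x / 2"] by (intro iffD1[OF abs_le_square_iff]) (simp add: abs_mult)
  finally show ?thesis by (rule power2_le_imp_le) simp
qed

lemma E'_0: "E' 0 x 0 = X x" by (simp add: E'_def \<tau>'_def sqpow_at_0)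

lemma h_\<mu>: "norm x < pi \<Longrightarrow> h x \<mu> = (norm x)\<^sup>2"
  by (simp add: h_def E_inner_\<mu> arccos_cos)

lemma segment_in_ball:
  fixes x y :: "real ^ 'd"
  assumes "norm x < 1" "norm y < 1" "t \<in> {0..1}"
  shows "norm (x + t *\<^sub>R (y - x)) \<le> 1"
proof -
  have "x + t *\<^sub>R (y - x) = (1 - t) *\<^sub>R x + t *\<^sub>R y" by (simp add: algebra_simps)
  also have "\<dots> \<in> ball 0 1" using assms convexD[OF convex_ball[of "0 :: real ^ 'd" 1], of x y "1 - t" t] by auto
  finally show ?thesis by simp
qed

text \<open>Each estimate is first derived along a segment for generic points \<open>qs k\<close>,
  for which the squared distance is twice differentiable along the curve, and then passed to the
  limit q. The constants depend only on bounds for E on the unit ball, so they are uniform in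
  q.\<close>

lemma h_bounds:
  obtains b K where "b \<ge> 1" "K > 0"
    "\<And>x y q. norm x < 1 \<Longrightarrow> norm y < 1 \<Longrightarrow> norm q = 1 \<Longrightarrow> \<bar>h x q - h y q\<bar> \<le> 2 * pi * b * norm (x - y)"
    "\<And>q. norm q = 1 \<Longrightarrow> convex_on (ball 0 1) (\<lambda>u. K * (norm u)\<^sup>2 - h u q)"
    "\<And>x q. norm x < 1 \<Longrightarrow> norm q = 1 \<Longrightarrow> q \<noteq> - \<mu> \<Longrightarrow>
       \<bar>h x q - h 0 q - g q \<bullet> x\<bar> \<le> K * (norm x)\<^sup>2 / norm (q + \<mu>)"
proof -
  obtain b where b: "b \<ge> 1"
    "\<And>x v t. norm (x + t *\<^sub>R v) \<le> 1 \<Longrightarrow> norm (E' x v t) \<le> b * norm v"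
    "\<And>x v t. norm (x + t *\<^sub>R v) \<le> 1 \<Longrightarrow> norm (E'' x v t) \<le> b * (norm v)\<^sup>2"
    using E_deriv_bounds by blast
  have E'2: "(norm (E' x v t))\<^sup>2 \<le> b\<^sup>2 * (norm v)\<^sup>2" if "norm (x + t *\<^sub>R v) \<le> 1" for x v t
    using power_mono[OF b(2)[OF that], of 2] by (simp add: power_mult_distrib)
  define K1 where "K1 = 2 * b\<^sup>2 + pi * b"
  have K1: "K1 > 0" using b(1) by (simp add: K1_def add_pos_pos)
  have K1b: "4 * (norm (E' x v t))\<^sup>2 + 2 * pi * norm (E'' x v t) \<le> 2 * (K1 * (norm v)\<^sup>2)"
    if "norm (x + t *\<^sub>R v) \<le> 1" for x v t
  proof -
    have "2 * pi * norm (E'' x v t) \<le> 2 * pi * (b * (norm v)\<^sup>2)" using b(3)[OF that] by (intro mult_left_mono) auto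
    moreover have "2 * (K1 * (norm v)\<^sup>2) = 4 * (b\<^sup>2 * (norm v)\<^sup>2) + 2 * pi * (b * (norm v)\<^sup>2)"
      by (simp add: K1_def algebra_simps)
    ultimately show ?thesis using E'2[OF that] by linarith
  qed
  define K2 where "K2 = 4 * pi * b\<^sup>2 + 2 * pi * b"
  \<comment> \<open>One constant for every use: the first summand covers semiconcavity and the upper
    remainder (with r at most 2), K2 the lower remainder, the third summand points q close to the
    cut locus, and 2 the point q = mu.\<close>
  define K where "K = K1 * 2 + K2 + 8 * b * (2 * pi * b + 2 * pi) + 2"
  have K2: "K2 > 0" using b(1) by (simp add: K2_def add_pos_pos)
  have Kpos: "8 * b * (2 * pi * b + 2 * pi) > 0" using b(1) by (intro mult_pos_pos add_pos_pos) auto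
  have K: "K1 \<le> K" "K1 * 2 \<le> K" "K2 \<le> K" "8 * b * (2 * pi * b + 2 * pi) \<le> K" "2 \<le> K" "K > 0"
    using K1 K2 Kpos unfolding K_def by linarith+
  have Kb: "4 * (norm (E' x v t))\<^sup>2 + 2 * pi * norm (E'' x v t) \<le> 2 * (K * (norm v)\<^sup>2)"
    if "norm (x + t *\<^sub>R v) \<le> 1" for x v t
    using K1b[OF that] mult_right_mono[OF K(1), of "(norm v)\<^sup>2"] by simp
  have lip: "\<bar>h x q - h y q\<bar> \<le> 2 * pi * b * norm (x - y)" if x: "norm x < 1" "norm y < 1" and q: "norm q = 1" for x y q
  proof -
    obtain qs where qs: "\<And>k. norm (qs k) = 1" "\<And>k t. \<bar>E (x + t *\<^sub>R (y - x)) \<bullet> qs k\<bar> < 1" "qs \<longlonglongrightarrow> q"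
      using generic_points[OF q] by blast
    have "\<bar>h x (qs k) - h y (qs k)\<bar> \<le> 2 * pi * b * norm (x - y)" for k
    proof -
      interpret c: sphere_curve_point "\<lambda>t. E (x + t *\<^sub>R (y - x))" "E' x (y - x)" "E'' x (y - x)" "qs k"
        by (rule curve_point[OF qs(1)])
      have "\<bar>c.d 1 - c.d 0\<bar> \<le> 2 * pi * (b * norm (y - x))"
        by (rule c.d_lipschitz) (use qs(2) b(2)[OF segment_in_ball[OF x]] in \<open>auto simp: c.s_def\<close>)
      then show ?thesis by (simp add: c.d_def c.s_def h_def abs_minus_commute norm_minus_commute)
    qed
    moreover have "(\<lambda>k. \<bar>h x (qs k) - h y (qs k)\<bar>) \<longlonglongrightarrow> \<bar>h x q - h y q\<bar>"
      by (intro tendsto_intros h_tendsto qs)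
    ultimately show ?thesis by (intro LIMSEQ_le_const2) auto
  qed
  have conv: "convex_on (ball 0 1) (\<lambda>u. K * (norm u)\<^sup>2 - h u q)" if q: "norm q = 1" for q
  proof (rule convex_onI)
    fix t :: real and x y :: "real ^ 'd"
    assume t: "0 < t" "t < 1" and "x \<in> ball 0 1" "y \<in> ball 0 1"
    then have x: "norm x < 1" "norm y < 1" by auto
    define v where "v = y - x"
    have xv: "x + v = y" by (simp add: v_def)
    have seg: "norm (x + t *\<^sub>R v) \<le> 1" if "t \<in> {0..1}" for t
      using segment_in_ball[OF x that] by (simp add: v_def)
    obtain qs where qs: "\<And>k. norm (qs k) = 1" "\<And>k t. \<bar>E (x + t *\<^sub>R v) \<bullet> qs k\<bar> < 1" "qs \<longlonglongrightarrow> q"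
      using generic_points[OF q] by blast
    \<comment> \<open>Along the segment K |x + t v|^2 and K |v|^2 t^2 differ by an affine function
      of t, which does not affect convexity; hence the scalar statement suffices.\<close>
    have "K * (norm v)\<^sup>2 * t\<^sup>2 - h (x + t *\<^sub>R v) (qs k) \<le> (1 - t) * (- h x (qs k)) + t * (K * (norm v)\<^sup>2 - h y (qs k))" for k
    proof -
      interpret c: sphere_curve_point "\<lambda>t. E (x + t *\<^sub>R v)" "E' x v" "E'' x v" "qs k"
        by (rule curve_point[OF qs(1)])
      have "convex_on {0..1} (\<lambda>t. K * (norm v)\<^sup>2 * t\<^sup>2 - c.d t)"
      proof (rule c.d_semiconcave)
        show "\<bar>c.s t\<bar> < 1" for t using qs(2)[of t k] by (simp add: c.s_def)
        show "4 * (norm (E' x v t))\<^sup>2 + 2 * pi * norm (E'' x v t) \<le> 2 * (K * (norm v)\<^sup>2)"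
          if "t \<in> {0..1}" for t by (rule Kb[OF seg[OF that]])
      qed
      from convex_onD[OF this, of t 0 1] t show ?thesis
        by (simp add: c.d_def c.s_def h_def xv)
    qed
    moreover have "(\<lambda>k. K * (norm v)\<^sup>2 * t\<^sup>2 - h (x + t *\<^sub>R v) (qs k)) \<longlonglongrightarrow> K * (norm v)\<^sup>2 * t\<^sup>2 - h (x + t *\<^sub>R v) q"
      by (intro tendsto_intros h_tendsto qs)
    moreover have "(\<lambda>k. (1 - t) * (- h x (qs k)) + t * (K * (norm v)\<^sup>2 - h y (qs k))) \<longlonglongrightarrow>
        (1 - t) * (- h x q) + t * (K * (norm v)\<^sup>2 - h y q)"
      by (intro tendsto_intros h_tendsto qs)
    ultimately have le: "K * (norm v)\<^sup>2 * t\<^sup>2 - h (x + t *\<^sub>R v) q \<le> (1 - t) * (- h x q) + t * (K * (norm v)\<^sup>2 - h y q)"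
      by (intro LIMSEQ_le) auto
    have xy: "(1 - t) *\<^sub>R x + t *\<^sub>R y = x + t *\<^sub>R v" by (simp add: v_def algebra_simps)
    have n1: "(norm (x + t *\<^sub>R v))\<^sup>2 = (norm x)\<^sup>2 + 2 * t * (x \<bullet> v) + t\<^sup>2 * (norm v)\<^sup>2"
    proof -
      have "v \<bullet> x = x \<bullet> v" by (rule inner_commute)
      then show ?thesis
        unfolding power2_norm_eq_inner inner_add_left inner_add_right inner_scaleR_left inner_scaleR_right
        by (simp add: power2_eq_square distrib_left)
    qed
    have n2: "(norm y)\<^sup>2 = (norm x)\<^sup>2 + 2 * (x \<bullet> v) + (norm v)\<^sup>2"
    proof -
      have "y = x + v" by (simp add: v_def)
      then show ?thesis by (simp add: power2_norm_eq_inner inner_add_left inner_add_right inner_commute[of v x])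
    qed
    show "K * (norm ((1 - t) *\<^sub>R x + t *\<^sub>R y))\<^sup>2 - h ((1 - t) *\<^sub>R x + t *\<^sub>R y) q
        \<le> (1 - t) * (K * (norm x)\<^sup>2 - h x q) + t * (K * (norm y)\<^sup>2 - h y q)"
      unfolding xy n1 n2 using le by (simp add: algebra_simps)
  qed simp
  have rem: "\<bar>h x q - h 0 q - g q \<bullet> x\<bar> \<le> K * (norm x)\<^sup>2 / norm (q + \<mu>)"
    if x: "norm x < 1" and q: "norm q = 1" "q \<noteq> - \<mu>" for x q
  proof -
    define r where "r = norm (q + \<mu>)"
    have "q + \<mu> \<noteq> 0" using q(2) by (metis add_eq_0_iff2)
    then have r: "r > 0" by (simp add: r_def)
    have r2: "r \<le> 2" using norm_triangle_ineq[of q \<mu>] q norm_\<mu> by (simp add: r_def)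
    have mono: "k * (norm x)\<^sup>2 / r \<le> K * (norm x)\<^sup>2 / r" if "k \<le> K" for k
      using r that by (intro divide_right_mono mult_right_mono) auto
    \<comment> \<open>If r = |q + mu| is below 4 b |x|, the Lipschitz bound O(|x|) is already
      O(|x|^2 / r). Otherwise the curve moves by at most r/4, and as |qs k + mu| exceeds 3r/4 it
      stays at distance at least r/2 from the cut point - qs k, where the second derivative is
      O(1/r). The point q = mu is separate because \<open>arccos_ratio\<close> is discontinuous at
      1.\<close>
    consider "q = \<mu>" | "q \<noteq> \<mu>" "r < 4 * b * norm x" | "q \<noteq> \<mu>" "4 * b * norm x \<le> r" by linarith
    then show ?thesis
    proof cases
      case 1
      have "arccos_ratio 1 = 0" by (simp add: arccos_ratio_def)
      then have "g q = 0" using 1 \<mu>\<mu> by (simp add: g_def)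
      moreover have "norm x < pi" using x pi_gt3 by linarith
      ultimately have "\<bar>h x q - h 0 q - g q \<bullet> x\<bar> = (norm x)\<^sup>2" using 1 h_\<mu>[of x] h_\<mu>[of 0] by simp
      also have "\<dots> \<le> 2 * (norm x)\<^sup>2 / r" using r r2 by (simp add: pos_le_divide_eq mult_right_mono mult.commute)
      also have "\<dots> \<le> K * (norm x)\<^sup>2 / r" by (rule mono[OF K(5)])
      finally show ?thesis by (simp add: r_def)
    next
      case 2
      have "\<bar>g q \<bullet> x\<bar> \<le> 2 * pi * norm x"
        using norm_g_le[OF q(1)] by (intro order_trans[OF Cauchy_Schwarz_ineq2] mult_right_mono) auto
      moreover have "\<bar>h x q - h 0 q\<bar> \<le> 2 * pi * b * norm x" using lip[OF x _ q(1), of 0] by simp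
      ultimately have "\<bar>h x q - h 0 q - g q \<bullet> x\<bar> \<le> (2 * pi * b + 2 * pi) * norm x" by (simp add: distrib_right)
      also have "\<dots> \<le> (4 * b * (2 * pi * b + 2 * pi)) * (norm x)\<^sup>2 / r"
      proof -
        have "((2 * pi * b + 2 * pi) * norm x) * r \<le> ((2 * pi * b + 2 * pi) * norm x) * (4 * b * norm x)"
          using 2 b(1) by (intro mult_left_mono) auto
        then show ?thesis using r by (simp add: pos_le_divide_eq power2_eq_square mult_ac)
      qed
      also have "\<dots> \<le> K * (norm x)\<^sup>2 / r" using K(4) Kpos by (intro mono) linarith
      finally show ?thesis by (simp add: r_def)
    next
      case 3
      obtain qs where qs: "\<And>k. norm (qs k) = 1" "\<And>k t. \<bar>E (0 + t *\<^sub>R x) \<bullet> qs k\<bar> < 1" "qs \<longlonglongrightarrow> q"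
        using generic_points[OF q(1)] by blast
      have xb: "norm (0 + t *\<^sub>R x) \<le> norm x" if "t \<in> {0..1}" for t :: real
        using that by (auto simp: mult_left_le_one_le)
      then have x1: "norm (0 + t *\<^sub>R x) \<le> 1" if "t \<in> {0..1}" for t :: real
        using that x by (meson less_imp_le order_trans)
      have "(\<lambda>k. norm (qs k + \<mu>)) \<longlonglongrightarrow> r" unfolding r_def by (intro tendsto_intros qs)
      from order_tendstoD(1)[OF this, of "3 / 4 * r"] have ev: "\<forall>\<^sub>F k in sequentially. 3 / 4 * r < norm (qs k + \<mu>)"
        using r by simp
      have dprime: "sphere_curve_point.d' (\<lambda>t. E (0 + t *\<^sub>R x)) (E' 0 x) (qs k) 0 = g (qs k) \<bullet> x" for k
      proof -
        interpret c: sphere_curve_point "\<lambda>t. E (0 + t *\<^sub>R x)" "E' 0 x" "E'' 0 x" "qs k"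
          by (rule curve_point[OF qs(1)])
        show ?thesis unfolding c.d'_def c.s_def c.s'_def E'_0 g_def by (simp add: inner_commute[of "X x"] inner_X)
      qed
      have up: "h x (qs k) - h 0 (qs k) - g (qs k) \<bullet> x \<le> K1 * (norm x)\<^sup>2" for k
      proof -
        interpret c: sphere_curve_point "\<lambda>t. E (0 + t *\<^sub>R x)" "E' 0 x" "E'' 0 x" "qs k"
          by (rule curve_point[OF qs(1)])
        have "c.d 1 - c.d 0 - c.d' 0 \<le> K1 * (norm x)\<^sup>2"
        proof (rule c.d_taylor_upper)
          show "\<bar>c.s t\<bar> < 1" for t unfolding c.s_def by (rule qs(2))
          show "4 * (norm (E' 0 x t))\<^sup>2 + 2 * pi * norm (E'' 0 x t) \<le> 2 * (K1 * (norm x)\<^sup>2)"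
            if "t \<in> {0..1}" for t by (rule K1b[OF x1[OF that]])
        qed
        then show ?thesis unfolding dprime c.d_def c.s_def h_def by simp
      qed
      have lo: "\<forall>\<^sub>F k in sequentially. - (K2 * (norm x)\<^sup>2 / r) \<le> h x (qs k) - h 0 (qs k) - g (qs k) \<bullet> x"
        using ev
      proof eventually_elim
        case (elim k)
        interpret c: sphere_curve_point "\<lambda>t. E (0 + t *\<^sub>R x)" "E' 0 x" "E'' 0 x" "qs k"
          by (rule curve_point[OF qs(1)])
        have "- (K2 * (norm x)\<^sup>2 / r) \<le> c.d 1 - c.d 0 - c.d' 0"
        proof (rule c.d_taylor_lower)
          show "\<bar>c.s t\<bar> < 1" if "t \<in> {0..1}" for t unfolding c.s_def by (rule qs(2))
          fix t :: real assume t: "t \<in> {0..1}"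
          have "norm (E (0 + t *\<^sub>R x) - \<mu>) \<le> norm x" using norm_E_diff[of "0 + t *\<^sub>R x"] xb[OF t] by linarith
          also have "norm x \<le> b * norm x" using b(1) mult_right_mono[of 1 b "norm x"] by simp
          also have "b * norm x \<le> r / 4" using 3 by simp
          finally have "norm (E (0 + t *\<^sub>R x) - \<mu>) \<le> r / 4" .
          moreover have "norm (qs k + \<mu>) \<le> norm (E (0 + t *\<^sub>R x) + qs k) + norm (E (0 + t *\<^sub>R x) - \<mu>)"
            using norm_triangle_ineq4[of "E (0 + t *\<^sub>R x) + qs k" "E (0 + t *\<^sub>R x) - \<mu>"] by (simp add: algebra_simps)
          ultimately have low: "r / 2 \<le> norm (E (0 + t *\<^sub>R x) + qs k)" using elim by linarith
          have "4 * pi / norm (E (0 + t *\<^sub>R x) + qs k) * (norm (E' 0 x t))\<^sup>2 \<le> 4 * pi / (r / 2) * (b\<^sup>2 * (norm x)\<^sup>2)"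
            using low r E'2[OF x1[OF t]] by (intro mult_mono divide_left_mono mult_pos_pos) auto
          moreover have "2 * pi * norm (E'' 0 x t) \<le> 2 * pi * (b * (norm x)\<^sup>2) * (2 / r)"
          proof -
            have "2 * pi * norm (E'' 0 x t) \<le> 2 * pi * (b * (norm x)\<^sup>2)"
              using b(3)[OF x1[OF t]] by (intro mult_left_mono) auto
            also have "\<dots> * 1 \<le> 2 * pi * (b * (norm x)\<^sup>2) * (2 / r)"
              using r r2 b(1) by (intro mult_left_mono) (auto simp: pos_le_divide_eq)
            finally show ?thesis by simp
          qed
          moreover have "4 * pi / (r / 2) * (b\<^sup>2 * (norm x)\<^sup>2) + 2 * pi * (b * (norm x)\<^sup>2) * (2 / r) = 2 * (K2 * (norm x)\<^sup>2 / r)"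
            using r by (simp add: K2_def field_simps)
          ultimately show "4 * pi / norm (E (0 + t *\<^sub>R x) + qs k) * (norm (E' 0 x t))\<^sup>2 + 2 * pi * norm (E'' 0 x t)
              \<le> 2 * (K2 * (norm x)\<^sup>2 / r)" by linarith
        qed
        then show ?case unfolding dprime c.d_def c.s_def h_def by simp
      qed
      have glim: "(\<lambda>k. g (qs k) \<bullet> x) \<longlonglongrightarrow> g q \<bullet> x"
      proof -
        have "isCont arccos_ratio (\<mu> \<bullet> q)"
          using arccos_ratio_deriv(1)[OF \<mu>_inner_lt[OF q(1) 3(1) q(2)]] by (rule DERIV_isCont)
        moreover have "(\<lambda>k. \<mu> \<bullet> qs k) \<longlonglongrightarrow> \<mu> \<bullet> q" by (intro tendsto_intros qs)
        ultimately have "(\<lambda>k. arccos_ratio (\<mu> \<bullet> qs k)) \<longlonglongrightarrow> arccos_ratio (\<mu> \<bullet> q)"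
          by (rule isCont_tendsto_compose)
        moreover have "(\<lambda>k. coords (qs k) \<bullet> x) \<longlonglongrightarrow> coords q \<bullet> x"
          unfolding inner_X[symmetric] by (intro tendsto_intros qs)
        ultimately have "(\<lambda>k. (- 2 * arccos_ratio (\<mu> \<bullet> qs k)) * (coords (qs k) \<bullet> x)) \<longlonglongrightarrow> (- 2 * arccos_ratio (\<mu> \<bullet> q)) * (coords q \<bullet> x)"
          by (intro tendsto_mult tendsto_const)
        then show ?thesis by (simp add: g_def)
      qed
      have lim: "(\<lambda>k. h x (qs k) - h 0 (qs k) - g (qs k) \<bullet> x) \<longlonglongrightarrow> h x q - h 0 q - g q \<bullet> x"
        by (intro tendsto_diff h_tendsto qs glim)
      have "h x q - h 0 q - g q \<bullet> x \<le> K1 * (norm x)\<^sup>2"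
        by (rule tendsto_upperbound[OF lim]) (use up in auto)
      also have "K1 * (norm x)\<^sup>2 \<le> (K1 * 2) * (norm x)\<^sup>2 / r"
        using r mult_left_mono[OF r2, of "K1 * (norm x)\<^sup>2"] K1 by (simp add: pos_le_divide_eq mult_ac)
      also have "\<dots> \<le> K * (norm x)\<^sup>2 / r" by (rule mono[OF K(2)])
      finally have "h x q - h 0 q - g q \<bullet> x \<le> K * (norm x)\<^sup>2 / r" .
      moreover have "- (K2 * (norm x)\<^sup>2 / r) \<le> h x q - h 0 q - g q \<bullet> x"
        by (rule tendsto_lowerbound[OF lim lo]) simp
      ultimately show ?thesis using mono[OF K(3)] unfolding r_def[symmetric] abs_le_iff by linarith
    qed
  qed
  show thesis by (rule that[OF b(1) K(6) lip conv rem])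
qed

text \<open>The Hessian of the squared distance at mu: eigenvalue 2 in the direction of q and 2 t
  cot t across it. At q = mu both tend to 2, a limit the closed formula misses because
  \<open>arccos_ratio\<close> is 0 at 1.\<close>

definition Hess :: "'a \<Rightarrow> real ^ 'd ^ 'd" where
  "Hess q = (if q = \<mu> then mat 2 else
     (let s = \<mu> \<bullet> q; A = arccos_ratio s in
      \<chi> i j. 2 * (1 - s * A) / (1 - s\<^sup>2) * (coords q $ i * coords q $ j) + (if i = j then 2 * A * s else 0)))"

lemma Hess_sym: "transpose (Hess q) = Hess q"
  by (simp add: Hess_def Let_def transpose_def vec_eq_iff mat_def mult.commute)

lemma Hess_\<mu>: "x \<bullet> (Hess \<mu> *v x) = 2 * (norm x)\<^sup>2"
proof -
  have "Hess \<mu> *v x = 2 *\<^sub>R x"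
    by (simp add: Hess_def vec_eq_iff matrix_vector_mult_def mat_def if_distrib if_distribR cong: if_cong)
  then show ?thesis by (simp add: power2_norm_eq_inner)
qed

lemma Hess_quadratic:
  assumes "q \<noteq> \<mu>"
  shows "x \<bullet> (Hess q *v x) = 2 * (1 - (\<mu> \<bullet> q) * arccos_ratio (\<mu> \<bullet> q)) / (1 - (\<mu> \<bullet> q)\<^sup>2) * (coords q \<bullet> x)\<^sup>2
    + 2 * arccos_ratio (\<mu> \<bullet> q) * (\<mu> \<bullet> q) * (norm x)\<^sup>2"
proof -
  define a where "a = 2 * (1 - (\<mu> \<bullet> q) * arccos_ratio (\<mu> \<bullet> q)) / (1 - (\<mu> \<bullet> q)\<^sup>2)"
  define b where "b = 2 * arccos_ratio (\<mu> \<bullet> q) * (\<mu> \<bullet> q)"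
  have H: "Hess q $ i $ j = a * (coords q $ i * coords q $ j) + (if i = j then b else 0)" for i j
    using assms by (simp add: Hess_def Let_def a_def b_def)
  have "(Hess q *v x) $ i = a * (coords q $ i * (coords q \<bullet> x)) + b * x $ i" for i
  proof -
    have "(Hess q *v x) $ i = (\<Sum>j\<in>UNIV. a * coords q $ i * (coords q $ j * x $ j) + (if i = j then b * x $ j else 0))"
    proof -
      have "Hess q $ i $ j * x $ j = a * coords q $ i * (coords q $ j * x $ j) + (if i = j then b * x $ j else 0)" for j
        unfolding H by (simp add: algebra_simps)
      then show ?thesis by (simp add: matrix_vector_mult_def)
    qed
    also have "\<dots> = a * coords q $ i * (coords q \<bullet> x) + b * x $ i"
      by (simp add: sum.distrib sum_distrib_left inner_vec_def)
    finally show ?thesis by (simp add: mult.assoc)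
  qed
  then have "Hess q *v x = (a * (coords q \<bullet> x)) *\<^sub>R coords q + b *\<^sub>R x"
    by (simp add: vec_eq_iff mult_ac)
  then have "x \<bullet> (Hess q *v x) = a * (coords q \<bullet> x)\<^sup>2 + b * (norm x)\<^sup>2"
    by (simp add: inner_add_right power2_eq_square power2_norm_eq_inner inner_commute[of x "coords q"] dot_square_norm)
  then show ?thesis by (simp add: a_def b_def)
qed

section \<open>Second-order expansion at the mean\<close>

lemma norm_tendsto_0: "((\<lambda>x :: real ^ 'd. norm x) \<longlongrightarrow> 0) (at 0)"
  using tendsto_norm[OF tendsto_ident_at[of "0 :: real ^ 'd" UNIV]] by simp

lemma filterlim_norm2_at_0: "filterlim (\<lambda>x :: real ^ 'd. (norm x)\<^sup>2) (at 0) (at 0)"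
proof (rule filterlim_atI)
  show "((\<lambda>x :: real ^ 'd. (norm x)\<^sup>2) \<longlongrightarrow> 0) (at 0)"
    using tendsto_power[OF norm_tendsto_0, of 2] by simp
  show "\<forall>\<^sub>F x :: real ^ 'd in at 0. (norm x)\<^sup>2 \<noteq> 0"
    by (auto simp: eventually_at intro: exI[of _ 1])
qed

text \<open>Composition of two expansions: E x . q equals s + c . x - s |x|^2 / 2 + o(|x|^2), and
  the squared arc cosine is expanded at s to second order. The quadratic part of the inner map
  contributes the t cot t term of the Hessian, the second derivative of the outer map the rank-one
  term.\<close>

lemma h_expansion:
  assumes q: "norm q = 1" "q \<noteq> - \<mu>"
  shows "((\<lambda>x. (h x q - h 0 q - g q \<bullet> x - (x \<bullet> (Hess q *v x)) / 2) / (norm x)\<^sup>2) \<longlongrightarrow> 0) (at 0)"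
proof (cases "q = \<mu>")
  case True
  have "arccos_ratio 1 = 0" by (simp add: arccos_ratio_def)
  then have g0: "g q = 0" using True \<mu>\<mu> by (simp add: g_def)
  have "\<forall>\<^sub>F x in at 0. (h x q - h 0 q - g q \<bullet> x - (x \<bullet> (Hess q *v x)) / 2) / (norm x)\<^sup>2 = 0"
    unfolding eventually_at
  proof (intro exI[of _ 1] conjI ballI impI)
    fix x :: "real ^ 'd" assume "x \<noteq> 0 \<and> dist x 0 < 1"
    then have "norm x < pi" using pi_gt3 by simp
    then show "(h x q - h 0 q - g q \<bullet> x - (x \<bullet> (Hess q *v x)) / 2) / (norm x)\<^sup>2 = 0"
      using True g0 h_\<mu>[of x] h_\<mu>[of 0] Hess_\<mu>[of x] by simp
  qed simp
  then show ?thesis by (rule tendsto_eventually)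
next
  case False
  define s where "s = \<mu> \<bullet> q"
  have s1: "\<bar>s\<bar> < 1" using \<mu>_inner_lt[OF q(1) False q(2)] by (simp add: s_def)
  define a where "a u = (arccos u)\<^sup>2" for u :: real
  define A where "A = arccos_ratio s"
  define a2 where "a2 = 2 * (1 - s * A) / (1 - s\<^sup>2)"
  define R where "R u = (a (s + u) - a s - (- 2 * A) * u - a2 * u\<^sup>2 / 2) / u\<^sup>2" for u
  have Rlim: "(R \<longlongrightarrow> 0) (at 0)"
    unfolding R_def[abs_def] A_def
  proof (rule taylor2_peano[where f' = "\<lambda>s. - 2 * arccos_ratio s"])
    have "open {- 1<..<(1 :: real)}" by simp
    moreover have "s \<in> {- 1<..<1}" using s1 by (simp add: abs_less_iff)
    ultimately have "\<forall>\<^sub>F u in nhds s. u \<in> {- 1<..<1}" by (rule eventually_nhds_in_open)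
    then show "\<forall>\<^sub>F u in nhds s. (a has_real_derivative - 2 * arccos_ratio u) (at u)"
      unfolding a_def[abs_def] by eventually_elim (rule arccos_ratio_deriv(2), simp add: abs_less_iff)
    show "((\<lambda>s. - 2 * arccos_ratio s) has_real_derivative a2) (at s)"
    proof -
      have "((\<lambda>s. - 2 * arccos_ratio s) has_real_derivative - 2 * ((s * arccos_ratio s - 1) / (1 - s\<^sup>2))) (at s)"
        by (intro DERIV_cmult arccos_ratio_deriv(1) s1)
      moreover have "- 2 * ((s * arccos_ratio s - 1) / (1 - s\<^sup>2)) = a2"
        by (simp add: a2_def A_def minus_divide_left)
      ultimately show ?thesis by simp
    qed
  qed
  \<comment> \<open>Division by 0 gives 0, so the normalised remainder is continuous at 0 and may be
    composed with \<Delta>, which can vanish at points x other than 0.\<close>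
  have R0: "R 0 = 0" by (simp add: R_def)
  then have Rnhds: "(R \<longlongrightarrow> 0) (nhds 0)" using Rlim by (simp add: tendsto_nhds_iff)
  define c where "c = coords q"
  define \<Delta> where "\<Delta> x = E x \<bullet> q - s" for x
  have \<Delta>b: "\<bar>\<Delta> x\<bar> \<le> norm x" for x
  proof -
    have "\<Delta> x = (E x - \<mu>) \<bullet> q" by (simp add: \<Delta>_def s_def inner_diff_left)
    then have "\<bar>\<Delta> x\<bar> \<le> norm (E x - \<mu>) * norm q" by (metis Cauchy_Schwarz_ineq2)
    then show ?thesis using norm_E_diff[of x] q by simp
  qed
  have cb: "\<bar>c \<bullet> x\<bar> \<le> norm x" for x
  proof -
    have "\<bar>q \<bullet> X x\<bar> \<le> norm q * norm (X x)" by (rule Cauchy_Schwarz_ineq2)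
    then show ?thesis using q by (simp add: inner_X c_def)
  qed
  have \<Delta>lim: "(\<Delta> \<longlongrightarrow> 0) (at 0)"
    by (rule Lim_null_comparison[OF _ norm_tendsto_0]) (simp add: \<Delta>b)
  have R\<Delta>: "((\<lambda>x. R (\<Delta> x)) \<longlongrightarrow> 0) (at 0)"
    by (rule filterlim_compose[OF Rnhds \<Delta>lim])
  \<comment> \<open>The error of the inner expansion divided by |x|^2. It tends to 0 because (cos
    |x| - 1) / |x|^2 tends to -1/2 while the correction to sin |x| / |x| is multiplied by c .
    x.\<close>
  define U where "U x = (\<Delta> x - c \<bullet> x + s * (norm x)\<^sup>2 / 2) / (norm x)\<^sup>2" for x
  have Ulim: "(U \<longlongrightarrow> 0) (at 0)"
  proof -
    have D: "((\<lambda>\<rho>. (sqpow k \<rho> - 1) / \<rho>) \<longlongrightarrow> sqpow1 k 0) (at 0)" if "k \<le> 1" for k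
    proof -
      have "k = 0 \<or> k = 1" using that by linarith
      then have "sqpow k 0 = 1" by (auto simp: sqpow_at_0)
      then show ?thesis using DERIV_D[OF sqpow_deriv(1)[OF that], of 0] by simp
    qed
    have l0: "((\<lambda>x :: real ^ 'd. (sqpow 0 ((norm x)\<^sup>2) - 1) / (norm x)\<^sup>2) \<longlongrightarrow> - 1 / 2) (at 0)"
      using filterlim_compose[OF D[of 0] filterlim_norm2_at_0] by (simp add: sqpow_at_0)
    have l1: "((\<lambda>x :: real ^ 'd. (sqpow 1 ((norm x)\<^sup>2) - 1) / (norm x)\<^sup>2) \<longlongrightarrow> sqpow1 1 0) (at 0)"
      using filterlim_compose[OF D[of 1] filterlim_norm2_at_0] by simp
    have lc: "((\<lambda>x. c \<bullet> x) \<longlongrightarrow> c \<bullet> 0) (at 0)" by (intro tendsto_intros)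
    have "((\<lambda>x. s * ((sqpow 0 ((norm x)\<^sup>2) - 1) / (norm x)\<^sup>2 + 1 / 2)
        + (c \<bullet> x) * ((sqpow 1 ((norm x)\<^sup>2) - 1) / (norm x)\<^sup>2)) \<longlongrightarrow> s * (- 1 / 2 + 1 / 2) + (c \<bullet> 0) * sqpow1 1 0) (at 0)"
      by (intro tendsto_add tendsto_mult tendsto_const l0 l1 lc)
    moreover have "\<forall>\<^sub>F x in at 0. s * ((sqpow 0 ((norm x)\<^sup>2) - 1) / (norm x)\<^sup>2 + 1 / 2)
        + (c \<bullet> x) * ((sqpow 1 ((norm x)\<^sup>2) - 1) / (norm x)\<^sup>2) = U x"
      unfolding eventually_at
    proof (intro exI[of _ 1] conjI ballI impI)
      fix x :: "real ^ 'd" assume "x \<noteq> 0 \<and> dist x 0 < 1"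
      then have n: "(norm x)\<^sup>2 \<noteq> 0" by simp
      define N where "N = (norm x)\<^sup>2"
      have \<Delta>x: "\<Delta> x = s * (sqpow 0 N - 1) + sqpow 1 N * (c \<bullet> x)"
        by (simp add: \<Delta>_def E_inner s_def c_def N_def algebra_simps)
      have "s * ((sqpow 0 N - 1) / N + 1 / 2) + (c \<bullet> x) * ((sqpow 1 N - 1) / N)
          = (s * (sqpow 0 N - 1) + sqpow 1 N * (c \<bullet> x) - c \<bullet> x + s * N / 2) / N"
        using n unfolding N_def[symmetric] by (simp add: field_simps)
      then show "s * ((sqpow 0 ((norm x)\<^sup>2) - 1) / (norm x)\<^sup>2 + 1 / 2)
        + (c \<bullet> x) * ((sqpow 1 ((norm x)\<^sup>2) - 1) / (norm x)\<^sup>2) = U x"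
        unfolding U_def \<Delta>x N_def .
    qed simp
    ultimately have "(U \<longlongrightarrow> s * (- 1 / 2 + 1 / 2) + (c \<bullet> 0) * sqpow1 1 0) (at 0)"
      by (rule Lim_transform_eventually)
    then show ?thesis by simp
  qed
  have V: "((\<lambda>x. 2 * (norm x * \<bar>U x - s / 2\<bar>)) \<longlongrightarrow> 2 * (0 * \<bar>0 - s / 2\<bar>)) (at 0)"
    by (intro tendsto_mult tendsto_const norm_tendsto_0 tendsto_rabs tendsto_diff Ulim)
  \<comment> \<open>Difference of squares: one factor is |x|^2 (U x - s/2), the other at most 2
    |x|.\<close>
  have V': "((\<lambda>x. ((\<Delta> x)\<^sup>2 - (c \<bullet> x)\<^sup>2) / (norm x)\<^sup>2) \<longlongrightarrow> 0) (at 0)"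
  proof (rule Lim_null_comparison)
    show "((\<lambda>x. 2 * (norm x * \<bar>U x - s / 2\<bar>)) \<longlongrightarrow> 0) (at 0)" using V by simp
    show "\<forall>\<^sub>F x in at 0. norm (((\<Delta> x)\<^sup>2 - (c \<bullet> x)\<^sup>2) / (norm x)\<^sup>2) \<le> 2 * (norm x * \<bar>U x - s / 2\<bar>)"
      unfolding eventually_at
    proof (intro exI[of _ 1] conjI ballI impI)
      fix x :: "real ^ 'd" assume "x \<noteq> 0 \<and> dist x 0 < 1"
      then have n: "norm x > 0" by simp
      have "\<Delta> x - c \<bullet> x = (norm x)\<^sup>2 * (U x - s / 2)" using n by (simp add: U_def field_simps)
      then have "(\<Delta> x)\<^sup>2 - (c \<bullet> x)\<^sup>2 = (norm x)\<^sup>2 * (U x - s / 2) * (\<Delta> x + c \<bullet> x)"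
        by (metis mult.commute power2_eq_square square_diff_square_factored)
      then have "((\<Delta> x)\<^sup>2 - (c \<bullet> x)\<^sup>2) / (norm x)\<^sup>2 = (U x - s / 2) * (\<Delta> x + c \<bullet> x)" using n by simp
      then have "norm (((\<Delta> x)\<^sup>2 - (c \<bullet> x)\<^sup>2) / (norm x)\<^sup>2) = \<bar>U x - s / 2\<bar> * \<bar>\<Delta> x + c \<bullet> x\<bar>" by (simp add: abs_mult)
      also have "\<dots> \<le> \<bar>U x - s / 2\<bar> * (2 * norm x)" using \<Delta>b[of x] cb[of x] by (intro mult_left_mono) auto
      finally show "norm (((\<Delta> x)\<^sup>2 - (c \<bullet> x)\<^sup>2) / (norm x)\<^sup>2) \<le> 2 * (norm x * \<bar>U x - s / 2\<bar>)" by (simp add: mult_ac)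
    qed simp
  qed
  have T: "((\<lambda>x. R (\<Delta> x) * ((\<Delta> x)\<^sup>2 / (norm x)\<^sup>2)) \<longlongrightarrow> 0) (at 0)"
  proof (rule Lim_null_comparison)
    show "((\<lambda>x. \<bar>R (\<Delta> x)\<bar>) \<longlongrightarrow> 0) (at 0)" using tendsto_rabs[OF R\<Delta>] by simp
    show "\<forall>\<^sub>F x in at 0. norm (R (\<Delta> x) * ((\<Delta> x)\<^sup>2 / (norm x)\<^sup>2)) \<le> \<bar>R (\<Delta> x)\<bar>"
    proof (rule always_eventually, rule allI)
      fix x
      have "(\<Delta> x)\<^sup>2 \<le> (norm x)\<^sup>2" using \<Delta>b[of x] by (intro iffD1[OF abs_le_square_iff]) simp
      then have "(\<Delta> x)\<^sup>2 / (norm x)\<^sup>2 \<le> 1" by (cases "x = 0") (auto simp: divide_le_eq_1)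
      then show "norm (R (\<Delta> x) * ((\<Delta> x)\<^sup>2 / (norm x)\<^sup>2)) \<le> \<bar>R (\<Delta> x)\<bar>"
        using mult_left_mono[of "(\<Delta> x)\<^sup>2 / (norm x)\<^sup>2" 1 "\<bar>R (\<Delta> x)\<bar>"] by (simp add: abs_mult)
    qed
  qed
  have "((\<lambda>x. (- 2 * A) * U x + (a2 / 2) * (((\<Delta> x)\<^sup>2 - (c \<bullet> x)\<^sup>2) / (norm x)\<^sup>2) + R (\<Delta> x) * ((\<Delta> x)\<^sup>2 / (norm x)\<^sup>2))
      \<longlongrightarrow> (- 2 * A) * 0 + (a2 / 2) * 0 + 0) (at 0)"
    by (intro tendsto_add tendsto_mult tendsto_const Ulim V' T)
  moreover have "\<forall>\<^sub>F x in at 0. (- 2 * A) * U x + (a2 / 2) * (((\<Delta> x)\<^sup>2 - (c \<bullet> x)\<^sup>2) / (norm x)\<^sup>2) + R (\<Delta> x) * ((\<Delta> x)\<^sup>2 / (norm x)\<^sup>2)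
      = (h x q - h 0 q - g q \<bullet> x - (x \<bullet> (Hess q *v x)) / 2) / (norm x)\<^sup>2"
    unfolding eventually_at
  proof (intro exI[of _ 1] conjI ballI impI)
    fix x :: "real ^ 'd" assume "x \<noteq> 0 \<and> dist x 0 < 1"
    then have n: "(norm x)\<^sup>2 \<noteq> 0" by simp
    have RD: "R (\<Delta> x) * (\<Delta> x)\<^sup>2 = a (s + \<Delta> x) - a s - (- 2 * A) * \<Delta> x - a2 * (\<Delta> x)\<^sup>2 / 2"
      by (cases "\<Delta> x = 0") (simp_all add: R_def)
    have hx: "h x q = a (s + \<Delta> x)" "h 0 q = a s" by (simp_all add: h_def a_def \<Delta>_def s_def)
    have gx: "g q \<bullet> x = (- 2 * A) * (c \<bullet> x)" by (simp add: g_def A_def s_def c_def)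
    have Hx: "(x \<bullet> (Hess q *v x)) / 2 = a2 * (c \<bullet> x)\<^sup>2 / 2 + A * s * (norm x)\<^sup>2"
    proof -
      have "x \<bullet> (Hess q *v x) = a2 * (c \<bullet> x)\<^sup>2 + 2 * A * s * (norm x)\<^sup>2"
        unfolding Hess_quadratic[OF False] a2_def A_def s_def c_def by (rule refl)
      then show ?thesis by simp
    qed
    have UN: "(norm x)\<^sup>2 * U x = \<Delta> x - c \<bullet> x + s * (norm x)\<^sup>2 / 2" using n by (simp add: U_def)
    define N where "N = (norm x)\<^sup>2"
    have "((- 2 * A) * U x + (a2 / 2) * (((\<Delta> x)\<^sup>2 - (c \<bullet> x)\<^sup>2) / N) + R (\<Delta> x) * ((\<Delta> x)\<^sup>2 / N)) * N
        = (- 2 * A) * (N * U x) + (a2 / 2) * ((\<Delta> x)\<^sup>2 - (c \<bullet> x)\<^sup>2) + R (\<Delta> x) * (\<Delta> x)\<^sup>2"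
      using n unfolding N_def[symmetric] by (simp add: field_simps)
    also have "\<dots> = h x q - h 0 q - g q \<bullet> x - (x \<bullet> (Hess q *v x)) / 2"
      unfolding N_def UN RD hx gx Hx by (simp add: algebra_simps)
    finally have fin: "((- 2 * A) * U x + (a2 / 2) * (((\<Delta> x)\<^sup>2 - (c \<bullet> x)\<^sup>2) / N) + R (\<Delta> x) * ((\<Delta> x)\<^sup>2 / N)) * N
        = h x q - h 0 q - g q \<bullet> x - (x \<bullet> (Hess q *v x)) / 2" .
    show "(- 2 * A) * U x + (a2 / 2) * (((\<Delta> x)\<^sup>2 - (c \<bullet> x)\<^sup>2) / (norm x)\<^sup>2) + R (\<Delta> x) * ((\<Delta> x)\<^sup>2 / (norm x)\<^sup>2)
      = (h x q - h 0 q - g q \<bullet> x - (x \<bullet> (Hess q *v x)) / 2) / (norm x)\<^sup>2"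
      using n unfolding N_def[symmetric] by (rule nonzero_eq_divide_eq[THEN iffD2]) (rule fin)
  qed simp
  ultimately have "((\<lambda>x. (h x q - h 0 q - g q \<bullet> x - (x \<bullet> (Hess q *v x)) / 2) / (norm x)\<^sup>2) \<longlongrightarrow> (- 2 * A) * 0 + (a2 / 2) * 0 + 0) (at 0)"
    by (rule Lim_transform_eventually)
  then show ?thesis by simp
qed

text \<open>\<open>hh\<close> is any function that agrees with h on the unit ball. It stands for the
  squared distance read through the inverse chart, for which the exponential formula is available
  only inside the injectivity radius.\<close>

lemma partial_deriv_h:
  assumes hh: "\<And>x. norm x < 1 \<Longrightarrow> hh x = h x q" and q: "norm q = 1"
    and x: "norm x < 1" "\<bar>E x \<bullet> q\<bar> < 1"
  shows "partial_deriv r hh x = - 2 * arccos_ratio (E x \<bullet> q) * (E' x (axis r 1) 0 \<bullet> q)"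
proof -
  interpret c: sphere_curve_point "\<lambda>t. E (x + t *\<^sub>R axis r 1)" "E' x (axis r 1)" "E'' x (axis r 1)" q
    by (rule curve_point[OF q])
  have "open ((\<lambda>t :: real. x + t *\<^sub>R axis r 1) -` ball 0 1)"
    by (intro continuous_open_vimage open_ball continuous_intros)
  then have "(hh \<circ> (\<lambda>t. x + t *\<^sub>R axis r 1) has_real_derivative c.d' 0) (at 0)"
  proof (rule has_field_derivative_transform_within_open[rotated])
    show "(c.d has_real_derivative c.d' 0) (at 0)" by (rule c.deriv_d(1)) (use x in \<open>simp add: c.s_def\<close>)
  qed (use x hh in \<open>auto simp: c.d_def c.s_def h_def\<close>)
  then show ?thesis
    unfolding partial_deriv_def comp_def by (simp add: DERIV_imp_deriv c.d'_def c.s_def c.s'_def)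
qed

lemma partial_deriv_h_\<mu>:
  assumes hh: "\<And>x. norm x < 1 \<Longrightarrow> hh x = h x \<mu>" and x: "norm x < 1"
  shows "partial_deriv r hh x = 2 * x $ r"
proof -
  have "open ((\<lambda>t :: real. x + t *\<^sub>R axis r 1) -` ball 0 1)"
    by (intro continuous_open_vimage open_ball continuous_intros)
  then have "(hh \<circ> (\<lambda>t. x + t *\<^sub>R axis r 1) has_real_derivative 2 * x $ r) (at 0)"
  proof (rule has_field_derivative_transform_within_open[rotated])
    show "((\<lambda>t. (norm (x + t *\<^sub>R axis r 1))\<^sup>2) has_real_derivative 2 * x $ r) (at 0)"
      using deriv_norm2[of x "axis r 1" 0] by (simp add: \<tau>'_def inner_axis)
    fix t assume "t \<in> (\<lambda>t :: real. x + t *\<^sub>R axis r 1) -` ball 0 1"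
    then have "norm (x + t *\<^sub>R axis r 1) < 1" by simp
    moreover from this have "norm (x + t *\<^sub>R axis r 1) < pi" using pi_gt3 by linarith
    ultimately show "(norm (x + t *\<^sub>R axis r 1))\<^sup>2 = (hh \<circ> (\<lambda>t. x + t *\<^sub>R axis r 1)) t"
      using hh h_\<mu> by simp
  qed (use x in auto)
  then show ?thesis unfolding partial_deriv_def comp_def by (rule DERIV_imp_deriv)
qed

lemma partial_deriv_h_0:
  assumes hh: "\<And>x. norm x < 1 \<Longrightarrow> hh x = h x q" and q: "norm q = 1" "q \<noteq> - \<mu>"
  shows "partial_deriv r hh 0 = g q $ r"
proof (cases "q = \<mu>")
  case True
  have "arccos_ratio 1 = 0" by (simp add: arccos_ratio_def)
  then show ?thesis using True \<mu>\<mu> partial_deriv_h_\<mu>[of hh 0 r] hh by (simp add: g_def)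
next
  case False
  have "\<bar>E 0 \<bullet> q\<bar> < 1" using \<mu>_inner_lt[OF q(1) False q(2)] by simp
  from partial_deriv_h[OF hh q(1) _ this, of r] show ?thesis
    by (simp add: E'_0 g_def inner_commute[of "X _"] inner_X inner_axis)
qed

text \<open>The outer derivative is taken of the inner partial derivative along the axis r. The
  closed form of the latter holds only near 0, while the curve stays in the unit ball and avoids q
  and - q, so the two functions are identified locally before differentiating.\<close>

lemma partial_deriv2_h_0:
  assumes hh: "\<And>x. norm x < 1 \<Longrightarrow> hh x = h x q" and q: "norm q = 1" "q \<noteq> - \<mu>"
  shows "partial_deriv r (partial_deriv r' hh) 0 = Hess q $ r $ r'"
proof (cases "q = \<mu>")
  case True
  have "((\<lambda>t. partial_deriv r' hh (0 + t *\<^sub>R axis r 1)) has_real_derivative (if r = r' then 2 else 0)) (at 0)"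
  proof (rule has_field_derivative_transform_within_open[where S = "{- 1<..<1}"])
    show "((\<lambda>t :: real. 2 * (t *\<^sub>R axis r 1) $ r') has_real_derivative (if r = r' then 2 else 0)) (at 0)"
      by (auto intro!: derivative_eq_intros simp: axis_def)
    fix t :: real assume "t \<in> {- 1<..<1}"
    then have "norm (0 + t *\<^sub>R axis r 1 :: real ^ 'd) < 1" by (simp add: norm_axis_1 abs_less_iff)
    then show "2 * (t *\<^sub>R axis r 1) $ r' = partial_deriv r' hh (0 + t *\<^sub>R axis r 1)"
      using partial_deriv_h_\<mu>[of hh "0 + t *\<^sub>R axis r 1" r'] hh True by simp
  qed auto
  then have "partial_deriv r (partial_deriv r' hh) 0 = (if r = r' then 2 else 0)"
    unfolding partial_deriv_def[of r] by (rule DERIV_imp_deriv)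
  then show ?thesis using True by (simp add: Hess_def mat_def)
next
  case False
  define s where "s = \<mu> \<bullet> q"
  have s1: "\<bar>s\<bar> < 1" using \<mu>_inner_lt[OF q(1) False q(2)] by (simp add: s_def)
  define cr where "cr = coords q $ r"
  define cr' where "cr' = coords q $ r'"
  define \<delta> :: real where "\<delta> = (if r = r' then 1 else 0)"
  interpret c: sphere_curve_point "\<lambda>t. E (0 + t *\<^sub>R axis r 1)" "E' 0 (axis r 1)" "E'' 0 (axis r 1)" q
    by (rule curve_point[OF q(1)])
  have cs0: "c.s 0 = s" unfolding c.s_def s_def by simp
  have cs'0: "c.s' 0 = cr"
    unfolding c.s'_def E'_0 cr_def by (simp add: inner_commute[of "X _"] inner_X inner_axis)
  \<comment> \<open>The inner product with q of the derivative of E in direction r' at the point t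
    on the axis r.\<close>
  define k where "k t = (sqpow1 0 (t\<^sup>2) * (2 * (t * \<delta>))) * s + (sqpow1 1 (t\<^sup>2) * (2 * (t * \<delta>))) * (t * cr) + sqpow 1 (t\<^sup>2) * cr'" for t
  have k: "E' (0 + t *\<^sub>R axis r 1) (axis r' 1) 0 \<bullet> q = k t" for t
  proof -
    have n: "(norm (t *\<^sub>R axis r 1 :: real ^ 'd))\<^sup>2 = t\<^sup>2" by (simp add: norm_axis_1)
    have d: "\<tau>' (t *\<^sub>R axis r 1) (axis r' 1) 0 = 2 * (t * \<delta>)"
      by (simp add: \<tau>'_def \<delta>_def inner_axis_axis)
    have X1: "X (t *\<^sub>R axis r 1) \<bullet> q = t * cr" and X2: "X (axis r' 1) \<bullet> q = cr'"
      by (simp_all add: inner_commute[of "X _"] inner_X inner_axis cr_def cr'_def)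
    show ?thesis unfolding E'_def Let_def k_def
      by (simp only: scaleR_zero_left add_0_right add_0_left n d inner_add_left inner_scaleR_left X1 X2 s_def)
  qed
  have kd: "(k has_real_derivative (- \<delta> * s)) (at 0)"
    unfolding k_def[abs_def] by (auto intro!: derivative_eq_intros simp: sqpow_at_0)
  have "((\<lambda>t. - 2 * arccos_ratio (c.s t) * k t) has_real_derivative
      (- 2 * ((s * arccos_ratio s - 1) / (1 - s\<^sup>2) * cr)) * k 0 + (- \<delta> * s) * (- 2 * arccos_ratio (c.s 0))) (at 0)"
  proof (intro DERIV_mult DERIV_cmult kd)
    have "((\<lambda>t. arccos_ratio (c.s t)) has_real_derivative (s * arccos_ratio s - 1) / (1 - s\<^sup>2) * c.s' 0) (at 0)"
      using arccos_ratio_deriv(1)[OF s1] cs0 by (intro DERIV_chain2[where g = c.s] c.deriv_s) simp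
    then show "((\<lambda>t. arccos_ratio (c.s t)) has_real_derivative (s * arccos_ratio s - 1) / (1 - s\<^sup>2) * cr) (at 0)"
      by (simp add: cs'0)
  qed
  moreover have "(- 2 * ((s * arccos_ratio s - 1) / (1 - s\<^sup>2) * cr)) * k 0 + (- \<delta> * s) * (- 2 * arccos_ratio (c.s 0)) = Hess q $ r $ r'"
  proof -
    have "k 0 = cr'" by (simp add: k_def sqpow_at_0)
    moreover have "Hess q $ r $ r' = 2 * (1 - s * arccos_ratio s) / (1 - s\<^sup>2) * (cr * cr') + \<delta> * (2 * arccos_ratio s * s)"
      using False by (simp add: Hess_def Let_def s_def cr_def cr'_def \<delta>_def)
    moreover have "- 2 * ((s * arccos_ratio s - 1) / (1 - s\<^sup>2)) = 2 * (1 - s * arccos_ratio s) / (1 - s\<^sup>2)"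
      by (simp add: minus_divide_left)
    ultimately show ?thesis unfolding cs0 by (simp add: mult_ac)
  qed
  ultimately have D: "((\<lambda>t. - 2 * arccos_ratio (c.s t) * k t) has_real_derivative Hess q $ r $ r') (at 0)" by simp
  have "isCont c.s 0" by (rule DERIV_isCont[OF c.deriv_s(1)])
  then have "(c.s \<longlongrightarrow> s) (nhds 0)" using cs0 by (simp add: isCont_def tendsto_at_iff_tendsto_nhds)
  then have "((\<lambda>t. \<bar>c.s t\<bar>) \<longlongrightarrow> \<bar>s\<bar>) (nhds 0)" by (rule tendsto_rabs)
  then have ev1: "\<forall>\<^sub>F t in nhds 0. \<bar>c.s t\<bar> < 1" using s1 by (rule order_tendstoD(2))
  have ev2: "\<forall>\<^sub>F t :: real in nhds 0. t \<in> {- 1<..<1}" by (rule eventually_nhds_in_open) auto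
  have "\<forall>\<^sub>F t in nhds 0. - 2 * arccos_ratio (c.s t) * k t = partial_deriv r' hh (0 + t *\<^sub>R axis r 1)"
    using ev1 ev2
  proof eventually_elim
    case (elim t)
    have "norm (0 + t *\<^sub>R axis r 1 :: real ^ 'd) < 1" using elim(2) by (simp add: norm_axis_1 abs_less_iff)
    from partial_deriv_h[OF hh q(1) this, of r'] elim(1) show ?case
      unfolding k c.s_def by simp
  qed
  then have "((\<lambda>t. partial_deriv r' hh (0 + t *\<^sub>R axis r 1)) has_real_derivative Hess q $ r $ r') (at 0)"
    using D by (subst DERIV_cong_ev[OF refl _ refl, where g = "\<lambda>t. - 2 * arccos_ratio (c.s t) * k t"]) (auto elim: eventually_mono)
  then show ?thesis unfolding partial_deriv_def[of r] by (rule DERIV_imp_deriv)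
qed

end

section \<open>Spherical caps\<close>

lemma sgn_measurable_sphere:
  "sgn \<in> restrict_space lborel (cball 0 1 - {0}) \<rightarrow>\<^sub>M (sphere_borel :: 'a::euclidean_space measure)"
proof (rule measurable_restrict_space2)
  show "sgn \<in> space (restrict_space lborel (cball 0 1 - {0})) \<rightarrow> sphere (0 :: 'a) 1"
    by (auto simp: space_restrict_space norm_sgn)
  have "(\<lambda>x :: 'a. x /\<^sub>R norm x) \<in> borel_measurable lborel" by measurable
  then show "sgn \<in> restrict_space lborel (cball 0 1 - {0}) \<rightarrow>\<^sub>M (borel :: 'a measure)"
    unfolding sgn_div_norm[abs_def] by (rule measurable_restrict_space1)
qed

lemma sets_sphere_volume: "sets sphere_volume = sets sphere_borel"
  by (simp add: sphere_volume_def)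

lemma cap_in_sphere_borel: "{q \<in> sphere 0 1. norm (q + \<mu>) \<le> \<rho>} \<in> sets (sphere_borel :: 'a::euclidean_space measure)"
proof -
  have "{q :: 'a. norm (q + \<mu>) \<le> \<rho>} \<in> sets borel"
    by (intro borel_closed closed_Collect_le continuous_intros)
  moreover have "{q \<in> sphere 0 1. norm (q + \<mu>) \<le> \<rho>} = sphere 0 1 \<inter> {q :: 'a. norm (q + \<mu>) \<le> \<rho>}" by auto
  ultimately show ?thesis by (simp add: sets_restrict_space)
qed

text \<open>The cone over a cap of radius \<open>\<rho>\<close> is covered by about \<open>1 / \<rho>\<close> balls of radius \<open>2 \<rho>\<close>
  centred on the axis.\<close>

lemma sphere_volume_cap:
  fixes \<mu> :: "'a::euclidean_space"
  assumes \<mu>: "norm \<mu> = 1" and dim: "DIM('a) \<ge> 3"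
  obtains C where "C \<ge> 0"
    "\<And>\<rho>. 0 < \<rho> \<Longrightarrow> \<rho> \<le> 1 \<Longrightarrow> emeasure sphere_volume {q \<in> sphere 0 1. norm (q + \<mu>) \<le> \<rho>} \<le> ennreal (C * \<rho>\<^sup>2)"
proof
  let ?v = "unit_ball_vol (real DIM('a))"
  have v0: "?v \<ge> 0" by simp
  show "real DIM('a) * (3 * ?v * 2 ^ DIM('a)) \<ge> 0" using v0 by simp
  fix \<rho> :: real assume \<rho>: "0 < \<rho>" "\<rho> \<le> 1"
  define A where "A = {q \<in> sphere 0 1. norm (q + \<mu>) \<le> \<rho>}"
  have A: "A \<in> sets sphere_borel" unfolding A_def by (rule cap_in_sphere_borel)
  define B where "B = cball (0 :: 'a) 1 - {0}"
  have Bb: "B \<in> sets lborel" by (simp add: B_def)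
  define N where "N = nat \<lceil>1 / \<rho>\<rceil>"
  have N: "1 / \<rho> \<le> real N" "real N \<le> 1 / \<rho> + 1" using \<rho> by (simp_all add: N_def) 
  have Npos: "real N > 0" using N(1) \<rho> by (smt (verit) divide_pos_pos)
  have N\<rho>: "1 / real N \<le> \<rho>" using N(1) \<rho> Npos by (simp add: field_simps)
  \<comment> \<open>One \<rho> for the distance of z to the axis point of the same norm, one for
    rounding that norm to the grid of mesh 1/N \<le> \<rho>; hence the radius 2 \<rho>.\<close>
  let ?c = "\<lambda>i :: nat. cball (- (real i / real N) *\<^sub>R \<mu>) (2 * \<rho>)"
  have cover: "sgn -` A \<inter> B \<subseteq> (\<Union>i\<in>{..N}. ?c i)"
  proof
    fix z assume z: "z \<in> sgn -` A \<inter> B"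
    then have z1: "norm z \<le> 1" "z \<noteq> 0" "norm (sgn z + \<mu>) \<le> \<rho>" by (auto simp: A_def B_def)
    define i where "i = nat \<lfloor>norm z * real N\<rfloor>"
    have nz: "norm z * real N \<ge> 0" by simp
    have i1: "real i \<le> norm z * real N" "norm z * real N < real i + 1" using nz by (simp_all add: i_def)
    have "norm z * real N \<le> 1 * real N" using z1 by (intro mult_right_mono) auto
    then have iN: "i \<le> N" using i1(1) by simp
    have "norm (z + norm z *\<^sub>R \<mu>) \<le> \<rho>"
    proof -
      have "z + norm z *\<^sub>R \<mu> = norm z *\<^sub>R (sgn z + \<mu>)" using z1 by (simp add: sgn_div_norm scaleR_add_right)
      then have "norm (z + norm z *\<^sub>R \<mu>) = norm z * norm (sgn z + \<mu>)" by simp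
      also have "\<dots> \<le> 1 * \<rho>" using z1 by (intro mult_mono) auto
      finally show ?thesis by simp
    qed
    moreover have "norm ((real i / real N) *\<^sub>R \<mu> - norm z *\<^sub>R \<mu>) \<le> \<rho>"
    proof -
      have "norm ((real i / real N) *\<^sub>R \<mu> - norm z *\<^sub>R \<mu>) = \<bar>real i / real N - norm z\<bar>"
        using \<mu> by (simp flip: scaleR_diff_left)
      also have "\<dots> \<le> 1 / real N"
      proof -
        have "real i / real N \<le> norm z" using i1(1) Npos by (simp add: pos_divide_le_eq)
        moreover have "norm z \<le> real i / real N + 1 / real N"
          using i1(2) Npos by (simp add: pos_le_divide_eq flip: add_divide_distrib)
        ultimately show ?thesis by linarith
      qed
      finally show ?thesis using N\<rho> by simp
    qed
    ultimately have "norm (z + (real i / real N) *\<^sub>R \<mu>) \<le> 2 * \<rho>"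
      using norm_triangle_ineq[of "z + norm z *\<^sub>R \<mu>" "(real i / real N) *\<^sub>R \<mu> - norm z *\<^sub>R \<mu>"] by simp
    then have "z \<in> ?c i" by (simp add: dist_norm norm_minus_commute add.commute)
    then show "z \<in> (\<Union>i\<in>{..N}. ?c i)" using iN by blast
  qed
  have sA: "sgn -` A \<inter> B \<in> sets lborel"
  proof -
    have "sgn -` A \<inter> space (restrict_space lborel B) \<in> sets (restrict_space lborel B)"
      using measurable_sets[OF sgn_measurable_sphere A] by (simp add: B_def)
    then have "sgn -` A \<inter> B \<in> sets (restrict_space lborel B)" by (simp add: space_restrict_space)
    then show ?thesis using Bb by (simp add: sets_restrict_space_iff)
  qed
  have "emeasure lborel (sgn -` A \<inter> B) \<le> emeasure lborel (\<Union>i\<in>{..N}. ?c i)"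
    by (rule emeasure_mono[OF cover]) auto
  also have "\<dots> \<le> (\<Sum>i\<in>{..N}. emeasure lborel (?c i))"
    by (rule emeasure_subadditive_finite) auto
  also have "\<dots> = (\<Sum>i\<in>{..N}. ennreal (?v * (2 * \<rho>) ^ DIM('a)))"
    using \<rho> by (intro sum.cong refl emeasure_cball) simp
  also have "\<dots> = ennreal (real (N + 1) * (?v * (2 * \<rho>) ^ DIM('a)))"
    using v0 \<rho> by (simp add: ennreal_mult ennreal_of_nat_eq_real_of_nat mult_ac)
  also have "\<dots> \<le> ennreal (3 * ?v * 2 ^ DIM('a) * \<rho>\<^sup>2)"
  proof (rule ennreal_leI)
    \<comment> \<open>At most 3/\<rho> balls with volume of order \<rho>^D, D being the ambient
      dimension, give order \<rho>^(D - 1), which is at most order \<rho>^2 as D \<ge> 3 and \<rho>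
      \<le> 1.\<close>
    have "real (N + 1) \<le> 3 / \<rho>"
    proof -
      have "1 \<le> 1 / \<rho>" using \<rho> by simp
      then show ?thesis using N(2) by simp
    qed
    then have "real (N + 1) * (?v * (2 * \<rho>) ^ DIM('a)) \<le> 3 / \<rho> * (?v * (2 * \<rho>) ^ DIM('a))"
      using v0 \<rho> by (intro mult_right_mono) auto
    also have "\<dots> = 3 * ?v * 2 ^ DIM('a) * (\<rho> ^ DIM('a) / \<rho>)" by (simp add: power_mult_distrib)
    also have "\<dots> \<le> 3 * ?v * 2 ^ DIM('a) * \<rho>\<^sup>2"
    proof (rule mult_left_mono)
      have "\<rho> ^ DIM('a) \<le> \<rho> ^ 3" using \<rho> dim by (intro power_decreasing) auto
      then show "\<rho> ^ DIM('a) / \<rho> \<le> \<rho>\<^sup>2" using \<rho> by (simp add: pos_divide_le_eq power2_eq_square power3_eq_cube)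
    qed (use v0 in simp)
    finally show "real (N + 1) * (?v * (2 * \<rho>) ^ DIM('a)) \<le> 3 * ?v * 2 ^ DIM('a) * \<rho>\<^sup>2" .
  qed
  finally have lb: "emeasure lborel (sgn -` A \<inter> B) \<le> ennreal (3 * ?v * 2 ^ DIM('a) * \<rho>\<^sup>2)" .
  have "emeasure sphere_volume A = ennreal (real DIM('a)) * emeasure lborel (sgn -` A \<inter> B)"
  proof -
    have "emeasure (distr (restrict_space lborel B) sphere_borel sgn) A
        = emeasure (restrict_space lborel B) (sgn -` A \<inter> space (restrict_space lborel B))"
      using sgn_measurable_sphere A unfolding B_def by (rule emeasure_distr)
    also have "\<dots> = emeasure lborel (sgn -` A \<inter> B)"
      using Bb by (simp add: space_restrict_space emeasure_restrict_space)
    finally show ?thesis using A unfolding sphere_volume_def B_def by simp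
  qed
  also have "\<dots> \<le> ennreal (real DIM('a)) * ennreal (3 * ?v * 2 ^ DIM('a) * \<rho>\<^sup>2)"
    by (intro mult_left_mono lb) simp
  also have "\<dots> = ennreal (real DIM('a) * (3 * ?v * 2 ^ DIM('a)) * \<rho>\<^sup>2)"
    using v0 by (simp add: ennreal_mult[symmetric] mult_ac)
  finally show "emeasure sphere_volume {q \<in> sphere 0 1. norm (q + \<mu>) \<le> \<rho>}
      \<le> ennreal (real DIM('a) * (3 * ?v * 2 ^ DIM('a)) * \<rho>\<^sup>2)" by (simp add: A_def)
qed

text \<open>A closed ball about - mu inside the open set that cuts out W meets the sphere in a
  compact set, where the continuous density is bounded; the volume of caps does the rest.\<close>

lemma density_cap_bound:
  fixes Q :: "'a::euclidean_space measure" and \<mu> :: 'a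
  assumes \<mu>: "norm \<mu> = 1" and dim: "DIM('a) \<ge> 3"
    and Q: "prob_space Q" "sets Q = sets sphere_borel"
    and W: "openin (top_of_set (sphere 0 1)) W" "- \<mu> \<in> W"
    and f: "continuous_on W f" "\<forall>q\<in>W. 0 \<le> f q"
    and dens: "restrict_space Q W = density (restrict_space sphere_volume W) (\<lambda>q. ennreal (f q))"
  obtains C \<rho>0 where "C \<ge> 0" "0 < \<rho>0"
    "\<And>\<rho>. 0 < \<rho> \<Longrightarrow> \<rho> < \<rho>0 \<Longrightarrow> measure Q {q \<in> space Q. norm (q + \<mu>) \<le> \<rho>} \<le> C * \<rho>\<^sup>2"
proof -
  interpret prob_space Q by fact
  have spQ: "space Q = sphere 0 1" using sets_eq_imp_space_eq[OF Q(2)] by (simp add: space_restrict_space)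
  obtain U where U: "open U" "W = sphere 0 1 \<inter> U" using W(1) by (auto simp: openin_open)
  have WU: "W \<in> sets sphere_borel" using U by (auto simp: sets_restrict_space)
  obtain r where r: "r > 0" "cball (- \<mu>) r \<subseteq> U" using U W(2) open_contains_cball by blast
  have cap: "{q \<in> sphere 0 1. norm (q + \<mu>) \<le> \<rho>} \<subseteq> W" if "\<rho> \<le> r" for \<rho>
    using r(2) that unfolding U(2) by (auto simp: subset_iff dist_norm norm_minus_commute add.commute)
  have K: "compact (sphere 0 1 \<inter> cball (- \<mu>) r)" by (intro compact_Int compact_sphere compact_cball)
  have "sphere 0 1 \<inter> cball (- \<mu>) r \<subseteq> W" using r(2) U(2) by auto
  then have "continuous_on (sphere 0 1 \<inter> cball (- \<mu>) r) f" using f(1) continuous_on_subset by blast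
  from compact_imp_bounded[OF compact_continuous_image[OF this K]]
  obtain b where "\<forall>y\<in>f ` (sphere 0 1 \<inter> cball (- \<mu>) r). norm y \<le> b" unfolding bounded_iff by blast
  then have b: "\<bar>f q\<bar> \<le> b" if "q \<in> sphere 0 1 \<inter> cball (- \<mu>) r" for q using that by force
  obtain C where C: "C \<ge> 0"
    "\<And>\<rho>. 0 < \<rho> \<Longrightarrow> \<rho> \<le> 1 \<Longrightarrow> emeasure sphere_volume {q \<in> sphere 0 1. norm (q + \<mu>) \<le> \<rho>} \<le> ennreal (C * \<rho>\<^sup>2)"
    using sphere_volume_cap[OF \<mu> dim] by blast
  define b' where "b' = max b 0"
  have b'0: "b' \<ge> 0" by (simp add: b'_def)
  show thesis
  proof (rule that[of "b' * C" "min 1 r"])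
    fix \<rho> assume \<rho>: "0 < \<rho>" "\<rho> < min 1 r"
    define A where "A = {q \<in> sphere 0 1. norm (q + \<mu>) \<le> \<rho>}"
    have A: "A \<in> sets sphere_borel" unfolding A_def by (rule cap_in_sphere_borel)
    have AW: "A \<subseteq> W" using cap[of \<rho>] \<rho> by (simp add: A_def)
    have AWs: "A \<in> sets (restrict_space sphere_volume W)"
      using A AW WU by (simp add: sets_restrict_space_iff sets_sphere_volume)
    have fm: "f \<in> borel_measurable (restrict_space sphere_volume W)"
    proof -
      have "sets (restrict_space sphere_volume W) = sets (restrict_space borel W)"
      proof -
        have "restrict_space sphere_borel W = restrict_space borel (sphere 0 1 \<inter> W)"
          using U by (intro restrict_restrict_space) auto
        moreover have "sphere 0 1 \<inter> W = W" using U(2) by auto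
        ultimately show ?thesis using sets_restrict_space_cong[OF sets_sphere_volume, of W] by simp
      qed
      then show ?thesis
        using borel_measurable_continuous_on_restrict[OF f(1)] measurable_cong_sets by blast
    qed
    have "emeasure Q A = emeasure (restrict_space Q W) A"
      using AW WU by (simp add: emeasure_restrict_space Q(2))
    also have "\<dots> = (\<integral>\<^sup>+q. ennreal (f q) * indicator A q \<partial>restrict_space sphere_volume W)"
      unfolding dens using fm AWs by (intro emeasure_density) auto
    also have "\<dots> \<le> (\<integral>\<^sup>+q. ennreal b' * indicator A q \<partial>restrict_space sphere_volume W)"
    proof (rule nn_integral_mono)
      fix q
      show "ennreal (f q) * indicator A q \<le> ennreal b' * indicator A q"
      proof (cases "q \<in> A")
        case True
        then have "q \<in> sphere 0 1 \<inter> cball (- \<mu>) r"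
          using \<rho> by (auto simp: A_def dist_norm norm_minus_commute add.commute)
        then have "f q \<le> b'" using b[of q] by (simp add: b'_def abs_le_iff)
        then show ?thesis using True by (simp add: ennreal_leI)
      qed simp
    qed
    also have "\<dots> = ennreal b' * emeasure (restrict_space sphere_volume W) A"
      using AWs by (rule nn_integral_cmult_indicator)
    also have "emeasure (restrict_space sphere_volume W) A = emeasure sphere_volume A"
      using AW WU by (simp add: emeasure_restrict_space sets_sphere_volume)
    also have "ennreal b' * emeasure sphere_volume A \<le> ennreal b' * ennreal (C * \<rho>\<^sup>2)"
      unfolding A_def using \<rho> by (intro mult_left_mono C(2)) auto
    also have "\<dots> = ennreal (b' * C * \<rho>\<^sup>2)" using C(1) b'0 by (simp add: ennreal_mult[symmetric] mult_ac)
    finally have "measure Q A \<le> b' * C * \<rho>\<^sup>2"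
      using C(1) b'0 by (simp add: emeasure_eq_measure)
    then show "measure Q {q \<in> space Q. norm (q + \<mu>) \<le> \<rho>} \<le> b' * C * \<rho>\<^sup>2" by (simp add: A_def spQ)
  qed (use C r in \<open>auto simp: b'_def\<close>)
qed

text \<open>Dyadic layers: where u is about \<rho> k the function 1/u is at most 2 / \<rho> k, and
  that layer has probability at most C (\<rho> k)^2. The products are of order \<rho> k, a geometric
  series.\<close>

lemma integrable_inverse_of_tail:
  fixes Q :: "'a measure" and u :: "'a \<Rightarrow> real"
  assumes "prob_space Q" and um [measurable]: "u \<in> borel_measurable Q" and u0: "\<And>q. u q \<ge> 0"
    and C: "C \<ge> 0" "0 < \<rho>0" "\<And>\<rho>. 0 < \<rho> \<Longrightarrow> \<rho> < \<rho>0 \<Longrightarrow> measure Q {q \<in> space Q. u q \<le> \<rho>} \<le> C * \<rho>\<^sup>2"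
  shows "AE q in Q. u q \<noteq> 0" "integrable Q (\<lambda>q. 1 / u q)"
proof -
  interpret prob_space Q by fact
  obtain k0 :: nat where k0: "(1 / 2) ^ k0 < \<rho>0" using real_arch_pow_inv[OF C(2), of "1/2"] by auto
  define \<rho> where "\<rho> k = (1 / 2 :: real) ^ (k0 + k)" for k
  have \<rho>: "0 < \<rho> k" "\<rho> k < \<rho>0" for k
  proof -
    show "0 < \<rho> k" by (simp add: \<rho>_def)
    have "\<rho> k \<le> (1 / 2) ^ k0" unfolding \<rho>_def by (intro power_decreasing) auto
    then show "\<rho> k < \<rho>0" using k0 by simp
  qed
  have \<rho>inv: "1 / \<rho> k = 2 ^ k0 * 2 ^ k" for k by (simp add: \<rho>_def power_one_over power_add)
  define A where "A k = {q \<in> space Q. u q \<le> \<rho> k}" for k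
  have Am [measurable]: "A k \<in> sets Q" for k unfolding A_def by measurable
  have PA: "prob (A k) \<le> C * (\<rho> k)\<^sup>2" for k unfolding A_def by (rule C(3)[OF \<rho>])
  have \<rho>lim: "\<rho> \<longlonglongrightarrow> 0"
  proof -
    have "(\<lambda>k. (1 / 2 :: real) ^ k0 * (1 / 2) ^ k) \<longlonglongrightarrow> (1 / 2) ^ k0 * 0"
      by (intro tendsto_mult tendsto_const LIMSEQ_power_zero) simp
    then show ?thesis by (simp add: \<rho>_def[abs_def] power_add)
  qed
  have "prob {q \<in> space Q. u q = 0} \<le> 0"
  proof (rule LIMSEQ_le_const)
    show "(\<lambda>k. C * (\<rho> k)\<^sup>2) \<longlonglongrightarrow> 0"
      using tendsto_mult[OF tendsto_const tendsto_power[OF \<rho>lim, of 2], of C] by simp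
    have "prob {q \<in> space Q. u q = 0} \<le> prob (A k)" for k
      by (rule finite_measure_mono) (use \<rho>(1)[of k] in \<open>auto simp: A_def\<close>)
    then show "\<exists>N. \<forall>k\<ge>N. prob {q \<in> space Q. u q = 0} \<le> C * (\<rho> k)\<^sup>2" using PA order_trans by blast
  qed
  then have "prob {q \<in> space Q. u q = 0} = 0" using measure_nonneg antisym by blast
  then show "AE q in Q. u q \<noteq> 0"
    by (subst AE_iff_measurable[of "{q \<in> space Q. u q = 0}"]) (auto simp: emeasure_eq_measure)
  define a where "a k q = ennreal (2 / \<rho> k) * indicator (A k) q" for k q
  \<comment> \<open>For 0 < u q \<le> \<rho> 0 the single term with \<rho> k / 2 < u q \<le> \<rho>
    k suffices, and above \<rho> 0 the constant does. Where u q = 0 the quotient is 0 by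
    convention.\<close>
  have pw: "ennreal (norm (1 / u q)) \<le> ennreal (1 / \<rho> 0) + (\<Sum>k. a k q)" if q: "q \<in> space Q" for q
  proof (cases "u q = 0 \<or> u q > \<rho> 0")
    case True
    then have "norm (1 / u q) \<le> 1 / \<rho> 0" using \<rho>(1)[of 0] u0[of q] by (auto intro: divide_left_mono)
    then have "ennreal (norm (1 / u q)) \<le> ennreal (1 / \<rho> 0)" by (rule ennreal_leI)
    then show ?thesis by (simp add: add_increasing2)
  next
    case False
    then have uq: "u q > 0" "u q \<le> \<rho> 0" using u0[of q] by auto
    then have "1 \<le> \<rho> 0 / u q" by simp
    then obtain k where k: "2 ^ k \<le> \<rho> 0 / u q" "\<rho> 0 / u q < 2 ^ Suc k" by (rule ex_power2_interval)
    have \<rho>k: "\<rho> k * 2 ^ k = \<rho> 0" by (simp add: \<rho>_def power_add power_one_over)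
    have "u q * 2 ^ k \<le> \<rho> k * 2 ^ k" using k(1) uq by (simp add: \<rho>k pos_le_divide_eq mult.commute)
    then have "q \<in> A k" using q by (simp add: A_def)
    have "\<rho> k * 2 ^ k < 2 * 2 ^ k * u q" using k(2) uq by (simp add: \<rho>k pos_divide_less_eq)
    then have "\<rho> k < 2 * u q" by (simp add: mult_ac)
    then have "norm (1 / u q) \<le> 2 / \<rho> k" using uq \<rho>(1)[of k] by (simp add: field_simps)
    then have "ennreal (norm (1 / u q)) \<le> a k q" using \<open>q \<in> A k\<close> by (simp add: a_def ennreal_leI)
    also have "a k q \<le> (\<Sum>k. a k q)"
      using sum_le_suminf[of "\<lambda>k. a k q" "{k}"] by (simp add: summableI)
    finally show ?thesis by (simp add: add_increasing)
  qed
  have ia: "(\<integral>\<^sup>+q. a k q \<partial>Q) \<le> ennreal ((2 * C * \<rho> 0) * (1 / 2) ^ k)" for k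
  proof -
    have "(\<integral>\<^sup>+q. a k q \<partial>Q) = ennreal (2 / \<rho> k) * emeasure Q (A k)"
      unfolding a_def by (rule nn_integral_cmult_indicator) simp
    also have "\<dots> = ennreal (2 / \<rho> k * prob (A k))"
      unfolding emeasure_eq_measure using \<rho>(1)[of k] by (intro ennreal_mult[symmetric]) auto
    also have "\<dots> \<le> ennreal ((2 * C * \<rho> 0) * (1 / 2) ^ k)"
    proof (rule ennreal_leI)
      have "2 / \<rho> k * prob (A k) \<le> 2 / \<rho> k * (C * (\<rho> k)\<^sup>2)"
        using PA[of k] \<rho>(1)[of k] by (intro mult_left_mono) auto
      also have "\<dots> = (2 * C) * \<rho> k" using \<rho>(1)[of k] by (simp add: power2_eq_square)
      also have "\<dots> = (2 * C * \<rho> 0) * (1 / 2) ^ k" by (simp add: \<rho>_def power_add)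
      finally show "2 / \<rho> k * prob (A k) \<le> (2 * C * \<rho> 0) * (1 / 2) ^ k" .
    qed
    finally show ?thesis .
  qed
  have sm: "summable (\<lambda>k. (2 * C * \<rho> 0) * (1 / 2 :: real) ^ k)" by (intro summable_mult summable_geometric) simp
  have am: "a k \<in> borel_measurable Q" for k unfolding a_def[abs_def] by measurable
  have "(\<integral>\<^sup>+q. ennreal (norm (1 / u q)) \<partial>Q) \<le> (\<integral>\<^sup>+q. ennreal (1 / \<rho> 0) + (\<Sum>k. a k q) \<partial>Q)"
    by (rule nn_integral_mono) (rule pw)
  also have "\<dots> = ennreal (1 / \<rho> 0) + (\<Sum>k. \<integral>\<^sup>+q. a k q \<partial>Q)"
    using am by (simp add: nn_integral_add nn_integral_suminf emeasure_space_1)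
  also have "\<dots> \<le> ennreal (1 / \<rho> 0) + (\<Sum>k. ennreal ((2 * C * \<rho> 0) * (1 / 2) ^ k))"
    by (intro add_left_mono suminf_le ia summableI)
  also have "\<dots> = ennreal (1 / \<rho> 0) + ennreal (\<Sum>k. (2 * C * \<rho> 0) * (1 / 2) ^ k)"
    using C(1) \<rho>(1)[of 0] sm by (subst suminf_ennreal2) auto
  also have "\<dots> < \<infinity>" by (simp add: ennreal_add_less_top)
  finally show "integrable Q (\<lambda>q. 1 / u q)" by (intro integrableI_bounded) auto
qed

section \<open>The population criterion\<close>

context sphere_chart
begin

section \<open>Measurability on the sphere\<close>

lemma arccos_inner_measurable:
  assumes "norm p = 1"
  shows "(\<lambda>q. arccos (p \<bullet> q)) \<in> borel_measurable sphere_borel"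
proof (rule borel_measurable_continuous_on_restrict)
  have "\<bar>p \<bullet> q\<bar> \<le> 1" if "q \<in> sphere 0 1" for q
    using Cauchy_Schwarz_ineq2[of p q] assms that by simp
  then show "continuous_on (sphere 0 1) (\<lambda>q. arccos (p \<bullet> q))"
    by (intro continuous_on_compose2[OF continuous_on_arccos'] continuous_intros) (auto simp: abs_le_iff)
qed

lemma sphere_measurable: "f \<in> borel_measurable borel \<Longrightarrow> f \<in> borel_measurable sphere_borel"
  by (rule measurable_restrict_space1)

lemma h_measurable: "h u \<in> borel_measurable sphere_borel"
  unfolding h_def[abs_def] using arccos_inner_measurable[OF norm_E] by measurable

lemma coords_measurable: "coords \<in> borel_measurable sphere_borel"
proof (rule sphere_measurable)
  have "continuous_on UNIV coords" unfolding coords_def[abs_def] by (intro continuous_intros)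
  then show "coords \<in> borel_measurable borel" by (rule borel_measurable_continuous_onI)
qed

lemma inner_\<mu>_measurable: "(\<lambda>q. \<mu> \<bullet> q) \<in> borel_measurable sphere_borel"
  by (rule sphere_measurable) measurable

lemma arccos_ratio_measurable: "(\<lambda>q. arccos_ratio (\<mu> \<bullet> q)) \<in> borel_measurable sphere_borel"
  unfolding arccos_ratio_def using arccos_inner_measurable[OF norm_\<mu>] inner_\<mu>_measurable by measurable

lemma g_measurable: "g \<in> borel_measurable sphere_borel"
  unfolding g_def[abs_def] using arccos_ratio_measurable coords_measurable by measurable

lemma coords_component_measurable: "(\<lambda>q. coords q $ i) \<in> borel_measurable sphere_borel"
  unfolding coords_def by (rule sphere_measurable) simp

lemma singleton_sphere_measurable: "p \<in> sphere 0 1 \<Longrightarrow> {q \<in> space sphere_borel. q = p} \<in> sets sphere_borel"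
proof -
  assume "p \<in> sphere 0 1"
  then have "{q \<in> space sphere_borel. q = p} = sphere 0 1 \<inter> {p}" by (auto simp: space_restrict_space)
  then show ?thesis by (simp add: sets_restrict_space)
qed

lemma Hess_measurable: "(\<lambda>q. Hess q $ i $ j) \<in> borel_measurable sphere_borel"
proof -
  note [measurable] = arccos_ratio_measurable inner_\<mu>_measurable coords_component_measurable
  have "(\<lambda>q. if q = \<mu> then mat 2 $ i $ j else
     2 * (1 - (\<mu> \<bullet> q) * arccos_ratio (\<mu> \<bullet> q)) / (1 - (\<mu> \<bullet> q)\<^sup>2) * (coords q $ i * coords q $ j)
      + (if i = j then 2 * arccos_ratio (\<mu> \<bullet> q) * (\<mu> \<bullet> q) else 0)) \<in> borel_measurable sphere_borel"
  proof (rule measurable_If)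
    show "{q \<in> space sphere_borel. q = \<mu>} \<in> sets sphere_borel"
      using norm_\<mu> by (intro singleton_sphere_measurable) simp
    show "(\<lambda>q. 2 * (1 - (\<mu> \<bullet> q) * arccos_ratio (\<mu> \<bullet> q)) / (1 - (\<mu> \<bullet> q)\<^sup>2) * (coords q $ i * coords q $ j)
      + (if i = j then 2 * arccos_ratio (\<mu> \<bullet> q) * (\<mu> \<bullet> q) else 0)) \<in> borel_measurable sphere_borel"
      by measurable
  qed simp
  also have "(\<lambda>q. if q = \<mu> then mat 2 $ i $ j else
     2 * (1 - (\<mu> \<bullet> q) * arccos_ratio (\<mu> \<bullet> q)) / (1 - (\<mu> \<bullet> q)\<^sup>2) * (coords q $ i * coords q $ j)
      + (if i = j then 2 * arccos_ratio (\<mu> \<bullet> q) * (\<mu> \<bullet> q) else 0)) = (\<lambda>q. Hess q $ i $ j)"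
    by (auto simp: Hess_def Let_def fun_eq_iff)
  finally show ?thesis .
qed

lemma logc_measurable: "logc \<in> borel_measurable sphere_borel"
proof -
  have "(\<lambda>p. (arccos (\<mu> \<bullet> p) / norm (coords p)) *\<^sub>R coords p) \<in> borel_measurable sphere_borel"
    using arccos_inner_measurable[OF norm_\<mu>] coords_measurable by measurable
  then show ?thesis
    by (simp add: logc_def[abs_def] sgn_div_norm divide_inverse inner_commute)
qed

end

text \<open>The density near the antipode is used from here on only through the last two
  assumptions: the antipode is a null point and 1 / |q + mu| is integrable.\<close>

locale sphere_law = sphere_chart \<mu> e for \<mu> :: "'a::euclidean_space" and e :: "'d::finite \<Rightarrow> 'a" +
  fixes Q :: "'a measure"
  assumes prob_Q: "prob_space Q" and sets_Q: "sets Q = sets sphere_borel"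
    and mean: "is_intrinsic_mean Q \<mu>"
    and ae: "AE q in Q. q \<noteq> - \<mu>"
    and int_inv: "integrable Q (\<lambda>q. 1 / norm (q + \<mu>))"
begin

sublocale Q: prob_space Q by (rule prob_Q)

lemma space_Q: "space Q = sphere 0 1"
  using sets_eq_imp_space_eq[OF sets_Q] by (simp add: space_restrict_space)

lemma Q_measurable: "f \<in> borel_measurable sphere_borel \<Longrightarrow> f \<in> borel_measurable Q"
  by (simp add: measurable_cong_sets[OF sets_Q refl])

lemma h_le: "norm q = 1 \<Longrightarrow> 0 \<le> h u q \<and> h u q \<le> pi\<^sup>2"
  using inner_E_le[of q u] unfolding h_def
  by (auto intro!: power_mono arccos_lbound arccos_ubound simp: abs_le_iff)

lemma h_integrable: "integrable Q (h u)"
  by (rule Q.integrable_const_bound[of _ "pi\<^sup>2"])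
    (use h_le Q_measurable[OF h_measurable] in \<open>auto simp: space_Q\<close>)

lemma geo_dist_sphere: "norm p = 1 \<Longrightarrow> norm q = 1 \<Longrightarrow> geo_dist p q = arccos (p \<bullet> q)" for p q :: 'a
  using dim by (intro geo_dist_eq) auto

lemma frechet_fun_eq: "norm p = 1 \<Longrightarrow> frechet_fun Q p = (\<integral>q. (arccos (p \<bullet> q))\<^sup>2 \<partial>Q)"
  unfolding frechet_fun_def
  by (intro Bochner_Integration.integral_cong) (auto simp: space_Q geo_dist_sphere)

lemma mean_le: "norm p = 1 \<Longrightarrow> frechet_fun Q \<mu> \<le> frechet_fun Q p"
  and mean_unique: "norm p = 1 \<Longrightarrow> p \<noteq> \<mu> \<Longrightarrow> frechet_fun Q \<mu> < frechet_fun Q p"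
proof -
  have m: "frechet_minimizers (frechet_fun Q) = {\<mu>}" using mean by (simp add: is_intrinsic_mean_def)
  have "\<mu> \<in> frechet_minimizers (frechet_fun Q)" using m by simp
  then have le: "frechet_fun Q \<mu> \<le> frechet_fun Q p" if "norm p = 1" for p
    using that by (simp add: frechet_minimizers_def)
  show "norm p = 1 \<Longrightarrow> frechet_fun Q \<mu> \<le> frechet_fun Q p" by (rule le)
  show "frechet_fun Q \<mu> < frechet_fun Q p" if p: "norm p = 1" "p \<noteq> \<mu>"
  proof (rule ccontr)
    assume "\<not> ?thesis"
    then have "frechet_fun Q p \<le> frechet_fun Q p'" if "norm p' = 1" for p'
      using le[OF that] by linarith
    then have "p \<in> frechet_minimizers (frechet_fun Q)" using p by (simp add: frechet_minimizers_def)
    then show False using m p by simp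
  qed
qed

definition F :: "real ^ 'd \<Rightarrow> real" where "F u = (\<integral>q. h u q - h 0 q \<partial>Q)"

lemma F_nonneg: "0 \<le> F u"
proof -
  have "F u = frechet_fun Q (E u) - frechet_fun Q \<mu>"
  proof -
    have "integral\<^sup>L Q (h 0) = frechet_fun Q \<mu>" "integral\<^sup>L Q (h u) = frechet_fun Q (E u)"
      by (simp_all add: frechet_fun_eq norm_\<mu> h_def[abs_def])
    then show ?thesis using h_integrable by (simp add: F_def)
  qed
  then show ?thesis using mean_le[of "E u"] by simp
qed

definition rem :: "real ^ 'd \<Rightarrow> 'a \<Rightarrow> real" where "rem u q = h u q - h 0 q - g q \<bullet> u"

lemma g_inner_measurable: "(\<lambda>q. g q \<bullet> u) \<in> borel_measurable Q"
  by (rule Q_measurable) (use g_measurable in measurable)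

lemma g_integrable: "integrable Q (\<lambda>q. g q \<bullet> u)"
proof (rule Q.integrable_const_bound[of _ "2 * pi * norm u"])
  show "AE q in Q. norm (g q \<bullet> u) \<le> 2 * pi * norm u"
    using norm_g_le by (intro AE_I2) (auto simp: space_Q intro!: order_trans[OF Cauchy_Schwarz_ineq2] mult_right_mono)
qed (rule g_inner_measurable)

lemma rem_integrable: "integrable Q (rem u)"
  unfolding rem_def[abs_def] using h_integrable g_integrable by simp

lemma integral_rem: "(\<integral>q. rem u q \<partial>Q) = F u - (\<integral>q. g q \<bullet> u \<partial>Q)"
  unfolding rem_def F_def using h_integrable g_integrable by simp

lemma rem_bound:
  obtains K where "K > 0" "\<And>u q. norm u < 1 \<Longrightarrow> norm q = 1 \<Longrightarrow> q \<noteq> - \<mu> \<Longrightarrow>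
     \<bar>rem u q\<bar> \<le> K * (norm u)\<^sup>2 / norm (q + \<mu>)"
proof (rule h_bounds)
  fix K :: real
  assume "K > 0" and "\<And>x q. norm x < 1 \<Longrightarrow> norm q = 1 \<Longrightarrow> q \<noteq> - \<mu> \<Longrightarrow>
       \<bar>h x q - h 0 q - g q \<bullet> x\<bar> \<le> K * (norm x)\<^sup>2 / norm (q + \<mu>)"
  then show thesis unfolding rem_def[symmetric] by (rule that)
qed

lemma ae': "AE q in Q. norm q = 1 \<and> q \<noteq> - \<mu>"
  using ae AE_space by eventually_elim (simp add: space_Q)

lemma scaled_limit:
  fixes u :: "real ^ 'd"
  assumes "(\<phi> \<longlongrightarrow> 0) (at 0)" "u \<noteq> 0"
  shows "((\<lambda>s :: real. \<phi> (s *\<^sub>R u)) \<longlongrightarrow> 0) (at 0)"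
proof (rule filterlim_compose[OF assms(1)], rule filterlim_atI)
  show "((\<lambda>s :: real. s *\<^sub>R u) \<longlongrightarrow> 0) (at 0)"
    using tendsto_scaleR[OF tendsto_ident_at[of "0 :: real" UNIV] tendsto_const[of u]] by simp
  show "\<forall>\<^sub>F s :: real in at 0. s *\<^sub>R u \<noteq> 0" using assms(2) by (auto simp: eventually_at intro: exI[of _ 1])
qed

lemma small_scale:
  fixes u :: "real ^ 'd"
  shows "\<forall>\<^sub>F s :: real in at 0. s \<noteq> 0 \<and> norm (s *\<^sub>R u) < 1"
proof -
  have "((\<lambda>s :: real. norm (s *\<^sub>R u)) \<longlongrightarrow> norm (0 *\<^sub>R u)) (at 0)" by (intro tendsto_intros)
  then have "\<forall>\<^sub>F s :: real in at 0. norm (s *\<^sub>R u) < 1" by (rule order_tendstoD(2)) simp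
  moreover have "\<forall>\<^sub>F s :: real in at 0. s \<noteq> 0" by (auto simp: eventually_at intro: exI[of _ 1])
  ultimately show ?thesis by eventually_elim simp
qed

text \<open>First-order condition without differentiating under the integral: 0 \<le> F (s t) \<le>
  s G + O(s^2), the error coming from the integrable bound on the remainder. Letting s tend to 0
  from either side gives G \<ge> 0 and G \<le> 0.\<close>

lemma g_mean: "(\<integral>q. g q \<bullet> t \<partial>Q) = 0"
proof -
  obtain K where K: "K > 0" "\<And>u q. norm u < 1 \<Longrightarrow> norm q = 1 \<Longrightarrow> q \<noteq> - \<mu> \<Longrightarrow>
     \<bar>rem u q\<bar> \<le> K * (norm u)\<^sup>2 / norm (q + \<mu>)" by (rule rem_bound) blast
  define I where "I = (\<integral>q. 1 / norm (q + \<mu>) \<partial>Q)"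
  define G where "G = (\<integral>q. g q \<bullet> t \<partial>Q)"
  have ineq: "0 \<le> s * G + K * I * (norm t)\<^sup>2 * s\<^sup>2" if s: "norm (s *\<^sub>R t) < 1" for s :: real
  proof -
    have "(\<integral>q. rem (s *\<^sub>R t) q \<partial>Q) \<le> (\<integral>q. K * (norm (s *\<^sub>R t))\<^sup>2 * (1 / norm (q + \<mu>)) \<partial>Q)"
    proof (rule integral_mono_AE)
      show "integrable Q (rem (s *\<^sub>R t))" by (rule rem_integrable)
      show "integrable Q (\<lambda>q. K * (norm (s *\<^sub>R t))\<^sup>2 * (1 / norm (q + \<mu>)))" by (intro integrable_mult_right int_inv)
      show "AE q in Q. rem (s *\<^sub>R t) q \<le> K * (norm (s *\<^sub>R t))\<^sup>2 * (1 / norm (q + \<mu>))"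
        using ae'
      proof eventually_elim
        case (elim q)
        then have "\<bar>rem (s *\<^sub>R t) q\<bar> \<le> K * (norm (s *\<^sub>R t))\<^sup>2 / norm (q + \<mu>)" using K(2)[OF s] by blast
        then show ?case by (simp add: abs_le_iff)
      qed
    qed
    also have "\<dots> = K * (norm (s *\<^sub>R t))\<^sup>2 * I" unfolding I_def by (rule integral_mult_right_zero)
    finally have "F (s *\<^sub>R t) - s * G \<le> K * (norm (s *\<^sub>R t))\<^sup>2 * I" by (simp add: integral_rem G_def)
    then have "0 \<le> s * G + K * (norm (s *\<^sub>R t))\<^sup>2 * I" using F_nonneg[of "s *\<^sub>R t"] by linarith
    then show ?thesis by (simp add: power_mult_distrib mult_ac)
  qed
  define B where "B = K * I * (norm t)\<^sup>2"
  have lim: "((\<lambda>s :: real. G + B * s) \<longlongrightarrow> G + B * 0) (at_right 0)" "((\<lambda>s :: real. G + B * s) \<longlongrightarrow> G + B * 0) (at_left 0)"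
    by (intro tendsto_intros)+
  have ev: "\<forall>\<^sub>F s :: real in at 0. s \<noteq> 0 \<and> norm (s *\<^sub>R t) < 1" by (rule small_scale)
  have "0 \<le> G + B * 0"
  proof (rule tendsto_lowerbound[OF lim(1)])
    have "\<forall>\<^sub>F s :: real in at_right 0. s \<noteq> 0 \<and> norm (s *\<^sub>R t) < 1" "\<forall>\<^sub>F s :: real in at_right 0. s > 0"
      using ev by (auto simp: eventually_at_split eventually_at_right_less)
    then show "\<forall>\<^sub>F s in at_right 0. 0 \<le> G + B * s"
    proof eventually_elim
      case (elim s)
      have "0 \<le> s * (G + B * s)" using ineq[of s] elim by (simp add: B_def power2_eq_square algebra_simps)
      then show ?case using elim by (simp add: zero_le_mult_iff)
    qed
  qed simp
  moreover have "G + B * 0 \<le> 0"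
  proof (rule tendsto_upperbound[OF lim(2)])
    have "\<forall>\<^sub>F s :: real in at_left 0. s \<noteq> 0 \<and> norm (s *\<^sub>R t) < 1"
      using ev by (auto simp: eventually_at_split)
    moreover have "\<forall>\<^sub>F s :: real in at_left 0. s < 0" by (simp add: eventually_at_filter)
    ultimately show "\<forall>\<^sub>F s in at_left 0. G + B * s \<le> 0"
    proof eventually_elim
      case (elim s)
      have "0 \<le> s * (G + B * s)" using ineq[of s] elim by (simp add: B_def power2_eq_square algebra_simps)
      then show ?case using elim by (simp add: zero_le_mult_iff)
    qed
  qed simp
  ultimately show ?thesis by (simp add: G_def)
qed

text \<open>The Hessian is recovered from the remainder by rescaling, so dividing the remainder
  bound by |s u|^2 and letting s tend to 0 transfers it. Both bounds share K, so that one function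
  dominates remainder and quadratic form together.\<close>

lemma Hess_bound:
  obtains K where "K > 0" "\<And>u q. norm q = 1 \<Longrightarrow> q \<noteq> - \<mu> \<Longrightarrow> \<bar>u \<bullet> (Hess q *v u)\<bar> \<le> 2 * K * (norm u)\<^sup>2 / norm (q + \<mu>)"
    "\<And>u q. norm u < 1 \<Longrightarrow> norm q = 1 \<Longrightarrow> q \<noteq> - \<mu> \<Longrightarrow> \<bar>rem u q\<bar> \<le> K * (norm u)\<^sup>2 / norm (q + \<mu>)"
proof -
  obtain K where K: "K > 0" "\<And>u q. norm u < 1 \<Longrightarrow> norm q = 1 \<Longrightarrow> q \<noteq> - \<mu> \<Longrightarrow>
     \<bar>rem u q\<bar> \<le> K * (norm u)\<^sup>2 / norm (q + \<mu>)" by (rule rem_bound) blast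
  have Hb: "\<bar>u \<bullet> (Hess q *v u)\<bar> \<le> 2 * K * (norm u)\<^sup>2 / norm (q + \<mu>)" if q: "norm q = 1" "q \<noteq> - \<mu>" for u q
  proof (cases "u = 0")
    case False
    define r where "r = norm (q + \<mu>)"
    define \<phi> where "\<phi> x = (rem x q - (x \<bullet> (Hess q *v x)) / 2) / (norm x)\<^sup>2" for x
    have "(\<phi> \<longlongrightarrow> 0) (at 0)" using h_expansion[OF q] by (simp add: \<phi>_def[abs_def] rem_def)
    from scaled_limit[OF this False] have l: "((\<lambda>s :: real. K / r + \<bar>\<phi> (s *\<^sub>R u)\<bar>) \<longlongrightarrow> K / r + \<bar>0\<bar>) (at 0)"
      by (intro tendsto_intros)
    define w where "w = (u \<bullet> (Hess q *v u)) / 2 / (norm u)\<^sup>2"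
    have "\<bar>w\<bar> \<le> K / r + \<bar>0\<bar>"
    proof (rule tendsto_lowerbound[OF l])
      show "\<forall>\<^sub>F s :: real in at 0. \<bar>w\<bar> \<le> K / r + \<bar>\<phi> (s *\<^sub>R u)\<bar>"
        using small_scale[of u]
      proof eventually_elim
        case (elim s)
        define n where "n = (norm (s *\<^sub>R u))\<^sup>2"
        have n: "n > 0" "n = s\<^sup>2 * (norm u)\<^sup>2" using elim False by (simp_all add: n_def power_mult_distrib)
        have "((s *\<^sub>R u) \<bullet> (Hess q *v (s *\<^sub>R u))) / 2 = w * n"
          using False elim unfolding n(2) w_def by (simp add: matrix_vector_mult_scaleR power2_eq_square)
        then have "\<phi> (s *\<^sub>R u) = (rem (s *\<^sub>R u) q - w * n) / n" by (simp add: \<phi>_def n_def)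
        then have "w = rem (s *\<^sub>R u) q / n - \<phi> (s *\<^sub>R u)" using n(1) by (simp add: field_simps)
        moreover have "\<bar>rem (s *\<^sub>R u) q / n\<bar> \<le> K / r"
        proof -
          have "\<bar>rem (s *\<^sub>R u) q\<bar> \<le> K * n / r" using K(2)[OF _ q, of "s *\<^sub>R u"] elim by (simp add: n_def r_def)
          then have "\<bar>rem (s *\<^sub>R u) q\<bar> / n \<le> (K * n / r) / n" using n(1) by (intro divide_right_mono) auto
          then show ?thesis using n(1) by (simp add: abs_div)
        qed
        ultimately show ?case by linarith
      qed
    qed simp
    then have "\<bar>u \<bullet> (Hess q *v u)\<bar> / (2 * (norm u)\<^sup>2) \<le> K / r" by (simp add: w_def abs_div)
    then have "\<bar>u \<bullet> (Hess q *v u)\<bar> \<le> K / r * (2 * (norm u)\<^sup>2)"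
      using False by (subst (asm) pos_divide_le_eq) auto
    then show ?thesis by (simp add: r_def mult_ac)
  qed simp
  show thesis by (rule that[OF K(1) Hb K(2)])
qed

text \<open>Polarization expresses an entry through the quadratic form at a, b and a + b, where a
  and b are unit axes. The weights 4 + 1 + 1, halved and multiplied by 2 K, give the constant 6
  K.\<close>

lemma Hess_entry_integrable: "integrable Q (\<lambda>q. Hess q $ i $ j)"
proof -
  obtain K where K: "K > 0" "\<And>u q. norm q = 1 \<Longrightarrow> q \<noteq> - \<mu> \<Longrightarrow> \<bar>u \<bullet> (Hess q *v u)\<bar> \<le> 2 * K * (norm u)\<^sup>2 / norm (q + \<mu>)"
    by (rule Hess_bound) blast
  show ?thesis
  proof (rule Bochner_Integration.integrable_bound)
    show "integrable Q (\<lambda>q. 6 * K * (1 / norm (q + \<mu>)))" by (intro integrable_mult_right int_inv)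
    show "(\<lambda>q. Hess q $ i $ j) \<in> borel_measurable Q" by (rule Q_measurable[OF Hess_measurable])
    show "AE q in Q. norm (Hess q $ i $ j) \<le> norm (6 * K * (1 / norm (q + \<mu>)))"
      using ae'
    proof eventually_elim
      case (elim q)
      define r where "r = norm (q + \<mu>)"
      define a b :: "real ^ 'd" where "a = axis i 1" and "b = axis j 1"
      have na: "norm a = 1" "norm b = 1" by (simp_all add: a_def b_def norm_axis_1)
      have nab: "(norm (a + b))\<^sup>2 \<le> 4"
        using norm_triangle_ineq[of a b] na power_mono[of "norm (a + b)" 2 2] by simp
      have "a \<bullet> (Hess q *v b) = Hess q $ i $ j"
        by (simp add: a_def b_def inner_axis' matrix_vector_mult_basis column_def)
      moreover have "b \<bullet> (Hess q *v a) = a \<bullet> (Hess q *v b)" by (rule inner_matrix_symmetric[OF Hess_sym])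
      ultimately have eq: "2 * Hess q $ i $ j = (a + b) \<bullet> (Hess q *v (a + b)) - a \<bullet> (Hess q *v a) - b \<bullet> (Hess q *v b)"
        by (simp add: matrix_vector_right_distrib inner_add_left inner_add_right)
      have B: "\<bar>u \<bullet> (Hess q *v u)\<bar> \<le> (2 * K / r) * (norm u)\<^sup>2" for u
        using K(2)[of q u] elim by (simp add: r_def)
      have "(2 * K / r) * (norm (a + b))\<^sup>2 \<le> (2 * K / r) * 4"
        using nab K(1) by (intro mult_left_mono) (auto simp: r_def)
      then have "\<bar>2 * Hess q $ i $ j\<bar> \<le> (2 * K / r) * 4 + (2 * K / r) + (2 * K / r)"
        unfolding eq using B[of "a + b"] B[of a] B[of b] na unfolding abs_le_iff by simp
      then show ?case using K(1) by (simp add: r_def abs_mult)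
    qed
  qed
qed

definition \<Lambda>Q :: "real ^ 'd ^ 'd" where "\<Lambda>Q = (\<chi> i j. \<integral>q. Hess q $ i $ j \<partial>Q)"

lemma \<Lambda>Q_sym: "transpose \<Lambda>Q = \<Lambda>Q"
proof -
  have "Hess q $ j $ i = Hess q $ i $ j" for q i j
    using arg_cong[OF Hess_sym[of q], of "\<lambda>A. A $ i $ j"] by (simp add: transpose_def)
  then show ?thesis by (simp add: \<Lambda>Q_def transpose_def vec_eq_iff)
qed

lemma \<Lambda>Q_quadratic: "u \<bullet> (\<Lambda>Q *v u) = (\<integral>q. u \<bullet> (Hess q *v u) \<partial>Q)" "integrable Q (\<lambda>q. u \<bullet> (Hess q *v u))"
  unfolding quadratic_form_sum by (simp_all add: \<Lambda>Q_def Hess_entry_integrable)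

text \<open>Although h is not twice differentiable near 0 for q near the antipode, the pointwise
  normalised remainders are dominated by 2 K / |q + mu|, so the expansion at 0 can be integrated
  along any sequence.\<close>

lemma F_taylor: "((\<lambda>u. (F u - (u \<bullet> (\<Lambda>Q *v u)) / 2) / (norm u)\<^sup>2) \<longlongrightarrow> 0) (at 0)"
  unfolding tendsto_at_iff_sequentially
proof (intro allI impI)
  fix x :: "nat \<Rightarrow> real ^ 'd"
  assume x0: "\<forall>i. x i \<in> UNIV - {0}" and xl: "x \<longlonglongrightarrow> 0"
  obtain K where K: "K > 0" "\<And>u q. norm q = 1 \<Longrightarrow> q \<noteq> - \<mu> \<Longrightarrow> \<bar>u \<bullet> (Hess q *v u)\<bar> \<le> 2 * K * (norm u)\<^sup>2 / norm (q + \<mu>)"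
    "\<And>u q. norm u < 1 \<Longrightarrow> norm q = 1 \<Longrightarrow> q \<noteq> - \<mu> \<Longrightarrow> \<bar>rem u q\<bar> \<le> K * (norm u)\<^sup>2 / norm (q + \<mu>)"
    by (rule Hess_bound) blast
  \<comment> \<open>The remainder bound is available only in the unit ball; the value 0 elsewhere
    concerns finitely many n and makes the domination hold for all.\<close>
  define s where "s n q = (if norm (x n) < 1 then (rem (x n) q - (x n \<bullet> (Hess q *v x n)) / 2) / (norm (x n))\<^sup>2 else 0)" for n q
  have ev: "\<forall>\<^sub>F n in sequentially. norm (x n) < 1"
    using tendstoD[OF xl, of 1] by simp
  have filt: "filterlim x (at 0) sequentially"
    using xl x0 by (intro filterlim_atI) auto
  have Hm: "(\<lambda>q. u \<bullet> (Hess q *v u)) \<in> borel_measurable Q" for u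
    using \<Lambda>Q_quadratic(2) by (rule borel_measurable_integrable)
  have sm: "s n \<in> borel_measurable Q" for n
    unfolding s_def[abs_def] using Hm[of "x n"] borel_measurable_integrable[OF rem_integrable[of "x n"]] by measurable
  have "(\<lambda>n. \<integral>q. s n q \<partial>Q) \<longlonglongrightarrow> (\<integral>q. 0 \<partial>Q)"
  proof (rule integral_dominated_convergence[where w = "\<lambda>q. 2 * K * (1 / norm (q + \<mu>))"])
    show "integrable Q (\<lambda>q. 2 * K * (1 / norm (q + \<mu>)))" by (intro integrable_mult_right int_inv)
    show "AE q in Q. (\<lambda>n. s n q) \<longlonglongrightarrow> 0"
      using ae'
    proof eventually_elim
      case (elim q)
      have "((\<lambda>u. (rem u q - (u \<bullet> (Hess q *v u)) / 2) / (norm u)\<^sup>2) \<longlongrightarrow> 0) (at 0)"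
        using h_expansion[of q] elim by (simp add: rem_def)
      from filterlim_compose[OF this filt]
      have "(\<lambda>n. (rem (x n) q - (x n \<bullet> (Hess q *v x n)) / 2) / (norm (x n))\<^sup>2) \<longlonglongrightarrow> 0" .
      moreover have "\<forall>\<^sub>F n in sequentially. (rem (x n) q - (x n \<bullet> (Hess q *v x n)) / 2) / (norm (x n))\<^sup>2 = s n q"
        using ev by eventually_elim (simp add: s_def)
      ultimately show ?case by (rule Lim_transform_eventually)
    qed
    show "AE q in Q. norm (s n q) \<le> 2 * K * (1 / norm (q + \<mu>))" for n
      using ae'
    proof eventually_elim
      case (elim q)
      show ?case
      proof (cases "norm (x n) < 1")
        case True
        define N where "N = (norm (x n))\<^sup>2"
        have N: "N > 0" using x0 by (simp add: N_def)
        have "\<bar>rem (x n) q - (x n \<bullet> (Hess q *v x n)) / 2\<bar> \<le> K * N / norm (q + \<mu>) + (2 * K * N / norm (q + \<mu>)) / 2"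
        proof -
          have "\<bar>rem (x n) q\<bar> \<le> K * N / norm (q + \<mu>)"
            using K(3)[OF True, of q] elim unfolding N_def by blast
          moreover have "\<bar>x n \<bullet> (Hess q *v x n)\<bar> \<le> 2 * K * N / norm (q + \<mu>)"
            using K(2)[of q "x n"] elim unfolding N_def by blast
          moreover have "\<bar>a - b / 2\<bar> \<le> A + B / 2" if "\<bar>a\<bar> \<le> A" "\<bar>b\<bar> \<le> B" for a b A B :: real
            using that by linarith
          ultimately show ?thesis by blast
        qed
        also have "\<dots> = (2 * K * (1 / norm (q + \<mu>))) * N" by simp
        finally have "\<bar>rem (x n) q - (x n \<bullet> (Hess q *v x n)) / 2\<bar> / N \<le> 2 * K * (1 / norm (q + \<mu>))"
          using N by (simp add: pos_divide_le_eq)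
        then show ?thesis using True N by (simp add: s_def N_def[symmetric] abs_div)
      next
        case False
        then show ?thesis using K(1) by (simp add: s_def)
      qed
    qed
  qed (use sm in auto)
  then have "(\<lambda>n. \<integral>q. s n q \<partial>Q) \<longlonglongrightarrow> 0" by simp
  moreover have "\<forall>\<^sub>F n in sequentially. (\<integral>q. s n q \<partial>Q) = ((\<lambda>u. (F u - (u \<bullet> (\<Lambda>Q *v u)) / 2) / (norm u)\<^sup>2) \<circ> x) n"
    using ev
  proof eventually_elim
    case (elim n)
    have "(\<integral>q. s n q \<partial>Q) = (\<integral>q. (rem (x n) q - (x n \<bullet> (Hess q *v x n)) / 2) / (norm (x n))\<^sup>2 \<partial>Q)"
      using elim by (simp add: s_def)
    also have "\<dots> = ((\<integral>q. rem (x n) q \<partial>Q) - (x n \<bullet> (\<Lambda>Q *v x n)) / 2) / (norm (x n))\<^sup>2"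
      using rem_integrable \<Lambda>Q_quadratic by simp
    finally show ?case by (simp add: integral_rem g_mean)
  qed
  ultimately show "((\<lambda>u. (F u - (u \<bullet> (\<Lambda>Q *v u)) / 2) / (norm u)\<^sup>2) \<circ> x) \<longlonglongrightarrow> 0"
    by (rule Lim_transform_eventually)
qed

text \<open>Second-order necessary condition: F is nonnegative, and F (s u) / s^2 tends to half the
  quadratic form at u.\<close>

lemma \<Lambda>Q_psd: "0 \<le> u \<bullet> (\<Lambda>Q *v u)"
proof (cases "u = 0")
  case False
  define w where "w = (u \<bullet> (\<Lambda>Q *v u)) / 2 / (norm u)\<^sup>2"
  define \<phi> where "\<phi> v = (F v - (v \<bullet> (\<Lambda>Q *v v)) / 2) / (norm v)\<^sup>2" for v
  have "(\<phi> \<longlongrightarrow> 0) (at 0)" using F_taylor by (simp add: \<phi>_def[abs_def])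
  from tendsto_minus[OF scaled_limit[OF this False]] have l: "((\<lambda>s :: real. - \<phi> (s *\<^sub>R u)) \<longlongrightarrow> 0) (at 0)" by simp
  have "0 \<le> w"
  proof (rule tendsto_upperbound[OF l])
    show "\<forall>\<^sub>F s :: real in at 0. - \<phi> (s *\<^sub>R u) \<le> w"
      using small_scale[of u]
    proof eventually_elim
      case (elim s)
      define n where "n = (norm (s *\<^sub>R u))\<^sup>2"
      have n: "n > 0" "n = s\<^sup>2 * (norm u)\<^sup>2" using elim False by (simp_all add: n_def power_mult_distrib)
      have "((s *\<^sub>R u) \<bullet> (\<Lambda>Q *v (s *\<^sub>R u))) / 2 = w * n"
        using False elim unfolding n(2) w_def by (simp add: matrix_vector_mult_scaleR power2_eq_square)
      then have "\<phi> (s *\<^sub>R u) = (F (s *\<^sub>R u) - w * n) / n" by (simp add: \<phi>_def n_def)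
      then have "w = F (s *\<^sub>R u) / n - \<phi> (s *\<^sub>R u)" using n(1) by (simp add: field_simps)
      moreover have "F (s *\<^sub>R u) / n \<ge> 0" using F_nonneg n(1) by simp
      ultimately show ?case by linarith
    qed
  qed simp
  then show ?thesis using False by (simp add: w_def zero_le_divide_iff)
qed simp

text \<open>A semidefinite invertible matrix is definite: in a factorization A A^T the map A^T is
  injective, hence bounded below, and the square of that bound is c.\<close>

lemma \<Lambda>Q_pos:
  assumes "invertible \<Lambda>Q"
  obtains c where "c > 0" "\<And>u. c * (norm u)\<^sup>2 \<le> u \<bullet> (\<Lambda>Q *v u)"
proof -
  obtain A :: "real ^ 'd ^ 'd" where A: "A ** transpose A = \<Lambda>Q"
    using psd_factorization[OF \<Lambda>Q_sym \<Lambda>Q_psd] by blast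
  have q: "u \<bullet> (\<Lambda>Q *v u) = (norm (transpose A *v u))\<^sup>2" for u
    unfolding power2_norm_eq_inner A[symmetric]
    by (metis dot_lmul_matrix matrix_vector_mul_assoc transpose_matrix_vector)
  have "inj (\<lambda>u. transpose A *v u)"
  proof (rule linear_injective_0[THEN iffD2, rule_format])
    show "linear (\<lambda>u. transpose A *v u)" by (rule matrix_vector_mul_linear)
    fix u assume "transpose A *v u = 0"
    then have "\<Lambda>Q *v u = 0" unfolding A[symmetric] matrix_vector_mul_assoc[symmetric] by simp
    then show "u = 0" using assms by (metis invertible_left_inverse matrix_left_invertible_ker)
  qed
  then obtain B where B: "B > 0" "\<And>u. B * norm u \<le> norm (transpose A *v u)"
    using linear_inj_bounded_below_pos[OF matrix_vector_mul_linear[of "transpose A"]] by blast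
  show thesis
  proof (rule that[of "B\<^sup>2"])
    show "B\<^sup>2 * (norm u)\<^sup>2 \<le> u \<bullet> (\<Lambda>Q *v u)" for u
      unfolding q power_mult_distrib[symmetric] using B by (intro power_mono) auto
  qed (use B in simp)
qed

end

section \<open>The sample mean\<close>

text \<open>Observations are numbered from 1, while the sums of the M-estimation argument run over i
  < n.\<close>

lemma (in prob_space) indep_vars_Suc:
  assumes "indep_vars (\<lambda>_. N) Y {1..}"
  shows "indep_vars (\<lambda>_. N) (\<lambda>i :: nat. Y (Suc i)) UNIV"
proof -
  have rv: "random_variable N (Y (Suc i))" for i using assms unfolding indep_vars_def2 by simp
  define F where "F i = {Y i -` A \<inter> space M |A. A \<in> sets N}" for i
  have ind: "indep_sets F {1..}" using assms unfolding indep_vars_def2 F_def[abs_def] by simp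
  have "indep_sets (\<lambda>i. F (Suc i)) UNIV"
  proof (rule indep_setsI)
    show "F (Suc i) \<subseteq> events" for i using measurable_sets[OF rv[of i]] by (auto simp: F_def)
    fix A and J :: "nat set"
    assume J: "J \<noteq> {}" "finite J" and A: "\<forall>j\<in>J. A j \<in> F (Suc j)"
    have "prob (\<Inter>j\<in>Suc ` J. A (j - 1)) = (\<Prod>j\<in>Suc ` J. prob (A (j - 1)))"
      by (rule indep_setsD[OF ind]) (use J A in auto)
    then show "prob (\<Inter>j\<in>J. A j) = (\<Prod>j\<in>J. prob (A j))" by (simp add: prod.reindex)
  qed
  then show ?thesis using rv unfolding indep_vars_def2 F_def by simp
qed

text \<open>For a test function bounded by B the two integrals differ by at most 2 B times the
  probability of disagreement. This allows an arbitrary value of the chart at the antipode.\<close>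

lemma (in prob_space) converges_in_distribution_transfer:
  fixes X X' :: "nat \<Rightarrow> 'a \<Rightarrow> 'b::euclidean_space"
  assumes conv: "converges_in_distribution M X G"
    and X [measurable]: "\<And>n. X n \<in> borel_measurable M" and X' [measurable]: "\<And>n. X' n \<in> borel_measurable M"
    and diff: "(\<lambda>n. prob {\<omega> \<in> space M. X n \<omega> \<noteq> X' n \<omega>}) \<longlonglongrightarrow> 0"
  shows "converges_in_distribution M X' G"
  unfolding converges_in_distribution_def weakly_converges_def
proof (intro allI impI)
  fix f :: "'b \<Rightarrow> real"
  assume f: "continuous_on UNIV f \<and> bounded (range f)"
  then obtain B where B: "\<And>x. \<bar>f x\<bar> \<le> B" by (auto simp: bounded_iff)
  have fm [measurable]: "f \<in> borel_measurable borel" using f by (simp add: borel_measurable_continuous_onI)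
  have i: "integrable M (\<lambda>\<omega>. f (Z \<omega>))" if [measurable]: "Z \<in> borel_measurable M" for Z
    by (rule integrable_const_bound[of _ B]) (use B in auto)
  have d: "(\<integral>x. f x \<partial>distr M borel Z) = expectation (\<lambda>\<omega>. f (Z \<omega>))" if [measurable]: "Z \<in> borel_measurable M" for Z
    by (rule integral_distr) measurable
  have lim: "(\<lambda>n. \<integral>x. f x \<partial>distr M borel (X n)) \<longlonglongrightarrow> (\<integral>x. f x \<partial>G)"
    using conv f unfolding converges_in_distribution_def weakly_converges_def by blast
  have "(\<lambda>n. (\<integral>x. f x \<partial>distr M borel (X' n)) - (\<integral>x. f x \<partial>distr M borel (X n))) \<longlonglongrightarrow> 0"
  proof (rule Lim_null_comparison)
    show "(\<lambda>n. (2 * B) * prob {\<omega> \<in> space M. X n \<omega> \<noteq> X' n \<omega>}) \<longlonglongrightarrow> 0"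
      using tendsto_mult[OF tendsto_const diff, of "2 * B"] by simp
    show "\<forall>\<^sub>F n in sequentially. norm ((\<integral>x. f x \<partial>distr M borel (X' n)) - (\<integral>x. f x \<partial>distr M borel (X n)))
        \<le> (2 * B) * prob {\<omega> \<in> space M. X n \<omega> \<noteq> X' n \<omega>}"
    proof (rule always_eventually, rule allI)
      fix n
      let ?T = "{\<omega> \<in> space M. X n \<omega> \<noteq> X' n \<omega>}"
      have T: "?T \<in> events" by measurable
      then have iT: "integrable M (indicat_real ?T)" by (intro integrable_real_indicator) (auto simp: less_top[symmetric])
      have "norm ((\<integral>x. f x \<partial>distr M borel (X' n)) - (\<integral>x. f x \<partial>distr M borel (X n)))
          = \<bar>expectation (\<lambda>\<omega>. f (X' n \<omega>) - f (X n \<omega>))\<bar>"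
        using i[OF X] i[OF X'] by (simp add: d)
      also have "\<dots> \<le> expectation (\<lambda>\<omega>. \<bar>f (X' n \<omega>) - f (X n \<omega>)\<bar>)" by (rule integral_abs_bound)
      also have "\<dots> \<le> expectation (\<lambda>\<omega>. (2 * B) * indicat_real ?T \<omega>)"
      proof (rule integral_mono)
        fix \<omega> assume w: "\<omega> \<in> space M"
        show "\<bar>f (X' n \<omega>) - f (X n \<omega>)\<bar> \<le> (2 * B) * indicat_real ?T \<omega>"
        proof (cases "\<omega> \<in> ?T")
          case True
          then show ?thesis using B[of "X' n \<omega>"] B[of "X n \<omega>"] by simp
        next
          case False
          then show ?thesis using w by simp
        qed
      qed (use i[OF X] i[OF X'] iT in auto)
      also have "\<dots> = (2 * B) * prob ?T" using T by simp
      finally show "norm ((\<integral>x. f x \<partial>distr M borel (X' n)) - (\<integral>x. f x \<partial>distr M borel (X n))) \<le> (2 * B) * prob ?T" .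
    qed
  qed
  from tendsto_add[OF this lim] show "(\<lambda>n. \<integral>x. f x \<partial>distr M borel (X' n)) \<longlonglongrightarrow> (\<integral>x. f x \<partial>G)" by simp
qed

locale sphere_sample = sphere_law \<mu> e Q + M: prob_space M
  for \<mu> :: "'a::euclidean_space" and e :: "'d::finite \<Rightarrow> 'a" and Q :: "'a measure" and M :: "'w measure" +
  fixes Y :: "nat \<Rightarrow> 'w \<Rightarrow> 'a" and \<mu>s :: "nat \<Rightarrow> 'w \<Rightarrow> 'a"
  assumes ind: "M.indep_vars (\<lambda>_. sphere_borel) Y UNIV"
    and law: "\<And>i. distr M sphere_borel (Y i) = Q"
    and \<mu>s_meas: "\<And>n. n \<ge> 1 \<Longrightarrow> \<mu>s n \<in> borel_measurable M"
    and \<mu>s_min: "\<And>n \<omega>. n \<ge> 1 \<Longrightarrow> \<omega> \<in> space M \<Longrightarrow>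
      \<mu>s n \<omega> \<in> frechet_minimizers (\<lambda>p. (\<Sum>i<n. (geo_dist p (Y i \<omega>))\<^sup>2) / real n)"
begin

lemma Y_meas: "Y i \<in> M \<rightarrow>\<^sub>M sphere_borel"
  using ind unfolding M.indep_vars_def2 by simp

lemma norm_Y: "\<omega> \<in> space M \<Longrightarrow> norm (Y i \<omega>) = 1"
  using measurable_space[OF Y_meas, of \<omega> i] by (simp add: space_restrict_space)

lemma norm_\<mu>s: "n \<ge> 1 \<Longrightarrow> \<omega> \<in> space M \<Longrightarrow> norm (\<mu>s n \<omega>) = 1"
  using \<mu>s_min[of n \<omega>] by (simp add: frechet_minimizers_def)

lemma \<mu>s_le:
  assumes "n \<ge> 1" "\<omega> \<in> space M" "norm p = 1"
  shows "(\<Sum>i<n. (arccos (\<mu>s n \<omega> \<bullet> Y i \<omega>))\<^sup>2) \<le> (\<Sum>i<n. (arccos (p \<bullet> Y i \<omega>))\<^sup>2)"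
proof -
  have "(\<Sum>i<n. (geo_dist (\<mu>s n \<omega>) (Y i \<omega>))\<^sup>2) / real n \<le> (\<Sum>i<n. (geo_dist p (Y i \<omega>))\<^sup>2) / real n"
    using \<mu>s_min[OF assms(1,2)] assms(3) by (simp add: frechet_minimizers_def)
  then have "(\<Sum>i<n. (geo_dist (\<mu>s n \<omega>) (Y i \<omega>))\<^sup>2) \<le> (\<Sum>i<n. (geo_dist p (Y i \<omega>))\<^sup>2)"
    using assms(1) by (simp add: divide_le_cancel)
  then show ?thesis
    using geo_dist_sphere[OF norm_\<mu>s[OF assms(1,2)] norm_Y[OF assms(2)]] geo_dist_sphere[OF assms(3) norm_Y[OF assms(2)]]
    by simp
qed

section \<open>Consistency of the sample mean\<close>

lemma dist2_measurable: "norm p = 1 \<Longrightarrow> (\<lambda>q. (arccos (p \<bullet> q))\<^sup>2) \<in> borel_measurable sphere_borel"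
  using arccos_inner_measurable[of p] by measurable

lemma dist2_bound: "norm p = 1 \<Longrightarrow> q \<in> space sphere_borel \<Longrightarrow> \<bar>(arccos (p \<bullet> q))\<^sup>2\<bar> \<le> pi\<^sup>2"
proof -
  assume p: "norm p = 1" and "q \<in> space sphere_borel"
  then have "\<bar>p \<bullet> q\<bar> \<le> 1" using Cauchy_Schwarz_ineq2[of p q] by (simp add: space_restrict_space)
  then have "0 \<le> arccos (p \<bullet> q)" "arccos (p \<bullet> q) \<le> pi" by (auto simp: abs_le_iff intro: arccos_lbound arccos_ubound)
  then show ?thesis by (simp add: power_mono)
qed

lemma dist2_integrable:
  assumes "norm p = 1"
  shows "integrable Q (\<lambda>q. (arccos (p \<bullet> q))\<^sup>2)"
proof (rule Q.integrable_const_bound[OF _ Q_measurable[OF dist2_measurable[OF assms]]])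
  show "AE q in Q. norm ((arccos (p \<bullet> q))\<^sup>2) \<le> pi\<^sup>2"
    unfolding real_norm_def
    by (rule AE_I2, rule dist2_bound[OF assms]) (simp add: space_Q space_restrict_space)
qed

text \<open>The squared distance is continuous on the compact square of the sphere, also across the
  cut locus, hence uniformly so. The modulus does not depend on q, so one finite set of centres
  serves every sample.\<close>

lemma dist2_equicontinuous:
  assumes "\<epsilon> > 0"
  obtains d where "d > 0" "\<And>p p' q. norm p = 1 \<Longrightarrow> norm p' = 1 \<Longrightarrow> norm q = 1 \<Longrightarrow> norm (p - p') < d \<Longrightarrow>
    \<bar>(arccos ((p :: 'a) \<bullet> q))\<^sup>2 - (arccos (p' \<bullet> q))\<^sup>2\<bar> < \<epsilon>"
proof -
  let ?S = "sphere (0 :: 'a) 1 \<times> sphere (0 :: 'a) 1"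
  have b: "\<bar>fst z \<bullet> snd z\<bar> \<le> 1" if "z \<in> ?S" for z
    using Cauchy_Schwarz_ineq2[of "fst z" "snd z"] that by (auto simp: mem_Times_iff)
  have "continuous_on ?S (\<lambda>z. (arccos (fst z \<bullet> snd z))\<^sup>2)"
    by (intro continuous_on_power continuous_on_compose2[OF continuous_on_arccos'] continuous_intros)
      (use b in \<open>auto simp: abs_le_iff\<close>)
  moreover have "compact ?S" by (intro compact_Times compact_sphere)
  ultimately have "uniformly_continuous_on ?S (\<lambda>z. (arccos (fst z \<bullet> snd z))\<^sup>2)"
    by (rule compact_uniformly_continuous)
  then obtain d where d: "d > 0" "\<And>z z'. z \<in> ?S \<Longrightarrow> z' \<in> ?S \<Longrightarrow> dist z' z < d \<Longrightarrow>
      dist ((arccos (fst z' \<bullet> snd z'))\<^sup>2) ((arccos (fst z \<bullet> snd z))\<^sup>2) < \<epsilon>"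
    using assms unfolding uniformly_continuous_on_def by metis
  show thesis
  proof (rule that[OF d(1)])
    fix p p' q :: 'a assume "norm p = 1" "norm p' = 1" "norm q = 1" "norm (p - p') < d"
    then show "\<bar>(arccos (p \<bullet> q))\<^sup>2 - (arccos (p' \<bullet> q))\<^sup>2\<bar> < \<epsilon>"
      using d(2)[of "(p', q)" "(p, q)"] by (simp add: dist_Pair_Pair dist_norm)
  qed
qed

lemma frechet_fun_continuous: "continuous_on (sphere 0 1) (frechet_fun Q)"
  unfolding continuous_on_iff
proof (intro ballI allI impI)
  fix p :: 'a and \<epsilon> :: real assume p: "p \<in> sphere 0 1" and \<epsilon>: "\<epsilon> > 0"
  then have e2: "\<epsilon> / 2 > 0" by simp
  obtain d where d: "d > 0" "\<And>p p' q. norm p = 1 \<Longrightarrow> norm p' = 1 \<Longrightarrow> norm q = 1 \<Longrightarrow> norm (p - p') < d \<Longrightarrow>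
    \<bar>(arccos ((p :: 'a) \<bullet> q))\<^sup>2 - (arccos (p' \<bullet> q))\<^sup>2\<bar> < \<epsilon> / 2" by (rule dist2_equicontinuous[OF e2]) blast
  have "dist (frechet_fun Q p') (frechet_fun Q p) < \<epsilon>" if p': "p' \<in> sphere 0 1" "dist p' p < d" for p'
  proof -
    have n: "norm p = 1" "norm p' = 1" using p p' by auto
    have "\<bar>frechet_fun Q p' - frechet_fun Q p\<bar> = \<bar>\<integral>q. (arccos (p' \<bullet> q))\<^sup>2 - (arccos (p \<bullet> q))\<^sup>2 \<partial>Q\<bar>"
      using n dist2_integrable by (simp add: frechet_fun_eq)
    also have "\<dots> \<le> (\<integral>q. \<bar>(arccos (p' \<bullet> q))\<^sup>2 - (arccos (p \<bullet> q))\<^sup>2\<bar> \<partial>Q)" by (rule integral_abs_bound)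
    also have "\<dots> \<le> (\<integral>q. \<epsilon> / 2 \<partial>Q)"
    proof (rule integral_mono)
      show "integrable Q (\<lambda>q. \<bar>(arccos (p' \<bullet> q))\<^sup>2 - (arccos (p \<bullet> q))\<^sup>2\<bar>)"
        using n dist2_integrable by (intro integrable_abs Bochner_Integration.integrable_diff)
      show "\<bar>(arccos (p' \<bullet> q))\<^sup>2 - (arccos (p \<bullet> q))\<^sup>2\<bar> \<le> \<epsilon> / 2" if "q \<in> space Q" for q
        using d(2)[OF n(2,1), of q] p'(2) that by (simp add: space_Q dist_norm less_imp_le)
    qed simp
    also have "\<dots> = \<epsilon> / 2" by (simp add: Q.prob_space)
    finally show ?thesis using \<epsilon> by (simp add: dist_real_def)
  qed
  then show "\<exists>d>0. \<forall>x'\<in>sphere 0 1. dist x' p < d \<longrightarrow> dist (frechet_fun Q x') (frechet_fun Q p) < \<epsilon>"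
    using d(1) by blast
qed

text \<open>Wald's argument: away from mu the population criterion exceeds its minimum by a fixed
  \<gamma> on a compact set. Finitely many balls reduce the empirical criterion there to its values
  at the centres, where Chebyshev's inequality applies.\<close>

theorem sample_mean_consistent:
  assumes t: "t < 1"
  shows "(\<lambda>n. M.prob {\<omega> \<in> space M. \<mu> \<bullet> \<mu>s n \<omega> \<le> t}) \<longlonglongrightarrow> 0"
proof -
  define K where "K = {p \<in> sphere 0 1. \<mu> \<bullet> p \<le> t}"
  show ?thesis
  proof (cases "K = {}")
    case True
    have "\<forall>\<^sub>F n in sequentially. M.prob {\<omega> \<in> space M. \<mu> \<bullet> \<mu>s n \<omega> \<le> t} = 0"
      using eventually_ge_at_top[of 1]
    proof eventually_elim
      case (elim n)
      have "{\<omega> \<in> space M. \<mu> \<bullet> \<mu>s n \<omega> \<le> t} = {}" using True norm_\<mu>s[OF elim] by (auto simp: K_def)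
      then show ?case by (simp only: measure_empty)
    qed
    then show ?thesis by (rule tendsto_eventually)
  next
    case False
    have "K = sphere 0 1 \<inter> {p. \<mu> \<bullet> p \<le> t}" by (auto simp: K_def)
    then have cK: "compact K" by (simp add: compact_Int_closed closed_halfspace_le)
    have "continuous_on K (frechet_fun Q)"
      by (rule continuous_on_subset[OF frechet_fun_continuous]) (auto simp: K_def)
    from continuous_attains_inf[OF cK False this] obtain p0 where p0: "p0 \<in> K"
      "\<And>p. p \<in> K \<Longrightarrow> frechet_fun Q p0 \<le> frechet_fun Q p" by blast
    \<comment> \<open>Sampling errors at a centre and at mu cost \<gamma>/4 each and moving to the
      nearest centre costs \<gamma>/8. The sum 5\<gamma>/8 is less than the gap, so no minimiser can
      lie in K.\<close>
    define \<gamma> where "\<gamma> = frechet_fun Q p0 - frechet_fun Q \<mu>"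
    have "p0 \<noteq> \<mu>" using p0(1) t by (auto simp: K_def \<mu>\<mu>)
    then have \<gamma>: "\<gamma> > 0" using mean_unique[of p0] p0(1) by (simp add: \<gamma>_def K_def)
    then have g8: "\<gamma> / 8 > 0" and g4: "\<gamma> / 4 > 0" by simp_all
    obtain d where d: "d > 0" "\<And>p p' q. norm p = 1 \<Longrightarrow> norm p' = 1 \<Longrightarrow> norm q = 1 \<Longrightarrow> norm (p - p') < d \<Longrightarrow>
      \<bar>(arccos ((p :: 'a) \<bullet> q))\<^sup>2 - (arccos (p' \<bullet> q))\<^sup>2\<bar> < \<gamma> / 8" by (rule dist2_equicontinuous[OF g8]) blast
    have "K \<subseteq> (\<Union>p\<in>K. ball p d)" using d(1) by auto
    then obtain V where V: "V \<subseteq> K" "finite V" "K \<subseteq> (\<Union>p\<in>V. ball p d)"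
      using compactE_image[OF cK, of K "\<lambda>p. ball p d"] by blast
    have nV: "norm v = 1" if "v \<in> insert \<mu> V" for v using that V(1) norm_\<mu> by (auto simp: K_def)
    define Gn where "Gn n v \<omega> = (\<Sum>i<n. (arccos (v \<bullet> Y i \<omega>))\<^sup>2) / real n" for n v \<omega>
    define Bad where "Bad n v = {\<omega> \<in> space M. \<gamma> / 4 \<le> \<bar>Gn n v \<omega> - (\<integral>q. (arccos (v \<bullet> q))\<^sup>2 \<partial>Q)\<bar>}" for n v
    have Bad_events: "Bad n v \<in> M.events" if "v \<in> insert \<mu> V" for n v
    proof -
      have "(\<lambda>\<omega>. (arccos (v \<bullet> Y i \<omega>))\<^sup>2) \<in> borel_measurable M" for i
        using measurable_compose[OF Y_meas dist2_measurable[OF nV[OF that]]] by blast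
      then have [measurable]: "Gn n v \<in> borel_measurable M" unfolding Gn_def[abs_def] by measurable
      show ?thesis unfolding Bad_def by measurable
    qed
    have Bad_prob: "M.prob (Bad n v) \<le> (\<integral>q. ((arccos (v \<bullet> q))\<^sup>2)\<^sup>2 \<partial>Q) / (real n * (\<gamma> / 4)\<^sup>2)"
      if "v \<in> insert \<mu> V" "n \<ge> 1" for n v
      unfolding Bad_def Gn_def
      by (rule M.iid_mean_deviation[OF ind law dist2_measurable[OF nV[OF that(1)]] dist2_bound[OF nV[OF that(1)]] that(2) g4])
    have sub: "{\<omega> \<in> space M. \<mu> \<bullet> \<mu>s n \<omega> \<le> t} \<subseteq> (\<Union>v\<in>insert \<mu> V. Bad n v)" if n: "n \<ge> 1" for n
    proof (rule subsetI, rule ccontr)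
      fix \<omega> assume w: "\<omega> \<in> {\<omega> \<in> space M. \<mu> \<bullet> \<mu>s n \<omega> \<le> t}" and no: "\<omega> \<notin> (\<Union>v\<in>insert \<mu> V. Bad n v)"
      have close: "\<bar>Gn n v \<omega> - frechet_fun Q v\<bar> < \<gamma> / 4" if "v \<in> insert \<mu> V" for v
        using no w that nV[OF that] by (auto simp: Bad_def frechet_fun_eq not_le)
      have wM: "\<omega> \<in> space M" using w by simp
      then have "\<mu>s n \<omega> \<in> K" using w norm_\<mu>s[OF n] by (simp add: K_def)
      then obtain v where v: "v \<in> V" "\<mu>s n \<omega> \<in> ball v d" using V(3) by blast
      have "Gn n v \<omega> - Gn n (\<mu>s n \<omega>) \<omega> = (\<Sum>i<n. (arccos (v \<bullet> Y i \<omega>))\<^sup>2 - (arccos (\<mu>s n \<omega> \<bullet> Y i \<omega>))\<^sup>2) / real n"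
        by (simp add: Gn_def sum_subtractf diff_divide_distrib)
      also have "\<dots> \<le> (\<Sum>i<n. \<gamma> / 8) / real n"
      proof (intro divide_right_mono sum_mono)
        fix i
        have "\<bar>(arccos (v \<bullet> Y i \<omega>))\<^sup>2 - (arccos (\<mu>s n \<omega> \<bullet> Y i \<omega>))\<^sup>2\<bar> < \<gamma> / 8"
          using v nV[of v] norm_\<mu>s[OF n wM] norm_Y[OF wM] by (intro d(2)) (auto simp: dist_norm)
        then show "(arccos (v \<bullet> Y i \<omega>))\<^sup>2 - (arccos (\<mu>s n \<omega> \<bullet> Y i \<omega>))\<^sup>2 \<le> \<gamma> / 8" by linarith
      qed simp
      also have "\<dots> = \<gamma> / 8" using n by simp
      finally have 1: "Gn n v \<omega> \<le> Gn n (\<mu>s n \<omega>) \<omega> + \<gamma> / 8" by simp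
      have 2: "Gn n (\<mu>s n \<omega>) \<omega> \<le> Gn n \<mu> \<omega>"
        unfolding Gn_def by (intro divide_right_mono \<mu>s_le[OF n wM norm_\<mu>]) simp
      have 3: "frechet_fun Q \<mu> + \<gamma> \<le> frechet_fun Q v" using p0(2)[of v] v V(1) by (auto simp: \<gamma>_def)
      show False using 1 2 3 close[of v] close[of \<mu>] v(1) \<gamma> unfolding abs_less_iff by simp
    qed
    show ?thesis
    proof (rule tendsto_sandwich[OF _ _ tendsto_const])
      show "(\<lambda>n. \<Sum>v\<in>insert \<mu> V. (\<integral>q. ((arccos (v \<bullet> q))\<^sup>2)\<^sup>2 \<partial>Q) / (\<gamma> / 4)\<^sup>2 * inverse (real n)) \<longlonglongrightarrow> 0"
        by (rule tendsto_null_sum, rule tendsto_mult_right_zero, rule lim_inverse_n)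
      show "\<forall>\<^sub>F n in sequentially. M.prob {\<omega> \<in> space M. \<mu> \<bullet> \<mu>s n \<omega> \<le> t}
          \<le> (\<Sum>v\<in>insert \<mu> V. (\<integral>q. ((arccos (v \<bullet> q))\<^sup>2)\<^sup>2 \<partial>Q) / (\<gamma> / 4)\<^sup>2 * inverse (real n))"
        using eventually_ge_at_top[of 1]
      proof eventually_elim
        case (elim n)
        have "M.prob {\<omega> \<in> space M. \<mu> \<bullet> \<mu>s n \<omega> \<le> t} \<le> M.prob (\<Union>v\<in>insert \<mu> V. Bad n v)"
          by (rule M.finite_measure_mono[OF sub[OF elim]]) (use Bad_events V(2) in blast)
        also have "\<dots> \<le> (\<Sum>v\<in>insert \<mu> V. M.prob (Bad n v))"
          by (rule M.finite_measure_subadditive_finite) (use Bad_events V(2) in auto)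
        also have "\<dots> \<le> (\<Sum>v\<in>insert \<mu> V. (\<integral>q. ((arccos (v \<bullet> q))\<^sup>2)\<^sup>2 \<partial>Q) / (\<gamma> / 4)\<^sup>2 * inverse (real n))"
        proof (rule sum_mono)
          fix v assume "v \<in> insert \<mu> V"
          have eq: "X / (real n * a) = X / a * inverse (real n)" for X a by (simp add: field_simps)
          from Bad_prob[OF \<open>v \<in> insert \<mu> V\<close> elim, unfolded eq] show "M.prob (Bad n v) \<le> (\<integral>q. ((arccos (v \<bullet> q))\<^sup>2)\<^sup>2 \<partial>Q) / (\<gamma> / 4)\<^sup>2 * inverse (real n)" .
        qed
        finally show ?case .
      qed
    qed simp
  qed
qed

text \<open>The value of \<open>log_chart\<close> at \<open>- \<mu>\<close> is unspecified; a vector outside the unit ball is used instead.\<close>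

definition x :: "nat \<Rightarrow> 'w \<Rightarrow> real ^ 'd" where
  "x n \<omega> = (if \<mu>s n \<omega> = - \<mu> then 2 *\<^sub>R axis undefined 1 else logc (\<mu>s n \<omega>))"

text \<open>The uncentred second moments are the covariances because the gradient has mean
  zero.\<close>

definition Cmat :: "real ^ 'd ^ 'd" where "Cmat = (\<chi> i j. \<integral>q. g q $ i * g q $ j \<partial>Q)"

lemma \<mu>s_sphere_measurable: "n \<ge> 1 \<Longrightarrow> \<mu>s n \<in> M \<rightarrow>\<^sub>M sphere_borel"
  using \<mu>s_meas norm_\<mu>s by (intro measurable_restrict_space2) auto

lemma if_antipode_measurable:
  fixes c :: "'c::topological_space"
  assumes "n \<ge> 1" and k: "k \<in> sphere_borel \<rightarrow>\<^sub>M borel"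
  shows "(\<lambda>\<omega>. if \<mu>s n \<omega> = - \<mu> then c else k (\<mu>s n \<omega>)) \<in> borel_measurable M"
proof (rule measurable_If)
  have [measurable]: "\<mu>s n \<in> borel_measurable M" by (rule \<mu>s_meas[OF assms(1)])
  show "{\<omega> \<in> space M. \<mu>s n \<omega> = - \<mu>} \<in> sets M" by measurable
  show "(\<lambda>\<omega>. k (\<mu>s n \<omega>)) \<in> borel_measurable M"
    by (rule measurable_compose[OF \<mu>s_sphere_measurable[OF assms(1)] k])
qed simp

lemma x_measurable: "n \<ge> 1 \<Longrightarrow> x n \<in> borel_measurable M"
  unfolding x_def[abs_def] by (rule if_antipode_measurable[OF _ logc_measurable])

lemma x_consistent:
  assumes "\<eta> > 0"
  shows "(\<lambda>n. M.prob {\<omega> \<in> space M. norm (x n \<omega>) \<ge> \<eta>}) \<longlonglongrightarrow> 0"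
proof -
  \<comment> \<open>Capping \<eta> at 1 keeps the angle in [0, pi], where the cosine decreases. The
    antipode belongs to the event as well, since t \<ge> -1.\<close>
  define t where "t = cos (min \<eta> 1)"
  have m: "0 < min \<eta> 1" "min \<eta> 1 \<le> pi" using assms pi_gt3 by auto
  have t: "t < 1" using cos_monotone_0_pi[of 0 "min \<eta> 1"] m by (simp add: t_def)
  have t': "t \<ge> -1" by (simp add: t_def)
  show ?thesis
  proof (rule tendsto_sandwich[OF _ _ tendsto_const sample_mean_consistent[OF t]])
    show "\<forall>\<^sub>F n in sequentially. M.prob {\<omega> \<in> space M. \<eta> \<le> norm (x n \<omega>)} \<le> M.prob {\<omega> \<in> space M. \<mu> \<bullet> \<mu>s n \<omega> \<le> t}"
      using eventually_ge_at_top[of 1]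
    proof eventually_elim
      case (elim n)
      have [measurable]: "\<mu>s n \<in> borel_measurable M" by (rule \<mu>s_meas[OF elim])
      show ?case
      proof (rule M.finite_measure_mono)
        show "{\<omega> \<in> space M. \<mu> \<bullet> \<mu>s n \<omega> \<le> t} \<in> M.events" by measurable
        show "{\<omega> \<in> space M. \<eta> \<le> norm (x n \<omega>)} \<subseteq> {\<omega> \<in> space M. \<mu> \<bullet> \<mu>s n \<omega> \<le> t}"
        proof safe
          fix \<omega> assume w: "\<omega> \<in> space M" "\<eta> \<le> norm (x n \<omega>)"
          show "\<mu> \<bullet> \<mu>s n \<omega> \<le> t"
          proof (cases "\<mu>s n \<omega> = - \<mu>")
            case True
            then show ?thesis using t' by (simp add: \<mu>\<mu>)
          next
            case False
            note l = norm_logc[OF norm_\<mu>s[OF elim w(1)] False]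
            have b: "\<bar>\<mu>s n \<omega> \<bullet> \<mu>\<bar> \<le> 1"
              using Cauchy_Schwarz_ineq2[of "\<mu>s n \<omega>" \<mu>] norm_\<mu>s[OF elim w(1)] norm_\<mu> by simp
            have "min \<eta> 1 \<le> arccos (\<mu>s n \<omega> \<bullet> \<mu>)" using w(2) False l(1) by (simp add: x_def)
            then have "cos (arccos (\<mu>s n \<omega> \<bullet> \<mu>)) \<le> t"
              unfolding t_def using m l(2) by (intro cos_monotone_0_pi_le) auto
            then show ?thesis using b by (simp add: cos_arccos_abs inner_commute)
          qed
        qed
      qed
    qed
  qed simp
qed

lemma h_pointwise_differentiable:
  assumes q: "norm q = 1" "q \<noteq> - \<mu>"
  shows "((\<lambda>u. (h u q - h 0 q - g q \<bullet> u) / norm u) \<longlongrightarrow> 0) (at 0)"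
proof (rule rem_bound)
  fix K :: real
  assume K: "K > 0" "\<And>u q. norm u < 1 \<Longrightarrow> norm q = 1 \<Longrightarrow> q \<noteq> - \<mu> \<Longrightarrow> \<bar>rem u q\<bar> \<le> K * (norm u)\<^sup>2 / norm (q + \<mu>)"
  show ?thesis
  proof (rule Lim_null_comparison)
    show "((\<lambda>u :: real ^ 'd. K / norm (q + \<mu>) * norm u) \<longlongrightarrow> 0) (at 0)"
      using tendsto_mult[OF tendsto_const norm_tendsto_0, of "K / norm (q + \<mu>)"] by simp
    have "\<forall>\<^sub>F u :: real ^ 'd in at 0. dist u 0 < 1" unfolding eventually_at by (intro exI[of _ 1]) simp
    then show "\<forall>\<^sub>F u in at 0. norm ((h u q - h 0 q - g q \<bullet> u) / norm u) \<le> K / norm (q + \<mu>) * norm u"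
    proof eventually_elim
      case (elim u)
      then have "\<bar>rem u q\<bar> \<le> K * (norm u)\<^sup>2 / norm (q + \<mu>)" using K(2)[OF _ q] by (simp add: dist_norm)
      then have "\<bar>rem u q\<bar> / norm u \<le> (K * (norm u)\<^sup>2 / norm (q + \<mu>)) / norm u" by (rule divide_right_mono) simp
      also have "\<dots> = K / norm (q + \<mu>) * norm u" by (cases "u = 0") (simp_all add: power2_eq_square)
      finally show ?case by (simp add: rem_def)
    qed
  qed
qed

lemma m_estimation:
  assumes "invertible \<Lambda>Q"
  obtains L C c where "semiconcave_m_estimation M sphere_borel Q Y h g \<Lambda>Q x 1 L C c"
proof -
  obtain c where c: "c > 0" "\<And>u. c * (norm u)\<^sup>2 \<le> u \<bullet> (\<Lambda>Q *v u)" by (rule \<Lambda>Q_pos[OF assms]) blast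
  show thesis
  proof (rule h_bounds)
    fix b K :: real
    assume b: "b \<ge> 1" and K: "K > 0"
      and lip: "\<And>x y q. norm x < 1 \<Longrightarrow> norm y < 1 \<Longrightarrow> norm q = 1 \<Longrightarrow> \<bar>h x q - h y q\<bar> \<le> 2 * pi * b * norm (x - y)"
      and conc: "\<And>q. norm q = 1 \<Longrightarrow> convex_on (ball 0 1) (\<lambda>u. K * (norm u)\<^sup>2 - h u q)"
    have s: "q \<in> space sphere_borel \<longleftrightarrow> norm q = 1" for q :: 'a by (simp add: space_restrict_space)
    \<comment> \<open>A single constant L = 2 pi b bounds both the gradient and the Lipschitz
      quotient.\<close>
    have b2: "2 * pi \<le> 2 * pi * b" using b by simp
    have "semiconcave_m_estimation M sphere_borel Q Y h g \<Lambda>Q x 1 (2 * pi * b) K c"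
    proof unfold_locales
      show "M.indep_vars (\<lambda>_. sphere_borel) Y UNIV" by (rule ind)
      show "distr M sphere_borel (Y i) = Q" for i by (rule law)
      show "(0::real) < 1" "0 \<le> 2 * pi * b" "0 \<le> K" "0 < c" using b K c by simp_all
      show "h u \<in> borel_measurable sphere_borel" if "norm u < 1" for u by (rule h_measurable)
      show "g \<in> borel_measurable sphere_borel" by (rule g_measurable)
      show "norm (g q) \<le> 2 * pi * b" if "q \<in> space sphere_borel" for q
        using norm_g_le[of q] that b2 unfolding s by linarith
      show "\<bar>h u q - h 0 q\<bar> \<le> 2 * pi * b * norm u" if "q \<in> space sphere_borel" "norm u < 1" for q u
        using lip[of u 0 q] that unfolding s by simp
      show "convex_on (ball 0 1) (\<lambda>u. K * (norm u)\<^sup>2 - h u q)" if "q \<in> space sphere_borel" for q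
        using conc that unfolding s by blast
      show "(\<integral>q. g q \<bullet> t \<partial>Q) = 0" for t by (rule g_mean)
      show "AE q in Q. ((\<lambda>u. (h u q - h 0 q - g q \<bullet> u) / norm u) \<longlongrightarrow> 0) (at 0)"
        using ae' by eventually_elim (rule h_pointwise_differentiable; simp)
      show "((\<lambda>u. ((\<integral>q. h u q - h 0 q \<partial>Q) - (u \<bullet> (\<Lambda>Q *v u)) / 2) / (norm u)\<^sup>2) \<longlongrightarrow> 0) (at 0)"
        using F_taylor unfolding F_def .
      show "transpose \<Lambda>Q = \<Lambda>Q" by (rule \<Lambda>Q_sym)
      show "c * (norm u)\<^sup>2 \<le> u \<bullet> (\<Lambda>Q *v u)" for u by (rule c(2))
      show "x n \<in> borel_measurable M" if "n \<ge> 1" for n by (rule x_measurable[OF that])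
      show "(\<lambda>n. M.prob {\<omega> \<in> space M. norm (x n \<omega>) \<ge> \<eta>}) \<longlonglongrightarrow> 0" if "\<eta> > 0" for \<eta>
        by (rule x_consistent[OF that])
      show "(\<Sum>i<n. h (x n \<omega>) (Y i \<omega>)) \<le> (\<Sum>i<n. h y (Y i \<omega>))"
        if n: "n \<ge> 1" and w: "\<omega> \<in> space M" and nx: "norm (x n \<omega>) < 1" for n \<omega> y
      proof -
        \<comment> \<open>The substitute vector for the antipode has norm 2, so a value in the unit
          ball comes from a point where the chart is genuine.\<close>
        have "\<mu>s n \<omega> \<noteq> - \<mu>" using nx by (auto simp: x_def)
        then have "E (x n \<omega>) = \<mu>s n \<omega>" using norm_logc(3)[OF norm_\<mu>s[OF n w]] by (simp add: x_def)
        then show ?thesis using \<mu>s_le[OF n w, of "E y"] by (simp add: h_def)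
      qed
    qed
    then show thesis by (rule that)
  qed
qed

section \<open>The limit law in the chart\<close>

lemma g_components_integrable: "integrable Q (\<lambda>q. g q $ i * g q $ j)"
proof (rule Q.integrable_const_bound[of _ "(2 * pi) * (2 * pi)"])
  have "(\<lambda>q. g q $ i) \<in> borel_measurable Q" for i
    using g_inner_measurable[of "axis i 1"] by (simp add: inner_axis)
  then show "(\<lambda>q. g q $ i * g q $ j) \<in> borel_measurable Q" by measurable
  show "AE q in Q. norm (g q $ i * g q $ j) \<le> (2 * pi) * (2 * pi)"
  proof (rule AE_I2)
    fix q assume "q \<in> space Q"
    then have "norm (g q) \<le> 2 * pi" using norm_g_le[of q] by (simp add: space_Q)
    then have "\<bar>g q $ i\<bar> \<le> 2 * pi" for i using component_le_norm_cart[of "g q" i] by linarith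
    then show "norm (g q $ i * g q $ j) \<le> (2 * pi) * (2 * pi)"
      unfolding real_norm_def abs_mult by (intro mult_mono) auto
  qed
qed

lemma Cmat_quadratic: "w \<bullet> (Cmat *v w) = (\<integral>q. (g q \<bullet> w)\<^sup>2 \<partial>Q)"
proof -
  have "(g q \<bullet> w)\<^sup>2 = (\<Sum>i\<in>UNIV. \<Sum>j\<in>UNIV. w $ i * w $ j * (g q $ i * g q $ j))" for q
    by (simp add: inner_vec_def power2_eq_square sum_product mult_ac)
  then have "(\<integral>q. (g q \<bullet> w)\<^sup>2 \<partial>Q) = (\<Sum>i\<in>UNIV. \<Sum>j\<in>UNIV. w $ i * w $ j * (\<integral>q. g q $ i * g q $ j \<partial>Q))"
    using g_components_integrable by simp
  also have "\<dots> = w \<bullet> (Cmat *v w)"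
    by (simp add: Cmat_def inner_vec_def matrix_vector_mult_def sum_distrib_left mult_ac)
  finally show ?thesis by simp
qed

lemma Cmat_sym: "transpose Cmat = Cmat"
  by (simp add: Cmat_def transpose_def vec_eq_iff mult.commute)

theorem scaled_chart_clt:
  assumes "invertible \<Lambda>Q"
  shows "converges_in_distribution M (\<lambda>n \<omega>. sqrt n *\<^sub>R x n \<omega>) (gaussian 0 (matrix_inv \<Lambda>Q ** Cmat ** matrix_inv \<Lambda>Q))"
proof (rule m_estimation[OF assms])
  fix L C c
  assume "semiconcave_m_estimation M sphere_borel Q Y h g \<Lambda>Q x 1 L C c"
  then interpret est: semiconcave_m_estimation M sphere_borel Q Y h g \<Lambda>Q x 1 L C c .
  let ?I = "matrix_inv \<Lambda>Q" let ?S = "?I ** Cmat ** ?I"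
  have I: "transpose ?I = ?I" by (rule est.\<Lambda>_inverse(2))
  have "\<exists>B :: real ^ 'd ^ 'd. B ** transpose B = Cmat"
    by (rule psd_factorization[OF Cmat_sym]) (simp add: Cmat_quadratic)
  then obtain B :: "real ^ 'd ^ 'd" where B: "B ** transpose B = Cmat" by blast
  \<comment> \<open>An explicit factor of the sandwich covariance; its existence gives meaning to
    the choice inside \<open>gaussian\<close>.\<close>
  have "(?I ** B) ** transpose (?I ** B) = ?S"
    unfolding matrix_transpose_mul I B[symmetric] by (simp only: matrix_mul_assoc)
  then have ex: "\<exists>A :: real ^ 'd ^ 'd. A ** transpose A = ?S" by blast
  show ?thesis
  proof (rule est.asymptotic_normality[OF gaussian_zero(1)[OF ex] gaussian_zero(2)[OF ex]])
    fix t :: "real ^ 'd"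
    have "t \<bullet> (?S *v t) = t \<bullet> (?I *v (Cmat *v (?I *v t)))"
      by (simp only: matrix_vector_mul_assoc matrix_mul_assoc)
    also have "\<dots> = (?I *v t) \<bullet> (Cmat *v (?I *v t))"
      by (subst inner_matrix_symmetric[OF I]) (rule inner_commute)
    also have "\<dots> = (\<integral>q. (g q \<bullet> (?I *v t))\<^sup>2 \<partial>Q)" by (rule Cmat_quadratic)
    finally show "(\<integral>z. cis (t \<bullet> z) \<partial>gaussian 0 ?S) = of_real (exp (- (\<integral>q. (g q \<bullet> (?I *v t))\<^sup>2 \<partial>Q) / 2))"
      unfolding gaussian_zero(3)[OF ex] by simp
  qed
qed

text \<open>The chart and the substitute coordinate \<open>x\<close> can differ only if the sample
  mean is the antipode. This lies in the event of a nonpositive inner product with mu, whose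
  probability tends to 0 by consistency.\<close>

theorem sample_mean_clt:
  assumes "invertible \<Lambda>Q"
  shows "converges_in_distribution M (\<lambda>n \<omega>. sqrt n *\<^sub>R (log_chart \<mu> e (\<mu>s n \<omega>) - log_chart \<mu> e \<mu>))
    (gaussian 0 (matrix_inv \<Lambda>Q ** Cmat ** matrix_inv \<Lambda>Q))"
proof (rule M.converges_in_distribution_transfer[OF scaled_chart_clt[OF assms]])
  have 0: "log_chart \<mu> e \<mu> = 0" using log_chart_E[of 0] by simp
  show "(\<lambda>\<omega>. sqrt n *\<^sub>R x n \<omega>) \<in> borel_measurable M" for n
    using x_measurable[of n] by (cases "n = 0") auto
  have eq: "log_chart \<mu> e (\<mu>s n \<omega>) = (if \<mu>s n \<omega> = - \<mu> then log_chart \<mu> e (- \<mu>) else logc (\<mu>s n \<omega>))"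
    if "n \<ge> 1" "\<omega> \<in> space M" for n \<omega>
    using log_chart_eq[OF norm_\<mu>s[OF that]] by simp
  show "(\<lambda>\<omega>. sqrt n *\<^sub>R (log_chart \<mu> e (\<mu>s n \<omega>) - log_chart \<mu> e \<mu>)) \<in> borel_measurable M" for n
  proof (cases "n = 0")
    case False
    then have n: "n \<ge> 1" by simp
    have "(\<lambda>\<omega>. log_chart \<mu> e (\<mu>s n \<omega>)) \<in> borel_measurable M"
      using if_antipode_measurable[OF n logc_measurable] by (rule measurable_cong[THEN iffD1, rotated]) (simp add: eq[OF n])
    then show ?thesis by measurable
  qed simp
  show "(\<lambda>n. M.prob {\<omega> \<in> space M. sqrt n *\<^sub>R x n \<omega> \<noteq> sqrt n *\<^sub>R (log_chart \<mu> e (\<mu>s n \<omega>) - log_chart \<mu> e \<mu>)}) \<longlonglongrightarrow> 0"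
  proof (rule tendsto_sandwich[OF _ _ tendsto_const sample_mean_consistent[of 0]])
    show "\<forall>\<^sub>F n in sequentially. M.prob {\<omega> \<in> space M. sqrt n *\<^sub>R x n \<omega> \<noteq> sqrt n *\<^sub>R (log_chart \<mu> e (\<mu>s n \<omega>) - log_chart \<mu> e \<mu>)}
      \<le> M.prob {\<omega> \<in> space M. \<mu> \<bullet> \<mu>s n \<omega> \<le> 0}"
      using eventually_ge_at_top[of 1]
    proof eventually_elim
      case (elim n)
      have [measurable]: "\<mu>s n \<in> borel_measurable M" by (rule \<mu>s_meas[OF elim])
      show ?case
      proof (rule M.finite_measure_mono)
        show "{\<omega> \<in> space M. \<mu> \<bullet> \<mu>s n \<omega> \<le> 0} \<in> M.events" by measurable
        show "{\<omega> \<in> space M. sqrt n *\<^sub>R x n \<omega> \<noteq> sqrt n *\<^sub>R (log_chart \<mu> e (\<mu>s n \<omega>) - log_chart \<mu> e \<mu>)}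
          \<subseteq> {\<omega> \<in> space M. \<mu> \<bullet> \<mu>s n \<omega> \<le> 0}"
          using eq[OF elim] by (auto simp: x_def 0 \<mu>\<mu> split: if_splits)
      qed
    qed
  qed simp_all
qed

text \<open>Partial derivatives of the squared distance are computed only for q other than - mu.
  That point is null under Q, so the integrand may be redefined there without changing the
  integral.\<close>

lemma integral_sample:
  fixes k :: "'a \<Rightarrow> real"
  assumes k: "k \<in> borel_measurable sphere_borel"
    and eq: "\<And>q. norm q = 1 \<Longrightarrow> q \<noteq> - \<mu> \<Longrightarrow> k' q = k q"
  shows "(\<integral>\<omega>. k' (Y i \<omega>) \<partial>M) = (\<integral>q. k q \<partial>Q)"
proof -
  let ?k = "\<lambda>q. if q = - \<mu> then k' (- \<mu>) else k q"
  have km: "?k \<in> borel_measurable sphere_borel"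
    using singleton_sphere_measurable[of "- \<mu>"] norm_\<mu> by (intro measurable_If k) auto
  have "(\<integral>\<omega>. k' (Y i \<omega>) \<partial>M) = (\<integral>\<omega>. ?k (Y i \<omega>) \<partial>M)"
    using eq norm_Y by (intro Bochner_Integration.integral_cong) auto
  also have "\<dots> = (\<integral>q. ?k q \<partial>distr M sphere_borel (Y i))" by (rule integral_distr[OF Y_meas km, symmetric])
  also have "\<dots> = (\<integral>q. ?k q \<partial>Q)" by (simp add: law)
  also have "\<dots> = (\<integral>q. k q \<partial>Q)"
  proof (rule integral_cong_AE)
    show "?k \<in> borel_measurable Q" "k \<in> borel_measurable Q" by (rule Q_measurable[OF km], rule Q_measurable[OF k])
    show "AE q in Q. ?k q = k q" using ae by eventually_elim simp
  qed
  finally show ?thesis .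
qed

section \<open>Identification of the expected Hessian and the gradient covariance\<close>

lemma chart_distance_eq:
  assumes "norm q = 1" "norm u < 1"
  shows "(geo_dist (log_chart_inv \<mu> e u) q)\<^sup>2 = h u q"
  using assms pi_gt3 by (simp add: log_chart_inv_eq geo_dist_sphere h_def)

lemma expected_hessian:
  "(\<chi> r r'. \<integral>\<omega>. partial_deriv r (partial_deriv r' (\<lambda>u. (geo_dist (log_chart_inv \<mu> e u) (Y i \<omega>))\<^sup>2)) 0 \<partial>M) = \<Lambda>Q"
proof -
  have "(\<integral>\<omega>. partial_deriv r (partial_deriv r' (\<lambda>u. (geo_dist (log_chart_inv \<mu> e u) (Y i \<omega>))\<^sup>2)) 0 \<partial>M)
      = (\<integral>q. Hess q $ r $ r' \<partial>Q)" for r r'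
    by (rule integral_sample[OF Hess_measurable, where k' = "\<lambda>q. partial_deriv r (partial_deriv r' (\<lambda>u. (geo_dist (log_chart_inv \<mu> e u) q)\<^sup>2)) 0"],
        rule partial_deriv2_h_0[OF chart_distance_eq]) auto
  then show ?thesis by (simp add: \<Lambda>Q_def)
qed

lemma gradient_covariance:
  "covariance_matrix M (\<lambda>\<omega>. \<chi> r. partial_deriv r (\<lambda>u. (geo_dist (log_chart_inv \<mu> e u) (Y i \<omega>))\<^sup>2) 0) = Cmat"
proof -
  let ?D = "\<lambda>r q. partial_deriv r (\<lambda>u. (geo_dist (log_chart_inv \<mu> e u) q)\<^sup>2) 0"
  have D: "?D r q = g q $ r" if "norm q = 1" "q \<noteq> - \<mu>" for r q
    by (rule partial_deriv_h_0[OF chart_distance_eq]) (use that in auto)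
  have gm: "(\<lambda>q. g q $ r) \<in> borel_measurable sphere_borel" for r
  proof -
    have "(\<lambda>q. g q \<bullet> axis r 1) \<in> borel_measurable sphere_borel" using g_measurable by measurable
    then show ?thesis by (simp add: inner_axis)
  qed
  have "(\<integral>\<omega>. ?D r (Y i \<omega>) \<partial>M) = (\<integral>q. g q $ r \<partial>Q)" for r
    by (rule integral_sample[OF gm D])
  also have "(\<integral>q. g q $ r \<partial>Q) = 0" for r using g_mean[of "axis r 1"] by (simp add: inner_axis)
  finally have m: "(\<integral>\<omega>. ?D r (Y i \<omega>) \<partial>M) = 0" for r .
  have gg: "(\<lambda>q. g q $ r * g q $ s) \<in> borel_measurable sphere_borel" for r s
    by (rule borel_measurable_times[OF gm gm])
  have "(\<integral>\<omega>. ?D r (Y i \<omega>) * ?D s (Y i \<omega>) \<partial>M) = (\<integral>q. g q $ r * g q $ s \<partial>Q)" for r s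
    by (rule integral_sample[OF gg, where k' = "\<lambda>q. ?D r q * ?D s q"]) (simp add: D)
  then show ?thesis by (simp add: covariance_matrix_def Cmat_def m)
qed

end

theorem corollary4p11:
  fixes Q :: "(real ^ 'n) measure"
    and \<mu> :: "real ^ 'n"
    and e :: "'d::finite \<Rightarrow> real ^ 'n"
    and W :: "(real ^ 'n) set"
    and f :: "real ^ 'n \<Rightarrow> real"
    and M :: "'w measure"
    and Y :: "nat \<Rightarrow> 'w \<Rightarrow> real ^ 'n"
    and \<mu>s :: "nat \<Rightarrow> 'w \<Rightarrow> real ^ 'n"
  defines "\<phi> \<equiv> log_chart \<mu> e"
    and "h \<equiv> (\<lambda>(x :: real ^ 'd) q. (geo_dist (log_chart_inv \<mu> e x) q)\<^sup>2)"
  defines "\<Lambda> \<equiv> (\<chi> r r'. \<integral>\<omega>. partial_deriv r (partial_deriv r' (\<lambda>x. h x (Y 1 \<omega>))) (\<phi> \<mu>) \<partial>M)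
                 :: real ^ 'd ^ 'd"
    and "C \<equiv> covariance_matrix M (\<lambda>\<omega>. \<chi> r. partial_deriv r (\<lambda>x. h x (Y 1 \<omega>)) (\<phi> \<mu>))"
  assumes "CARD('d) > 2" and "CARD('n) = CARD('d) + 1"
    and "prob_space Q" and "sets Q = sets sphere_borel"
    and "is_intrinsic_mean Q \<mu>"
    and "tangent_onb \<mu> e"
    and "openin (top_of_set (sphere 0 1)) W" and "- \<mu> \<in> W"
    and "continuous_on W f" and "\<forall>q\<in>W. 0 \<le> f q"
    and "restrict_space Q W = density (restrict_space sphere_volume W) (\<lambda>q. ennreal (f q))"
    and "prob_space M"
    and "prob_space.indep_vars M (\<lambda>_. sphere_borel) Y {1..}"
    and "\<forall>j\<ge>1. distr M sphere_borel (Y j) = Q"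
    and "\<forall>n\<ge>1. \<mu>s n \<in> M \<rightarrow>\<^sub>M borel"
    and "\<forall>n\<ge>1. \<forall>\<omega>\<in>space M.
           \<mu>s n \<omega> \<in> frechet_minimizers (sample_frechet_fun n (\<lambda>j. Y j \<omega>))"
    and "invertible \<Lambda>"
  shows "converges_in_distribution M (\<lambda>n \<omega>. sqrt (real n) *\<^sub>R (\<phi> (\<mu>s n \<omega>) - \<phi> \<mu>))
           (gaussian 0 (matrix_inv \<Lambda> ** C ** matrix_inv \<Lambda>))"
proof -
  note dist2_def = h_def
  have "\<mu> \<in> frechet_minimizers (frechet_fun Q)"
    using \<open>is_intrinsic_mean Q \<mu>\<close> by (simp add: is_intrinsic_mean_def)
  then have norm_\<mu>: "norm \<mu> = 1" by (simp add: frechet_minimizers_def)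
  have dim: "DIM(real ^ 'n) \<ge> 4"
    using \<open>CARD('d) > 2\<close> \<open>CARD('n) = CARD('d) + 1\<close> by simp
  then have dim3: "DIM(real ^ 'n) \<ge> 3" by simp
  interpret sphere_chart \<mu> e
    by unfold_locales (use norm_\<mu> \<open>tangent_onb \<mu> e\<close> dim in blast)+
  \<comment> \<open>The only use of the density: caps around the antipode have probability of order
    \<rho>^2, which makes 1 / |q + mu| integrable and the antipode a null point.\<close>
  obtain K \<rho>0 where K: "K \<ge> 0" "0 < \<rho>0"
    "\<And>\<rho>. 0 < \<rho> \<Longrightarrow> \<rho> < \<rho>0 \<Longrightarrow> measure Q {q \<in> space Q. norm (q + \<mu>) \<le> \<rho>} \<le> K * \<rho>\<^sup>2"
    by (rule density_cap_bound[OF norm_\<mu> dim3 \<open>prob_space Q\<close> \<open>sets Q = sets sphere_borel\<close>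
        \<open>openin (top_of_set (sphere 0 1)) W\<close> \<open>- \<mu> \<in> W\<close> \<open>continuous_on W f\<close> \<open>\<forall>q\<in>W. 0 \<le> f q\<close>
        \<open>restrict_space Q W = density (restrict_space sphere_volume W) (\<lambda>q. ennreal (f q))\<close>]) blast
  have nm: "(\<lambda>q. norm (q + \<mu>)) \<in> borel_measurable Q"
    unfolding measurable_cong_sets[OF \<open>sets Q = sets sphere_borel\<close> refl]
    by (rule sphere_measurable) measurable
  have tail: "AE q in Q. norm (q + \<mu>) \<noteq> 0" "integrable Q (\<lambda>q. 1 / norm (q + \<mu>))"
    by (rule integrable_inverse_of_tail[OF \<open>prob_space Q\<close> nm norm_ge_zero K(1,2)], erule (1) K(3))+
  have ae: "AE q in Q. q \<noteq> - \<mu>"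
    using tail(1) by eventually_elim (auto simp: add_eq_0_iff)
  interpret sphere_law \<mu> e Q
    by (intro sphere_law.intro sphere_law_axioms.intro sphere_chart_axioms)
      (fact \<open>prob_space Q\<close> \<open>sets Q = sets sphere_borel\<close> \<open>is_intrinsic_mean Q \<mu>\<close> ae tail(2))+
  interpret M: prob_space M by fact
  have "sphere_sample \<mu> e Q M (\<lambda>i. Y (Suc i)) \<mu>s"
  proof (intro sphere_sample.intro sphere_sample_axioms.intro sphere_law_axioms M.prob_space_axioms)
    show "M.indep_vars (\<lambda>_. sphere_borel) (\<lambda>i. Y (Suc i)) UNIV"
      by (rule M.indep_vars_Suc) fact
    show "distr M sphere_borel (Y (Suc i)) = Q" for i
      using \<open>\<forall>j\<ge>1. distr M sphere_borel (Y j) = Q\<close> by simp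
    show "\<mu>s n \<in> borel_measurable M" if "n \<ge> 1" for n
      using \<open>\<forall>n\<ge>1. \<mu>s n \<in> M \<rightarrow>\<^sub>M borel\<close> that by blast
    show "\<mu>s n \<omega> \<in> frechet_minimizers (\<lambda>p. (\<Sum>i<n. (geo_dist p (Y (Suc i) \<omega>))\<^sup>2) / real n)"
      if "n \<ge> 1" "\<omega> \<in> space M" for n \<omega>
    proof -
      have "sample_frechet_fun n (\<lambda>j. Y j \<omega>) p = (\<Sum>i<n. (geo_dist p (Y (Suc i) \<omega>))\<^sup>2) / real n" for p
        unfolding sample_frechet_fun_def by (simp add: sum.atLeast1_atMost_eq)
      then have "sample_frechet_fun n (\<lambda>j. Y j \<omega>) = (\<lambda>p. (\<Sum>i<n. (geo_dist p (Y (Suc i) \<omega>))\<^sup>2) / real n)"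
        by (rule ext)
      then show ?thesis
        using \<open>\<forall>n\<ge>1. \<forall>\<omega>\<in>space M. \<mu>s n \<omega> \<in> frechet_minimizers (sample_frechet_fun n (\<lambda>j. Y j \<omega>))\<close> that
        by metis
    qed
  qed
  then interpret S: sphere_sample \<mu> e Q M "\<lambda>i. Y (Suc i)" \<mu>s .
  \<comment> \<open>The derivatives at \<phi> \<mu> are therefore the derivatives at 0 computed
    above. Index 0 of the shifted sample is the observation \<open>Y 1\<close>.\<close>
  have "\<phi> \<mu> = 0" unfolding \<phi>_def using log_chart_E[of 0] by simp
  then have "\<Lambda> = \<Lambda>Q" "C = S.Cmat"
    using S.expected_hessian[of 0] S.gradient_covariance[of 0] by (simp_all add: \<Lambda>_def C_def dist2_def)
  then show ?thesis
    using S.sample_mean_clt \<open>invertible \<Lambda>\<close> unfolding \<phi>_def by simp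
qed

end
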